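(* Let $\ell:\mathbb{N}\to\mathbb{R}_{>0}$ be a function such that the min-plus product of two $n\times n$ matrices can be computed in $O(n^3/\ell(n))$ time. Then: (1) jumbled pattern matching on strings of length $n$ can be solved in $O(n^2/\ell(\sqrt{n}))$ time; and (2) for every choice of a parameter $r$ (with $1\le r\le n$), jumbled pattern matching on trees with $n$ nodes can be solved in $O(nr + n^2/\ell(\sqrt{r}))$ time.
   Context: The min-plus product of an $a\times b$ matrix $A$ and a $b\times c$ matrix $B$ is the $a\times c$ matrix $A\star B$ with $(A\star B)[i,j]=\min_k (A[i,k]+B[k,j])$. Jumbled pattern matching on strings: given a binary string $T$ of length $n$, compute, for every $s=1,\ldots,n$, the minimum and the maximum number of 1s over all substrings (contiguous) of $T$ of length $s$. Jumbled pattern matching on trees: given a tree $T$ with $n$ nodes, each labeled 0 or 1, compute, for every $i=1,\ldots,n$, the minimum and the maximum number of nodes labeled 1 over all connected subgraphs of $T$ with exactly $i$ nodes. Running times are in the word RAM model. *)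

theory Defs
  imports Complex_Main "HOL-Library.Sublist" "Jordan_Normal_Form.Matrix"
begin

section \<open>The word RAM\<close>

text \<open>
  A word of length w is a natural number below 2^w. A program is a list of instructions over
  registers and arrays, both named by natural numbers, so that a program mentions only finitely many
  of each. The memory consists of these arrays; each has one cell for every word used as address.
  All instructions have unit cost. A run ends when the program counter leaves the program.
\<close>

datatype binop = Add | Sub | Mul | Div | Mod | And | Or | Xor | Shl | Shr

datatype instr =
    Const nat nat \<comment> \<open>register, immediate value\<close>
  | Op binop nat nat nat \<comment> \<open>target register, two operand registers\<close>
  | Load nat nat nat \<comment> \<open>target register, array, address register\<close>
  | Store nat nat nat \<comment> \<open>array, address register, source register\<close>
  | Jump nat
  | JumpLess nat nat nat \<comment> \<open>two registers to compare, jump target\<close>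

type_synonym program = "instr list"

record config =
  pc :: nat
  regs :: "nat \<Rightarrow> nat"
  mem :: "nat \<Rightarrow> nat \<Rightarrow> nat"

fun binop_val :: "nat \<Rightarrow> binop \<Rightarrow> nat \<Rightarrow> nat \<Rightarrow> nat" where
  "binop_val w Add x y = (x + y) mod 2 ^ w"
| "binop_val w Sub x y = (x + 2 ^ w - y) mod 2 ^ w"
| "binop_val w Mul x y = (x * y) mod 2 ^ w"
| "binop_val w Div x y = x div y"
| "binop_val w Mod x y = x mod y"
| "binop_val w And x y = semiring_bit_operations_class.and x y"
| "binop_val w Or x y = semiring_bit_operations_class.or x y"
| "binop_val w Xor x y = semiring_bit_operations_class.xor x y"
| "binop_val w Shl x y = (x * 2 ^ y) mod 2 ^ w"
| "binop_val w Shr x y = x div 2 ^ y"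

fun exec :: "nat \<Rightarrow> instr \<Rightarrow> config \<Rightarrow> config" where
  "exec w (Const r k) s = s\<lparr>pc := Suc (pc s), regs := (regs s)(r := k mod 2 ^ w)\<rparr>"
| "exec w (Op f r a b) s =
     s\<lparr>pc := Suc (pc s), regs := (regs s)(r := binop_val w f (regs s a) (regs s b))\<rparr>"
| "exec w (Load r m a) s = s\<lparr>pc := Suc (pc s), regs := (regs s)(r := mem s m (regs s a))\<rparr>"
| "exec w (Store m a b) s =
     s\<lparr>pc := Suc (pc s), mem := (mem s)(m := (mem s m)(regs s a := regs s b))\<rparr>"
| "exec w (Jump l) s = s\<lparr>pc := l\<rparr>"
| "exec w (JumpLess a b l) s = s\<lparr>pc := (if regs s a < regs s b then l else Suc (pc s))\<rparr>"

definition halted :: "program \<Rightarrow> config \<Rightarrow> bool" where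
  "halted P s \<longleftrightarrow> length P \<le> pc s"

definition step :: "nat \<Rightarrow> program \<Rightarrow> config \<Rightarrow> config" where
  "step w P s = (if halted P s then s else exec w (P ! pc s) s)"

definition words_config :: "nat \<Rightarrow> config \<Rightarrow> bool" where
  "words_config w s \<longleftrightarrow> (\<forall>r. regs s r < 2 ^ w) \<and> (\<forall>m a. mem s m a < 2 ^ w)"

definition stores :: "config \<Rightarrow> nat \<Rightarrow> nat list \<Rightarrow> bool" where
  "stores s m xs \<longleftrightarrow> (\<forall>i < length xs. mem s m i = xs ! i)"

section \<open>Computational problems and running times\<close>

text \<open>
  The encodings of the input and of the output as lists of words may depend on the word length,
  because of negative numbers. The magnitude of an instance bounds both its size parameter
  and the absolute values of the numbers occurring in it.
\<close>

record 'x problem =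
  instances :: "'x set"
  magnitude :: "'x \<Rightarrow> nat"
  enc_input :: "nat \<Rightarrow> 'x \<Rightarrow> nat list"
  enc_output :: "nat \<Rightarrow> 'x \<Rightarrow> nat list"

text \<open>
  As usual for the word RAM, words have at least c log N bits, where N is the magnitude of the
  instance and the constant c may depend on the program. One program has to work for all such word
  lengths w. The input is given in array 0, the output is expected in array 1, and all registers and
  all other memory cells are uninitialised, i.e. contain arbitrary words.
\<close>

definition solvable_in_time_O :: "'x problem \<Rightarrow> ('x \<Rightarrow> real) \<Rightarrow> bool" where
  "solvable_in_time_O X T \<longleftrightarrow>
     (\<exists>P (c::nat) (C::real). \<forall>x \<in> instances X. \<forall>w s.
        (magnitude X x + 2) ^ c \<le> 2 ^ w \<longrightarrow>
        words_config w s \<longrightarrow> pc s = 0 \<longrightarrow> stores s 0 (enc_input X w x) \<longrightarrow>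
        (\<exists>t. real t \<le> C * T x \<and> halted P ((step w P ^^ t) s) \<and>
             stores ((step w P ^^ t) s) 1 (enc_output X w x)))"

section \<open>Min-plus products\<close>

definition min_plus :: "int mat \<Rightarrow> int mat \<Rightarrow> int mat" (infixl \<open>\<star>\<close> 70) where
  "A \<star> B = mat (dim_row A) (dim_col B)
     (\<lambda>(i, j). Min ((\<lambda>k. A $$ (i, k) + B $$ (k, j)) ` {..<dim_col A}))"

definition twos_complement :: "nat \<Rightarrow> int \<Rightarrow> nat" where
  "twos_complement w z = nat (z mod 2 ^ w)"

definition row_major :: "nat \<Rightarrow> int mat \<Rightarrow> nat list" where
  "row_major w A = map (twos_complement w) (concat (mat_to_list A))"

definition min_plus_problem :: "(int mat \<times> int mat) problem" where
  "min_plus_problem = \<lparr>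
     instances = {(A, B). \<exists>n \<ge> 1. A \<in> carrier_mat n n \<and> B \<in> carrier_mat n n},
     magnitude = (\<lambda>(A, B).
       Max (insert (dim_row A) ((\<lambda>z. nat \<bar>z\<bar>) ` (elements_mat A \<union> elements_mat B)))),
     enc_input = (\<lambda>w (A, B). dim_row A # row_major w A @ row_major w B),
     enc_output = (\<lambda>w (A, B). row_major w (A \<star> B))\<rparr>"

section \<open>Jumbled pattern matching on strings\<close>

definition substring_ones :: "bool list \<Rightarrow> nat \<Rightarrow> nat set" where
  "substring_ones T s = {count_list u True |u. sublist u T \<and> length u = s}"

definition string_jpm_problem :: "bool list problem" where
  "string_jpm_problem = \<lparr>
     instances = {T. length T \<ge> 1},
     magnitude = length,
     enc_input = (\<lambda>w T. length T # map of_bool T),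
     enc_output = (\<lambda>w T. map (\<lambda>s. Min (substring_ones T s)) [1..<length T + 1] @
                     map (\<lambda>s. Max (substring_ones T s)) [1..<length T + 1])\<rparr>"

section \<open>Jumbled pattern matching on trees\<close>

type_synonym 'v graph = "'v set \<times> 'v set set"

definition simple_graph :: "'v graph \<Rightarrow> bool" where
  "simple_graph G \<longleftrightarrow> (\<forall>e \<in> snd G. e \<subseteq> fst G \<and> card e = 2)"

definition connected_graph :: "'v graph \<Rightarrow> bool" where
  "connected_graph G \<longleftrightarrow> fst G \<noteq> {} \<and>
     (\<forall>u \<in> fst G. \<forall>v \<in> fst G. (u, v) \<in> {(x, y). {x, y} \<in> snd G}\<^sup>*)"

definition is_cycle :: "'v graph \<Rightarrow> 'v list \<Rightarrow> bool" where
  "is_cycle G vs \<longleftrightarrow> length vs \<ge> 3 \<and> distinct vs \<and>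
     (\<forall>i < length vs. {vs ! i, vs ! (Suc i mod length vs)} \<in> snd G)"

definition tree_graph :: "'v graph \<Rightarrow> bool" where
  "tree_graph G \<longleftrightarrow> simple_graph G \<and> connected_graph G \<and> (\<nexists>vs. is_cycle G vs)"

definition subgraph_of :: "'v graph \<Rightarrow> 'v graph \<Rightarrow> bool" where
  "subgraph_of H G \<longleftrightarrow> simple_graph H \<and> fst H \<subseteq> fst G \<and> snd H \<subseteq> snd G"

text \<open>
  A labelled tree with n nodes is given by the list of the labels of its nodes, which are the numbers
  below n, together with a list of its edges. Edges and their end points come in arbitrary order.
\<close>

type_synonym labelled_graph = "bool list \<times> (nat \<times> nat) list"

definition graph_of :: "labelled_graph \<Rightarrow> nat graph" where
  "graph_of = (\<lambda>(L, es). ({..<length L}, (\<lambda>(u, v). {u, v}) ` set es))"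

definition labelled_tree :: "labelled_graph \<Rightarrow> bool" where
  "labelled_tree = (\<lambda>(L, es).
     tree_graph (graph_of (L, es)) \<and> distinct (map (\<lambda>(u, v). {u, v}) es))"

definition num_nodes :: "labelled_graph \<Rightarrow> nat" where
  "num_nodes T = length (fst T)"

definition connected_subgraph_ones :: "labelled_graph \<Rightarrow> nat \<Rightarrow> nat set" where
  "connected_subgraph_ones T i =
     {card {v \<in> fst H. fst T ! v} |H.
        subgraph_of H (graph_of T) \<and> connected_graph H \<and> card (fst H) = i}"

text \<open>The parameter r is part of the input: a single program serves all choices of r.\<close>

definition tree_jpm_problem :: "(labelled_graph \<times> nat) problem" where
  "tree_jpm_problem = \<lparr>
     instances = {(T, r). labelled_tree T \<and> 1 \<le> r \<and> r \<le> num_nodes T},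
     magnitude = (\<lambda>(T, r). num_nodes T),
     enc_input = (\<lambda>w (T, r). num_nodes T # r # map of_bool (fst T) @
                         concat (map (\<lambda>(u, v). [u, v]) (snd T))),
     enc_output = (\<lambda>w (T, r).
       map (\<lambda>i. Min (connected_subgraph_ones T i)) [1..<num_nodes T + 1] @
       map (\<lambda>i. Max (connected_subgraph_ones T i)) [1..<num_nodes T + 1])\<rparr>"

end

theory Submission
  imports Defs
begin

section \<open>A small imperative language with calls of the min-plus program\<close>

section \<open>A structured language over the word RAM\<close>

text \<open>Only minima have to be computed. The maximum number of ones over objects of size i is i
  minus the minimum for the complemented labels (\<open>Max_complement\<close>). Both problems then
  reduce to min-plus convolutions truncated at a value I that stands for infinity:
  \<open>cv I f h s\<close> is the minimum of I and of all f i + h j with i + j = s.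

  Convolution by matrix products. Cut f into blocks of length m * m and read block b as the m by m
  matrix with entry f (b m^2 + x m + k) at (x, k). Multiply it with the matrix whose entry at (k, y)
  is h (J m + y - k). Entry (x, y) of the product collects sums whose indices add up to b m^2 + J m
  + x m + y. When b and J vary, all pairs (i, j) that matter are met (\<open>block_pairs\<close>).
  Sequences of lengths p and q are thus convolved by (p div m^2 + 1) * (q div m + 2) products
  (\<open>wp_conv\<close>).

  Strings. Let P be the prefix sums of the labels. A window of length s that ends at i has P i - P
  (i - s) ones. Up to the constant n this is the sum of P i and n - P (n - v) with i + v = n + s, so
  one convolution answers all s (\<open>cv_window\<close>). With m the rounded square root of n it
  takes O(sqrt n) products of dimension m, that is, time O(n^2 / l m) (\<open>string_cost\<close>).

  Trees. Leaves are contracted into their neighbours one after another. A remaining node v stands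
  for the nodes contracted into it. These are split into an open part W v of at most r nodes and a
  closed part K v, which is empty or has more than r nodes; the two are connected only through a
  gate b v in K v. Open parts are merged by naive products. An open part that grows beyond r is
  closed, that is, moved into the closed part by fast convolutions with m the rounded square root of
  r. If two closed parts meet, both open parts are closed first and then the closed parts are joined
  by a fast convolution. How the relevant families of connected sets change is the content of
  \<open>close_families\<close>, \<open>merge_families\<close> and \<open>join_families\<close>;
  \<open>mw_fprod\<close> turns products of families into convolutions of their weight sequences.

  Cost for trees. Let rho = tau m / m^3, which is O(1 / l m). Naive products of open sizes s and s'
  cost O(s s') and sum up to O(n r). A closing costs O(n r rho). It is paid either by the more than
  r open nodes that it consumes or, before a join, by the closed part that the join makes disappear;
  so the closings cost O(n^2 rho) together. A join of closed sizes h and h' costs O(h h' rho), and 2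
  h h' is the growth of the sum of the squares of the closed sizes, which never exceeds n^2. The
  potential \<open>pot\<close> makes this precise and \<open>wp_tree_step\<close> is the amortised
  step.

  The machine. The algorithms are commands of a small language with a weakest precondition calculus
  that has a clock (\<open>wp\<close>). The compiled code takes at most a constant number of machine
  steps per tick (\<open>cc_correct\<close>). The given program for min-plus products is extracted
  by \<open>min_plus_program\<close> together with tau m \<ge> m * m, which holds because it has to
  write m * m results; hence preparing a product never costs more than the product.
  \<open>solvable_by_com\<close> turns a statement about \<open>wp\<close> into a statement about
  solvability.\<close>

datatype aexp =
    N nat
  | V nat
  | Plus aexp aexp
  | Minus aexp aexp
  | Times aexp aexp
  | Divi aexp aexp
  | Rd nat aexp

datatype com =
    Asg nat aexp
  | St nat aexp aexp
  | Seq com com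
  | Ite aexp aexp com com
  | For nat aexp com
  | Call

type_synonym state = "(nat \<Rightarrow> nat) \<times> (nat \<Rightarrow> nat \<Rightarrow> nat) \<times> nat"

fun val :: "aexp \<Rightarrow> (nat \<Rightarrow> nat) \<Rightarrow> (nat \<Rightarrow> nat \<Rightarrow> nat) \<Rightarrow> nat" where
  "val (N k) g a = k"
| "val (V x) g a = g x"
| "val (Plus e f) g a = val e g a + val f g a"
| "val (Minus e f) g a = val e g a - val f g a"
| "val (Times e f) g a = val e g a * val f g a"
| "val (Divi e f) g a = val e g a div val f g a"
| "val (Rd A e) g a = a A (val e g a)"

fun avars :: "aexp \<Rightarrow> nat set" where
  "avars (N k) = {}"
| "avars (V x) = {x}"
| "avars (Plus e f) = avars e \<union> avars f"
| "avars (Minus e f) = avars e \<union> avars f"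
| "avars (Times e f) = avars e \<union> avars f"
| "avars (Divi e f) = avars e \<union> avars f"
| "avars (Rd A e) = avars e"

fun aarrs :: "aexp \<Rightarrow> nat set" where
  "aarrs (N k) = {}"
| "aarrs (V x) = {}"
| "aarrs (Plus e f) = aarrs e \<union> aarrs f"
| "aarrs (Minus e f) = aarrs e \<union> aarrs f"
| "aarrs (Times e f) = aarrs e \<union> aarrs f"
| "aarrs (Divi e f) = aarrs e \<union> aarrs f"
| "aarrs (Rd A e) = insert A (aarrs e)"

text \<open>A degree: if all variables and all cells read are at most B and B is at least 2, then
  \<open>e\<close> has a value of at most \<open>B ^ adeg e\<close> (\<open>val_le\<close>). So only
  values that are stored or read are tied to B, whereas intermediate results just have to fit into a
  word. A constant k counts with degree k because k \<le> 2 ^ k.\<close>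

fun adeg :: "aexp \<Rightarrow> nat" where
  "adeg (N k) = k"
| "adeg (V x) = 1"
| "adeg (Plus e f) = adeg e + adeg f + 1"
| "adeg (Minus e f) = adeg e + adeg f"
| "adeg (Times e f) = adeg e + adeg f"
| "adeg (Divi e f) = adeg e + adeg f"
| "adeg (Rd A e) = 1 + adeg e"

fun cvars :: "com \<Rightarrow> nat set" where
  "cvars (Asg x e) = insert x (avars e)"
| "cvars (St A e f) = avars e \<union> avars f"
| "cvars (Seq c d) = cvars c \<union> cvars d"
| "cvars (Ite e f c d) = avars e \<union> avars f \<union> cvars c \<union> cvars d"
| "cvars (For x e c) = insert x (avars e \<union> cvars c)"
| "cvars Call = {}"

fun mods :: "com \<Rightarrow> nat set" where
  "mods (Asg x e) = {x}"
| "mods (St A e f) = {}"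
| "mods (Seq c d) = mods c \<union> mods d"
| "mods (Ite e f c d) = mods c \<union> mods d"
| "mods (For x e c) = insert x (mods c)"
| "mods Call = {}"

fun warrs :: "com \<Rightarrow> nat set" where
  "warrs (Asg x e) = {}"
| "warrs (St A e f) = {A}"
| "warrs (Seq c d) = warrs c \<union> warrs d"
| "warrs (Ite e f c d) = warrs c \<union> warrs d"
| "warrs (For x e c) = warrs c"
| "warrs Call = {0, 1}"

fun cdeg :: "com \<Rightarrow> nat" where
  "cdeg (Asg x e) = adeg e"
| "cdeg (St A e f) = adeg e + adeg f"
| "cdeg (Seq c d) = cdeg c + cdeg d"
| "cdeg (Ite e f c d) = adeg e + adeg f + cdeg c + cdeg d"
| "cdeg (For x e c) = adeg e + cdeg c + 1"
| "cdeg Call = 0"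

lemma val_cong:
  "(\<And>x. x \<in> avars e \<Longrightarrow> g x = g' x) \<Longrightarrow> (\<And>A. A \<in> aarrs e \<Longrightarrow> a A = a' A) \<Longrightarrow> val e g a = val e g' a'"
  by (induction e) auto

lemma finite_cvars: "finite (cvars c)"
proof -
  have "finite (avars e)" for e by (induction e) auto
  then show ?thesis by (induction c) auto
qed

section \<open>Weakest preconditions with a clock and a bound on stored values\<close>

locale bounded_machine =
  fixes B :: nat and tau :: "nat \<Rightarrow> nat"
begin

fun ok :: "aexp \<Rightarrow> (nat \<Rightarrow> nat) \<Rightarrow> (nat \<Rightarrow> nat \<Rightarrow> nat) \<Rightarrow> bool" where
  "ok (N k) g a = True"
| "ok (V x) g a = True"
| "ok (Plus e f) g a = (ok e g a \<and> ok f g a)"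
| "ok (Minus e f) g a = (ok e g a \<and> ok f g a)"
| "ok (Times e f) g a = (ok e g a \<and> ok f g a)"
| "ok (Divi e f) g a = (ok e g a \<and> ok f g a)"
| "ok (Rd A e) g a = (ok e g a \<and> a A (val e g a) \<le> B)"

lemma ok_cong:
  "(\<And>x. x \<in> avars e \<Longrightarrow> g x = g' x) \<Longrightarrow> (\<And>A. A \<in> aarrs e \<Longrightarrow> a A = a' A) \<Longrightarrow> ok e g a = ok e g' a'"
  by (induction e) (auto simp: val_cong[of _ g g' a a'])

text \<open>
  The weakest precondition guarantees that no assigned value exceeds B. The last component of a
  state is a clock that ticks once per command; a call of the min-plus program on dimension m
  takes tau m additional ticks and leaves the array 0 and the rest of the array 1 unspecified.
\<close>

primrec wp :: "com \<Rightarrow> (state \<Rightarrow> bool) \<Rightarrow> state \<Rightarrow> bool" where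
  "wp (Asg x e) = (\<lambda>Q (g, a, t). ok e g a \<and> val e g a \<le> B \<and> Q (g(x := val e g a), a, Suc t))"
| "wp (St A e f) = (\<lambda>Q (g, a, t). ok e g a \<and> ok f g a \<and> val f g a \<le> B \<and>
     Q (g, a(A := (a A)(val e g a := val f g a)), Suc t))"
| "wp (Seq c d) = (\<lambda>Q. wp c (wp d Q))"
| "wp (Ite e f c d) = (\<lambda>Q (g, a, t). ok e g a \<and> ok f g a \<and>
     (if val e g a < val f g a then wp c Q (g, a, Suc t) else wp d Q (g, a, Suc t)))"
| "wp (For x e c) = (\<lambda>Q (g, a, t). \<exists>n I. n \<le> B \<and> I 0 (g(x := 0), a, Suc t) \<and>
     (\<forall>i s. I i s \<longrightarrow> fst s x = i \<and> ok e (fst s) (fst (snd s)) \<and> val e (fst s) (fst (snd s)) = n \<and> t < snd (snd s) \<and>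
        (i < n \<longrightarrow> wp c (\<lambda>(g', a', t'). I (Suc i) (g'(x := Suc (g' x)), a', Suc t') \<and> g' x = i) s)) \<and>
     (\<forall>s. I n s \<longrightarrow> Q (fst s, fst (snd s), Suc (snd (snd s)))))"
| "wp Call = (\<lambda>Q (g, a, t). let m = a 0 0 in 1 \<le> m \<and> m \<le> B \<and> (\<forall>i<2 * m * m. a 0 (Suc i) \<le> B) \<and>
     (\<forall>a'. (\<forall>A\<ge>2. a' A = a A) \<longrightarrow>
        (\<forall>i<m. \<forall>j<m. a' 1 (i * m + j) =
            Min ((\<lambda>k. a 0 (Suc (i * m + k)) + a 0 (Suc (m * m + (k * m + j)))) ` {..<m})) \<longrightarrow>
        Q (g, a', Suc (t + tau m))))"

lemma wp_mono: "wp c Q s \<Longrightarrow> (\<And>s. Q s \<Longrightarrow> R s) \<Longrightarrow> wp c R s"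
proof (induction c arbitrary: Q R s)
  case (Asg x e) then show ?case by (auto split: prod.splits)
next
  case (St A e f) then show ?case by (auto split: prod.splits)
next
  case (Seq c d)
  have "wp c (wp d Q) s" using Seq.prems(1) by simp
  then have "wp c (wp d R) s" by (rule Seq.IH(1)) (rule Seq.IH(2)[OF _ Seq.prems(2)])
  then show ?case by simp
next
  case (Ite e f c d)
  obtain g a t where s: "s = (g, a, t)" by (cases s) auto
  show ?case
    using Ite.prems(1) Ite.IH(1)[of Q "(g, a, Suc t)" R] Ite.IH(2)[of Q "(g, a, Suc t)" R] Ite.prems(2)
    by (auto simp: s split: if_splits)
next
  case (For x e c)
  obtain g a t where s: "s = (g, a, t)" by (cases s) auto
  from For.prems(1) obtain n I where "n \<le> B" "I 0 (g(x := 0), a, Suc t)"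
     "\<forall>i s. I i s \<longrightarrow> fst s x = i \<and> ok e (fst s) (fst (snd s)) \<and> val e (fst s) (fst (snd s)) = n \<and> t < snd (snd s) \<and>
        (i < n \<longrightarrow> wp c (\<lambda>(g', a', t'). I (Suc i) (g'(x := Suc (g' x)), a', Suc t') \<and> g' x = i) s)"
     "\<forall>s. I n s \<longrightarrow> Q (fst s, fst (snd s), Suc (snd (snd s)))" by (auto simp: s)
  with For.prems(2) show ?case unfolding s wp.simps prod.case by blast
next
  case Call then show ?case by (auto simp: Let_def split: prod.splits)
qed

text \<open>Whatever the postcondition, variables outside \<open>mods c\<close> and arrays outside
  \<open>warrs c\<close> survive and the clock advances. This frees loop invariants from restating
  what stays fixed, and the strict advance of the clock later pays for the initialisation of the
  registers.\<close>

lemma wp_frame: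
  "wp c Q s \<Longrightarrow> wp c (\<lambda>s'. Q s' \<and> (\<forall>x. x \<notin> mods c \<longrightarrow> fst s' x = fst s x) \<and>
     (\<forall>A. A \<notin> warrs c \<longrightarrow> fst (snd s') A = fst (snd s) A) \<and> snd (snd s) < snd (snd s')) s"
proof (induction c arbitrary: Q s)
  case (Asg x e) then show ?case by (auto split: prod.splits)
next
  case (St A e f) then show ?case by (auto split: prod.splits)
next
  case (Seq c d)
  have "wp c (wp d Q) s" using Seq.prems(1) by simp
  from Seq.IH(1)[OF this] show ?case
    unfolding wp.simps
    by (rule wp_mono) (elim conjE, drule Seq.IH(2), erule wp_mono, auto)
next
  case (Ite e f c d)
  obtain g a t where s: "s = (g, a, t)" by (cases s) auto
  show ?case
  proof (cases "val e g a < val f g a")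
    case True
    with Ite.prems have "wp c Q (g, a, Suc t)" by (simp add: s)
    from Ite.IH(1)[OF this] show ?thesis using Ite.prems True by (auto simp: s elim!: wp_mono)
  next
    case False
    with Ite.prems have "wp d Q (g, a, Suc t)" by (simp add: s)
    from Ite.IH(2)[OF this] show ?thesis using Ite.prems False by (auto simp: s elim!: wp_mono)
  qed
next
  case (For x e c)
  obtain g a t where s: "s = (g, a, t)" by (cases s) auto
  from For.prems obtain n I where I: "n \<le> B" "I 0 (g(x := 0), a, Suc t)"
     "\<And>i s. I i s \<Longrightarrow> fst s x = i \<and> ok e (fst s) (fst (snd s)) \<and> val e (fst s) (fst (snd s)) = n \<and> t < snd (snd s) \<and>
        (i < n \<longrightarrow> wp c (\<lambda>(g', a', t'). I (Suc i) (g'(x := Suc (g' x)), a', Suc t') \<and> g' x = i) s)"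
     "\<And>s. I n s \<Longrightarrow> Q (fst s, fst (snd s), Suc (snd (snd s)))" by (auto simp: s)
  let ?J = "\<lambda>i s. I i s \<and> (\<forall>y. y \<notin> insert x (mods c) \<longrightarrow> fst s y = g y) \<and>
     (\<forall>A. A \<notin> warrs c \<longrightarrow> fst (snd s) A = a A)"
  have step: "wp c (\<lambda>(g', a', t'). ?J (Suc i) (g'(x := Suc (g' x)), a', Suc t') \<and> g' x = i) s"
    if J: "?J i s" and "i < n" for i s
  proof -
    have "wp c (\<lambda>(g', a', t'). I (Suc i) (g'(x := Suc (g' x)), a', Suc t') \<and> g' x = i) s"
      using J I(3) \<open>i < n\<close> by blast
    from For.IH[OF this] show ?thesis
      by (rule wp_mono) (use J in \<open>auto split: prod.splits\<close>)
  qed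
  show ?case unfolding s wp.simps prod.case
    apply (intro exI[of _ n] exI[of _ ?J] conjI allI impI)
    using I(1) apply blast
    using I(2) apply simp_all[3]
    using I(3) apply blast
    using I(3) apply blast
    using I(3) apply blast
    using I(3) apply blast
    using step apply blast
    using I(4) apply blast
    apply simp
    apply simp
    using I(3) apply (metis fst_conv snd_conv less_SucI)
    done
next
  case Call then show ?case by (auto simp: Let_def split: prod.splits)
qed

text \<open>The working form of the loop rule: frame facts are handed to the body and to the
  conclusion, so the invariant speaks only of what the loop changes. The compiled loop evaluates its
  bound before every round; the disjointness assumptions keep that value at n.\<close>

lemma wp_For:
  assumes "n \<le> B" and val: "val e g a = n" and okay: "ok e g a"
    and xe: "x \<notin> avars e" "x \<notin> mods c" "avars e \<inter> mods c = {}" "aarrs e \<inter> warrs c = {}"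
    and init: "I 0 (g(x := 0)) a (Suc t)"
    and body: "\<And>i g' a' t'. I i g' a' t' \<Longrightarrow> i < n \<Longrightarrow> g' x = i \<Longrightarrow> t < t' \<Longrightarrow>
      (\<And>y. y \<noteq> x \<Longrightarrow> y \<notin> mods c \<Longrightarrow> g' y = g y) \<Longrightarrow> (\<And>A. A \<notin> warrs c \<Longrightarrow> a' A = a A) \<Longrightarrow>
      wp c (\<lambda>(g', a', t'). I (Suc i) (g'(x := Suc i)) a' (Suc t')) (g', a', t')"
    and fin: "\<And>g' a' t'. I n g' a' t' \<Longrightarrow> g' x = n \<Longrightarrow> t < t' \<Longrightarrow>
      (\<And>y. y \<noteq> x \<Longrightarrow> y \<notin> mods c \<Longrightarrow> g' y = g y) \<Longrightarrow> (\<And>A. A \<notin> warrs c \<Longrightarrow> a' A = a A) \<Longrightarrow> Q (g', a', Suc t')"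
  shows "wp (For x e c) Q (g, a, t)"
proof -
  let ?J = "\<lambda>i (s::state). I i (fst s) (fst (snd s)) (snd (snd s)) \<and> fst s x = i \<and> t < snd (snd s) \<and>
     (\<forall>y. y \<noteq> x \<longrightarrow> y \<notin> mods c \<longrightarrow> fst s y = g y) \<and> (\<forall>A. A \<notin> warrs c \<longrightarrow> fst (snd s) A = a A)"
  have step: "wp c (\<lambda>(g', a', t'). ?J (Suc i) (g'(x := Suc (g' x)), a', Suc t') \<and> g' x = i) s"
    if J: "?J i s" and "i < n" for i s
  proof -
    obtain g1 a1 t1 where s: "s = (g1, a1, t1)" by (cases s) auto
    have "wp c (\<lambda>(g', a', t'). I (Suc i) (g'(x := Suc i)) a' (Suc t')) (g1, a1, t1)"
      by (rule body) (use J \<open>i < n\<close> s in auto)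
    from wp_frame[OF this] show ?thesis unfolding s
      by (rule wp_mono) (use J xe in \<open>auto simp: s split: prod.splits\<close>)
  qed
  have e: "val e (fst s) (fst (snd s)) = n \<and> ok e (fst s) (fst (snd s))" if "?J i s" for i s
  proof -
    have "\<And>y. y \<in> avars e \<Longrightarrow> fst s y = g y" "\<And>A. A \<in> aarrs e \<Longrightarrow> fst (snd s) A = a A"
      using that xe by (metis disjoint_iff)+
    then show ?thesis using val okay val_cong[of e "fst s" g "fst (snd s)" a]
       ok_cong[of e "fst s" g "fst (snd s)" a] by auto
  qed
  show ?thesis unfolding wp.simps prod.case
    apply (intro exI[of _ n] exI[of _ ?J] conjI allI impI)
    using assms(1) apply blast
    using init apply (simp_all)[5]
    apply blast
    using e apply blast
    using e apply blast
    apply blast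
    using step apply blast
    using fin by (metis)
qed

end

section \<open>Runs of the machine and programs embedded into other programs\<close>

definition reach :: "nat \<Rightarrow> program \<Rightarrow> nat \<Rightarrow> config \<Rightarrow> config \<Rightarrow> bool" where
  "reach w P k s s' \<longleftrightarrow> (\<exists>j\<le>k. (step w P ^^ j) s = s')"

lemma reach_refl: "reach w P k s s"
  by (auto simp: reach_def intro: exI[of _ 0])

lemma reach_eq: "pc s = pc s' \<Longrightarrow> regs s = regs s' \<Longrightarrow> mem s = mem s' \<Longrightarrow> reach w P k s s'"
  using reach_refl[of w P k s] by (cases s, cases s') auto

lemma reach_trans: "reach w P k s s' \<Longrightarrow> reach w P k' s' s'' \<Longrightarrow> reach w P (k + k') s s''"
proof -
  assume "reach w P k s s'" "reach w P k' s' s''"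
  then obtain i j where "i \<le> k" "(step w P ^^ i) s = s'" "j \<le> k'" "(step w P ^^ j) s' = s''"
    unfolding reach_def by blast
  then have "j + i \<le> k + k'" "(step w P ^^ (j + i)) s = s''" by (auto simp: funpow_add)
  then show "reach w P (k + k') s s''" unfolding reach_def by blast
qed

lemma reach_mono: "reach w P k s s' \<Longrightarrow> k \<le> k' \<Longrightarrow> reach w P k' s s'"
  unfolding reach_def using order_trans by blast

lemma reach_step: "pc s < length P \<Longrightarrow> reach w P 1 s (exec w (P ! pc s) s)"
  unfolding reach_def step_def halted_def by (intro exI[of _ 1]) (auto simp: step_def halted_def)

lemma reach_then: "pc s < length P \<Longrightarrow> reach w P k (exec w (P ! pc s) s) s' \<Longrightarrow> reach w P (Suc k) s s'"
  using reach_trans[OF reach_step, of s P w k s'] by simp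

lemma binop_val_less:
  assumes "x < 2 ^ w" "y < 2 ^ w"
  shows "binop_val w f x y < 2 ^ w"
proof -
  have "x div z < 2 ^ w" for z using assms(1) by (meson div_le_dividend le_less_trans)
  moreover have "semiring_bit_operations_class.or x y < 2 ^ w" "semiring_bit_operations_class.and x y < 2 ^ w"
     "semiring_bit_operations_class.xor x y < 2 ^ w"
    using assms by (metis take_bit_and take_bit_or take_bit_xor take_bit_nat_eq_self_iff)+
  moreover have "x mod y < 2 ^ w" using assms(1) by (meson le_less_trans mod_less_eq_dividend)
  ultimately show ?thesis by (cases f) auto
qed

lemma words_step: "words_config w s \<Longrightarrow> words_config w (step w P s)"
proof (cases "halted P s")
  case False
  assume s: "words_config w s"
  have "words_config w (exec w i s)" for i
    using s binop_val_less by (cases i) (auto simp: words_config_def)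
  then show ?thesis by (simp add: step_def False)
qed (simp add: step_def)

lemma words_reach:
  assumes "reach w P k s s'" "words_config w s"
  shows "words_config w s'"
proof -
  have "words_config w ((step w P ^^ j) s)" for j
    by (induction j) (auto simp: assms words_step)
  then show ?thesis using assms by (auto simp: reach_def)
qed

definition code_at :: "program \<Rightarrow> nat \<Rightarrow> program \<Rightarrow> bool" where
  "code_at P off cs \<longleftrightarrow> (\<forall>i<length cs. off + i < length P \<and> P ! (off + i) = cs ! i)"

lemma code_at_Nil [simp]: "code_at P off []"
  by (simp add: code_at_def)

lemma code_at_Cons [simp]:
  "code_at P off (x # xs) \<longleftrightarrow> off < length P \<and> P ! off = x \<and> code_at P (Suc off) xs"
proof
  assume L: "code_at P off (x # xs)"
  have "Suc off + i < length P \<and> P ! (Suc off + i) = xs ! i" if "i < length xs" for i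
    using L[unfolded code_at_def, rule_format, of "Suc i"] that by simp
  moreover have "off < length P \<and> P ! off = x"
    using L[unfolded code_at_def, rule_format, of 0] by simp
  ultimately show "off < length P \<and> P ! off = x \<and> code_at P (Suc off) xs"
    unfolding code_at_def by blast
next
  assume R: "off < length P \<and> P ! off = x \<and> code_at P (Suc off) xs"
  have "off + i < length P \<and> P ! (off + i) = (x # xs) ! i" if "i < length (x # xs)" for i
    using R that by (cases i) (auto simp: code_at_def)
  then show "code_at P off (x # xs)" unfolding code_at_def by blast
qed

lemma code_at_append [simp]:
  "code_at P off (xs @ ys) \<longleftrightarrow> code_at P off xs \<and> code_at P (off + length xs) ys"
  by (induction xs arbitrary: off) auto

fun instr_regs :: "instr \<Rightarrow> nat set" where
  "instr_regs (Const r k) = {r}"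
| "instr_regs (Op f r a b) = {r, a, b}"
| "instr_regs (Load r m a) = {r, a}"
| "instr_regs (Store m a b) = {a, b}"
| "instr_regs (Jump l) = {}"
| "instr_regs (JumpLess a b l) = {a, b}"

fun instr_arrs :: "instr \<Rightarrow> nat set" where
  "instr_arrs (Load r m a) = {m}"
| "instr_arrs (Store m a b) = {m}"
| "instr_arrs _ = {}"

text \<open>Targets beyond the end of a program of length n are clipped to n. Halting by any jump
  thereby becomes a transfer of control to the first instruction after the embedded copy.\<close>

fun relocate_instr :: "nat \<Rightarrow> nat \<Rightarrow> instr \<Rightarrow> instr" where
  "relocate_instr off n (Jump l) = Jump (off + min l n)"
| "relocate_instr off n (JumpLess a b l) = JumpLess a b (off + min l n)"
| "relocate_instr off n i = i"

definition relocate :: "nat \<Rightarrow> program \<Rightarrow> program" where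
  "relocate off P = map (relocate_instr off (length P)) P"

lemma length_relocate [simp]: "length (relocate off P) = length P"
  by (simp add: relocate_def)

lemma run_relocated:
  assumes "code_at P off (relocate off P0)" "pc s' = off + min (pc s) (length P0)"
    "regs s' = regs s" "mem s' = mem s"
  shows "\<exists>s''. reach w P t s' s'' \<and> pc s'' = off + min (pc ((step w P0 ^^ t) s)) (length P0) \<and>
    regs s'' = regs ((step w P0 ^^ t) s) \<and> mem s'' = mem ((step w P0 ^^ t) s)"
proof (induction t)
  case 0
  show ?case using assms by (auto intro: reach_refl)
next
  case (Suc t)
  let ?u = "(step w P0 ^^ t) s"
  from Suc.IH obtain s'' where s'': "reach w P t s' s''" "pc s'' = off + min (pc ?u) (length P0)"
    "regs s'' = regs ?u" "mem s'' = mem ?u" by blast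
  show ?case
  proof (cases "halted P0 ?u")
    case True
    then have "(step w P0 ^^ Suc t) s = ?u" by (simp add: step_def)
    then show ?thesis using s'' reach_mono[of w P t s' s'' "Suc t"] by auto
  next
    case False
    then have u: "pc ?u < length P0" "(step w P0 ^^ Suc t) s = exec w (P0 ! pc ?u) ?u"
      by (auto simp: halted_def step_def)
    have P: "pc s'' < length P" "P ! pc s'' = relocate_instr off (length P0) (P0 ! pc ?u)"
      using assms(1) u(1) s''(2) by (auto simp: code_at_def relocate_def)
    show ?thesis
      unfolding u(2)
      apply (rule exI[of _ "exec w (relocate_instr off (length P0) (P0 ! pc ?u)) s''"])
      using reach_trans[OF s''(1) reach_step[OF P(1), of w, unfolded P(2)]] s''(2-4) u(1)
      by (cases "P0 ! pc ?u") auto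
  qed
qed

text \<open>This protects the caller: compiled code keeps its registers from R on, and its arrays
  other than 0 and 1 above M, where the embedded program writes nothing.\<close>

lemma run_local:
  assumes "\<And>i. i \<in> set P0 \<Longrightarrow> instr_regs i \<subseteq> {..<R} \<and> instr_arrs i \<subseteq> {..<M}"
  shows "(\<forall>r\<ge>R. regs ((step w P0 ^^ t) s) r = regs s r) \<and> (\<forall>m\<ge>M. mem ((step w P0 ^^ t) s) m = mem s m)"
proof (induction t)
  case (Suc t)
  let ?u = "(step w P0 ^^ t) s"
  have "(\<forall>r\<ge>R. regs (step w P0 ?u) r = regs ?u r) \<and> (\<forall>m\<ge>M. mem (step w P0 ?u) m = mem ?u m)"
  proof (cases "halted P0 ?u")
    case False
    then have i: "P0 ! pc ?u \<in> set P0" by (simp add: halted_def)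
    show ?thesis using False assms[OF i] by (cases "P0 ! pc ?u") (auto simp: step_def)
  qed (simp add: step_def)
  then show ?case using Suc by simp
qed simp

section \<open>The compiler for expressions and commands\<close>

fun elen :: "aexp \<Rightarrow> nat" where
  "elen (N k) = 1"
| "elen (V x) = 1"
| "elen (Plus e f) = elen e + elen f + 1"
| "elen (Minus e f) = elen e + elen f + 4"
| "elen (Times e f) = elen e + elen f + 1"
| "elen (Divi e f) = elen e + elen f + 1"
| "elen (Rd A e) = elen e + 1"

fun clen :: "nat \<Rightarrow> com \<Rightarrow> nat" where
  "clen p (Asg x e) = elen e + 1"
| "clen p (St A e f) = elen e + elen f + 1"
| "clen p (Seq c d) = clen p c + clen p d"
| "clen p (Ite e f c d) = elen e + elen f + 2 + clen p c + clen p d"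
| "clen p (For x e c) = elen e + 6 + clen p c"
| "clen p Call = p + 4"

locale compiler = bounded_machine +
  fixes w :: nat and P0 :: program and R M nv :: nat
begin

text \<open>Registers from R on alternate between program variables (\<open>rv\<close>) and cells of
  an evaluation stack (\<open>rt\<close>). Arrays 0 and 1 are shared with the embedded program, as
  its input and output; all others are shifted above its arrays.\<close>

definition rv :: "nat \<Rightarrow> nat" where "rv x = R + 2 * x"
definition rt :: "nat \<Rightarrow> nat" where "rt d = R + 2 * d + 1"
definition ar :: "nat \<Rightarrow> nat" where "ar A = (if A < 2 then A else M + A)"

lemma rv_neq_rt [simp]: "rv x \<noteq> rt d" "rt d \<noteq> rv x"
  unfolding rv_def rt_def by presburger+

lemma rv_inj [simp]: "rv x = rv y \<longleftrightarrow> x = y" "rt x = rt y \<longleftrightarrow> x = y"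
  unfolding rv_def rt_def by auto

lemma ar_inj [simp]: "ar x = ar y \<longleftrightarrow> x = y"
  unfolding ar_def by auto

text \<open>The argument d is the height of the evaluation stack: the value ends up in
  \<open>rt d\<close>, and only stack cells from d on change. \<open>Minus\<close> needs a
  comparison because the language truncates at 0 whereas the machine wraps around.\<close>

fun ce :: "nat \<Rightarrow> nat \<Rightarrow> aexp \<Rightarrow> program" where
  "ce off d (N k) = [Const (rt d) k]"
| "ce off d (V x) = [Op Or (rt d) (rv x) (rv x)]"
| "ce off d (Plus e f) = ce off d e @ ce (off + elen e) (Suc d) f @ [Op Add (rt d) (rt d) (rt (Suc d))]"
| "ce off d (Minus e f) = ce off d e @ ce (off + elen e) (Suc d) f @
     (let p = off + elen e + elen f in
       [JumpLess (rt d) (rt (Suc d)) (p + 3), Op Sub (rt d) (rt d) (rt (Suc d)), Jump (p + 4), Const (rt d) 0])"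
| "ce off d (Times e f) = ce off d e @ ce (off + elen e) (Suc d) f @ [Op Mul (rt d) (rt d) (rt (Suc d))]"
| "ce off d (Divi e f) = ce off d e @ ce (off + elen e) (Suc d) f @ [Op Div (rt d) (rt d) (rt (Suc d))]"
| "ce off d (Rd A e) = ce off d e @ [Load (rt d) (ar A) (rt d)]"

text \<open>The four idle instructions after the embedded program make the code of a call nonempty
  whatever \<open>P0\<close> is. The code length then is at least 4, so that every tick of a call
  can pay for a machine step.\<close>

fun cc :: "nat \<Rightarrow> com \<Rightarrow> program" where
  "cc off (Asg x e) = ce off 0 e @ [Op Or (rv x) (rt 0) (rt 0)]"
| "cc off (St A e f) = ce off 0 e @ ce (off + elen e) 1 f @ [Store (ar A) (rt 0) (rt 1)]"
| "cc off (Seq c d) = cc off c @ cc (off + clen (length P0) c) d"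
| "cc off (Ite e f c d) = (let p = off + elen e + elen f; q = p + 1 + clen (length P0) d + 1 in
     ce off 0 e @ ce (off + elen e) 1 f @ [JumpLess (rt 0) (rt 1) q] @ cc (p + 1) d @
     [Jump (q + clen (length P0) c)] @ cc q c)"
| "cc off (For x e c) = (let p = off + 1 + elen e in
     [Const (rv x) 0] @ ce (off + 1) 0 e @ [JumpLess (rv x) (rt 0) (p + 2), Jump (p + 5 + clen (length P0) c)] @
     cc (p + 2) c @ [Const (rt 0) 1, Op Add (rv x) (rv x) (rt 0), Jump (off + 1)])"
| "cc off Call = relocate off P0 @ [Const (rt 0) 0, Const (rt 0) 0, Const (rt 0) 0, Const (rt 0) 0]"

lemma length_ce [simp]: "length (ce off d e) = elen e"
  by (induction e arbitrary: off d) (auto simp: Let_def)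

lemma length_cc [simp]: "length (cc off c) = clen (length P0) c"
  by (induction c arbitrary: off) (auto simp: Let_def)

definition rel :: "config \<Rightarrow> (nat \<Rightarrow> nat) \<Rightarrow> (nat \<Rightarrow> nat \<Rightarrow> nat) \<Rightarrow> bool" where
  "rel s g a \<longleftrightarrow> (\<forall>x<nv. regs s (rv x) = g x \<and> g x \<le> B) \<and> (\<forall>A. mem s (ar A) = a A)"

end

locale compiler_correct = compiler +
  assumes P0_local: "\<And>i. i \<in> set P0 \<Longrightarrow> instr_regs i \<subseteq> {..<R} \<and> instr_arrs i \<subseteq> {..<M}"
    and P0_run: "\<And>s m. words_config w s \<Longrightarrow> pc s = 0 \<Longrightarrow> m = mem s 0 0 \<Longrightarrow> 1 \<le> m \<Longrightarrow> m \<le> B \<Longrightarrow>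
      (\<And>i. i < 2 * m * m \<Longrightarrow> mem s 0 (Suc i) \<le> B) \<Longrightarrow>
      \<exists>t\<le>tau m. halted P0 ((step w P0 ^^ t) s) \<and> (\<forall>i<m. \<forall>j<m. mem ((step w P0 ^^ t) s) 1 (i * m + j) =
         Min ((\<lambda>k. mem s 0 (Suc (i * m + k)) + mem s 0 (Suc (m * m + (k * m + j)))) ` {..<m}))"
    and B_ge_2: "2 \<le> B"
begin

text \<open>For products the bounds multiply. A sum of x, y \<ge> 1 is at most 2 x y \<le> B x y,
  which is where the extra degree of \<open>Plus\<close> comes from; the other operations do not
  exceed an operand or read a cell, which is bounded by B.\<close>

lemma val_le:
  assumes "ok e g a" "\<And>x. x \<in> avars e \<Longrightarrow> g x \<le> B"
  shows "val e g a \<le> B ^ adeg e"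
  using assms
proof (induction e)
  case (N k)
  have "k \<le> 2 ^ k" by (simp add: less_imp_le)
  also have "\<dots> \<le> B ^ k" using B_ge_2 by (simp add: power_mono)
  finally show ?case by simp
next
  case (Plus e f)
  have *: "x \<le> B * (x * y)" if "y \<ge> 1" for x y using that B_ge_2 by simp
  have a: "2 * (x * y) \<ge> x + y" if "x \<ge> 1" "y \<ge> 1" for x y :: nat
    using that by (metis add_mono mult.commute mult_2 mult_le_mono1 nat_mult_1)
  have one: "1 \<le> B ^ k" for k using B_ge_2 by simp
  have "val e g a + val f g a \<le> B ^ adeg e + B ^ adeg f" using Plus by (simp add: add_mono)
  also have "\<dots> \<le> 2 * (B ^ adeg e * B ^ adeg f)" by (rule a) (rule one)+
  also have "\<dots> \<le> B * (B ^ adeg e * B ^ adeg f)" using B_ge_2 by simp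
  finally show ?case by (simp add: power_add)
next
  case (Minus e f)
  have "val e g a - val f g a \<le> B ^ adeg e" using Minus by (simp add: le_diff_conv trans_le_add1)
  also have "\<dots> \<le> B ^ adeg e * B ^ adeg f" using B_ge_2 by simp
  finally show ?case by (simp add: power_add)
next
  case (Divi e f)
  have "val e g a div val f g a \<le> val e g a" by (rule div_le_dividend)
  also have "\<dots> \<le> B ^ adeg e" using Divi by simp
  also have "\<dots> \<le> B ^ adeg e * B ^ adeg f" using B_ge_2 by simp
  finally show ?case by (simp add: power_add)
next
  case (Times e f)
  then show ?case by (simp add: power_add mult_mono)
next
  case (Rd A e)
  then have "val (Rd A e) g a \<le> B" by simp
  also have "\<dots> \<le> B * B ^ adeg e" using B_ge_2 by simp
  finally show ?case by simp
qed auto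

lemma val_less:
  assumes "ok e g a" "rel s g a" "avars e \<subseteq> {..<nv}" "B ^ adeg e < 2 ^ w"
  shows "val e g a < 2 ^ w"
proof (rule le_less_trans[OF val_le assms(4)])
  show "g x \<le> B" if "x \<in> avars e" for x using that assms(2,3) by (auto simp: rel_def)
qed (rule assms(1))

lemma pow_less: "B ^ (d + e) < 2 ^ w \<Longrightarrow> B ^ d < 2 ^ w" "B ^ (d + e) < 2 ^ w \<Longrightarrow> B ^ e < 2 ^ w"
proof -
  assume *: "B ^ (d + e) < 2 ^ w"
  have "B ^ d \<le> B ^ (d + e)" "B ^ e \<le> B ^ (d + e)" using B_ge_2 by (simp_all add: power_increasing)
  then show "B ^ d < 2 ^ w" "B ^ e < 2 ^ w" using * by linarith+
qed

definition same_below :: "nat \<Rightarrow> config \<Rightarrow> config \<Rightarrow> bool" where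
  "same_below d s s' \<longleftrightarrow> mem s' = mem s \<and> (\<forall>r. (\<forall>d'\<ge>d. r \<noteq> rt d') \<longrightarrow> regs s' r = regs s r)"

lemma same_below_trans: "same_below d s s' \<Longrightarrow> same_below d s' s'' \<Longrightarrow> same_below d s s''"
  unfolding same_below_def by simp

lemma same_below_Suc: "same_below (Suc d) s s' \<Longrightarrow> same_below d s s'"
  unfolding same_below_def by simp

lemma same_below_rt: "same_below (Suc d) s s' \<Longrightarrow> regs s' (rt d) = regs s (rt d)"
  unfolding same_below_def by simp

lemma same_below_rel: "same_below d s s' \<Longrightarrow> rel s' g a = rel s g a"
  unfolding same_below_def rel_def by simp

lemma same_below_upd: "same_below d s (s\<lparr>pc := p, regs := (regs s)(rt d := v)\<rparr>)"
  unfolding same_below_def by auto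

definition evals :: "program \<Rightarrow> config \<Rightarrow> nat \<Rightarrow> nat \<Rightarrow> nat \<Rightarrow> nat \<Rightarrow> bool" where
  "evals P s k q d v \<longleftrightarrow> (\<exists>s'. reach w P k s s' \<and> pc s' = q \<and> regs s' (rt d) = v \<and> same_below d s s')"

lemma evals_binop:
  assumes s1: "reach w P k s s1" "pc s1 = p" "regs s1 (rt d) = x" "same_below d s s1"
    and s2: "reach w P k' s1 s2" "pc s2 = q" "regs s2 (rt (Suc d)) = y" "same_below (Suc d) s1 s2"
    and s3: "reach w P k'' s2 (s2\<lparr>pc := q', regs := (regs s2)(rt d := v)\<rparr>)"
  shows "evals P s (k + k' + k'') q' d v"
  unfolding evals_def
proof (intro exI conjI)
  show "reach w P (k + k' + k'') s (s2\<lparr>pc := q', regs := (regs s2)(rt d := v)\<rparr>)"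
    by (intro reach_trans[OF reach_trans[OF s1(1) s2(1)] s3])
  show "same_below d s (s2\<lparr>pc := q', regs := (regs s2)(rt d := v)\<rparr>)"
    by (rule same_below_trans[OF same_below_trans[OF s1(4) same_below_Suc[OF s2(4)]] same_below_upd])
qed auto

lemma evals_op:
  assumes s1: "reach w P k s s1" "pc s1 = p" "regs s1 (rt d) = x" "same_below d s s1"
    and s2: "reach w P k' s1 s2" "pc s2 = q" "regs s2 (rt (Suc d)) = y" "same_below (Suc d) s1 s2"
    and P: "q < length P" "P ! q = Op f (rt d) (rt d) (rt (Suc d))" and v: "binop_val w f x y = v"
  shows "evals P s (k + k' + 1) (q + 1) d v"
proof (rule evals_binop[OF s1 s2])
  have x: "regs s2 (rt d) = x" using same_below_rt[OF s2(4)] s1(3) by simp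
  show "reach w P 1 s2 (s2\<lparr>pc := q + 1, regs := (regs s2)(rt d := v)\<rparr>)"
    using reach_step[of s2 P w] s2(2,3) P v x by simp
qed

lemma ce_run:
  assumes "code_at P off (ce off d e)" "rel s g a" "pc s = off" "ok e g a" "avars e \<subseteq> {..<nv}"
    "B ^ adeg e < 2 ^ w"
  shows "evals P s (elen e) (off + elen e) d (val e g a)"
  using assms
proof (induction e arbitrary: off d s)
  case (N k)
  have k: "k < 2 ^ w" using N.prems val_le[of "N k" g a] by simp
  have "reach w P 1 s (s\<lparr>pc := off + 1, regs := (regs s)(rt d := k)\<rparr>)"
    using N.prems k reach_step[of s P w] by simp
  then show ?case unfolding evals_def by (intro exI conjI) (auto simp: same_below_upd)
next
  case (V x)
  have "reach w P 1 s (s\<lparr>pc := off + 1, regs := (regs s)(rt d := g x)\<rparr>)"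
    using V.prems reach_step[of s P w] by (simp add: rel_def)
  then show ?case unfolding evals_def by (intro exI conjI) (auto simp: same_below_upd)
next
  case (Rd A e)
  have "B ^ adeg e < 2 ^ w" using Rd.prems(6) pow_less(2)[of 1] by simp
  then have "evals P s (elen e) (off + elen e) d (val e g a)"
    by (intro Rd.IH) (use Rd.prems in auto)
  then obtain s1 where s1: "reach w P (elen e) s s1" "pc s1 = off + elen e" "regs s1 (rt d) = val e g a"
     "same_below d s s1" unfolding evals_def by blast
  have r: "rel s1 g a" using same_below_rel[OF s1(4)] Rd.prems(2) by blast
  have "reach w P 1 s1 (s1\<lparr>pc := off + elen e + 1, regs := (regs s1)(rt d := val (Rd A e) g a)\<rparr>)"
    using Rd.prems s1 r reach_step[of s1 P w] by (simp add: rel_def)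
  from reach_trans[OF s1(1) this] show ?case unfolding evals_def
    by (intro exI conjI) (use same_below_trans[OF s1(4) same_below_upd] in auto)
next
  case (Plus e f)
  have B: "B ^ adeg e < 2 ^ w" "B ^ adeg f < 2 ^ w"
  proof -
    have "B ^ (adeg e + (adeg f + 1)) < 2 ^ w" using Plus.prems(6) by (simp only: adeg.simps add.assoc)
    then show "B ^ adeg e < 2 ^ w" by (rule pow_less(1))
    have "B ^ ((adeg e + 1) + adeg f) < 2 ^ w" using Plus.prems(6) by (simp only: adeg.simps ac_simps)
    then show "B ^ adeg f < 2 ^ w" by (rule pow_less(2))
  qed
  have vv: "val (Plus e f) g a < 2 ^ w" by (rule val_less[OF Plus.prems(4,2,5,6)])
  have "evals P s (elen e) (off + elen e) d (val e g a)"
    by (rule Plus.IH(1)) (use Plus.prems B in auto)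
  then obtain s1 where s1: "reach w P (elen e) s s1" "pc s1 = off + elen e" "regs s1 (rt d) = val e g a"
     "same_below d s s1" unfolding evals_def by blast
  have "evals P s1 (elen f) (off + elen e + elen f) (Suc d) (val f g a)"
    by (rule Plus.IH(2)) (use Plus.prems B s1 same_below_rel[OF s1(4)] in auto)
  then obtain s2 where s2: "reach w P (elen f) s1 s2" "pc s2 = off + elen e + elen f"
     "regs s2 (rt (Suc d)) = val f g a" "same_below (Suc d) s1 s2" unfolding evals_def by blast
  have "evals P s (elen e + elen f + 1) (off + elen e + elen f + 1) d (val (Plus e f) g a)"
    by (rule evals_op[OF s1 s2, where f = Add]) (use Plus.prems(1) vv in simp_all)
  then show ?case by (simp only: elen.simps add.assoc)
next
  case (Times e f)
  have B: "B ^ adeg e < 2 ^ w" "B ^ adeg f < 2 ^ w" by (rule pow_less[of "adeg e" "adeg f"], use Times.prems(6) in simp)+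
  have vv: "val (Times e f) g a < 2 ^ w" by (rule val_less[OF Times.prems(4,2,5,6)])
  have "evals P s (elen e) (off + elen e) d (val e g a)"
    by (rule Times.IH(1)) (use Times.prems B in auto)
  then obtain s1 where s1: "reach w P (elen e) s s1" "pc s1 = off + elen e" "regs s1 (rt d) = val e g a"
     "same_below d s s1" unfolding evals_def by blast
  have "evals P s1 (elen f) (off + elen e + elen f) (Suc d) (val f g a)"
    by (rule Times.IH(2)) (use Times.prems B s1 same_below_rel[OF s1(4)] in auto)
  then obtain s2 where s2: "reach w P (elen f) s1 s2" "pc s2 = off + elen e + elen f"
     "regs s2 (rt (Suc d)) = val f g a" "same_below (Suc d) s1 s2" unfolding evals_def by blast
  have "evals P s (elen e + elen f + 1) (off + elen e + elen f + 1) d (val (Times e f) g a)"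
    by (rule evals_op[OF s1 s2, where f = Mul]) (use Times.prems(1) vv in simp_all)
  then show ?case by (simp only: elen.simps add.assoc)
next
  case (Divi e f)
  have B: "B ^ adeg e < 2 ^ w" "B ^ adeg f < 2 ^ w" by (rule pow_less[of "adeg e" "adeg f"], use Divi.prems(6) in simp)+
  have "evals P s (elen e) (off + elen e) d (val e g a)"
    by (rule Divi.IH(1)) (use Divi.prems B in auto)
  then obtain s1 where s1: "reach w P (elen e) s s1" "pc s1 = off + elen e" "regs s1 (rt d) = val e g a"
     "same_below d s s1" unfolding evals_def by blast
  have "evals P s1 (elen f) (off + elen e + elen f) (Suc d) (val f g a)"
    by (rule Divi.IH(2)) (use Divi.prems B s1 same_below_rel[OF s1(4)] in auto)
  then obtain s2 where s2: "reach w P (elen f) s1 s2" "pc s2 = off + elen e + elen f"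
     "regs s2 (rt (Suc d)) = val f g a" "same_below (Suc d) s1 s2" unfolding evals_def by blast
  have "evals P s (elen e + elen f + 1) (off + elen e + elen f + 1) d (val (Divi e f) g a)"
    by (rule evals_op[OF s1 s2, where f = Div]) (use Divi.prems(1) in simp_all)
  then show ?case by (simp only: elen.simps add.assoc)
next
  case (Minus e f)
  have B: "B ^ adeg e < 2 ^ w" "B ^ adeg f < 2 ^ w" by (rule pow_less[of "adeg e" "adeg f"], use Minus.prems(6) in simp)+
  have vv: "val e g a < 2 ^ w" by (rule val_less) (use Minus.prems B in auto)
  have "evals P s (elen e) (off + elen e) d (val e g a)"
    by (rule Minus.IH(1)) (use Minus.prems B in auto)
  then obtain s1 where s1: "reach w P (elen e) s s1" "pc s1 = off + elen e" "regs s1 (rt d) = val e g a"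
     "same_below d s s1" unfolding evals_def by blast
  have "evals P s1 (elen f) (off + elen e + elen f) (Suc d) (val f g a)"
    by (rule Minus.IH(2)) (use Minus.prems B s1 same_below_rel[OF s1(4)] in auto)
  then obtain s2 where s2: "reach w P (elen f) s1 s2" "pc s2 = off + elen e + elen f"
     "regs s2 (rt (Suc d)) = val f g a" "same_below (Suc d) s1 s2" unfolding evals_def by blast
  let ?p = "off + elen e + elen f"
  have code: "?p + 3 < length P" "P ! ?p = JumpLess (rt d) (rt (Suc d)) (?p + 3)"
    "P ! Suc ?p = Op Sub (rt d) (rt d) (rt (Suc d))" "P ! Suc (Suc ?p) = Jump (?p + 4)"
    "P ! Suc (Suc (Suc ?p)) = Const (rt d) 0"
    using Minus.prems(1) by (auto simp: Let_def eval_nat_numeral)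
  have d: "regs s2 (rt d) = val e g a" using same_below_rt[OF s2(4)] s1(3) by simp
  have "evals P s (elen e + elen f + 4) (?p + 4) d (val (Minus e f) g a)"
  proof (rule evals_binop[OF s1 s2])
    let ?s = "s2\<lparr>pc := ?p + 4, regs := (regs s2)(rt d := val (Minus e f) g a)\<rparr>"
    show "reach w P 4 s2 ?s"
    proof (cases "val e g a < val f g a")
      case True
      have "reach w P (Suc (Suc 0)) s2 ?s"
        apply (rule reach_then)
        using code s2(2) apply simp
        apply (rule reach_then)
        using code s2(2,3) d True apply (simp add: eval_nat_numeral)
        using code s2(2,3) d True apply (auto intro!: reach_eq simp: eval_nat_numeral)
        done
      then show ?thesis by (rule reach_mono) simp
    next
      case False
      have e: "(val e g a + 2 ^ w - val f g a) mod 2 ^ w = val e g a - val f g a"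
      proof -
        have "val e g a + 2 ^ w - val f g a = (val e g a - val f g a) + 2 ^ w" using False by simp
        then show ?thesis using vv by (metis less_imp_diff_less mod_add_self2 mod_less)
      qed
      have "reach w P (Suc (Suc (Suc 0))) s2 ?s"
        apply (rule reach_then)
        using code s2(2) apply simp
        apply (rule reach_then)
        using code s2(2,3) d False apply (simp add: eval_nat_numeral)
        apply (rule reach_then)
        using code s2(2,3) d False apply (simp add: eval_nat_numeral)
        using code s2(2,3) d False e apply (auto intro!: reach_eq simp: eval_nat_numeral)
        done
      then show ?thesis by (rule reach_mono) simp
    qed
  qed
  then show ?case by (simp only: elen.simps add.assoc)
qed

end

section \<open>Compiled commands simulate the calculus\<close>

context compiler_correct
begin

lemma rel_upd_reg:
  "rel s g a \<Longrightarrow> v \<le> B \<Longrightarrow> (\<And>y. y \<noteq> x \<Longrightarrow> regs s' (rv y) = regs s (rv y)) \<Longrightarrow> regs s' (rv x) = v \<Longrightarrow>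
    mem s' = mem s \<Longrightarrow> rel s' (g(x := v)) a"
  unfolding rel_def by simp

lemma ce_rel:
  assumes "code_at P off (ce off d e)" "rel s g a" "pc s = off" "ok e g a" "avars e \<subseteq> {..<nv}"
    "B ^ adeg e < 2 ^ w"
  obtains s' where "reach w P (elen e) s s'" "pc s' = off + elen e" "regs s' (rt d) = val e g a" "rel s' g a"
    "same_below d s s'"
  using ce_run[OF assms] same_below_rel assms(2) unfolding evals_def by blast

lemma ce_rel2:
  assumes "code_at P off (ce off 0 e)" "code_at P (off + elen e) (ce (off + elen e) 1 f)"
    "rel s g a" "pc s = off" "ok e g a" "ok f g a" "avars e \<subseteq> {..<nv}" "avars f \<subseteq> {..<nv}"
    "B ^ adeg e < 2 ^ w" "B ^ adeg f < 2 ^ w"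
  obtains s' where "reach w P (elen e + elen f) s s'" "pc s' = off + elen e + elen f" "regs s' (rt 0) = val e g a"
    "regs s' (rt 1) = val f g a" "rel s' g a"
proof -
  obtain s1 where s1: "reach w P (elen e) s s1" "pc s1 = off + elen e" "regs s1 (rt 0) = val e g a" "rel s1 g a"
    using ce_rel[OF assms(1,3-5,7,9)] by metis
  obtain s2 where s2: "reach w P (elen f) s1 s2" "pc s2 = off + elen e + elen f" "regs s2 (rt 1) = val f g a" "rel s2 g a"
    "same_below 1 s1 s2"
    using ce_rel[OF assms(2) s1(4,2) assms(6,8,10)] by metis
  have "regs s2 (rt 0) = val e g a" using same_below_rt[of 0] s2(5) s1(3) by simp
  then show thesis using that reach_trans[OF s1(1) s2(1)] s2 by blast
qed

text \<open>The relocated run mirrors a run of \<open>P0\<close> from program counter 0, so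
  \<open>P0_run\<close> describes array 1 and \<open>run_local\<close> keeps everything the caller
  owns. The new abstract arrays are read off from the final memory, as nothing is promised about
  array 0 and the rest of array 1.\<close>

lemma call_run:
  assumes "code_at P off (relocate off P0)" "pc s = off" "words_config w s" "rel s g a"
    and m: "m = a 0 0" "1 \<le> m" "m \<le> B" "\<And>i. i < 2 * m * m \<Longrightarrow> a 0 (Suc i) \<le> B"
  shows "\<exists>s' a'. reach w P (tau m) s s' \<and> pc s' = off + length P0 \<and> rel s' g a' \<and> (\<forall>A\<ge>2. a' A = a A) \<and>
     (\<forall>i<m. \<forall>j<m. a' 1 (i * m + j) =
        Min ((\<lambda>k. a 0 (Suc (i * m + k)) + a 0 (Suc (m * m + (k * m + j)))) ` {..<m}))"
proof -
  let ?s0 = "s\<lparr>pc := 0\<rparr>"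
  have a0: "mem s 0 = a 0" using assms(4) by (auto simp: rel_def ar_def dest: spec[of _ 0])
  have "words_config w ?s0" using assms(3) by (simp add: words_config_def)
  then obtain t where t: "t \<le> tau m" "halted P0 ((step w P0 ^^ t) ?s0)"
     "\<forall>i<m. \<forall>j<m. mem ((step w P0 ^^ t) ?s0) 1 (i * m + j) =
         Min ((\<lambda>k. mem ?s0 0 (Suc (i * m + k)) + mem ?s0 0 (Suc (m * m + (k * m + j)))) ` {..<m})"
    using P0_run[of ?s0 m] m a0 by auto
  have "\<exists>s'. reach w P t s s' \<and> pc s' = off + min (pc ((step w P0 ^^ t) ?s0)) (length P0) \<and>
      regs s' = regs ((step w P0 ^^ t) ?s0) \<and> mem s' = mem ((step w P0 ^^ t) ?s0)"
    by (rule run_relocated[OF assms(1)]) (use assms(2) in auto)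
  then obtain s' where s': "reach w P t s s'" "pc s' = off + min (pc ((step w P0 ^^ t) ?s0)) (length P0)"
      "regs s' = regs ((step w P0 ^^ t) ?s0)" "mem s' = mem ((step w P0 ^^ t) ?s0)" by blast
  have "(\<forall>r\<ge>R. regs ((step w P0 ^^ t) ?s0) r = regs ?s0 r) \<and> (\<forall>m\<ge>M. mem ((step w P0 ^^ t) ?s0) m = mem ?s0 m)"
    by (rule run_local) (rule P0_local)
  then have loc: "\<And>r. r \<ge> R \<Longrightarrow> regs s' r = regs s r" and locm: "\<And>r. r \<ge> M \<Longrightarrow> mem s' r = mem s r"
    using s'(3,4) by auto
  have "rel s' g (\<lambda>A. mem s' (ar A))"
    using assms(4) by (auto simp: rel_def loc rv_def)
  moreover have "mem s' (ar A) = a A" if "A \<ge> 2" for A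
  proof -
    have "mem s (ar A) = a A" using assms(4) by (simp add: rel_def)
    then show ?thesis using that locm[of "ar A"] by (simp add: ar_def)
  qed
  moreover have "pc s' = off + length P0" using s'(2) t(2) by (simp add: halted_def)
  moreover have "reach w P (tau m) s s'" using s'(1) t(1) by (rule reach_mono)
  ultimately show ?thesis using t(3) s'(4) a0
    by (intro exI[of _ s'] exI[of _ "\<lambda>A. mem s' (ar A)"]) (auto simp: ar_def)
qed

text \<open>Every tick of the clock pays for at most L machine steps.\<close>

definition runs_to :: "nat \<Rightarrow> program \<Rightarrow> nat \<Rightarrow> config \<Rightarrow> nat \<Rightarrow> (state \<Rightarrow> bool) \<Rightarrow> bool" where
  "runs_to L P q s t Q \<longleftrightarrow> (\<exists>k s' g' a' t'. Q (g', a', t') \<and> reach w P k s s' \<and> rel s' g' a' \<and> pc s' = q \<and>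
     t \<le> t' \<and> k + L * t \<le> L * t')"

lemma runs_to_prefix:
  assumes "reach w P k s s'" "k + L * t \<le> L * t'" "t \<le> t'" "runs_to L P q s' t' Q"
  shows "runs_to L P q s t Q"
proof -
  obtain k' s'' g a t'' where *: "Q (g, a, t'')" "reach w P k' s' s''" "rel s'' g a" "pc s'' = q" "t' \<le> t''" "k' + L * t' \<le> L * t''"
    using assms(4) unfolding runs_to_def by blast
  have "reach w P (k + k') s s''" using assms(1) *(2) by (rule reach_trans)
  moreover have "k + k' + L * t \<le> L * t''" using * assms by linarith
  ultimately show ?thesis unfolding runs_to_def
    by (intro exI[of _ "k + k'"] exI[of _ s''] exI[of _ g] exI[of _ a] exI[of _ t'']) (use * assms(3) in auto)
qed

lemma runs_to_seq:
  assumes "runs_to L P q s t Q" "words_config w s"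
    and "\<And>s' g a t. Q (g, a, t) \<Longrightarrow> rel s' g a \<Longrightarrow> pc s' = q \<Longrightarrow> words_config w s' \<Longrightarrow> runs_to L P q' s' t Q'"
  shows "runs_to L P q' s t Q'"
proof -
  obtain k s' g a t' where *: "Q (g, a, t')" "reach w P k s s'" "rel s' g a" "pc s' = q" "t \<le> t'" "k + L * t \<le> L * t'"
    using assms(1) unfolding runs_to_def by blast
  have "words_config w s'" using words_reach[OF *(2)] assms(2) by blast
  then show ?thesis using runs_to_prefix[OF *(2,6,5)] assms(3)[OF *(1,3,4)] by blast
qed

lemma runs_to_end:
  "Q (g, a, t) \<Longrightarrow> rel s g a \<Longrightarrow> pc s = q \<Longrightarrow> runs_to L P q s t Q"
  unfolding runs_to_def using reach_refl[of w P 0 s] by (metis add_0 order_refl)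

lemma runs_to_tick:
  assumes "reach w P k s s'" "k \<le> L" "Q (g', a', Suc t)" "rel s' g' a'" "pc s' = q"
  shows "runs_to L P q s t Q"
  using runs_to_prefix[OF assms(1) _ _ runs_to_end[where Q = Q, OF assms(3,4,5)], of L t] assms(2) by simp

text \<open>Induction on the command, with the step bound in amortised form: going from clock t to
  clock t' takes at most L * (t' - t) steps. The instructions which a command adds to those of its
  parts are covered by its own tick, as L is at least the length of its code; those of a called
  program are covered by the tau m ticks of the call.\<close>

theorem cc_correct:
  assumes "wp c Q (g, a, t)" "code_at P off (cc off c)" "rel s g a" "pc s = off" "words_config w s"
    "cvars c \<subseteq> {..<nv}" "B ^ cdeg c < 2 ^ w" "clen (length P0) c \<le> L"
  shows "runs_to L P (off + clen (length P0) c) s t Q"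
  using assms
proof (induction c arbitrary: Q g a t off s)
  case (Asg x e)
  obtain s1 where s1: "reach w P (elen e) s s1" "pc s1 = off + elen e" "regs s1 (rt 0) = val e g a" "rel s1 g a"
    using ce_rel[of P off 0 e s g a] Asg.prems by auto
  have "reach w P (elen e + 1) s (exec w (P ! pc s1) s1)"
    by (intro reach_trans[OF s1(1)] reach_step) (use Asg.prems s1 in auto)
  then show ?case using Asg.prems s1
    by (intro runs_to_tick[of _ _ s "exec w (P ! pc s1) s1" _ _ "g(x := val e g a)" a]) (auto intro!: rel_upd_reg[where s = s1])
next
  case (St A e f)
  have B: "B ^ adeg e < 2 ^ w" "B ^ adeg f < 2 ^ w"
    by (rule pow_less[of "adeg e" "adeg f"], use St.prems(7) in simp)+
  obtain s1 where s1: "reach w P (elen e + elen f) s s1" "pc s1 = off + elen e + elen f" "regs s1 (rt 0) = val e g a"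
      "regs s1 (rt 1) = val f g a" "rel s1 g a"
    by (rule ce_rel2[of P off e f s g a]) (use St.prems B in auto)
  have "reach w P (elen e + elen f + 1) s (exec w (P ! pc s1) s1)"
    by (intro reach_trans[OF s1(1)] reach_step) (use St.prems s1 in auto)
  then show ?case using St.prems s1
    by (intro runs_to_tick[of _ _ s "exec w (P ! pc s1) s1" _ _ g "a(A := (a A)(val e g a := val f g a))"])
       (auto simp: rel_def)
next
  case (Seq c d)
  have B: "B ^ cdeg c < 2 ^ w" "B ^ cdeg d < 2 ^ w"
    by (rule pow_less[of "cdeg c" "cdeg d"], use Seq.prems(7) in simp)+
  have "runs_to L P (off + clen (length P0) c) s t (wp d Q)"
    by (rule Seq.IH(1)) (use Seq.prems B in auto)
  then show ?case
  proof (rule runs_to_seq[OF _ Seq.prems(5)])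
    fix s' g' a' t'
    assume *: "wp d Q (g', a', t')" "rel s' g' a'" "pc s' = off + clen (length P0) c" "words_config w s'"
    have "runs_to L P (off + clen (length P0) c + clen (length P0) d) s' t' Q"
      by (rule Seq.IH(2)[OF *(1) _ *(2,3,4)]) (use Seq.prems B in auto)
    then show "runs_to L P (off + clen (length P0) (Seq c d)) s' t' Q" by (simp add: add.assoc)
  qed
next
  case (Ite e f c d)
  have B: "B ^ adeg e < 2 ^ w" "B ^ adeg f < 2 ^ w" "B ^ cdeg c < 2 ^ w" "B ^ cdeg d < 2 ^ w"
  proof -
    have a: "B ^ (adeg e + adeg f + cdeg c + cdeg d) < 2 ^ w" using Ite.prems(7) by simp
    show "B ^ cdeg d < 2 ^ w" by (rule pow_less(2)[OF a])
    show "B ^ cdeg c < 2 ^ w" by (rule pow_less(2)[OF pow_less(1)[OF a]])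
    show "B ^ adeg f < 2 ^ w" by (rule pow_less(2)[OF pow_less(1)[OF pow_less(1)[OF a]]])
    show "B ^ adeg e < 2 ^ w" by (rule pow_less(1)[OF pow_less(1)[OF pow_less(1)[OF a]]])
  qed
  obtain s1 where s1: "reach w P (elen e + elen f) s s1" "pc s1 = off + elen e + elen f" "regs s1 (rt 0) = val e g a"
      "regs s1 (rt 1) = val f g a" "rel s1 g a"
    by (rule ce_rel2[of P off e f s g a]) (use Ite.prems B in \<open>auto simp: Let_def\<close>)
  let ?p = "off + elen e + elen f"
  let ?q = "?p + 1 + clen (length P0) d + 1"
  have code: "?p < length P" "P ! ?p = JumpLess (rt 0) (rt 1) ?q" "code_at P (?p + 1) (cc (?p + 1) d)"
    "?p + 1 + clen (length P0) d < length P" "P ! (?p + 1 + clen (length P0) d) = Jump (?q + clen (length P0) c)"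
    "code_at P ?q (cc ?q c)" using Ite.prems(2) by (auto simp: Let_def)
  have r2: "reach w P (elen e + elen f + 1) s (exec w (P ! pc s1) s1)"
    by (intro reach_trans[OF s1(1)] reach_step) (use code s1 in auto)
  show ?case
  proof (cases "val e g a < val f g a")
    case True
    have e: "exec w (P ! pc s1) s1 = s1\<lparr>pc := ?q\<rparr>" using code s1 True by simp
    show ?thesis
    proof (rule runs_to_prefix[OF r2, of L t "Suc t"])
      have "words_config w (s1\<lparr>pc := ?q\<rparr>)" using words_reach[OF r2] Ite.prems(5) e by auto
      then have "runs_to L P (?q + clen (length P0) c) (s1\<lparr>pc := ?q\<rparr>) (Suc t) Q"
        by (intro Ite.IH(1)[of _ g a]) (use Ite.prems True B code s1 in \<open>auto simp: rel_def\<close>)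
      then show "runs_to L P (off + clen (length P0) (Ite e f c d)) (exec w (P ! pc s1) s1) (Suc t) Q"
        unfolding e by (simp add: ac_simps)
    qed (use Ite.prems in auto)
  next
    case False
    have e: "exec w (P ! pc s1) s1 = s1\<lparr>pc := ?p + 1\<rparr>" using code s1 False by simp
    have L: "elen e + elen f + 2 \<le> L" using Ite.prems(8) by simp
    have "words_config w (s1\<lparr>pc := ?p + 1\<rparr>)" using words_reach[OF r2] Ite.prems(5) e by auto
    then have "runs_to L P (?p + 1 + clen (length P0) d) (s1\<lparr>pc := ?p + 1\<rparr>) (Suc t) Q"
      by (intro Ite.IH(2)[of _ g a]) (use Ite.prems False B code s1 in \<open>auto simp: rel_def\<close>)
    then obtain k s' g' a' t' where *: "Q (g', a', t')" "reach w P k (s1\<lparr>pc := ?p + 1\<rparr>) s'" "rel s' g' a'"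
        "pc s' = ?p + 1 + clen (length P0) d" "Suc t \<le> t'" "k + L * Suc t \<le> L * t'"
      unfolding runs_to_def by blast
    have "reach w P (elen e + elen f + 1 + k + 1) s (exec w (P ! pc s') s')"
      by (intro reach_trans[OF reach_trans[OF r2] reach_step]) (use * code e in auto)
    moreover have "elen e + elen f + 1 + k + 1 + L * t \<le> L * t'" using *(6) L by simp
    ultimately show ?thesis unfolding runs_to_def using *
      by (intro exI[of _ "elen e + elen f + 1 + k + 1"] exI[of _ "exec w (P ! pc s') s'"] exI[of _ g'] exI[of _ a'] exI[of _ t'])
         (use code * in \<open>auto simp: rel_def\<close>)
  qed
next
  case (For x e c)
  let ?p = "off + 1 + elen e"
  let ?n = "clen (length P0) c"
  let ?end = "?p + 5 + ?n"
  have B: "B ^ adeg e < 2 ^ w" "B ^ cdeg c < 2 ^ w" "B < 2 ^ w"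
  proof -
    have a: "B ^ (adeg e + cdeg c + 1) < 2 ^ w" using For.prems(7) by (simp only: cdeg.simps)
    show "B < 2 ^ w" using pow_less(2)[OF a] by (simp only: power_one_right)
    show "B ^ cdeg c < 2 ^ w" by (rule pow_less(2)[OF pow_less(1)[OF a]])
    show "B ^ adeg e < 2 ^ w" by (rule pow_less(1)[OF pow_less(1)[OF a]])
  qed
  have code: "off < length P" "P ! off = Const (rv x) 0" "code_at P (off + 1) (ce (off + 1) 0 e)"
    "?p + 1 < length P" "P ! ?p = JumpLess (rv x) (rt 0) (?p + 2)" "P ! (?p + 1) = Jump ?end"
    "code_at P (?p + 2) (cc (?p + 2) c)" "?p + 4 + ?n < length P"
    "P ! (?p + 2 + ?n) = Const (rt 0) 1" "P ! (?p + 3 + ?n) = Op Add (rv x) (rv x) (rt 0)"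
    "P ! (?p + 4 + ?n) = Jump (off + 1)"
    using For.prems(2) by (auto simp: Let_def eval_nat_numeral)
  have L: "elen e + 6 + ?n \<le> L" using For.prems(8) by simp
  from For.prems(1) obtain N I where I: "N \<le> B" "I 0 (g(x := 0), a, Suc t)"
     "\<And>i s. I i s \<Longrightarrow> fst s x = i \<and> ok e (fst s) (fst (snd s)) \<and> val e (fst s) (fst (snd s)) = N \<and> t < snd (snd s) \<and>
        (i < N \<longrightarrow> wp c (\<lambda>(g', a', t'). I (Suc i) (g'(x := Suc (g' x)), a', Suc t') \<and> g' x = i) s)"
     "\<And>s. I N s \<Longrightarrow> Q (fst s, fst (snd s), Suc (snd (snd s)))" by auto
  \<comment> \<open>Induction on the number j of rounds that remain, from the point where the bound
    is about to be evaluated.\<close>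
  have loop: "runs_to L P ?end s t Q" if "I (N - j) (g, a, t)" "j \<le> N" "rel s g a" "pc s = off + 1" "words_config w s"
    for j s g a t
    using that
  proof (induction j arbitrary: s g a t)
    case 0
    have vi: "ok e g a" "val e g a = N" "g x = N" using I(3)[OF 0(1)] by auto
    obtain s1 where s1: "reach w P (elen e) s s1" "pc s1 = ?p" "regs s1 (rt 0) = N" "rel s1 g a"
      by (rule ce_rel[of P "off + 1" 0 e s g a]) (use code 0 vi For.prems(6) B in auto)
    have x: "regs s1 (rv x) = N" using s1(4) vi For.prems(6) by (auto simp: rel_def)
    have "reach w P (Suc (Suc 0)) s1 (s1\<lparr>pc := ?end\<rparr>)"
      apply (rule reach_then)
      using code s1 x apply simp
      apply (rule reach_then)
      using code s1 x apply simp
      using code s1 x apply (auto intro!: reach_eq simp: eval_nat_numeral)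
      done
    from reach_trans[OF s1(1) this] show ?case
      by (rule runs_to_tick[where g' = g and a' = a]) (use L I(4)[of "(g, a, t)"] 0 s1 in \<open>auto simp: rel_def\<close>)
  next
    case (Suc j)
    define i where "i = N - Suc j"
    have i: "i < N" "N - j = Suc i" using Suc.prems by (auto simp: i_def)
    have vi: "ok e g a" "val e g a = N" "g x = i"
        "wp c (\<lambda>(g', a', t'). I (Suc i) (g'(x := Suc (g' x)), a', Suc t') \<and> g' x = i) (g, a, t)"
      using I(3)[OF Suc.prems(1)] i by (auto simp: i_def)
    obtain s1 where s1: "reach w P (elen e) s s1" "pc s1 = ?p" "regs s1 (rt 0) = N" "rel s1 g a"
      by (rule ce_rel[of P "off + 1" 0 e s g a]) (use code Suc.prems vi For.prems(6) B in auto)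
    have x: "regs s1 (rv x) = i" using s1(4) vi For.prems(6) by (auto simp: rel_def)
    have r2: "reach w P (elen e + Suc 0) s (s1\<lparr>pc := ?p + 2\<rparr>)"
      apply (rule reach_trans[OF s1(1)])
      apply (rule reach_then)
      using code s1 x i by (auto intro!: reach_eq simp: eval_nat_numeral)
    have wd: "words_config w (s1\<lparr>pc := ?p + 2\<rparr>)" using words_reach[OF r2] Suc.prems by auto
    have "runs_to L P (?p + 2 + ?n) (s1\<lparr>pc := ?p + 2\<rparr>) t (\<lambda>(g', a', t'). I (Suc i) (g'(x := Suc (g' x)), a', Suc t') \<and> g' x = i)"
      by (rule For.IH[OF vi(4)]) (use For.prems B code s1 wd in \<open>auto simp: rel_def\<close>)
    then obtain k s' g' a' t' where *: "I (Suc i) (g'(x := Suc (g' x)), a', Suc t')" "g' x = i"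
        "reach w P k (s1\<lparr>pc := ?p + 2\<rparr>) s'" "rel s' g' a'"
        "pc s' = ?p + 2 + ?n" "t \<le> t'" "k + L * t \<le> L * t'"
      unfolding runs_to_def by blast
    have x': "regs s' (rv x) = i" using *(4) *(2) For.prems(6) by (auto simp: rel_def)
    have iw: "Suc i < 2 ^ w" "1 < (2::nat) ^ w" using i I(1) B B_ge_2 by linarith+
    let ?s2 = "s'\<lparr>pc := off + 1, regs := (regs s')(rt 0 := 1, rv x := Suc i)\<rparr>"
    have r3: "reach w P (Suc (Suc (Suc 0))) s' ?s2"
      apply (rule reach_then)
      using code * apply simp
      apply (rule reach_then)
      using code * apply (simp add: eval_nat_numeral)
      apply (rule reach_then)
      using code * apply (simp add: eval_nat_numeral)
      using code * x' iw apply (auto intro!: reach_eq simp: eval_nat_numeral)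
      done
    have r4: "reach w P (elen e + Suc 0 + k + Suc (Suc (Suc 0))) s ?s2"
      by (rule reach_trans[OF reach_trans[OF r2 *(3)] r3])
    show ?case
    proof (rule runs_to_prefix[OF r4, of L t "Suc t'"])
      show "elen e + Suc 0 + k + Suc (Suc (Suc 0)) + L * t \<le> L * Suc t'" using *(7) L by simp
      show "t \<le> Suc t'" using *(6) by simp
      show "runs_to L P ?end ?s2 (Suc t') Q"
      proof (rule Suc.IH[where g = "g'(x := Suc (g' x))" and a = a'])
        show "I (N - j) (g'(x := Suc (g' x)), a', Suc t')" using *(1) i(2) by metis
        show "rel ?s2 (g'(x := Suc (g' x))) a'" using *(2,4) i I(1) by (auto simp: rel_def)
        show "words_config w ?s2" using words_reach[OF r4] Suc.prems by blast
      qed (use Suc.prems in auto)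
    qed
  qed
  have r1: "reach w P (Suc 0) s (s\<lparr>pc := off + 1, regs := (regs s)(rv x := 0)\<rparr>)"
    apply (rule reach_then)
    using code For.prems(4) by (auto intro!: reach_eq simp: eval_nat_numeral)
  have "runs_to L P ?end (s\<lparr>pc := off + 1, regs := (regs s)(rv x := 0)\<rparr>) (Suc t) Q"
  proof (rule loop[of N "g(x := 0)" a])
    show "words_config w (s\<lparr>pc := off + 1, regs := (regs s)(rv x := 0)\<rparr>)"
      using words_reach[OF r1] For.prems by blast
  qed (use I(2) For.prems in \<open>auto simp: rel_def\<close>)
  from runs_to_prefix[OF r1 _ _ this, of t] L show ?case by (simp add: ac_simps)
next
  case Call
  let ?m = "a 0 0"
  have m: "1 \<le> ?m" "?m \<le> B" "\<And>i. i < 2 * ?m * ?m \<Longrightarrow> a 0 (Suc i) \<le> B"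
    using Call.prems(1) by (auto simp: Let_def)
  have code: "code_at P off (relocate off P0)" using Call.prems(2) by simp
  obtain s' a' where s': "reach w P (tau ?m) s s'" "pc s' = off + length P0" "rel s' g a'" "\<forall>A\<ge>2. a' A = a A"
     "\<forall>i<?m. \<forall>j<?m. a' 1 (i * ?m + j) =
        Min ((\<lambda>k. a 0 (Suc (i * ?m + k)) + a 0 (Suc (?m * ?m + (k * ?m + j)))) ` {..<?m})"
    using call_run[OF code Call.prems(4,5,3) refl m] by blast
  let ?s2 = "s'\<lparr>pc := off + length P0 + 4, regs := (regs s')(rt 0 := 0)\<rparr>"
  have "reach w P (Suc (Suc (Suc (Suc 0)))) s' ?s2"
    apply (rule reach_then)
    using Call.prems(2) s' apply simp
    apply (rule reach_then)
    using Call.prems(2) s' apply simp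
    apply (rule reach_then)
    using Call.prems(2) s' apply simp
    apply (rule reach_then)
    using Call.prems(2) s' apply simp
    using Call.prems(2) s' apply (auto intro!: reach_eq simp: eval_nat_numeral)
    done
  from reach_trans[OF s'(1) this] have r: "reach w P (tau ?m + 4) s ?s2" by (simp add: eval_nat_numeral)
  have "Q (g, a', Suc (t + tau ?m))" using Call.prems(1) s' by (auto simp: Let_def)
  then have "runs_to L P (off + length P0 + 4) ?s2 (Suc (t + tau ?m)) Q"
    by (rule runs_to_end) (use s' in \<open>auto simp: rel_def\<close>)
  \<comment> \<open>Each of the tau ticks pays for one step of the called program, the additional
    tick for the four idle instructions.\<close>
  moreover have "tau ?m + 4 + L * t \<le> L * Suc (t + tau ?m)"
  proof -
    have L: "4 \<le> L" using Call.prems(8) by simp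
    then have "tau ?m \<le> L * tau ?m" by simp
    then show ?thesis using L unfolding mult_Suc_right distrib_left by linarith
  qed
  ultimately show ?case using runs_to_prefix[OF r, of L t "Suc (t + tau ?m)"] by (simp add: ac_simps)
qed

end

section \<open>From solvability to a callable program, and from commands back to solvability\<close>

section \<open>Solving problems with a program for min-plus products\<close>

text \<open>A step writes at most one cell. Applied to a result that differs from the initial
  contents everywhere, this yields a lower bound on the running time of any program for min-plus
  products.\<close>

lemma changed_cells:
  "finite {i. mem ((step w P ^^ t) s) m i \<noteq> mem s m i} \<and> card {i. mem ((step w P ^^ t) s) m i \<noteq> mem s m i} \<le> t"
proof (induction t)
  case (Suc t)
  let ?u = "(step w P ^^ t) s"
  obtain b where "\<forall>i. i \<noteq> b \<longrightarrow> mem (step w P ?u) m i = mem ?u m i"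
  proof (cases "P ! pc ?u")
    case (Store A x y)
    then show ?thesis by (intro that[of "regs ?u x"]) (auto simp: step_def)
  qed (auto simp: step_def intro: that[of 0])
  then have "{i. mem ((step w P ^^ Suc t) s) m i \<noteq> mem s m i} \<subseteq> insert b {i. mem ?u m i \<noteq> mem s m i}" (is "?A \<subseteq> insert b ?B")
    by auto
  moreover have "finite (insert b ?B)" "card (insert b ?B) \<le> Suc t"
    using Suc card_insert_le_m1[of "Suc t" ?B b] by auto
  ultimately show ?case by (meson card_mono finite_subset le_trans)
qed simp

lemma concat_rows:
  "concat (map (\<lambda>i. map (\<lambda>j. h (i * n + j)) [0..<n]) [0..<m]) = map h [0..<m * n]"
proof (induction m)
  case (Suc m)
  have "map (\<lambda>j. h (m * n + j)) [0..<n] = map h [m * n..<m * n + n]"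
    by (simp add: map_add_upt[symmetric] comp_def add.commute del: map_add_upt)
  moreover have "[0..<Suc m * n] = [0..<m * n] @ [m * n..<m * n + n]"
    using upt_add_eq_append[of 0 "m * n" n] by (simp add: add.commute)
  ultimately show ?case using Suc by simp
qed simp

lemma row_major_eq:
  assumes "A \<in> carrier_mat m m" "\<And>i j. i < m \<Longrightarrow> j < m \<Longrightarrow> twos_complement w (A $$ (i, j)) = h (i * m + j)"
  shows "row_major w A = map h [0..<m * m]"
proof -
  have "row_major w A = concat (map (\<lambda>i. map (\<lambda>j. h (i * m + j)) [0..<m]) [0..<m])"
    unfolding row_major_def mat_to_list_def map_concat using assms
    by (auto simp: comp_def intro!: arg_cong[where f = concat])
  then show ?thesis by (simp add: concat_rows)
qed

lemma twos_complement_int: "x < 2 ^ w \<Longrightarrow> twos_complement w (int x) = x"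
  unfolding twos_complement_def by (metis mod_less nat_int of_nat_numeral of_nat_power zmod_int)

text \<open>The interface to the given program, restricted to natural numbers: sums of two entries
  are at most 2 * B and hence below 2 ^ w, so the two's complement of an entry of the product is the
  entry itself. The bound tau depends on the dimension alone.\<close>

definition computes_min_plus :: "program \<Rightarrow> nat \<Rightarrow> (nat \<Rightarrow> nat) \<Rightarrow> bool" where
  "computes_min_plus P d tau \<longleftrightarrow> (\<forall>B w s m. (B + 2) ^ d \<le> 2 ^ w \<longrightarrow> 2 * B < 2 ^ w \<longrightarrow> words_config w s \<longrightarrow> pc s = 0 \<longrightarrow>
     m = mem s 0 0 \<longrightarrow> 1 \<le> m \<longrightarrow> m \<le> B \<longrightarrow> (\<forall>i<2 * m * m. mem s 0 (Suc i) \<le> B) \<longrightarrow>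
     (\<exists>t\<le>tau m. halted P ((step w P ^^ t) s) \<and> (\<forall>i<m. \<forall>j<m. mem ((step w P ^^ t) s) 1 (i * m + j) =
         Min ((\<lambda>k. mem s 0 (Suc (i * m + k)) + mem s 0 (Suc (m * m + (k * m + j)))) ` {..<m}))))"

lemma index_less_square: "i < m \<Longrightarrow> j < m \<Longrightarrow> i * m + j < m * (m::nat)"
proof -
  assume "i < m" "j < m"
  then have "i * m + j < Suc i * m" by simp
  also have "\<dots> \<le> m * m" using \<open>i < m\<close> by (intro mult_le_mono1) simp
  finally show ?thesis .
qed

lemma elements_mat_finite: "finite (elements_mat A)"
  by (simp add: elements_mat_def)

lemma of_nat_Min:
  "finite S \<Longrightarrow> S \<noteq> {} \<Longrightarrow> int (Min S) = Min (int ` S)"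
  by (rule mono_Min_commute) (auto simp: mono_def)

text \<open>Here tau is the assumed time bound, rounded down. The lower bound m * m follows by
  running the program on zero matrices while its output array initially contains ones, all of which
  have to be overwritten. It allows the O(m * m) preparation of a product to be charged to the
  product.\<close>

lemma min_plus_program:
  assumes "solvable_in_time_O min_plus_problem (\<lambda>(A, B). real (dim_row A) ^ 3 / l (dim_row A))"
  obtains P d tau C where "computes_min_plus P d tau" "\<And>m. 1 \<le> m \<Longrightarrow> m * m \<le> tau m"
    "\<And>m. 1 \<le> m \<Longrightarrow> real (tau m) \<le> C * (real m ^ 3 / l m)"
proof -
  from assms obtain P d C where P: "\<forall>x \<in> instances min_plus_problem. \<forall>w s.
        (magnitude min_plus_problem x + 2) ^ d \<le> 2 ^ w \<longrightarrow>
        words_config w s \<longrightarrow> pc s = 0 \<longrightarrow> stores s 0 (enc_input min_plus_problem w x) \<longrightarrow>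
        (\<exists>t. real t \<le> C * (\<lambda>(A, B). real (dim_row A) ^ 3 / l (dim_row A)) x \<and> halted P ((step w P ^^ t) s) \<and>
             stores ((step w P ^^ t) s) 1 (enc_output min_plus_problem w x))"
    unfolding solvable_in_time_O_def by (elim exE)
  define tau where "tau m = nat \<lfloor>C * (real m ^ 3 / l m)\<rfloor>" for m
  have run: "\<exists>t\<le>tau m. real t \<le> C * (real m ^ 3 / l m) \<and> halted P ((step w P ^^ t) s) \<and>
       stores ((step w P ^^ t) s) 1 (row_major w (A \<star> A'))"
    if m: "1 \<le> m" and A: "A \<in> carrier_mat m m" "A' \<in> carrier_mat m m"
      and mag: "(Max (insert m ((\<lambda>z. nat \<bar>z\<bar>) ` (elements_mat A \<union> elements_mat A'))) + 2) ^ d \<le> 2 ^ w"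
      and s: "words_config w s" "pc s = 0" "stores s 0 (m # row_major w A @ row_major w A')" for m A A' w s
  proof -
    obtain t where t: "real t \<le> C * (real m ^ 3 / l m)" "halted P ((step w P ^^ t) s)"
       "stores ((step w P ^^ t) s) 1 (row_major w (A \<star> A'))"
    proof -
      have x: "(A, A') \<in> instances min_plus_problem" using m A by (auto simp: min_plus_problem_def)
      have d: "dim_row A = m" using A by simp
      have e: "magnitude min_plus_problem (A, A') = Max (insert m ((\<lambda>z. nat \<bar>z\<bar>) ` (elements_mat A \<union> elements_mat A')))"
        "enc_input min_plus_problem w (A, A') = m # row_major w A @ row_major w A'"
        "enc_output min_plus_problem w (A, A') = row_major w (A \<star> A')"
        by (simp_all add: min_plus_problem_def d)
      from P[rule_format, OF x, of w s, unfolded e prod.case d, OF mag s] obtain t where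
          "real t \<le> C * (real m ^ 3 / l m)" "halted P ((step w P ^^ t) s)"
          "stores ((step w P ^^ t) s) 1 (row_major w (A \<star> A'))" by blast
      then show thesis by (rule that)
    qed
    have "t \<le> tau m" using t(1) unfolding tau_def by (simp add: le_nat_floor)
    then show ?thesis using t by blast
  qed
  have lower: "m * m \<le> tau m \<and> real (tau m) \<le> C * (real m ^ 3 / l m)" if m: "1 \<le> m" for m
  proof -
    \<comment> \<open>Long enough for this instance: (m + 2) ^ d is at most 2 ^ ((m + 2) * d), and
      the other summands make m itself a word.\<close>
    define w where "w = (m + 2) * d + m + 2"
    define A where "A = (mat m m (\<lambda>_. 0) :: int mat)"
    have A: "A \<in> carrier_mat m m" by (simp add: A_def)
    have r: "row_major w A = map (\<lambda>_. 0) [0..<m * m]"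
      by (rule row_major_eq[OF A]) (auto simp: A_def twos_complement_def)
    have AA: "A \<star> A = A"
      using m by (auto simp: A_def min_plus_def intro!: eq_matI) (simp add: image_constant_conv lessThan_empty_iff)
    \<comment> \<open>Array 0 encodes two zero matrices, and every cell of any other array is 1, in
      contrast to the product, which is zero.\<close>
    define s where "s = \<lparr>pc = 0, regs = (\<lambda>_. 0), mem = (\<lambda>a i. if a = 0 then if i = 0 then m else 0 else 1)\<rparr>"
    have mw: "m < 2 ^ w" "1 < (2::nat) ^ w" 
    proof -
      have "m < 2 ^ m" by simp
      also have "\<dots> \<le> 2 ^ w" unfolding w_def by (intro power_increasing) auto
      finally show "m < 2 ^ w" .
      then show "1 < (2::nat) ^ w" using m by linarith
    qed
    have "nat \<bar>z\<bar> \<le> m" if "z \<in> elements_mat A" for z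
      using that by (auto simp: A_def elements_mat_def split: if_splits)
    then have "Max (insert m ((\<lambda>z. nat \<bar>z\<bar>) ` (elements_mat A \<union> elements_mat A))) \<le> m"
      by (subst Max_le_iff) (auto simp: elements_mat_finite)
    then have "(Max (insert m ((\<lambda>z. nat \<bar>z\<bar>) ` (elements_mat A \<union> elements_mat A))) + 2) ^ d \<le> (m + 2) ^ d"
      by (intro power_mono) auto
    also have "\<dots> \<le> (2 ^ (m + 2)) ^ d" by (intro power_mono less_imp_le[OF less_exp]) simp
    also have "\<dots> \<le> 2 ^ w" unfolding w_def power_mult[symmetric] by (intro power_increasing) auto
    finally have mag: "(Max (insert m ((\<lambda>z. nat \<bar>z\<bar>) ` (elements_mat A \<union> elements_mat A))) + 2) ^ d \<le> 2 ^ w" .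
    have "words_config w s" "pc s = 0" using mw by (auto simp: s_def words_config_def)
    moreover have "stores s 0 (m # row_major w A @ row_major w A)"
      unfolding r stores_def s_def by (auto simp: nth_Cons nth_append split: nat.splits)
    ultimately obtain t where t: "t \<le> tau m" "real t \<le> C * (real m ^ 3 / l m)" "stores ((step w P ^^ t) s) 1 (row_major w A)"
      using run[OF m A A mag] AA by metis
    have "{..<m * m} \<subseteq> {i. mem ((step w P ^^ t) s) 1 i \<noteq> mem s 1 i}"
      using t(3) unfolding r stores_def by (auto simp: s_def)
    then have "m * m \<le> card {i. mem ((step w P ^^ t) s) 1 i \<noteq> mem s 1 i}"
      using changed_cells[of t w P s 1] by (metis card_lessThan card_mono)
    also have "\<dots> \<le> t" using changed_cells[of t w P s 1] by blast
    finally have "m * m \<le> tau m" using t(1) by linarith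
    moreover have "real (tau m) \<le> C * (real m ^ 3 / l m)"
      using t(2) unfolding tau_def by (metis of_nat_0_le_iff of_nat_floor order_trans)
    ultimately show ?thesis by blast
  qed
  have "computes_min_plus P d tau"
    unfolding computes_min_plus_def
  proof (intro allI impI)
    fix B w s m
    assume a: "(B + 2) ^ d \<le> 2 ^ w" "2 * B < 2 ^ w" "words_config w s" "pc s = 0" "m = mem s 0 0" "1 \<le> m" "m \<le> B"
      "\<forall>i<2 * m * m. mem s 0 (Suc i) \<le> B"
    define A where "A = mat m m (\<lambda>(i, k). int (mem s 0 (Suc (i * m + k))))"
    define A' where "A' = mat m m (\<lambda>(i, k). int (mem s 0 (Suc (m * m + (i * m + k)))))"
    have AA: "A \<in> carrier_mat m m" "A' \<in> carrier_mat m m" by (simp_all add: A_def A'_def)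
    have le: "mem s 0 (Suc (i * m + k)) \<le> B" "mem s 0 (Suc (m * m + (i * m + k))) \<le> B" if "i < m" "k < m" for i k
      using a(8) index_less_square[OF that] by (auto simp: algebra_simps)
    have rA: "row_major w A = map (\<lambda>i. mem s 0 (Suc i)) [0..<m * m]"
      by (rule row_major_eq[OF AA(1)]) (use le a(2) in \<open>force simp: A_def intro!: twos_complement_int\<close>)
    have rA': "row_major w A' = map (\<lambda>i. mem s 0 (Suc (m * m + i))) [0..<m * m]"
      by (rule row_major_eq[OF AA(2)]) (use le a(2) in \<open>force simp: A'_def intro!: twos_complement_int\<close>)
    have st: "stores s 0 (m # row_major w A @ row_major w A')"
      unfolding rA rA' stores_def using a(5) by (auto simp: nth_Cons nth_append split: nat.splits)
    have "nat \<bar>z\<bar> \<le> B" if "z \<in> elements_mat A \<union> elements_mat A'" for z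
      using that le by (auto simp: A_def A'_def elements_mat_def)
    then have "Max (insert m ((\<lambda>z. nat \<bar>z\<bar>) ` (elements_mat A \<union> elements_mat A'))) \<le> B"
      using elements_mat_finite[of A] elements_mat_finite[of A'] a(7) by (subst Max_le_iff) auto
    then have mag: "(Max (insert m ((\<lambda>z. nat \<bar>z\<bar>) ` (elements_mat A \<union> elements_mat A'))) + 2) ^ d \<le> 2 ^ w"
      using a(1) by (meson add_le_mono1 le_trans power_mono zero_le)
    obtain t where t: "t \<le> tau m" "halted P ((step w P ^^ t) s)" "stores ((step w P ^^ t) s) 1 (row_major w (A \<star> A'))"
      using run[OF a(6) AA mag a(3,4) st] by blast
    let ?f = "\<lambda>i j. Min ((\<lambda>k. mem s 0 (Suc (i * m + k)) + mem s 0 (Suc (m * m + (k * m + j)))) ` {..<m})"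
    have fin: "(A \<star> A') $$ (i, j) = int (?f i j) \<and> ?f i j < 2 ^ w" if ij: "i < m" "j < m" for i j
    proof
      have "(A \<star> A') $$ (i, j) = Min ((\<lambda>k. A $$ (i, k) + A' $$ (k, j)) ` {..<m})"
        using ij AA by (auto simp: min_plus_def)
      also have "(\<lambda>k. A $$ (i, k) + A' $$ (k, j)) ` {..<m} =
          int ` ((\<lambda>k. mem s 0 (Suc (i * m + k)) + mem s 0 (Suc (m * m + (k * m + j)))) ` {..<m})"
        unfolding image_image using ij by (intro image_cong) (auto simp: A_def A'_def)
      finally show "(A \<star> A') $$ (i, j) = int (?f i j)" using a(6) by (subst of_nat_Min) (auto simp: lessThan_empty_iff)
      have "?f i j \<le> mem s 0 (Suc (i * m + 0)) + mem s 0 (Suc (m * m + (0 * m + j)))"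
      proof (rule Min_le)
        show "mem s 0 (Suc (i * m + 0)) + mem s 0 (Suc (m * m + (0 * m + j))) \<in>
          (\<lambda>k. mem s 0 (Suc (i * m + k)) + mem s 0 (Suc (m * m + (k * m + j)))) ` {..<m}"
          by (rule image_eqI[of _ _ 0]) (use a(6) in auto)
      qed auto
      also have "\<dots> \<le> 2 * B" using le[of i 0] le[of 0 j] ij a(6) by simp
      finally show "?f i j < 2 ^ w" using a(2) by linarith
    qed
    have sq: "A \<star> A' \<in> carrier_mat m m" using AA by (simp add: min_plus_def)
    have "row_major w (A \<star> A') = map (\<lambda>p. ?f (p div m) (p mod m)) [0..<m * m]"
      by (rule row_major_eq[OF sq]) (use fin in \<open>simp add: twos_complement_int\<close>)
    then have "mem ((step w P ^^ t) s) 1 p = ?f (p div m) (p mod m)" if "p < m * m" for p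
      using t(3) that by (simp add: stores_def)
    then have "mem ((step w P ^^ t) s) 1 (i * m + j) = ?f i j" if "i < m" "j < m" for i j
      using index_less_square[OF that] that by simp
    then show "\<exists>t\<le>tau m. halted P ((step w P ^^ t) s) \<and> (\<forall>i<m. \<forall>j<m. mem ((step w P ^^ t) s) 1 (i * m + j) = ?f i j)"
      using t by blast
  qed
  then show thesis using that lower by blast
qed

lemma program_bounds:
  obtains R M where "\<And>i. i \<in> set P \<Longrightarrow> instr_regs i \<subseteq> {..<R} \<and> instr_arrs i \<subseteq> {..<M::nat}"
proof -
  have "finite (instr_regs i)" "finite (instr_arrs i)" for i by (cases i; simp)+
  then have "finite (\<Union>i\<in>set P. instr_regs i)" "finite (\<Union>i\<in>set P. instr_arrs i)" by auto
  then obtain R M where "(\<Union>i\<in>set P. instr_regs i) \<subseteq> {..<R}" "(\<Union>i\<in>set P. instr_arrs i) \<subseteq> {..<M}"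
    by (metis finite_nat_set_iff_bounded subsetI lessThan_iff)
  then show thesis by (intro that[of R M]) blast
qed

text \<open>The bridge used for both problems. As B is polynomial in the magnitude, all values of
  degree up to \<open>cdeg c\<close> fit into words of logarithmic length. Registers are
  uninitialised, so the code is preceded by a prefix that sets the variables of \<open>c\<close> to
  0.\<close>

lemma solvable_by_com:
  assumes mp: "computes_min_plus P0 d tau"
    and enc: "\<And>x w. enc_input X w x = inp x" "\<And>x w. enc_output X w x = outp x"
    and c: "\<And>x. x \<in> instances X \<Longrightarrow> \<exists>B. 2 \<le> B \<and> B \<le> (magnitude X x + 2) ^ b \<and>
       (\<forall>a. (\<forall>i<length (inp x). a 0 i = inp x ! i) \<longrightarrow>
          bounded_machine.wp B tau c (\<lambda>(g, a', t). (\<forall>i<length (outp x). a' 1 i = outp x ! i) \<and> real t \<le> K * T x)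
            ((\<lambda>_. 0), a, 0))"
  shows "solvable_in_time_O X T"
proof -
  obtain R M where RM: "\<And>i. i \<in> set P0 \<Longrightarrow> instr_regs i \<subseteq> {..<R} \<and> instr_arrs i \<subseteq> {..<M}"
    using program_bounds by blast
  obtain nv where nv: "cvars c \<subseteq> {..<nv}"
    using finite_cvars[of c] by (metis finite_nat_set_iff_bounded subsetI lessThan_iff)
  let ?pre = "map (\<lambda>x. Const (compiler.rv R x) 0) [0..<nv]"
  let ?P = "?pre @ compiler.cc P0 R M nv c"
  let ?L = "clen (length P0) c"
  \<comment> \<open>Since B + 2 is at most (magnitude + 2) ^ (b + 1), this makes (B + 2) ^ (d + cdeg
    c + 3) at most 2 ^ w. The exponent d serves the min-plus program and \<open>cdeg c\<close> the
    compiled code; the summand 3 leaves room for strict inequalities and for 2 * B < 2 ^ w.\<close>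
  let ?e = "(b + 1) * (d + cdeg c + 3)"
  show ?thesis unfolding solvable_in_time_O_def
  proof (rule exI[of _ ?P], rule exI[of _ ?e], rule exI[of _ "(real nv + real ?L) * K"], intro ballI allI impI)
    fix x w s
    assume x: "x \<in> instances X" and w: "(magnitude X x + 2) ^ ?e \<le> 2 ^ w"
      and s: "words_config w s" "pc s = 0" "stores s 0 (enc_input X w x)"
    obtain B where B: "2 \<le> B" "B \<le> (magnitude X x + 2) ^ b" and
       wpc: "\<And>a. (\<forall>i<length (inp x). a 0 i = inp x ! i) \<Longrightarrow>
          bounded_machine.wp B tau c (\<lambda>(g, a', t). (\<forall>i<length (outp x). a' 1 i = outp x ! i) \<and> real t \<le> K * T x)
            ((\<lambda>_. 0), a, 0)" using c[OF x] by blast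
    have "B + 2 \<le> 2 * B" using B by simp
    also have "\<dots> \<le> (magnitude X x + 2) * (magnitude X x + 2) ^ b" using B(2) by (intro mult_le_mono) auto
    finally have "(B + 2) ^ (d + cdeg c + 3) \<le> ((magnitude X x + 2) ^ (b + 1)) ^ (d + cdeg c + 3)"
      by (intro power_mono) auto
    also have "\<dots> = (magnitude X x + 2) ^ ?e" by (simp only: power_mult)
    finally have big: "(B + 2) ^ (d + cdeg c + 3) \<le> 2 ^ w" using w by linarith
    have pw: "(B + 2) ^ k \<le> 2 ^ w" if "k \<le> d + cdeg c + 3" for k
      by (rule le_trans[OF power_increasing[OF that] big]) simp
    have "2 * B < (B + 2) ^ 2" by (simp add: power2_eq_square algebra_simps)
    then have B2: "2 * B < 2 ^ w" using pw[of 2] by linarith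
    have "B ^ cdeg c \<le> (B + 2) ^ cdeg c" by (intro power_mono) auto
    also have "\<dots> < (B + 2) ^ (cdeg c + 1)" by (intro power_strict_increasing) auto
    finally have Bc: "B ^ cdeg c < 2 ^ w" using pw[of "cdeg c + 1"] by simp
    interpret compiler_correct B tau w P0 R M nv
    proof
      fix s m
      assume *: "words_config w s" "pc s = 0" "m = mem s 0 0" "1 \<le> m" "m \<le> B" "\<And>i. i < 2 * m * m \<Longrightarrow> mem s 0 (Suc i) \<le> B"
      show "\<exists>t\<le>tau m. halted P0 ((step w P0 ^^ t) s) \<and> (\<forall>i<m. \<forall>j<m. mem ((step w P0 ^^ t) s) 1 (i * m + j) =
         Min ((\<lambda>k. mem s 0 (Suc (i * m + k)) + mem s 0 (Suc (m * m + (k * m + j)))) ` {..<m}))"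
        by (rule mp[unfolded computes_min_plus_def, rule_format, of B w s m, OF pw B2 *(1-5)]) (simp_all add: *(6))
    next
      show "instr_regs i \<subseteq> {..<R} \<and> instr_arrs i \<subseteq> {..<M}" if "i \<in> set P0" for i using RM that .
    next
      show "2 \<le> B" by (rule B(1))
    qed
    have pre: "\<exists>s'. reach w ?P n s s' \<and> pc s' = n \<and> mem s' = mem s \<and> (\<forall>y<n. regs s' (rv y) = 0)" if "n \<le> nv" for n
      using that
    proof (induction n)
      case 0
      then show ?case using s(2) reach_refl by blast
    next
      case (Suc n)
      then obtain s' where s': "reach w ?P n s s'" "pc s' = n" "mem s' = mem s" "\<forall>y<n. regs s' (rv y) = 0" by auto
      have Pn: "n < length ?P" "?P ! n = Const (rv n) 0" using Suc.prems by (auto simp: nth_append)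
      have "reach w ?P (n + 1) s (exec w (?P ! pc s') s')"
        by (intro reach_trans[OF s'(1)] reach_step) (use s'(2) Pn in auto)
      then show ?case unfolding s'(2) Pn(2)
        by (intro exI[of _ "exec w (Const (rv n) 0) s'"]) (use s' in \<open>auto simp: less_Suc_eq\<close>)
    qed
    then obtain s1 where s1: "reach w ?P nv s s1" "pc s1 = nv" "mem s1 = mem s" "\<forall>y<nv. regs s1 (rv y) = 0" by blast
    let ?a = "\<lambda>A. mem s (ar A)"
    have a0: "\<forall>i<length (inp x). ?a 0 i = inp x ! i" using s(3) by (auto simp: stores_def enc ar_def)
    let ?Q = "\<lambda>(g, a', t). (\<forall>i<length (outp x). a' 1 i = outp x ! i) \<and> real t \<le> K * T x"
    have "wp c (\<lambda>s'. ?Q s' \<and> 0 < snd (snd s')) ((\<lambda>_. 0), ?a, 0)"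
      using wp_frame[OF wpc[of ?a, OF a0]] by (rule wp_mono) auto
    then have "runs_to ?L ?P (nv + ?L) s1 0 (\<lambda>s'. ?Q s' \<and> 0 < snd (snd s'))"
    proof (rule cc_correct)
      show "code_at ?P nv (cc nv c)" by (auto simp: code_at_def nth_append)
      show "rel s1 (\<lambda>_. 0) ?a" using s1 by (simp add: rel_def)
      show "words_config w s1" using words_reach[OF s1(1) s(1)] .
    qed (use s1 nv Bc in auto)
    then obtain k s' g' a' t' where *: "\<forall>i<length (outp x). a' 1 i = outp x ! i" "real t' \<le> K * T x" "0 < t'"
       "reach w ?P k s1 s'" "rel s' g' a'" "pc s' = nv + ?L" "k \<le> ?L * t'"
      unfolding runs_to_def by auto
    obtain j where j: "j \<le> nv + k" "(step w ?P ^^ j) s = s'"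
      using reach_trans[OF s1(1) *(4)] unfolding reach_def by blast
    \<comment> \<open>As the final clock is positive, the nv initialising steps disappear in the
      constant factor.\<close>
    have "nv \<le> nv * t'" using *(3) by simp
    then have "j \<le> (nv + ?L) * t'" using j(1) *(7) unfolding distrib_right by linarith
    then have "real j \<le> real ((nv + ?L) * t')" by (simp only: of_nat_le_iff)
    then have "real j \<le> (real nv + real ?L) * real t'" by (simp only: of_nat_mult of_nat_add)
    also have "\<dots> \<le> (real nv + real ?L) * (K * T x)" using *(2) by (intro mult_left_mono) auto
    finally have "real j \<le> (real nv + real ?L) * K * T x" by (simp add: mult.assoc)
    moreover have "halted ?P s'" using *(6) by (simp add: halted_def)
    moreover have "stores s' 1 (enc_output X w x)"
    proof -
      have "mem s' (ar 1) = a' 1" using *(5) unfolding rel_def by blast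
      then show ?thesis using *(1) unfolding stores_def enc ar_def by simp
    qed
    ultimately show "\<exists>t. real t \<le> (real nv + real ?L) * K * T x \<and> halted ?P ((step w ?P ^^ t) s) \<and>
        stores ((step w ?P ^^ t) s) 1 (enc_output X w x)" using j(2) by blast
  qed
qed

section \<open>Truncated min-plus convolution by matrix products\<close>

section \<open>Loops and truncated min-plus convolutions\<close>

text \<open>The language has no minimum. Throughout, e - (e - f) with truncated subtraction stands
  for it.\<close>

lemma nat_diff_diff_min: "(x::nat) - (x - y) = min x y"
  by simp

definition tabulate :: "nat \<Rightarrow> aexp \<Rightarrow> nat \<Rightarrow> aexp \<Rightarrow> aexp \<Rightarrow> com" where
  "tabulate x bd A off f = For x bd (St A (Plus off (V x)) f)"

text \<open>Min-plus convolution truncated at I, which plays the role of infinity: finite sequences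
  are continued by the value I.\<close>

definition cv :: "nat \<Rightarrow> (nat \<Rightarrow> nat) \<Rightarrow> (nat \<Rightarrow> nat) \<Rightarrow> nat \<Rightarrow> nat" where
  "cv I f h s = Min (insert I ((\<lambda>i. f i + h (s - i)) ` {..s}))"

text \<open>Minima are handled through their lower bounds z. A condition on all pairs (i, j) can be
  split and regrouped at will, and \<open>nat_eq_by_le\<close> turns the resulting equivalences back
  into equations.\<close>

lemma le_cv: "z \<le> cv I f h s \<longleftrightarrow> z \<le> I \<and> (\<forall>i j. i + j = s \<longrightarrow> z \<le> f i + h j)"
proof -
  have "z \<le> cv I f h s \<longleftrightarrow> z \<le> I \<and> (\<forall>i\<le>s. z \<le> f i + h (s - i))"
    unfolding cv_def by (subst Min_ge_iff) auto
  also have "\<dots> \<longleftrightarrow> z \<le> I \<and> (\<forall>i j. i + j = s \<longrightarrow> z \<le> f i + h j)"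
    by (metis add_diff_cancel_left' le_add1 le_add_diff_inverse)
  finally show ?thesis .
qed

lemma nat_eq_by_le: "(\<And>z. z \<le> x \<longleftrightarrow> z \<le> y) \<Longrightarrow> x = (y::nat)"
  by (meson order_antisym order_refl)

text \<open>
  The pairs (i, j) that are treated by the product of block b of the first sequence with the shift J
  of the second one.
\<close>

lemma div_block: "r < q \<Longrightarrow> (b * q + r) div q = (b::nat)"
proof -
  assume r: "r < q"
  then have "q \<noteq> 0" by simp
  with r show ?thesis by simp
qed

lemma block_pairs:
  fixes m b J nb nJ s :: nat
  assumes m: "1 \<le> m" and b: "b < nb" and J: "J < nJ"
  shows "(\<forall>i j. i < nb * (m * m) \<longrightarrow> i + j = s \<longrightarrow> (j + i mod m) div m < nJ \<longrightarrow>
            i div (m * m) * nJ + (j + i mod m) div m = b * nJ + J \<longrightarrow> (z::nat) \<le> f i + h j) \<longleftrightarrow>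
    (\<forall>r k. r < m * m \<longrightarrow> s = b * (m * m) + J * m + r \<longrightarrow> k < m \<longrightarrow> k \<le> J * m + r mod m \<longrightarrow>
        z \<le> f (b * (m * m) + r div m * m + k) + h (J * m + r mod m - k))" (is "?L \<longleftrightarrow> ?R")
proof
  assume L: ?L
  show ?R
  proof (intro allI impI)
    fix r k assume r: "r < m * m" "s = b * (m * m) + J * m + r" and k: "k < m" "k \<le> J * m + r mod m"
    define x where "x = r div m"
    define y where "y = r mod m"
    have xy: "x < m" "y < m" "r = x * m + y"
      using r m by (auto simp: x_def y_def less_mult_imp_div_less)
    let ?i = "b * (m * m) + x * m + k" and ?j = "J * m + y - k"
    have xk: "x * m + k < m * m" by (rule index_less_square[OF xy(1) k(1)])
    have i: "?i mod m = k" "?i div (m * m) = b"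
    proof -
      have "?i = (b * m + x) * m + k" by (simp add: algebra_simps)
      then show "?i mod m = k" using k(1) by simp
      have "?i = b * (m * m) + (x * m + k)" by simp
      then show "?i div (m * m) = b" by (simp only: div_block[OF xk])
    qed
    have "?i < (b + 1) * (m * m)" using xk by simp
    also have "\<dots> \<le> nb * (m * m)" using b by (intro mult_le_mono1) simp
    finally have "?i < nb * (m * m)" .
    moreover have "?j + ?i mod m = J * m + y" using i(1) k by (simp add: y_def)
    moreover have "(J * m + y) div m = J" by (rule div_block[OF xy(2)])
    moreover have "?i + ?j = s" using r k xy(3) unfolding y_def by linarith
    ultimately show "z \<le> f (b * (m * m) + r div m * m + k) + h (J * m + r mod m - k)"
      using L[rule_format, of ?i ?j] i(2) J unfolding x_def[symmetric] y_def[symmetric] by simp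
  qed
next
  assume R: ?R
  show ?L
  proof (intro allI impI)
    fix i j assume i: "i < nb * (m * m)" "i + j = s" and K: "(j + i mod m) div m < nJ"
      and e: "i div (m * m) * nJ + (j + i mod m) div m = b * nJ + J"
    have "(i div (m * m) * nJ + (j + i mod m) div m) div nJ = i div (m * m)" by (rule div_block[OF K])
    moreover have "(b * nJ + J) div nJ = b" by (rule div_block[OF J])
    ultimately have b': "i div (m * m) = b" using e by (simp only:)
    have J': "(j + i mod m) div m = J" using e unfolding b' by simp
    \<comment> \<open>The coordinates of the pair: i = b m^2 + x m + k and j + k = J m + y. The k
      cancels in i + j, which therefore is b m^2 + J m + x m + y.\<close>
    define k where "k = i mod m"
    define x where "x = i div m mod m"
    define y where "y = (j + k) mod m"
    have ie: "i = b * (m * m) + x * m + k"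
    proof -
      have "i div m div m = b" using b' by (simp add: div_mult2_eq)
      then have "i div m = b * m + x" unfolding x_def by (metis div_mult_mod_eq)
      then have "i = (b * m + x) * m + k" unfolding k_def by (metis div_mult_mod_eq)
      then show ?thesis by (simp add: algebra_simps)
    qed
    have je: "j + k = J * m + y" using J' unfolding y_def k_def by (metis div_mult_mod_eq)
    have lt: "k < m" "x < m" "y < m" using m by (auto simp: k_def x_def y_def)
    let ?r = "x * m + y"
    have r: "?r < m * m" "?r div m = x" "?r mod m = y"
      using index_less_square[OF lt(2,3)] div_block[OF lt(3)] lt(3) by (simp_all del: div_mult_self3)
    have "s = b * (m * m) + J * m + ?r" using i ie je by simp
    from R[rule_format, OF r(1) this lt(1)] have "z \<le> f (b * (m * m) + x * m + k) + h (J * m + y - k)"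
      unfolding r(2,3) using je by linarith
    moreover have "J * m + y - k = j" using je by linarith
    ultimately show "z \<le> f i + h j" by (simp only: ie)
  qed
qed

text \<open>Variables 20 and 21 hold the numbers of blocks and of shifts. As j + k with j < q and k
  < m is at most q + m - 2, shifts up to q div m + 1 occur, hence the summand 2. Array 41 has one
  additional group of m cells in front; they keep the value I and serve the negative indices J m + y
  - k.\<close>

definition conv_init :: com where
  "conv_init = Seq (Asg 20 (Plus (Divi (V 26) (V 5)) (N 1))) (Seq (Asg 21 (Plus (Divi (V 27) (V 4)) (N 2)))
     (Seq (tabulate 25 (Times (V 20) (V 5)) 40 (N 0) (V 6))
     (Seq (tabulate 25 (Times (Plus (V 21) (N 1)) (V 4)) 41 (N 0) (V 6))
       (tabulate 25 (Plus (Plus (Times (V 20) (V 5)) (Times (V 21) (V 4))) (V 5)) 42 (N 0) (V 6)))))"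

text \<open>One product. The counter in variable 22 encodes the block b (quotient by the number of
  shifts) and the shift J (remainder). Array 0 receives the dimension, block b row by row, and the
  matrix with entry h (J m + y - k) at (k, y), read from array 41 with offset m. Finally the product
  is merged by minimum into array 42 from position b m^2 + J m on.\<close>

definition conv_body :: com where
  "conv_body = Seq (Asg 23 (Divi (V 22) (V 21))) (Seq (Asg 24 (Minus (V 22) (Times (V 23) (V 21))))
     (Seq (St 0 (N 0) (V 4))
     (Seq (tabulate 25 (V 5) 0 (N 1) (Rd 40 (Plus (Times (V 23) (V 5)) (V 25))))
     (Seq (tabulate 25 (V 5) 0 (Plus (N 1) (V 5))
             (Rd 41 (Minus (Plus (Plus (Times (V 24) (V 4)) (V 4)) (Minus (V 25) (Times (Divi (V 25) (V 4)) (V 4))))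
                (Divi (V 25) (V 4)))))
     (Seq Call
       (tabulate 25 (V 5) 42 (Plus (Times (V 23) (V 5)) (Times (V 24) (V 4)))
          (let e = Rd 42 (Plus (Plus (Times (V 23) (V 5)) (Times (V 24) (V 4))) (V 25)) in
            Minus e (Minus e (Rd 1 (V 25))))))))))"

definition conv_run :: com where
  "conv_run = For 22 (Times (V 20) (V 21)) conv_body"

context bounded_machine
begin

text \<open>The expression f may read the array A that is being filled: cells not yet overwritten
  are known to have their old values. Updates in place, such as taking minima, rely on this.\<close>

lemma wp_tabulate:
  assumes n: "val bd g a = n" "ok bd g a" "n \<le> B"
    and off: "val off g a = p" "ok off g a"
    and x: "x \<notin> avars bd" "x \<notin> avars off" "A \<notin> aarrs bd" "A \<notin> aarrs off"
    and body: "\<And>i g' a'. i < n \<Longrightarrow> g' x = i \<Longrightarrow> (\<And>y. y \<noteq> x \<Longrightarrow> g' y = g y) \<Longrightarrow> (\<And>C. C \<noteq> A \<Longrightarrow> a' C = a C) \<Longrightarrow>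
       (\<And>j. j < p \<or> p + i \<le> j \<Longrightarrow> a' A j = a A j) \<Longrightarrow> ok f g' a' \<and> val f g' a' = F i \<and> F i \<le> B"
    and Q: "\<And>g' a'. g' x = n \<Longrightarrow> (\<And>y. y \<noteq> x \<Longrightarrow> g' y = g y) \<Longrightarrow> (\<And>C. C \<noteq> A \<Longrightarrow> a' C = a C) \<Longrightarrow>
       (\<And>j. j < p \<or> p + n \<le> j \<Longrightarrow> a' A j = a A j) \<Longrightarrow> (\<And>i. i < n \<Longrightarrow> a' A (p + i) = F i) \<Longrightarrow>
       Q (g', a', t + 2 * n + 2)"
  shows "wp (tabulate x bd A off f) Q (g, a, t)"
  unfolding tabulate_def
proof (rule wp_For[where n = n and I = "\<lambda>i g' a' t'. (\<forall>j. j < p \<or> p + i \<le> j \<longrightarrow> a' A j = a A j) \<and>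
    (\<forall>j<i. a' A (p + j) = F j) \<and> t' = t + 2 * i + 1"])
  fix i g' a' t'
  assume I: "(\<forall>j. j < p \<or> p + i \<le> j \<longrightarrow> a' A j = a A j) \<and> (\<forall>j<i. a' A (p + j) = F j) \<and> t' = t + 2 * i + 1"
    and i: "i < n" and g': "g' x = i" "\<And>y. y \<noteq> x \<Longrightarrow> y \<notin> mods (St A (Plus off (V x)) f) \<Longrightarrow> g' y = g y"
    and a': "\<And>C. C \<notin> warrs (St A (Plus off (V x)) f) \<Longrightarrow> a' C = a C"
  have g: "\<And>y. y \<noteq> x \<Longrightarrow> g' y = g y" and ac: "\<And>C. C \<noteq> A \<Longrightarrow> a' C = a C" using g' a' by auto
  have f: "ok f g' a' \<and> val f g' a' = F i \<and> F i \<le> B" by (rule body) (use i I g'(1) g ac in auto)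
  have "\<And>y. y \<in> avars off \<Longrightarrow> g' y = g y" "\<And>C. C \<in> aarrs off \<Longrightarrow> a' C = a C" using x g ac by metis+
  then have o: "ok off g' a'" "val off g' a' = p" using off val_cong[of off g' g a' a] ok_cong[of off g' g a' a] by auto
  show "wp (St A (Plus off (V x)) f) (\<lambda>(g', a', t').
     (\<forall>j. j < p \<or> p + Suc i \<le> j \<longrightarrow> a' A j = a A j) \<and> (\<forall>j<Suc i. a' A (p + j) = F j) \<and> Suc t' = t + 2 * Suc i + 1) (g', a', t')"
    using f o g'(1) I by (auto simp: less_Suc_eq)
next
  fix g' a' t'
  assume *: "(\<forall>j. j < p \<or> p + n \<le> j \<longrightarrow> a' A j = a A j) \<and> (\<forall>j<n. a' A (p + j) = F j) \<and> t' = t + 2 * n + 1"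
    "g' x = n" "\<And>y. y \<noteq> x \<Longrightarrow> y \<notin> mods (St A (Plus off (V x)) f) \<Longrightarrow> g' y = g y"
    "\<And>C. C \<notin> warrs (St A (Plus off (V x)) f) \<Longrightarrow> a' C = a C"
  have "Q (g', a', t + 2 * n + 2)" by (rule Q) (use * in auto)
  then show "Q (g', a', Suc t')" using *(1) by simp
qed (use n x in auto)

lemma wp_CallI:
  assumes "a 0 0 = m" "1 \<le> m" "m \<le> B" "\<And>i. i < m * m + m * m \<Longrightarrow> a 0 (Suc i) \<le> B"
    "\<And>a'. (\<And>A. A \<ge> 2 \<Longrightarrow> a' A = a A) \<Longrightarrow> (\<And>i j. i < m \<Longrightarrow> j < m \<Longrightarrow> a' 1 (i * m + j) =
        Min ((\<lambda>k. a 0 (Suc (i * m + k)) + a 0 (Suc (m * m + (k * m + j)))) ` {..<m})) \<Longrightarrow> Q (g, a', Suc (t + tau m))"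
  shows "wp Call Q (g, a, t)"
  using assms by (simp add: Let_def mult_2 distrib_right)

lemma wp_conv_init:
  assumes g: "g 4 = m" "g 5 = m * m" "g 6 = I" "g 26 = p" "g 27 = q"
    and nb: "nb = p div (m * m) + 1" and nJ: "nJ = q div m + 2"
    and B: "nb * (m * m) + nJ * m + m * m \<le> B" "I \<le> B" "1 \<le> m"
    and Q: "\<And>g' a' t'. (\<And>y. y \<notin> {20, 21, 25} \<Longrightarrow> g' y = g y) \<Longrightarrow> g' 20 = nb \<Longrightarrow> g' 21 = nJ \<Longrightarrow>
      (\<And>A. A \<notin> {40, 41, 42} \<Longrightarrow> a' A = a A) \<Longrightarrow> (\<And>i. i < nb * (m * m) \<Longrightarrow> a' 40 i = I) \<Longrightarrow>
      (\<And>i. i < (nJ + 1) * m \<Longrightarrow> a' 41 i = I) \<Longrightarrow> (\<And>i. i < nb * (m * m) + nJ * m + m * m \<Longrightarrow> a' 42 i = I) \<Longrightarrow>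
      t' \<le> t + 20 * (nb * nJ * (m * m)) \<Longrightarrow> Q (g', a', t')"
  shows "wp conv_init Q (g, a, t)"
proof -
  have "1 * 1 \<le> m * m" using B(3) by (intro mult_le_mono)
  then have mm: "1 \<le> m * m" by simp
  have n1: "1 \<le> nb" "2 \<le> nJ" by (auto simp: nb nJ)
  have le: "nb * 1 \<le> nb * (m * m)" "nJ * 1 \<le> nJ * m" using mm B(3) by (intro mult_le_mono2; simp)+
  have mle: "m * 1 \<le> m * m" using B(3) by (intro mult_le_mono2) simp
  have cost: "nb * (m * m) \<le> nb * nJ * (m * m)" "nJ * m \<le> nb * nJ * (m * m)" "m * m \<le> nb * nJ * (m * m)" "1 \<le> nb * nJ * (m * m)"
    "m \<le> nb * nJ * (m * m)"
  proof -
    have "nb * 1 \<le> nb * nJ" using n1 by (intro mult_le_mono2) simp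
    then show "nb * (m * m) \<le> nb * nJ * (m * m)" by (intro mult_le_mono1) simp
    have "1 * nJ \<le> nb * nJ" using n1 by (intro mult_le_mono1) simp
    then show "nJ * m \<le> nb * nJ * (m * m)" using mle by (intro mult_le_mono) simp_all
    have n: "1 * 1 \<le> nb * nJ" using n1 by (intro mult_le_mono) simp_all
    then have "1 * (m * m) \<le> nb * nJ * (m * m)" by (intro mult_le_mono1) simp
    then show "m * m \<le> nb * nJ * (m * m)" by simp
    then show "1 \<le> nb * nJ * (m * m)" "m \<le> nb * nJ * (m * m)" using mm mle by linarith+
  qed
  have B': "nb \<le> B" "nJ \<le> B" "nb * (m * m) \<le> B" "(nJ + 1) * m \<le> B"
    using le mle B(1) unfolding distrib_right mult_1_right mult_1_left by linarith+
  show ?thesis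
    unfolding conv_init_def
    apply (simp add: g nb[symmetric, simplified] nJ[symmetric, simplified] B'(1,2)[simplified nb nJ, simplified] del: mult_Suc)
    apply (intro conjI, rule B'(1), rule B'(2))
    apply (rule wp_tabulate[where n = "nb * (m * m)" and p = 0 and F = "\<lambda>_. I"])
    using g nb B B' apply simp_all[10]
    subgoal for g1 a1
      apply (rule wp_tabulate[where n = "(nJ + 1) * m" and p = 0 and F = "\<lambda>_. I"])
      using g nb nJ B B' apply simp_all[10]
      subgoal for g2 a2
        apply (rule wp_tabulate[where n = "nb * (m * m) + nJ * m + m * m" and p = 0 and F = "\<lambda>_. I"])
        using g nb nJ B B' apply simp_all[10]
        subgoal for g3 a3
          apply (rule Q)
          using g nb nJ apply simp_all[7]
          using cost unfolding distrib_right distrib_left mult_1_left by linarith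
        done
      done
    done
qed

lemma wp_conv_body:
  assumes g: "g 4 = m" "g 5 = m * m" "g 21 = nJ" "g 22 = b * nJ + J"
    and b: "b < nb" "J < nJ" and m: "1 \<le> m" "m \<le> B" "nb * nJ \<le> B" "m * m \<le> B"
    and X: "\<And>i. i < nb * (m * m) \<Longrightarrow> a 40 i \<le> I" and Y: "\<And>j. j < (nJ + 1) * m \<Longrightarrow> a 41 j \<le> I"
    and Z: "\<And>s. s < nb * (m * m) + nJ * m + m * m \<Longrightarrow> a 42 s \<le> I" and I: "2 * I \<le> B"
    and Q: "\<And>g' a' t'. (\<And>y. y \<notin> {23, 24, 25} \<Longrightarrow> g' y = g y) \<Longrightarrow> (\<And>A. A \<notin> {0, 1, 42} \<Longrightarrow> a' A = a A) \<Longrightarrow>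
      (\<And>s z. z \<le> a' 42 s \<longleftrightarrow> z \<le> a 42 s \<and> (\<forall>r k. r < m * m \<longrightarrow> s = b * (m * m) + J * m + r \<longrightarrow> k < m \<longrightarrow>
         z \<le> a 40 (b * (m * m) + r div m * m + k) + a 41 (J * m + m + r mod m - k))) \<Longrightarrow>
      t' = t + tau m + 6 * (m * m) + 10 \<Longrightarrow> Q (g', a', t')"
  shows "wp conv_body Q (g, a, t)"
proof -
  have div: "(b * nJ + J) div nJ = b" by (rule div_block[OF b(2)])
  have "(b + 1) * 1 \<le> nb * nJ" "1 * (J + 1) \<le> nb * nJ" using b by (intro mult_le_mono; simp)+
  then have bB: "b \<le> B" "J \<le> B" using m(3) by auto
  have bm: "b * (m * m) + m * m \<le> nb * (m * m)" using mult_le_mono1[of "b + 1" nb "m * m"] b by simp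
  have Jm: "J * m + m \<le> nJ * m" using mult_le_mono1[of "J + 1" nJ m] b by simp
  have Xi: "a 40 (b * (m * m) + i) \<le> I" if "i < m * m" for i by (rule X) (use bm that in linarith)
  have rm: "r - r div m * m = r mod m" for r :: nat using minus_div_mult_eq_mod[of r m] .
  have rmod: "r mod m < m" for r using m by simp
  have Yi: "a 41 (J * m + m + r mod m - k) \<le> I" for r k
    by (rule Y) (use Jm rmod[of r] in \<open>simp add: less_imp_diff_less\<close>)
  let ?p = "b * (m * m) + J * m"
  have Zi: "a 42 (?p + r) \<le> I" if "r < m * m" for r by (rule Z) (use that bm Jm in linarith)
  let ?P = "\<lambda>r. Min ((\<lambda>k. a 40 (b * (m * m) + (r div m * m + k)) + a 41 (J * m + m + r mod m - k)) ` {..<m})"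
  have Pr: "?P r \<le> 2 * I" if "r < m * m" for r
  proof -
    have "r div m < m" using that by (simp add: less_mult_imp_div_less)
    then have "r div m * m + 0 < m * m" using m by (intro index_less_square) auto
    then have "a 40 (b * (m * m) + (r div m * m + 0)) + a 41 (J * m + m + r mod m - 0) \<le> 2 * I"
      using Xi[of "r div m * m + 0"] Yi[of r 0] by linarith
    moreover have "?P r \<le> a 40 (b * (m * m) + (r div m * m + 0)) + a 41 (J * m + m + r mod m - 0)"
      by (intro Min_le image_eqI[of _ _ 0]) (use m in auto)
    ultimately show ?thesis by linarith
  qed
  have XB: "a 40 (b * (m * m) + i) \<le> B" if "i < m * m" for i using Xi[OF that] I by linarith
  have YB: "a 41 (J * m + m + r mod m - k) \<le> B" for r k using Yi[of r k] I by linarith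
  show ?thesis
    unfolding conv_body_def
    apply (simp add: g div bB m(2) del: mult_Suc wp.simps(6))
    apply (rule wp_tabulate[where n = "m * m" and p = 1 and F = "\<lambda>i. a 40 (b * (m * m) + i)"])
    using g m apply simp_all[9]
    using XB apply (simp add: g)
    subgoal for g1 a1
      apply (rule wp_tabulate[where n = "m * m" and p = "1 + m * m" and F = "\<lambda>i. a 41 (J * m + m + i mod m - i div m)"])
      using g m apply simp_all[9]
      using YB apply (simp add: g rm)
      subgoal for g2 a2
        apply (rule wp_CallI[where m = m])
        using m apply simp_all[3]
        subgoal for i
          using XB[of i] YB[of "i - m * m" "(i - m * m) div m"] by (cases "i < m * m") (auto simp: not_less dest!: le_Suc_ex)
        subgoal premises p for a3
        proof -
          note g1 = p(1,2) and a1 = p(3,5) and g2 = p(6,7) and a2 = p(8,9,10) and a3 = p(11,12)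
          have A3: "a3 1 r = ?P r" if r: "r < m * m" for r
          proof -
            have xy: "r div m < m" "r mod m < m" "r div m * m + r mod m = r"
              using r m by (auto simp: less_mult_imp_div_less)
            have "a3 1 r = Min ((\<lambda>k. a2 0 (Suc (r div m * m + k)) + a2 0 (Suc (m * m + (k * m + r mod m)))) ` {..<m})"
              using a3(2)[OF xy(1,2)] xy(3) by simp
            also have "\<dots> = ?P r"
            proof (rule arg_cong[where f = Min], rule image_cong[OF refl])
              fix k assume "k \<in> {..<m}"
              then have k: "k < m" by simp
              have i1: "r div m * m + k < m * m" and i2: "k * m + r mod m < m * m"
                using index_less_square xy k by auto
              have "a2 0 (Suc (r div m * m + k)) = a1 0 (1 + (r div m * m + k))" using a2(2)[of "Suc (r div m * m + k)"] i1 by simp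
              also have "\<dots> = a 40 (b * (m * m) + (r div m * m + k))" by (rule a1(2)[OF i1])
              finally have e1: "a2 0 (Suc (r div m * m + k)) = a 40 (b * (m * m) + (r div m * m + k))" .
              have "a2 0 (Suc (m * m + (k * m + r mod m))) = a 41 (J * m + m + (k * m + r mod m) mod m - (k * m + r mod m) div m)"
                using a2(3)[OF i2] by simp
              also have "\<dots> = a 41 (J * m + m + r mod m - k)" using div_block[OF xy(2), of k] by simp
              finally show "a2 0 (Suc (r div m * m + k)) + a2 0 (Suc (m * m + (k * m + r mod m))) =
                  a 40 (b * (m * m) + (r div m * m + k)) + a 41 (J * m + m + r mod m - k)" using e1 by simp
            qed
            finally show ?thesis .
          qed
          have a342: "a3 42 = a 42" using a3(1) a2(1) a1(1) by simp
          have gg: "g2 4 = m" "g2 5 = m * m" "g2 23 = b" "g2 24 = J" using g1 g2 g by simp_all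
          show ?thesis
            apply (rule wp_tabulate[where n = "m * m" and p = ?p and F = "\<lambda>r. min (a 42 (?p + r)) (?P r)"])
            using gg m apply simp_all[9]
            subgoal for i g' a'
              using Zi[of i] Pr[of i] I by (simp add: gg A3[unfolded One_nat_def] a342 Let_def nat_diff_diff_min min.coboundedI1 del: diff_diff_cancel)
            subgoal premises q for g' a'
            proof (rule Q)
              show "g' y = g y" if "y \<notin> {23, 24, 25}" for y using that q(2) g1 g2 by simp
              show "a' A = a A" if "A \<notin> {0, 1, 42}" for A
              proof -
                have "A \<ge> 2" using that by auto
                then show ?thesis using that q(3) a1(1) a2(1) a3(1) by simp
              qed
              show "z \<le> a' 42 s \<longleftrightarrow> z \<le> a 42 s \<and> (\<forall>r k. r < m * m \<longrightarrow> s = ?p + r \<longrightarrow> k < m \<longrightarrow>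
                 z \<le> a 40 (b * (m * m) + r div m * m + k) + a 41 (J * m + m + r mod m - k))" for s z
              proof (cases "s < ?p \<or> ?p + m * m \<le> s")
                case True
                then have "a' 42 s = a 42 s" using q(4) a342 by simp
                then show ?thesis using True by auto
              next
                case False
                then obtain r where r: "r < m * m" "s = ?p + r" by (metis le_Suc_ex nat_add_left_cancel_less not_le)
                have "a' 42 s = min (a 42 s) (?P r)" using q(5)[OF r(1)] r by simp
                moreover have "z \<le> ?P r \<longleftrightarrow> (\<forall>k<m. z \<le> a 40 (b * (m * m) + (r div m * m + k)) + a 41 (J * m + m + r mod m - k))"
                  using m by (subst Min_ge_iff) (auto simp: lessThan_empty_iff)
                ultimately show ?thesis using r by (auto simp: add.assoc)
              qed
            qed simp
            done
        qed
        done
      done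
    done
qed

end

definition conv :: "nat \<Rightarrow> aexp \<Rightarrow> aexp \<Rightarrow> nat \<Rightarrow> aexp \<Rightarrow> aexp \<Rightarrow> com" where
  "conv X ox p Y oy q = Seq (Asg 26 p) (Seq (Asg 27 q) (Seq conv_init
     (Seq (tabulate 25 (V 26) 40 (N 0) (Rd X (Plus ox (V 25))))
     (Seq (tabulate 25 (V 27) 41 (V 4) (Rd Y (Plus oy (V 25)))) conv_run))))"

context bounded_machine
begin

text \<open>Invariant: after c products, array 42 holds at s the minimum of I and of the sums over
  those pairs whose number b * nJ + J is below c; \<open>block_pairs\<close> identifies the pairs
  that the next product adds. For a pair that is never reached, f i or h j equals I, so that it
  cannot lower the minimum.\<close>

lemma wp_conv_run:
  assumes g: "g 4 = m" "g 5 = m * m" "g 20 = nb" "g 21 = nJ"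
    and m: "1 \<le> m" "m \<le> B" "nb * nJ \<le> B" "m * m \<le> B" "2 * I \<le> B"
    and X: "\<And>i. i < nb * (m * m) \<Longrightarrow> a 40 i = f i" and Y: "\<And>j. j < m \<Longrightarrow> a 41 j = I"
      "\<And>j. j < nJ * m \<Longrightarrow> a 41 (m + j) = h j"
    and Z: "\<And>s. s < nb * (m * m) + nJ * m + m * m \<Longrightarrow> a 42 s = I"
    and f: "\<And>i. f i \<le> I" "\<And>i. nb * (m * m) \<le> i \<Longrightarrow> f i = I"
    and h: "\<And>i. h i \<le> I" "\<And>j. nJ * m \<le> j + m \<Longrightarrow> h j = I"
    and Q: "\<And>g' a' t'. (\<And>y. y \<notin> {22, 23, 24, 25} \<Longrightarrow> g' y = g y) \<Longrightarrow> (\<And>A. A \<notin> {0, 1, 42} \<Longrightarrow> a' A = a A) \<Longrightarrow>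
      (\<And>s. s < nb * (m * m) + nJ * m + m * m \<Longrightarrow> a' 42 s = cv I f h s) \<Longrightarrow>
      t' = t + 2 + nb * nJ * (tau m + 6 * (m * m) + 11) \<Longrightarrow> Q (g', a', t')"
  shows "wp conv_run Q (g, a, t)"
proof -
  let ?len = "nb * (m * m) + nJ * m + m * m"
  let ?K = "\<lambda>i j. (j + i mod m) div m"
  let ?C = "\<lambda>c s (z::nat). \<forall>i j. i < nb * (m * m) \<longrightarrow> i + j = s \<longrightarrow> ?K i j < nJ \<longrightarrow> i div (m * m) * nJ + ?K i j < c \<longrightarrow> z \<le> f i + h j"
  let ?D = "\<lambda>c s (z::nat). \<forall>i j. i < nb * (m * m) \<longrightarrow> i + j = s \<longrightarrow> ?K i j < nJ \<longrightarrow> i div (m * m) * nJ + ?K i j = c \<longrightarrow> z \<le> f i + h j"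
  have CD: "?C (Suc c) s z \<longleftrightarrow> ?C c s z \<and> ?D c s z" for c s z by (auto simp: less_Suc_eq)
  have modse: "mods conv_body = {23, 24, 25}" "warrs conv_body = {0, 1, 42}"
    by (auto simp: conv_body_def tabulate_def Let_def)
  show ?thesis
    unfolding conv_run_def
  proof (rule wp_For[where n = "nb * nJ" and I = "\<lambda>c g' a' t'. (\<forall>s<?len. \<forall>z. z \<le> a' 42 s \<longleftrightarrow> z \<le> I \<and> ?C c s z) \<and>
      t' = t + 1 + c * (tau m + 6 * (m * m) + 11)"])
    show "(\<forall>s<?len. \<forall>z. z \<le> a 42 s \<longleftrightarrow> z \<le> I \<and> ?C 0 s z) \<and> Suc t = t + 1 + 0 * (tau m + 6 * (m * m) + 11)"
      using Z by simp
  next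
    fix c g1 a1 t1
    assume inv: "(\<forall>s<?len. \<forall>z. z \<le> a1 42 s \<longleftrightarrow> z \<le> I \<and> ?C c s z) \<and> t1 = t + 1 + c * (tau m + 6 * (m * m) + 11)"
      and c: "c < nb * nJ" "g1 22 = c" and g1: "\<And>y. y \<noteq> 22 \<Longrightarrow> y \<notin> mods conv_body \<Longrightarrow> g1 y = g y"
      and a1: "\<And>A. A \<notin> warrs conv_body \<Longrightarrow> a1 A = a A"
    define b where "b = c div nJ"
    define J where "J = c mod nJ"
    have nJ: "0 < nJ" using c(1) by (cases nJ) auto
    have bJ: "c = b * nJ + J" "J < nJ" "b < nb"
      using c(1) nJ by (auto simp: b_def J_def less_mult_imp_div_less)
    have ag: "a1 40 = a 40" "a1 41 = a 41" "g1 4 = m" "g1 5 = m * m" "g1 21 = nJ"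
      using a1 g1 g by (auto simp: modse)
    show "wp conv_body (\<lambda>(g', a', t'). (\<lambda>c g' a' t'. (\<forall>s<?len. \<forall>z. z \<le> a' 42 s \<longleftrightarrow> z \<le> I \<and> ?C c s z) \<and>
      t' = t + 1 + c * (tau m + 6 * (m * m) + 11)) (Suc c) (g'(22 := Suc c)) a' (Suc t')) (g1, a1, t1)"
    proof (rule wp_conv_body[where b = b and J = J and nJ = nJ and nb = nb and I = I, OF ag(3-5) _ bJ(3,2) m(1-4)])
      show "g1 22 = b * nJ + J" using c bJ by simp
      show "a1 40 i \<le> I" if "i < nb * (m * m)" for i using X[OF that] f ag by simp
      show "a1 41 j \<le> I" if "j < (nJ + 1) * m" for j
      proof (cases "j < m")
        case True then show ?thesis using Y(1) ag by simp
      next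
        case False
        then obtain j' where "j = m + j'" by (metis le_Suc_ex not_le)
        then show ?thesis using Y(2)[of j'] that h(1) ag by (simp add: algebra_simps)
      qed
      show "a1 42 s \<le> I" if "s < ?len" for s using inv that by blast
    next
      fix g' a' t'
      assume a': "\<And>s z. z \<le> a' 42 s \<longleftrightarrow> z \<le> a1 42 s \<and> (\<forall>r k. r < m * m \<longrightarrow> s = b * (m * m) + J * m + r \<longrightarrow> k < m \<longrightarrow>
         z \<le> a1 40 (b * (m * m) + r div m * m + k) + a1 41 (J * m + m + r mod m - k))"
        and t': "t' = t1 + tau m + 6 * (m * m) + 10"
      have "z \<le> a' 42 s \<longleftrightarrow> z \<le> I \<and> ?C (Suc c) s z" if s: "s < ?len" for s z
      proof (cases "z \<le> I")
        case False
        then show ?thesis using a'[of z s] inv s by blast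
      next
        case True
        have "z \<le> a1 40 (b * (m * m) + r div m * m + k) + a1 41 (J * m + m + r mod m - k) \<longleftrightarrow>
            (k \<le> J * m + r mod m \<longrightarrow> z \<le> f (b * (m * m) + r div m * m + k) + h (J * m + r mod m - k))"
          if r: "r < m * m" and k: "k < m" for r k
        proof -
          have "r div m < m" using r by (simp add: less_mult_imp_div_less)
          then have "r div m * m + k < m * m" using k by (rule index_less_square)
          then have "b * (m * m) + r div m * m + k < (b + 1) * (m * m)" by simp
          also have "\<dots> \<le> nb * (m * m)" using bJ(3) by (intro mult_le_mono1) simp
          finally have x: "a1 40 (b * (m * m) + r div m * m + k) = f (b * (m * m) + r div m * m + k)" using X ag by simp
          show ?thesis
          \<comment> \<open>For larger k the index of h would be negative. The cell that is read
            then lies among the m leading cells of array 41 and contains I, which is no constraint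
            on z \<le> I.\<close>
          proof (cases "k \<le> J * m + r mod m")
            case True
            then have e: "J * m + m + r mod m - k = m + (J * m + r mod m - k)" by linarith
            have "r mod m < m" using m(1) by simp
            then have "J * m + r mod m - k < (J + 1) * m" by simp
            also have "\<dots> \<le> nJ * m" using bJ(2) by (intro mult_le_mono1) simp
            finally have "a1 41 (m + (J * m + r mod m - k)) = h (J * m + r mod m - k)" using Y(2) ag(2) by (simp only:)
            then show ?thesis unfolding x e using True by (simp only: simp_thms)
          next
            case False
            have "r mod m < m" using m(1) by simp
            then have "J * m + m + r mod m - k < m" using False m(1) by linarith
            then have "a1 41 (J * m + m + r mod m - k) = I" using Y(1) ag(2) by (simp only:)
            then show ?thesis using False \<open>z \<le> I\<close> by simp
          qed
        qed
        then have "z \<le> a' 42 s \<longleftrightarrow> z \<le> a1 42 s \<and> (\<forall>r k. r < m * m \<longrightarrow> s = b * (m * m) + J * m + r \<longrightarrow> k < m \<longrightarrow> k \<le> J * m + r mod m \<longrightarrow>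
            z \<le> f (b * (m * m) + r div m * m + k) + h (J * m + r mod m - k))"
          unfolding a' by blast
        also have "\<dots> \<longleftrightarrow> z \<le> a1 42 s \<and> ?D c s z"
          unfolding block_pairs[OF m(1) bJ(3,2), of s z f h, symmetric] bJ(1) by blast
        also have "\<dots> \<longleftrightarrow> z \<le> I \<and> ?C (Suc c) s z" using inv s CD by blast
        finally show ?thesis .
      qed
      then show "case (g', a', t') of (g', a', t') \<Rightarrow> (\<lambda>c g' a' t'. (\<forall>s<?len. \<forall>z. z \<le> a' 42 s \<longleftrightarrow> z \<le> I \<and> ?C c s z) \<and>
          t' = t + 1 + c * (tau m + 6 * (m * m) + 11)) (Suc c) (g'(22 := Suc c)) a' (Suc t')"
        using t' inv by simp
    qed (use m in auto)
  next
    fix g' a' t'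
    assume inv: "(\<forall>s<?len. \<forall>z. z \<le> a' 42 s \<longleftrightarrow> z \<le> I \<and> ?C (nb * nJ) s z) \<and> t' = t + 1 + nb * nJ * (tau m + 6 * (m * m) + 11)"
      and g': "\<And>y. y \<noteq> 22 \<Longrightarrow> y \<notin> mods conv_body \<Longrightarrow> g' y = g y" and a': "\<And>A. A \<notin> warrs conv_body \<Longrightarrow> a' A = a A"
    show "Q (g', a', Suc t')"
    proof (rule Q)
      fix s assume s: "s < ?len"
      have "z \<le> a' 42 s \<longleftrightarrow> z \<le> cv I f h s" for z
      proof -
        have "z \<le> f i + h j" if C: "?C (nb * nJ) s z" and z: "z \<le> I" and ij: "i + j = s" for i j
        proof (cases "i < nb * (m * m) \<and> ?K i j < nJ")
          case True
          have "i div (m * m) < nb" using True by (simp add: less_mult_imp_div_less)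
          then have "(i div (m * m) + 1) * nJ \<le> nb * nJ" by (intro mult_le_mono1) simp
          then have "i div (m * m) * nJ + ?K i j < nb * nJ" using True unfolding distrib_right mult_1_left by linarith
          then show ?thesis using C True ij by blast
        next
          case False
          have "h j = I" if "\<not> ?K i j < nJ"
          proof (rule h(2))
            have "nJ * m \<le> ?K i j * m" using that by (intro mult_le_mono1) simp
            also have "\<dots> \<le> j + i mod m" by (rule div_times_less_eq_dividend)
            also have "\<dots> \<le> j + m" using m(1) by (simp add: less_imp_le)
            finally show "nJ * m \<le> j + m" .
          qed
          then show ?thesis using False f(2)[of i] z by fastforce
        qed
        then show ?thesis using inv s unfolding le_cv by blast
      qed
      then show "a' 42 s = cv I f h s" by (rule nat_eq_by_le)
    qed (use g' a' inv in \<open>auto simp: modse\<close>)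
  qed (use g m modse in auto)
qed

text \<open>The time is that of the products up to a constant factor: initialising the arrays,
  filling the matrices and merging the results take O(m * m) ticks per product, and m * m is at most
  tau m.\<close>

lemma wp_conv:
  assumes g: "g 4 = m" "g 5 = m * m" "g 6 = I"
    and p: "val lp g a = p" "ok lp g a" "val lq g a = q" "ok lq g a"
      "avars lq \<inter> {26} = {}"
    and o: "val ox g a = o1" "ok ox g a" "val oy g a = o2" "ok oy g a"
      "(avars ox \<union> avars oy) \<inter> {20..27} = {}" "(aarrs ox \<union> aarrs oy) \<inter> {0, 1, 40, 41, 42} = {}"
    and XY: "X \<notin> {0, 1, 40, 41, 42}" "Y \<notin> {0, 1, 40, 41, 42}"
    and nb: "nb = p div (m * m) + 1" and nJ: "nJ = q div m + 2"
    and m: "1 \<le> m" "nb * nJ \<le> B" "nb * (m * m) + nJ * m + m * m \<le> B" "2 * I \<le> B"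
    and f: "\<And>i. f i \<le> I" "\<And>i. p \<le> i \<Longrightarrow> f i = I" "\<And>i. i < p \<Longrightarrow> a X (o1 + i) = f i"
    and h: "\<And>i. h i \<le> I" "\<And>i. q \<le> i \<Longrightarrow> h i = I" "\<And>i. i < q \<Longrightarrow> a Y (o2 + i) = h i"
    and tau: "m * m \<le> tau m"
    and Q: "\<And>g' a' t'. (\<And>y. y \<notin> {20..27} \<Longrightarrow> g' y = g y) \<Longrightarrow> (\<And>A. A \<notin> {0, 1, 40, 41, 42} \<Longrightarrow> a' A = a A) \<Longrightarrow>
      (\<And>s. s \<le> p + q \<Longrightarrow> a' 42 s = cv I f h s) \<Longrightarrow> t' \<le> t + 60 * (nb * nJ * tau m) \<Longrightarrow> Q (g', a', t')"
  shows "wp (conv X ox lp Y oy lq) Q (g, a, t)"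
proof -
  have "1 * 1 \<le> m * m" using m(1) by (intro mult_le_mono)
  then have mm: "1 \<le> m * m" by simp
  have pnb: "p < nb * (m * m)" using mm by (simp add: nb dividend_less_div_times)
  have qnJ: "q + m < nJ * m" using m(1) dividend_less_div_times[of m q] by (simp add: nJ)
  have mle: "m * 1 \<le> m * m" using m(1) by (intro mult_le_mono2) simp
  have IB: "I \<le> B" and mB: "m \<le> B" "m * m \<le> B" "p \<le> B" "q \<le> B" using m mle pnb qnJ by linarith+
  have n1: "1 \<le> nb" "2 \<le> nJ" by (auto simp: nb nJ)
  then have nn: "1 * 1 \<le> nb * nJ" by (intro mult_le_mono) simp_all
  let ?T = "nb * nJ * tau m"
  have cost: "nb * nJ * (m * m) \<le> ?T" "p \<le> ?T" "q \<le> ?T" "nb * nJ \<le> ?T"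
  proof -
    show A: "nb * nJ * (m * m) \<le> ?T" using tau by (intro mult_le_mono2)
    have "nb * 1 \<le> nb * nJ" "1 * nJ \<le> nb * nJ" using n1 by (intro mult_le_mono; simp)+
    then have "nb * (m * m) \<le> nb * nJ * (m * m)" "nJ * (m * m) \<le> nb * nJ * (m * m)" by (intro mult_le_mono1; simp)+
    moreover have "nJ * m \<le> nJ * (m * m)" using mle by (intro mult_le_mono2) simp
    ultimately show "p \<le> ?T" "q \<le> ?T" using A pnb qnJ by linarith+
    have "nb * nJ * 1 \<le> nb * nJ * (m * m)" using mm by (intro mult_le_mono2)
    then show "nb * nJ \<le> ?T" using A by linarith
  qed
  have vq: "val lq (g(26 := p)) a = q" "ok lq (g(26 := p)) a"
  proof -
    have "\<And>y. y \<in> avars lq \<Longrightarrow> (g(26 := p)) y = g y" using p(5) by auto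
    then have "val lq (g(26 := p)) a = val lq g a" "ok lq (g(26 := p)) a = ok lq g a"
      by (intro val_cong ok_cong; simp)+
    then show "val lq (g(26 := p)) a = q" "ok lq (g(26 := p)) a" using p(3,4) by blast+
  qed
  show ?thesis
    unfolding conv_def
    apply (simp add: p vq mB)
    apply (rule wp_conv_init[where p = p and q = q and nb = nb and nJ = nJ and m = m and I = I])
    using g nb nJ m IB apply simp_all[10]
    subgoal premises i for g1 a1 t1
    proof -
      have eo: "val ox g' a' = o1" "ok ox g' a'" "val oy g' a' = o2" "ok oy g' a'"
        if "\<And>y. y \<notin> {20..27} \<Longrightarrow> g' y = g y" "\<And>A. A \<notin> {0, 1, 40, 41, 42} \<Longrightarrow> a' A = a A" for g' a'
      proof -
        have v: "\<And>y. y \<in> avars ox \<Longrightarrow> g' y = g y" "\<And>y. y \<in> avars oy \<Longrightarrow> g' y = g y"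
          "\<And>A. A \<in> aarrs ox \<Longrightarrow> a' A = a A" "\<And>A. A \<in> aarrs oy \<Longrightarrow> a' A = a A"
          using that o(5,6) by (meson UnCI disjoint_iff)+
        show "val ox g' a' = o1" "ok ox g' a'" "val oy g' a' = o2" "ok oy g' a'"
          using o val_cong[of ox g' g a' a] val_cong[of oy g' g a' a] ok_cong[of ox g' g a' a] ok_cong[of oy g' g a' a] v
          by blast+
      qed
      have fB: "f i \<le> B" "h i \<le> B" for i using f(1) h(1) IB le_trans by blast+
      have out: "y \<noteq> 20 \<and> y \<noteq> 21 \<and> y \<noteq> 22 \<and> y \<noteq> 23 \<and> y \<noteq> 24 \<and> y \<noteq> 25 \<and> y \<noteq> 26 \<and> y \<noteq> 27"
        if "y \<notin> {20..27}" for y :: nat using that by auto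
      have g1: "g1 y = g y" if "y \<notin> {20..27}" for y using i(1)[of y] out[OF that] by simp
      have g1v: "g1 26 = p" "g1 27 = q" "g1 4 = m" using i(1) g by simp_all
      show ?thesis
        apply (rule wp_tabulate[where n = p and p = 0 and F = f])
        using g1v mB apply simp_all[9]
        subgoal premises q for j g' a'
        proof -
          have "val ox g' a' = o1 \<and> ok ox g' a'"
          proof (intro conjI eo)
            show "g' y = g y" if "y \<notin> {20..27}" for y using g1[OF that] q(3)[of y] out[OF that] by simp
            show "a' A = a A" if "A \<notin> {0, 1, 40, 41, 42}" for A using q(4)[of A] i(4)[of A] that by simp
            show "g' y = g y" if "y \<notin> {20..27}" for y using g1[OF that] q(3)[of y] out[OF that] by simp
            show "a' A = a A" if "A \<notin> {0, 1, 40, 41, 42}" for A using q(4)[of A] i(4)[of A] that by simp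
          qed
          moreover have "a' X = a X" using q(4) i(4) XY by simp
          ultimately show ?thesis using f(3)[OF q(1)] q(2) fB by simp
        qed
        subgoal premises r for g2 a2
          apply (rule wp_tabulate[where n = q and p = m and F = h])
          using g1v mB r(2) apply simp_all[9]
          subgoal premises q for j g' a'
          proof -
            have "val oy g' a' = o2 \<and> ok oy g' a'"
            proof (intro conjI eo)
              show "g' y = g y" if "y \<notin> {20..27}" for y using g1[OF that] q(3)[of y] r(2)[of y] out[OF that] by simp
              show "a' A = a A" if "A \<notin> {0, 1, 40, 41, 42}" for A using q(4)[of A] r(3)[of A] i(4)[of A] that by simp
              show "g' y = g y" if "y \<notin> {20..27}" for y using g1[OF that] q(3)[of y] r(2)[of y] out[OF that] by simp
              show "a' A = a A" if "A \<notin> {0, 1, 40, 41, 42}" for A using q(4)[of A] r(3)[of A] i(4)[of A] that by simp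
            qed
            moreover have "a' Y = a Y" using q(4) i(4) r(3) XY by simp
            ultimately show ?thesis using h(3)[OF q(1)] q(2) fB by simp
          qed
          subgoal premises s for g3 a3
          proof (rule wp_conv_run[where m = m and nb = nb and nJ = nJ and I = I and f = f and h = h])
            show "g3 4 = m" "g3 5 = m * m" "g3 20 = nb" "g3 21 = nJ" using s(2) r(2) i(1,2,3) g by simp_all
            show "a3 40 i = f i" if "i < nb * (m * m)" for i
            proof (cases "i < p")
              case True then show ?thesis using r(5)[of i] s(3) by simp
            next
              case False then show ?thesis using r(4)[of i] s(3) i(5) that f(2) by simp
            qed
            show "a3 41 j = I" if "j < m" for j
              using s(4)[of j] r(3) i(6)[of j] that n1 by simp
            show "a3 41 (m + j) = h j" if "j < nJ * m" for j
            proof (cases "j < q")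
              case True then show ?thesis using s(5)[of j] by simp
            next
              case False
              then show ?thesis using s(4)[of "m + j"] r(3) i(6)[of "m + j"] that h(2) by simp
            qed
            show "a3 42 k = I" if "k < nb * (m * m) + nJ * m + m * m" for k
              using s(3) r(3) i(7)[OF that] by simp
            show "f i = I" if "nb * (m * m) \<le> i" for i using f(2) that pnb by simp
            show "h j = I" if "nJ * m \<le> j + m" for j using h(2) that qnJ by simp
          next
            fix g' a' t'
            assume e: "\<And>y. y \<notin> {22, 23, 24, 25} \<Longrightarrow> g' y = g3 y" "\<And>A. A \<notin> {0, 1, 42} \<Longrightarrow> a' A = a3 A"
              "\<And>s. s < nb * (m * m) + nJ * m + m * m \<Longrightarrow> a' 42 s = cv I f h s"
              "t' = t1 + 2 * p + 2 + 2 * q + 2 + 2 + nb * nJ * (tau m + 6 * (m * m) + 11)"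
            show "Q (g', a', t')"
            proof (rule Q)
              show "g' y = g y" if "y \<notin> {20..27}" for y
                using g1[OF that] e(1)[of y] s(2)[of y] r(2)[of y] out[OF that] by simp
              show "a' A = a A" if "A \<notin> {0, 1, 40, 41, 42}" for A using that e(2) s(3) r(3) i(4) by simp
              show "a' 42 k = cv I f h k" if "k \<le> p + q" for k by (rule e(3)) (use that pnb qnJ in linarith)
              have "t1 \<le> t + 2 + 20 * (nb * nJ * (m * m))" using i(8) by simp
              then show "t' \<le> t + 60 * ?T"
              proof -
                have "nb * nJ * (6 * (m * m)) = 6 * (nb * nJ * (m * m))" "nb * nJ * 11 = 11 * (nb * nJ)" by simp_all
                moreover have "1 \<le> nb * nJ" using nn by simp
                ultimately show ?thesis unfolding e(4) distrib_left using cost i(8) by linarith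
              qed
            qed
          qed (use m mB f h in auto)
          done
        done
    qed
    done
qed

end

section \<open>Strings: one convolution of prefix sums\<close>

section \<open>Strings\<close>

text \<open>The rounded up square root. It is used through \<open>less_csr_iff\<close>, which lets a
  program find it by counting up.\<close>

definition csr :: "nat \<Rightarrow> nat" where
  "csr r = nat \<lceil>sqrt (real r)\<rceil>"

lemma less_csr_iff: "k < csr r \<longleftrightarrow> k * k < r"
proof -
  have "k < csr r \<longleftrightarrow> real k < sqrt (real r)"
    unfolding csr_def by (simp add: zless_nat_eq_int_zless less_ceiling_iff)
  also have "\<dots> \<longleftrightarrow> sqrt (real (k * k)) < sqrt (real r)" by (simp add: real_sqrt_mult)
  also have "\<dots> \<longleftrightarrow> k * k < r" by (simp only: real_sqrt_less_iff of_nat_less_iff)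
  finally show ?thesis .
qed

lemma csr_bounds:
  assumes "1 \<le> r"
  shows "1 \<le> csr r" "csr r \<le> r" "r \<le> csr r * csr r" "csr r * csr r \<le> 4 * r"
proof -
  show 1: "1 \<le> csr r" using less_csr_iff[of 0 r] assms by simp
  show "csr r \<le> r" using less_csr_iff[of r r] by (metis assms le_square mult_le_cancel1 not_le nat_mult_1_right)
  show "r \<le> csr r * csr r" using less_csr_iff[of "csr r" r] by simp
  obtain k where k: "csr r = Suc k" using 1 by (cases "csr r") auto
  then have kr: "k * k < r" using less_csr_iff[of k r] by simp
  show "csr r * csr r \<le> 4 * r"
  proof (cases "k = 0")
    case True then show ?thesis using k assms by simp
  next
    case False
    then have "k \<le> k * k" by simp
    then show ?thesis unfolding k mult_Suc mult_Suc_right using kr by linarith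
  qed
qed

text \<open>With the weight of a set of size s replaced by s minus its weight, which is its weight
  under the complemented labels, a maximum becomes a minimum. So an algorithm for minima, run twice,
  suffices.\<close>

lemma Max_complement:
  assumes "finite S" "S \<noteq> {}" "\<And>x. x \<in> S \<Longrightarrow> x \<le> (s::nat)"
  shows "Max S = s - Min ((\<lambda>x. s - x) ` S)"
proof -
  have "Min ((\<lambda>x. s - x) ` S) = s - Max S"
  proof (rule Min_eqI)
    show "s - Max S \<in> (\<lambda>x. s - x) ` S" using assms by simp
  qed (use assms in \<open>auto intro: diff_le_mono2\<close>)
  moreover have "Max S \<le> s" using assms by simp
  ultimately show ?thesis by simp
qed

text \<open>Variable 4 counts up while its square is below the parameter and ends at its rounded up
  square root. Variable 6 is set to 2 n + 2, the infinity of all later convolutions, which lies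
  above every genuine value.\<close>

definition prologue :: com where
  "prologue = Seq (Asg 4 (N 0)) (Seq (For 28 (V 3) (Ite (Times (V 4) (V 4)) (V 3) (Asg 4 (Plus (V 4) (N 1))) (Asg 4 (V 4))))
     (Seq (Asg 5 (Times (V 4) (V 4))) (Asg 6 (Plus (Plus (V 2) (V 2)) (N 2)))))"

definition min_window :: "(nat \<Rightarrow> nat) \<Rightarrow> nat \<Rightarrow> nat \<Rightarrow> nat" where
  "min_window lab n s = Min ((\<lambda>j. sum lab {j..<j + s}) ` {..n - s})"

text \<open>Array 47 receives the prefix sums P, array 43 the reversed sequence n - P (n - v).
  Adding n keeps the second sequence within the natural numbers; it is subtracted again by the
  caller.\<close>

definition string_pass :: com where
  "string_pass = Seq (St 47 (N 0) (N 0))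
    (Seq (For 28 (V 2) (St 47 (Plus (V 28) (N 1)) (Plus (Rd 47 (V 28)) (Rd 45 (V 28)))))
    (Seq (tabulate 25 (Plus (V 2) (N 1)) 43 (N 0) (Minus (V 2) (Rd 47 (Minus (V 2) (V 25)))))
      (conv 47 (N 0) (Plus (V 2) (N 1)) 43 (N 0) (Plus (V 2) (N 1)))))"

text \<open>One pass with the labels and one with their complements. Calls overwrite arrays 0 and 1;
  therefore the labels are moved to array 45 and the answers are collected in array 46 until both
  passes are done.\<close>

definition string_prog :: com where
  "string_prog = Seq (Asg 2 (Rd 0 (N 0))) (Seq (Asg 3 (V 2)) (Seq prologue
    (Seq (tabulate 25 (V 2) 45 (N 0) (Rd 0 (Plus (N 1) (V 25))))
    (Seq string_pass
    (Seq (tabulate 25 (V 2) 46 (N 0) (Minus (Rd 42 (Plus (Plus (V 2) (N 1)) (V 25))) (V 2)))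
    (Seq (tabulate 25 (V 2) 45 (N 0) (Minus (N 1) (Rd 45 (V 25))))
    (Seq string_pass
    (Seq (tabulate 25 (V 2) 46 (V 2) (Minus (Plus (V 25) (N 1)) (Minus (Rd 42 (Plus (Plus (V 2) (N 1)) (V 25))) (V 2))))
      (tabulate 25 (Plus (V 2) (V 2)) 1 (N 0) (Rd 46 (V 25)))))))))))"

text \<open>A pair with i + v = n + s and i, v \<le> n describes the window from i - s to i, as n -
  v = i - s, and contributes n plus the sum of its labels. Every other pair contributes at least 2 n
  + 2, more than any window.\<close>

lemma cv_window:
  assumes lab: "\<And>i. lab i \<le> (1::nat)" and s: "s \<le> n"
  shows "cv (2 * n + 2) (\<lambda>i. if i < n + 1 then sum lab {..<i} else 2 * n + 2)
     (\<lambda>v. if v < n + 1 then n - sum lab {..<n - v} else 2 * n + 2) (n + s) = n + min_window lab n s"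
proof (rule nat_eq_by_le)
  fix z
  let ?f = "\<lambda>i. if i < n + 1 then sum lab {..<i} else 2 * n + 2"
  let ?h = "\<lambda>v. if v < n + 1 then n - sum lab {..<n - v} else 2 * n + 2"
  have sle: "sum lab {a..<a + k} \<le> k" for a k
    using sum_mono[of "{a..<a + k}" lab "\<lambda>_. 1"] lab by simp
  have split: "sum lab {..<j + k} = sum lab {..<j} + sum lab {j..<j + k}" for j k
    by (metis add_diff_cancel_left' finite_lessThan le_add1 lessThan_minus_lessThan lessThan_subset_iff sum.subset_diff add.commute)
  have val: "?f i + ?h v = n + sum lab {i - s..<i - s + s}" if "i + v = n + s" "i \<le> n" "v \<le> n" for i v
  proof -
    have e: "n - v = i - s" "i = i - s + s" using that by auto
    have "sum lab {..<i} = sum lab {..<i - s} + sum lab {i - s..<i - s + s}" using split[of "i - s" s] e(2) by simp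
    moreover have "sum lab {..<i - s} \<le> n" using sle[of 0 "i - s"] that by (simp add: atLeast0LessThan)
    ultimately show ?thesis using that e(1) by simp
  qed
  have mw: "z \<le> n + min_window lab n s \<longleftrightarrow> (\<forall>j\<le>n - s. z \<le> n + sum lab {j..<j + s})"
  proof -
    have "n + min_window lab n s = Min ((\<lambda>j. n + sum lab {j..<j + s}) ` {..n - s})"
      unfolding min_window_def by (subst mono_Min_commute[of "\<lambda>x. n + x"]) (auto simp: mono_def image_image)
    then show ?thesis by (auto simp: Min_ge_iff)
  qed
  show "z \<le> cv (2 * n + 2) ?f ?h (n + s) \<longleftrightarrow> z \<le> n + min_window lab n s"
    unfolding le_cv mw
  proof (intro iffI allI impI conjI)
    fix j assume L: "z \<le> 2 * n + 2 \<and> (\<forall>i v. i + v = n + s \<longrightarrow> z \<le> ?f i + ?h v)" and j: "j \<le> n - s"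
    have "z \<le> ?f (j + s) + ?h (n - j)" using L j s by simp
    also have "\<dots> = n + sum lab {j + s - s..<j + s - s + s}" by (rule val) (use j s in auto)
    finally show "z \<le> n + sum lab {j..<j + s}" by simp
  next
    assume R: "\<forall>j\<le>n - s. z \<le> n + sum lab {j..<j + s}"
    have "z \<le> n + sum lab {0..<0 + s}" using R by blast
    then show z: "z \<le> 2 * n + 2" using sle[of 0 s] s by simp
    fix i v assume iv: "i + v = n + s"
    show "z \<le> ?f i + ?h v"
    proof (cases "i \<le> n \<and> v \<le> n")
      case True
      then have "z \<le> n + sum lab {i - s..<i - s + s}" by (intro R[rule_format]) (simp add: diff_le_mono)
      then show ?thesis using val[OF iv] True by simp
    qed (use z in auto)
  qed
qed

context bounded_machine
begin

lemma wp_prologue: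
  assumes g: "g 2 = n" "g 3 = r" and r: "1 \<le> r" "r \<le> n" and B: "6 * n + 2 \<le> B"
    and Q: "\<And>g' t'. (\<And>y. y \<notin> {4, 5, 6, 28} \<Longrightarrow> g' y = g y) \<Longrightarrow> g' 4 = csr r \<Longrightarrow> g' 5 = csr r * csr r \<Longrightarrow>
      g' 6 = 2 * n + 2 \<Longrightarrow> t' \<le> t + 5 + 3 * r \<Longrightarrow> Q (g', a, t')"
  shows "wp prologue Q (g, a, t)"
proof -
  have c: "csr r \<le> r" "csr r * csr r \<le> 4 * r" "r \<le> csr r * csr r" using csr_bounds[OF r(1)] by auto
  show ?thesis
    unfolding prologue_def
    apply (simp del: fun_upd_apply wp.simps(5))
    apply (rule wp_For[where n = r and I = "\<lambda>i g' a' t'. g' 4 = min i (csr r) \<and> a' = a \<and> t' = t + 2 + 3 * i"])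
    using g B r apply simp_all[8]
    subgoal for i g' a' t'
      using less_csr_iff[of i r] c r B g
      by (cases "i < csr r") (auto simp: min_def not_less intro: order_trans)
    subgoal premises p for g' a' t'
    proof -
      have m4: "g' 4 = csr r" "a' = a" "t' = t + 2 + 3 * r" using p(1) c(1) by simp_all
      have g2: "g' 2 = n" using p(4)[of 2] g by simp
      have bb: "csr r * csr r \<le> B" "n + n + 2 \<le> B" using c r(2) B by linarith+
      show ?thesis
        apply (simp add: m4 g2 bb(1))
        apply (rule conjI)
        using bb(2) apply simp
        apply (rule Q)
        subgoal for y using p(4)[of y] by simp
        using m4 g2 by simp_all
    qed
    done
qed

lemma wp_string_pass:
  assumes g: "g 2 = n" "g 4 = m" "g 5 = m * m" "g 6 = 2 * n + 2"
    and lab: "\<And>i. i < n \<Longrightarrow> a 45 i = lab i" "\<And>i. lab i \<le> 1"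
    and nb: "nb = (n + 1) div (m * m) + 1" and nJ: "nJ = (n + 1) div m + 2"
    and m: "1 \<le> m" "nb * nJ \<le> B" "nb * (m * m) + nJ * m + m * m \<le> B" "4 * n + 4 \<le> B"
    and tau: "m * m \<le> tau m"
    and Q: "\<And>g' a' t'. (\<And>y. y \<notin> {20..28} \<Longrightarrow> g' y = g y) \<Longrightarrow> (\<And>A. A \<notin> {0, 1, 40, 41, 42, 43, 47} \<Longrightarrow> a' A = a A) \<Longrightarrow>
      (\<And>s. s \<le> n \<Longrightarrow> a' 42 (n + s) = n + min_window lab n s) \<Longrightarrow>
      t' \<le> t + 10 + 4 * n + 60 * (nb * nJ * tau m) \<Longrightarrow> Q (g', a', t')"
  shows "wp string_pass Q (g, a, t)"
proof -
  have Ple: "sum lab {..<i} \<le> i" for i using sum_mono[of "{..<i}" lab "\<lambda>_. 1"] lab by simp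
  show ?thesis
    unfolding string_pass_def
    apply (simp del: fun_upd_apply mult_Suc wp.simps(5))
    apply (rule wp_For[where n = n and I = "\<lambda>i g' a' t'. (\<forall>j\<le>i. a' 47 j = sum lab {..<j}) \<and> t' = t + 2 + 2 * i"])
    using g m apply simp_all[8]
    subgoal for i g' a' t'
      using lab(1)[of i] lab(2)[of i] Ple[of i] m(4) by (auto simp add: le_Suc_eq all_conj_distrib)
    subgoal premises p for g1 a1 t1
    proof -
      have g1: "g1 y = g y" if "y \<noteq> 28" for y using p(4) that by simp
      have a1: "a1 A = a A" if "A \<noteq> 47" for A using p(5)[of A] that by simp
      have P: "a1 47 i = sum lab {..<i}" if "i \<le> n" for i using p(1) that by simp
      show ?thesis
        apply (rule wp_tabulate[where n = "n + 1" and p = 0 and F = "\<lambda>v. n - sum lab {..<n - v}"])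
        using g1 g m apply simp_all[9]
        subgoal premises q for i g' a'
        proof -
          have "sum lab {..<n - i} \<le> B" "n - sum lab {..<n - i} \<le> B" using Ple[of "n - i"] m(4) by linarith+
          then show ?thesis using q(1-4) g1 g P[of "n - i"] by simp
        qed
        subgoal premises q for g2 a2
        proof (rule wp_conv[where m = m and nb = nb and nJ = nJ and I = "2 * n + 2" and p = "n + 1" and q = "n + 1" and
             f = "\<lambda>i. if i < n + 1 then sum lab {..<i} else 2 * n + 2" and ?o1.0 = 0 and ?o2.0 = 0 and
             h = "\<lambda>v. if v < n + 1 then n - sum lab {..<n - v} else 2 * n + 2"])
          show "(if i < n + 1 then sum lab {..<i} else 2 * n + 2) \<le> 2 * n + 2" for i using Ple[of i] by simp
          show "a2 47 (0 + i) = (if i < n + 1 then sum lab {..<i} else 2 * n + 2)" if "i < n + 1" for i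
            using P[of i] q(3) that by simp
          show "a2 43 (0 + i) = (if i < n + 1 then n - sum lab {..<n - i} else 2 * n + 2)" if "i < n + 1" for i
            using q(5)[of i] that by simp
        next
          fix g' a' t'
          assume e: "\<And>y. y \<notin> {20..27} \<Longrightarrow> g' y = g2 y" "\<And>A. A \<notin> {0, 1, 40, 41, 42} \<Longrightarrow> a' A = a2 A"
            "\<And>s. s \<le> n + 1 + (n + 1) \<Longrightarrow> a' 42 s = cv (2 * n + 2) (\<lambda>i. if i < n + 1 then sum lab {..<i} else 2 * n + 2)
               (\<lambda>v. if v < n + 1 then n - sum lab {..<n - v} else 2 * n + 2) s"
            "t' \<le> Suc t1 + 2 * (n + 1) + 2 + 60 * (nb * nJ * tau m)"
          show "Q (g', a', t')"
          proof (rule Q)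
            show "g' y = g y" if "y \<notin> {20..28}" for y
            proof -
              have "y \<notin> {20..27}" "y \<noteq> 25" "y \<noteq> 28" using that by auto
              then show ?thesis using e(1) q(2) g1 by simp
            qed
            show "a' A = a A" if "A \<notin> {0, 1, 40, 41, 42, 43, 47}" for A using that e(2) q(3) a1 by simp
            show "a' 42 (n + s) = n + min_window lab n s" if "s \<le> n" for s
              using e(3)[of "n + s"] cv_window[OF lab(2) that] that by simp
            show "t' \<le> t + 10 + 4 * n + 60 * (nb * nJ * tau m)" using e(4) p(1) by simp
          qed
        qed (use q(2) g1 g nb nJ m tau in auto)
        done
    qed
    done
qed

end

context bounded_machine
begin

lemma wp_string_prog:
  assumes a0: "a 0 0 = n" "\<And>i. i < n \<Longrightarrow> a 0 (Suc i) = lab i" "\<And>i. lab i \<le> 1" and n: "1 \<le> n"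
    and m: "m = csr n" and nb: "nb = (n + 1) div (m * m) + 1" and nJ: "nJ = (n + 1) div m + 2"
    and B: "B = 100 * (n + 2)" and tau: "m * m \<le> tau m"
  shows "wp string_prog (\<lambda>(g, a', t). (\<forall>i<n. a' 1 i = min_window lab n (i + 1)) \<and>
     (\<forall>i<n. a' 1 (n + i) = (i + 1) - min_window (\<lambda>i. 1 - lab i) n (i + 1)) \<and> t \<le> 200 * (nb * nJ * tau m))
     ((\<lambda>_. 0), a, 0)"
proof -
  have c: "1 \<le> m" "m \<le> n" "n \<le> m * m" "m * m \<le> 4 * n" using csr_bounds[OF n] m by auto
  have d: "(n + 1) div (m * m) * (m * m) \<le> n + 1" "(n + 1) div m * m \<le> n + 1" "(n + 1) div m \<le> n + 1"
    by (rule div_times_less_eq_dividend div_le_dividend)+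
  have mm: "0 < m * m" using c(3) n by linarith
  have B100: "B = 100 * n + 200" by (simp add: B)
  have nb3: "nb \<le> 3"
  proof -
    have "(n + 1) div (m * m) \<le> (2 * (m * m)) div (m * m)" by (intro div_le_mono) (use c(3) n in linarith)
    also have "\<dots> = 2" using mm by simp
    finally show ?thesis by (simp add: nb)
  qed
  have "nb * nJ \<le> 3 * nJ" using nb3 by (intro mult_le_mono1)
  also have "\<dots> \<le> B" using d(3) unfolding nJ B100 distrib_left by linarith
  finally have b1: "nb * nJ \<le> B" .
  have "nb * (m * m) + nJ * m + m * m = (n + 1) div (m * m) * (m * m) + m * m + ((n + 1) div m * m + 2 * m) + m * m"
    unfolding nb nJ by (simp add: algebra_simps)
  also have "\<dots> \<le> B" using d c unfolding B100 by linarith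
  finally have b2: "nb * (m * m) + nJ * m + m * m \<le> B" .
  have b3: "4 * n + 4 \<le> B" "6 * n + 2 \<le> B" "n \<le> B" "n + n \<le> B" "n + 1 \<le> B" unfolding B100 by linarith+
  have "1 * 1 \<le> nb * nJ" by (intro mult_le_mono) (simp_all add: nb nJ)
  then have "1 * (m * m) \<le> nb * nJ * tau m" using tau by (intro mult_le_mono) simp_all
  then have cost: "n \<le> nb * nJ * tau m" using c(3) by linarith
  have mw: "min_window l n s \<le> s" if "\<And>i. l i \<le> 1" "s \<le> n" for l s
  proof -
    have "min_window l n s \<le> sum l {0..<0 + s}" unfolding min_window_def by (intro Min_le image_eqI[of _ _ 0]) auto
    also have "\<dots> \<le> s" using sum_mono[of "{0..<s}" l "\<lambda>_. 1"] that by simp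
    finally show ?thesis .
  qed
  let ?lab' = "\<lambda>i. 1 - lab i"
  have lB: "lab i \<le> B" for i using a0(3)[of i] n b3 by linarith
  have mB: "n + min_window lab n (Suc i) \<le> B" "n + min_window ?lab' n (Suc i) \<le> B"
     "min_window lab n (Suc i) \<le> B" "Suc i - min_window ?lab' n (Suc i) \<le> B" if "i < n" for i
    using mw[of lab "Suc i"] mw[of ?lab' "Suc i"] a0(3) that b3 by auto
  show ?thesis
    unfolding string_prog_def
    apply (simp add: a0 b3(3) del: mult_Suc)
    apply (rule wp_prologue[where n = n and r = n])
    using n b3 apply simp_all[5]
    subgoal premises p for g1 t1
      apply (rule wp_tabulate[where n = n and p = 0 and F = lab])
      using p(1) b3 apply simp_all[9]
      using a0 lB apply simp
      subgoal premises q for g2 a2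
      proof -
        have g2: "g2 2 = n" "g2 4 = m" "g2 5 = m * m" "g2 6 = 2 * n + 2" using q(2) p m by simp_all
        show ?thesis
          apply (rule wp_string_pass[where n = n and m = m and lab = lab and nb = nb and nJ = nJ, OF g2 _ a0(3) nb nJ c(1) b1 b2 b3(1) tau])
          using q(5) apply simp
          subgoal premises r for g3 a3 t3
          proof -
            have g3: "g3 2 = n" "g3 4 = m" "g3 5 = m * m" "g3 6 = 2 * n + 2" using r(1) g2 by simp_all
            have a45: "a3 45 i = lab i" if "i < n" for i using r(2) q(5)[OF that] by simp
            show ?thesis
              apply (rule wp_tabulate[where n = n and p = 0 and F = "\<lambda>i. min_window lab n (Suc i)"])
              using g3 b3 apply simp_all[9]
              subgoal for i g' a' using g3 r(3)[of "Suc i"] mB[of i] by simp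
              subgoal premises s for g4 a4
                apply (rule wp_tabulate[where n = n and p = 0 and F = ?lab'])
                using s(2) g3 b3 apply simp_all[9]
                subgoal for i g' a' using a45[of i] s(3) lB[of i] n b3 by simp
                subgoal premises u for g5 a5
                proof -
                  have g5: "g5 2 = n" "g5 4 = m" "g5 5 = m * m" "g5 6 = 2 * n + 2" using s(2) u(2) g3 by simp_all
                  show ?thesis
                    apply (rule wp_string_pass[where n = n and m = m and lab = ?lab' and nb = nb and nJ = nJ, OF g5 _ _ nb nJ c(1) b1 b2 b3(1) tau])
                    using u(5) apply simp
                     apply simp
                    subgoal premises v for g6 a6 t6
                      apply (rule wp_tabulate[where n = n and p = n and F = "\<lambda>i. Suc i - min_window ?lab' n (Suc i)"])
                      using v(1) g5 b3 apply simp_all[9]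
                      subgoal for i g' a' using v(1) g5 v(3)[of "Suc i"] mB[of i] by simp
                      subgoal premises w for g7 a7
                      proof -
                        have g7: "g7 2 = n" using w(2) v(1) g5 by simp
                        have o1: "a7 46 i = min_window lab n (Suc i)" if "i < n" for i
                          using w(4)[of i] v(2) u(3) s(5)[of i] that by simp
                        have o2: "a7 46 (n + i) = Suc i - min_window ?lab' n (Suc i)" if "i < n" for i
                          using w(5) that by simp
                        have o3: "a7 46 i \<le> B" if "i < n + n" for i
                          using o1[of i] o2[of "i - n"] mB[of i] mB[of "i - n"] that by (cases "i < n") auto
                        have T: "t6 + 2 * n + 2 + 2 * (n + n) + 2 \<le> 200 * (nb * nJ * tau m)"
                          using v(4) r(4) p(5) cost n unfolding distrib_left by linarith
                        show ?thesis
                          apply (rule wp_tabulate[where n = "n + n" and p = 0 and F = "\<lambda>i. a7 46 i"])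
                          using g7 b3 apply simp_all[9]
                          using o3 apply simp
                          subgoal for g8 a8
                            using o1 o2 T by auto
                          done
                      qed
                      done
                    done
                qed
                done
              done
          qed
          done
      qed
      done
    done
qed

end

section \<open>Substrings as windows, and the time bound for strings\<close>

lemma count_window:
  "j + s \<le> length T \<Longrightarrow> count_list (take s (drop j T)) True = (\<Sum>i = j..<j + s. of_bool (T ! i))"
proof (induction s)
  case (Suc s)
  have "take (Suc s) (drop j T) = take s (drop j T) @ [T ! (j + s)]"
    using Suc.prems by (simp add: take_Suc_conv_app_nth)
  then show ?case using Suc by simp
qed simp

lemma substring_ones_eq:
  assumes "s \<le> length T"
  shows "substring_ones T s = (\<lambda>j. \<Sum>i = j..<j + s. of_bool (T ! i)) ` {..length T - s}"
proof -
  have "sublist u T \<and> length u = s \<longleftrightarrow> (\<exists>j\<le>length T - s. u = take s (drop j T))" for u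
  proof
    assume "sublist u T \<and> length u = s"
    then obtain ps ss where T: "T = ps @ u @ ss" "length u = s" unfolding sublist_def by blast
    then show "\<exists>j\<le>length T - s. u = take s (drop j T)" by (intro exI[of _ "length ps"]) simp
  next
    assume "\<exists>j\<le>length T - s. u = take s (drop j T)"
    then obtain j where j: "j \<le> length T - s" "u = take s (drop j T)" by blast
    have "T = take j T @ u @ drop s (drop j T)" by (simp only: j append_take_drop_id)
    then have "sublist u T" unfolding sublist_def by blast
    then show "sublist u T \<and> length u = s" using j assms by simp
  qed
  then have "substring_ones T s = (\<lambda>j. count_list (take s (drop j T)) True) ` {..length T - s}"
    unfolding substring_ones_def by auto
  also have "\<dots> = (\<lambda>j. \<Sum>i = j..<j + s. of_bool (T ! i)) ` {..length T - s}"
    by (intro image_cong refl count_window) (use assms in auto)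
  finally show ?thesis .
qed

lemma string_outputs:
  assumes s: "s \<le> length T" and lab: "\<And>i. i < length T \<Longrightarrow> lab i = of_bool (T ! i)"
  shows "Min (substring_ones T s) = min_window lab (length T) s"
    "Max (substring_ones T s) = s - min_window (\<lambda>i. 1 - lab i) (length T) s"
proof -
  have eq: "substring_ones T s = (\<lambda>j. sum lab {j..<j + s}) ` {..length T - s}"
    unfolding substring_ones_eq[OF s] by (intro image_cong sum.cong refl) (use s lab in auto)
  show "Min (substring_ones T s) = min_window lab (length T) s" by (simp add: eq min_window_def)
  have le: "lab i \<le> 1" if "i < length T" for i using lab[OF that] by simp
  have c: "s - sum lab {j..<j + s} = (\<Sum>i = j..<j + s. 1 - lab i)" if "j \<le> length T - s" for j
    using le that s by (subst sum_subtractf_nat) auto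
  have "Max (substring_ones T s) = s - Min ((\<lambda>x. s - x) ` substring_ones T s)"
  proof (rule Max_complement)
    fix x assume "x \<in> substring_ones T s"
    then obtain j where "j \<le> length T - s" "x = sum lab {j..<j + s}" by (auto simp: eq)
    moreover have "sum lab {j..<j + s} \<le> (\<Sum>i = j..<j + s. 1)"
      by (rule sum_mono) (use le s \<open>j \<le> length T - s\<close> in auto)
    ultimately show "x \<le> s" by simp
  qed (auto simp: eq)
  also have "(\<lambda>x. s - x) ` substring_ones T s = (\<lambda>j. \<Sum>i = j..<j + s. 1 - lab i) ` {..length T - s}"
    unfolding eq image_image by (intro image_cong refl) (use c in auto)
  finally show "Max (substring_ones T s) = s - min_window (\<lambda>i. 1 - lab i) (length T) s"
    by (simp add: min_window_def)
qed

text \<open>There are at most 3 blocks, nJ * m is at most 4 n, and m * m is at most 4 n. In nb * nJ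
  * m^3 these factors multiply to 48 n^2.\<close>

lemma string_cost:
  assumes n: "1 \<le> n" and m: "m = csr n" and nb: "nb = (n + 1) div (m * m) + 1" and nJ: "nJ = (n + 1) div m + 2"
    and tau: "real tm \<le> C * (real m ^ 3 / lm)" and l: "lm > 0"
  shows "real (nb * nJ * tm) \<le> 48 * C * (real n ^ 2 / lm)"
proof -
  have c: "1 \<le> m" "m \<le> n" "n \<le> m * m" "m * m \<le> 4 * n" using csr_bounds[OF n] m by auto
  have mm: "0 < m * m" using c(3) n by linarith
  have "(n + 1) div (m * m) \<le> (2 * (m * m)) div (m * m)" by (intro div_le_mono) (use c(3) n in linarith)
  also have "\<dots> = 2" using mm by simp
  finally have nb3: "nb \<le> 3" by (simp add: nb)
  have "nJ * m = (n + 1) div m * m + 2 * m" by (simp add: nJ algebra_simps)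
  also have "\<dots> \<le> (n + 1) + 2 * n" using c(2) div_times_less_eq_dividend[of "n + 1" m] by linarith
  finally have "nJ * m \<le> 4 * n" using n by linarith
  then have nJm: "real nJ * real m \<le> 4 * real n" by (metis of_nat_le_iff of_nat_mult of_nat_numeral)
  have C: "0 \<le> C" 
  proof -
    have "0 \<le> C * (real m ^ 3 / lm)" using tau by (meson of_nat_0_le_iff order_trans)
    then show ?thesis using c(1) l by (simp add: zero_le_mult_iff zero_le_divide_iff not_le)
  qed
  have "real (nb * nJ * tm) \<le> 3 * real nJ * (C * (real m ^ 3 / lm))"
    unfolding of_nat_mult using nb3 tau by (intro mult_mono) auto
  also have "\<dots> = 3 * (real nJ * real m) * (C * (real (m * m) / lm))" by (simp add: power3_eq_cube)
  also have "\<dots> \<le> 3 * (4 * real n) * (C * (real (m * m) / lm))"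
    using nJm C l by (intro mult_right_mono mult_left_mono) auto
  also have "\<dots> \<le> 3 * (4 * real n) * (C * (real (4 * n) / lm))"
    using c(4) C l by (intro mult_left_mono divide_right_mono) (auto simp del: of_nat_mult)
  also have "\<dots> = 48 * C * (real n ^ 2 / lm)" by (simp add: power2_eq_square)
  finally show ?thesis .
qed

theorem string_jpm_solvable:
  assumes l: "\<And>n. l n > 0" and mp: "computes_min_plus P0 d tau" and tau: "\<And>m. 1 \<le> m \<Longrightarrow> m * m \<le> tau m"
    and tauC: "\<And>m. 1 \<le> m \<Longrightarrow> real (tau m) \<le> C * (real m ^ 3 / l m)"
  shows "solvable_in_time_O string_jpm_problem (\<lambda>T. real (length T) ^ 2 / l (nat \<lceil>sqrt (real (length T))\<rceil>))"
proof (rule solvable_by_com[OF mp, where c = string_prog and b = 8 and K = "200 * (48 * C)"])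
  show "enc_input string_jpm_problem w x = length x # map of_bool x" for w x by (simp add: string_jpm_problem_def)
  show "enc_output string_jpm_problem w x = map (\<lambda>s. Min (substring_ones x s)) [1..<length x + 1] @
       map (\<lambda>s. Max (substring_ones x s)) [1..<length x + 1]" for w x by (simp add: string_jpm_problem_def)
  fix T :: "bool list" assume "T \<in> instances string_jpm_problem"
  then have n: "1 \<le> length T" by (simp add: string_jpm_problem_def)
  let ?n = "length T"
  let ?B = "100 * (?n + 2)"
  define m where "m = csr ?n"
  define lab :: "nat \<Rightarrow> nat" where "lab i = (if i < ?n then of_bool (T ! i) else 0)" for i
  have m1: "1 \<le> m" using csr_bounds(1)[OF n] m_def by simp
  show "\<exists>B\<ge>2. B \<le> (magnitude string_jpm_problem T + 2) ^ 8 \<and> (\<forall>a. (\<forall>i<length (?n # map of_bool T). a 0 i = (?n # map of_bool T) ! i) \<longrightarrow>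
     bounded_machine.wp B tau string_prog (\<lambda>(g, a', t).
       (\<forall>i<length (map (\<lambda>s. Min (substring_ones T s)) [1..<?n + 1] @ map (\<lambda>s. Max (substring_ones T s)) [1..<?n + 1]).
          a' 1 i = (map (\<lambda>s. Min (substring_ones T s)) [1..<?n + 1] @ map (\<lambda>s. Max (substring_ones T s)) [1..<?n + 1]) ! i) \<and>
       real t \<le> 200 * (48 * C) * (real ?n ^ 2 / l (nat \<lceil>sqrt (real ?n)\<rceil>))) ((\<lambda>_. 0), a, 0))"
  proof (intro exI[of _ ?B] conjI allI impI)
    \<comment> \<open>The factor 100 of the bound is below 2 ^ 7, and n + 2 is at least 2.\<close>
    have "(2::nat) ^ 7 \<le> (?n + 2) ^ 7" by (intro power_mono) auto
    then have "128 * (?n + 2) \<le> (?n + 2) ^ 7 * (?n + 2)" by (intro mult_le_mono1) simp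
    also have "\<dots> = (?n + 2) ^ 8" using power_Suc2[of "?n + 2" 7] by (simp only: Suc_numeral semiring_norm)
    finally have "?B \<le> (?n + 2) ^ 8" by linarith
    then show "?B \<le> (magnitude string_jpm_problem T + 2) ^ 8" by (simp add: string_jpm_problem_def)
    fix a :: "nat \<Rightarrow> nat \<Rightarrow> nat"
    assume a: "\<forall>i<length (?n # map of_bool T). a 0 i = (?n # map of_bool T) ! i"
    have a0: "a 0 0 = ?n" "\<And>i. i < ?n \<Longrightarrow> a 0 (Suc i) = lab i" using a[rule_format, of 0] a[rule_format, of "Suc _"]
      by (auto simp: lab_def)
    have lab1: "lab i \<le> 1" for i by (simp add: lab_def)
    note wp = bounded_machine.wp_string_prog[where a = a and lab = lab and n = ?n and m = m and B = ?B and tau = tau,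
      OF a0 lab1 n m_def refl refl refl tau[OF m1]]
    have o: "Min (substring_ones T (Suc i)) = min_window lab ?n (Suc i)"
       "Max (substring_ones T (Suc i)) = Suc i - min_window (\<lambda>i. 1 - lab i) ?n (Suc i)" if "i < ?n" for i
      by (rule string_outputs; use that in \<open>simp add: lab_def\<close>)+
    show "bounded_machine.wp ?B tau string_prog (\<lambda>(g, a', t).
       (\<forall>i<length (map (\<lambda>s. Min (substring_ones T s)) [1..<?n + 1] @ map (\<lambda>s. Max (substring_ones T s)) [1..<?n + 1]).
          a' 1 i = (map (\<lambda>s. Min (substring_ones T s)) [1..<?n + 1] @ map (\<lambda>s. Max (substring_ones T s)) [1..<?n + 1]) ! i) \<and>
       real t \<le> 200 * (48 * C) * (real ?n ^ 2 / l (nat \<lceil>sqrt (real ?n)\<rceil>))) ((\<lambda>_. 0), a, 0)"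
    proof (rule bounded_machine.wp_mono[OF wp])
      fix s :: state
      obtain g a' t where s: "s = (g, a', t)" by (cases s) auto
      assume *: "case s of (g, a', t) \<Rightarrow> (\<forall>i<?n. a' 1 i = min_window lab ?n (i + 1)) \<and>
        (\<forall>i<?n. a' 1 (?n + i) = i + 1 - min_window (\<lambda>i. 1 - lab i) ?n (i + 1)) \<and>
        t \<le> 200 * (((?n + 1) div (m * m) + 1) * ((?n + 1) div m + 2) * tau m)"
      define X where "X = ((?n + 1) div (m * m) + 1) * ((?n + 1) div m + 2) * tau m"
      have o1: "\<forall>i<?n. a' 1 i = min_window lab ?n (i + 1)"
        and o2: "\<forall>i<?n. a' 1 (?n + i) = i + 1 - min_window (\<lambda>i. 1 - lab i) ?n (i + 1)" and tX: "t \<le> 200 * X"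
        using * unfolding s prod.case X_def by blast+
      have "real t \<le> real (200 * X)" using tX by (simp only: of_nat_le_iff)
      then have "real t \<le> 200 * real X" by simp
      also have "\<dots> \<le> 200 * (48 * C * (real ?n ^ 2 / l m))"
        unfolding X_def using string_cost[OF n m_def refl refl tauC[OF m1] l] by (intro mult_left_mono) simp_all
      finally have "real t \<le> 200 * (48 * C) * (real ?n ^ 2 / l (nat \<lceil>sqrt (real ?n)\<rceil>))"
        by (simp only: m_def csr_def mult.assoc)
      moreover have "a' 1 i = (map (\<lambda>s. Min (substring_ones T s)) [1..<?n + 1] @ map (\<lambda>s. Max (substring_ones T s)) [1..<?n + 1]) ! i"
        if "i < ?n + ?n" for i
      proof (cases "i < ?n")
        case True
        then show ?thesis using o1 o(1)[OF True] by (simp add: nth_append del: upt_Suc)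
      next
        case False
        then obtain j where "i = ?n + j" by (metis le_Suc_ex not_le)
        then show ?thesis using o2 o(2)[of j] that by (simp add: nth_append del: upt_Suc)
      qed
      ultimately show "case s of (g, a', t) \<Rightarrow>
       (\<forall>i<length (map (\<lambda>s. Min (substring_ones T s)) [1..<?n + 1] @ map (\<lambda>s. Max (substring_ones T s)) [1..<?n + 1]).
          a' 1 i = (map (\<lambda>s. Min (substring_ones T s)) [1..<?n + 1] @ map (\<lambda>s. Max (substring_ones T s)) [1..<?n + 1]) ! i) \<and>
       real t \<le> 200 * (48 * C) * (real ?n ^ 2 / l (nat \<lceil>sqrt (real ?n)\<rceil>))" unfolding s by simp
    qed
  qed simp
qed

section \<open>Connected sets and leaves in trees\<close>

section \<open>Connected sets in trees\<close>

locale finite_graph =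
  fixes V :: "nat set" and E :: "nat set set"
  assumes finite_V: "finite V" and simple: "\<And>e. e \<in> E \<Longrightarrow> e \<subseteq> V \<and> card e = 2"
begin

definition adj :: "nat \<Rightarrow> nat \<Rightarrow> bool" where
  "adj x y \<longleftrightarrow> {x, y} \<in> E"

lemma adj_sym: "adj x y \<longleftrightarrow> adj y x"
  unfolding adj_def by (simp add: insert_commute)

lemma adj_neq: "\<not> adj x x"
  using simple[of "{x, x}"] unfolding adj_def by auto

text \<open>Connectivity by cuts: this form makes unions and separations easy to handle.\<close>

definition conn :: "nat set \<Rightarrow> bool" where
  "conn C \<longleftrightarrow> C \<noteq> {} \<and> (\<forall>S. S \<subseteq> C \<longrightarrow> S \<noteq> {} \<longrightarrow> S \<noteq> C \<longrightarrow> (\<exists>a\<in>S. \<exists>b\<in>C - S. adj a b))"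

lemma conn_singleton: "conn {v}"
  unfolding conn_def by auto

lemma conn_nonempty: "conn C \<Longrightarrow> C \<noteq> {}"
  by (simp add: conn_def)

lemma conn_cut: "conn C \<Longrightarrow> S \<subseteq> C \<Longrightarrow> S \<noteq> {} \<Longrightarrow> S \<noteq> C \<Longrightarrow> \<exists>a\<in>S. \<exists>b\<in>C - S. adj a b"
  unfolding conn_def by blast

text \<open>It suffices to consider cuts that leave out a given element.\<close>

lemma connI:
  assumes "b \<in> C" and cut: "\<And>S. S \<subseteq> C \<Longrightarrow> S \<noteq> {} \<Longrightarrow> b \<notin> S \<Longrightarrow> \<exists>x\<in>S. \<exists>y\<in>C - S. adj x y"
  shows "conn C"
  unfolding conn_def
proof (intro conjI allI impI)
  show "C \<noteq> {}" using assms(1) by blast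
  fix S assume S: "S \<subseteq> C" "S \<noteq> {}" "S \<noteq> C"
  show "\<exists>a\<in>S. \<exists>b\<in>C - S. adj a b"
  proof (cases "b \<in> S")
    case False then show ?thesis using cut S by blast
  next
    case True
    have "\<exists>x\<in>C - S. \<exists>y\<in>C - (C - S). adj x y" by (rule cut) (use S True in auto)
    then obtain x y where "x \<in> C - S" "y \<in> C - (C - S)" "adj x y" by blast
    then show ?thesis using adj_sym by blast
  qed
qed

lemma conn_union_edge:
  assumes "conn A" "conn D" "x \<in> A" "y \<in> D" "adj x y"
  shows "conn (A \<union> D)"
proof (rule connI[of x])
  show "x \<in> A \<union> D" using assms by blast
  fix S assume S: "S \<subseteq> A \<union> D" "S \<noteq> {}" "x \<notin> S"
  show "\<exists>a\<in>S. \<exists>b\<in>A \<union> D - S. adj a b"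
  proof (cases "S \<inter> A = {}")
    case False
    have "\<exists>a\<in>S \<inter> A. \<exists>b\<in>A - (S \<inter> A). adj a b"
      by (rule conn_cut[OF assms(1)]) (use False S assms in auto)
    then show ?thesis by blast
  next
    case True
    then have SD: "S \<subseteq> D" using S by blast
    show ?thesis
    proof (cases "S = D")
      case False
      have "\<exists>a\<in>S. \<exists>b\<in>D - S. adj a b"
        by (rule conn_cut[OF assms(2) SD S(2) False])
      then show ?thesis by blast
    next
      case True
      then have "y \<in> S" "x \<in> A \<union> D - S" "adj y x" using assms S adj_sym by auto
      then show ?thesis by blast
    qed
  qed
qed

lemma conn_union_point:
  assumes "conn A" "conn D" "x \<in> A" "x \<in> D"
  shows "conn (A \<union> D)"
proof (rule connI[of x])
  show "x \<in> A \<union> D" using assms by blast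
  fix S assume S: "S \<subseteq> A \<union> D" "S \<noteq> {}" "x \<notin> S"
  show "\<exists>a\<in>S. \<exists>b\<in>A \<union> D - S. adj a b"
  proof (cases "S \<inter> A = {}")
    case False
    have "\<exists>a\<in>S \<inter> A. \<exists>b\<in>A - (S \<inter> A). adj a b"
      by (rule conn_cut[OF assms(1)]) (use False S assms in auto)
    then show ?thesis by blast
  next
    case True
    have "\<exists>a\<in>S \<inter> D. \<exists>b\<in>D - (S \<inter> D). adj a b"
      by (rule conn_cut[OF assms(2)]) (use True S assms in auto)
    then show ?thesis by blast
  qed
qed

text \<open>If all edges between O and K end in the element b of K, then b separates O from K.\<close>

lemma conn_separate:
  assumes C: "conn C" "C \<subseteq> X \<union> K" and OK: "X \<inter> K = {}" and b: "\<And>x y. x \<in> X \<Longrightarrow> y \<in> K \<Longrightarrow> adj x y \<Longrightarrow> y = b"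
    and ne: "C \<inter> X \<noteq> {}" "C \<inter> K \<noteq> {}"
  shows "b \<in> C" "conn (C \<inter> K)" "conn (insert b (C \<inter> X))"
proof -
  have "\<exists>x\<in>C \<inter> X. \<exists>y\<in>C - C \<inter> X. adj x y"
    by (rule conn_cut[OF C(1)]) (use ne OK C in auto)
  then obtain x y where xy: "x \<in> C \<inter> X" "y \<in> C - C \<inter> X" "adj x y" by blast
  have "y = b" by (rule b[of x]) (use xy C in auto)
  then show bC: "b \<in> C" using xy by blast
  have bK: "b \<in> K" using xy C \<open>y = b\<close> by blast
  show "conn (C \<inter> K)"
  proof (rule connI[of b])
    show "b \<in> C \<inter> K" using bC bK by blast
    fix S assume S: "S \<subseteq> C \<inter> K" "S \<noteq> {}" "b \<notin> S"
    have "\<exists>x\<in>S. \<exists>y\<in>C - S. adj x y" by (rule conn_cut[OF C(1)]) (use S bC in auto)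
    then obtain x y where xy: "x \<in> S" "y \<in> C - S" "adj x y" by blast
    have "y \<notin> X" using b[of y x] xy S adj_sym by blast
    then show "\<exists>x\<in>S. \<exists>y\<in>C \<inter> K - S. adj x y" using xy C(2) by blast
  qed
  show "conn (insert b (C \<inter> X))"
  proof (rule connI[of b])
    show "b \<in> insert b (C \<inter> X)" by blast
    fix S assume S: "S \<subseteq> insert b (C \<inter> X)" "S \<noteq> {}" "b \<notin> S"
    have "\<exists>x\<in>S. \<exists>y\<in>C - S. adj x y" by (rule conn_cut[OF C(1)]) (use S bC in auto)
    then obtain x y where xy: "x \<in> S" "y \<in> C - S" "adj x y" by blast
    have "y \<in> X \<or> y = b" using b[of x y] xy S C(2) by blast
    then show "\<exists>x\<in>S. \<exists>y\<in>insert b (C \<inter> X) - S. adj x y" using xy S by blast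
  qed
qed

definition nbrs :: "nat set \<Rightarrow> nat \<Rightarrow> nat set" where
  "nbrs L v = {w \<in> L. adj v w}"

text \<open>It suffices to look at cuts S that leave out p. An edge of L that leaves S cannot end in
  u, because the only neighbour of u is p.\<close>

lemma conn_remove_leaf:
  assumes L: "conn L" and u: "u \<in> L" "nbrs L u = {p}"
  shows "conn (L - {u})"
proof (rule connI[of p])
  have p: "p \<in> L" "adj u p" "p \<noteq> u" using u adj_neq by (auto simp: nbrs_def)
  then show "p \<in> L - {u}" by blast
  fix S assume S: "S \<subseteq> L - {u}" "S \<noteq> {}" "p \<notin> S"
  have "\<exists>x\<in>S. \<exists>y\<in>L - S. adj x y" by (rule conn_cut[OF L]) (use S p in auto)
  then obtain x y where xy: "x \<in> S" "y \<in> L - S" "adj x y" by blast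
  have "y \<noteq> u"
  proof
    assume "y = u"
    then have "x \<in> nbrs L u" using xy S adj_sym by (auto simp: nbrs_def)
    then show False using u S xy by auto
  qed
  then show "\<exists>x\<in>S. \<exists>y\<in>L - {u} - S. adj x y" using xy by blast
qed

lemma conn_has_nbr:
  assumes "conn L" "v \<in> L" "L \<noteq> {v}"
  shows "nbrs L v \<noteq> {}"
proof -
  have "\<exists>x\<in>{v}. \<exists>y\<in>L - {v}. adj x y" by (rule conn_cut) (use assms in auto)
  then show ?thesis by (auto simp: nbrs_def)
qed

definition is_path :: "nat set \<Rightarrow> nat list \<Rightarrow> bool" where
  "is_path L vs \<longleftrightarrow> vs \<noteq> [] \<and> distinct vs \<and> set vs \<subseteq> L \<and> (\<forall>i. Suc i < length vs \<longrightarrow> adj (vs ! i) (vs ! Suc i))"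

text \<open>Take a longest path in L. All neighbours of its first node x lie on it, since otherwise
  it could be extended. A neighbour other than the second node closes a cycle with the initial
  segment of the path.\<close>

lemma cycle_if_no_leaf:
  assumes L: "finite L" "L \<noteq> {}" and deg: "\<And>v. v \<in> L \<Longrightarrow> 2 \<le> card (nbrs L v)"
  shows "\<exists>vs. is_cycle (V, E) vs"
proof -
  obtain v where "v \<in> L" using L by blast
  then have "is_path L [v]" by (simp add: is_path_def)
  moreover have "\<forall>vs. is_path L vs \<longrightarrow> length vs < Suc (card L)"
    using L(1) by (auto simp: is_path_def less_Suc_eq_le distinct_card[symmetric] intro: card_mono)
  ultimately obtain vs where vs: "is_path L vs" "\<And>ws. is_path L ws \<Longrightarrow> length ws \<le> length vs"
    using ex_has_greatest_nat_lemma[of "is_path L" "[v]" length] by (metis ex_has_greatest_nat less_Suc_eq_le)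
  then obtain x xs where xs: "vs = x # xs" by (cases vs) (auto simp: is_path_def)
  have xL: "x \<in> L" using vs(1) by (auto simp: is_path_def xs)
  have on: "y \<in> set xs" if "y \<in> nbrs L x" for y
  proof (rule ccontr)
    assume y: "y \<notin> set xs"
    have "y \<noteq> x" using that adj_neq by (auto simp: nbrs_def)
    moreover have "adj ((y # vs) ! i) ((y # vs) ! Suc i)" if "Suc i < length (y # vs)" for i
      using that vs(1) \<open>y \<in> nbrs L x\<close> adj_sym by (cases i) (auto simp: nbrs_def is_path_def xs)
    ultimately have "is_path L (y # vs)" using vs(1) y that by (auto simp: is_path_def xs nbrs_def)
    then show False using vs(2) by fastforce
  qed
  have "\<not> nbrs L x \<subseteq> {xs ! 0}"
    using deg[OF xL] card_mono[of "{xs ! 0}" "nbrs L x"] by auto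
  then obtain y where y: "y \<in> nbrs L x" "y \<noteq> xs ! 0" by blast
  obtain j where j: "j < length xs" "xs ! j = y" using on[OF y(1)] by (auto simp: in_set_conv_nth)
  have j1: "1 \<le> j" using j y(2) by (cases j) auto
  let ?c = "take (j + 2) vs"
  have len: "length ?c = j + 2" using j by (simp add: xs)
  have "is_cycle (V, E) ?c"
    unfolding is_cycle_def
  proof (intro conjI allI impI)
    show "3 \<le> length ?c" using len j1 by simp
    show "distinct ?c" using vs(1) by (simp add: is_path_def)
    fix i assume i: "i < length ?c"
    show "{?c ! i, ?c ! (Suc i mod length ?c)} \<in> snd (V, E)"
    proof (cases "Suc i = length ?c")
      case True
      have "adj y x" using y(1) adj_sym by (simp add: nbrs_def)
      then show ?thesis using True len j by (simp add: xs adj_def)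
    next
      case False
      then have "Suc i < length ?c" using i by linarith
      moreover from this have "adj (vs ! i) (vs ! Suc i)" using vs(1) len j by (auto simp: is_path_def xs)
      ultimately show ?thesis by (simp add: adj_def)
    qed
  qed
  then show ?thesis by blast
qed

lemma simple_edge: "e \<in> E \<Longrightarrow> \<exists>x y. e = {x, y} \<and> x \<noteq> y \<and> adj x y"
  using simple[of e] by (auto simp: card_2_iff adj_def)

end

locale tree_on = finite_graph +
  assumes acyclic: "\<nexists>vs. is_cycle (V, E) vs" and conn_V: "conn V"
begin

lemma leaf_exists:
  assumes "conn L" "L \<subseteq> V" "2 \<le> card L"
  obtains u p where "u \<in> L" "nbrs L u = {p}"
proof -
  have fin: "finite L" using assms(2) finite_V finite_subset by blast
  obtain u where u: "u \<in> L" "card (nbrs L u) < 2"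
    using cycle_if_no_leaf[OF fin conn_nonempty[OF assms(1)]] acyclic by (meson not_le)
  have "L \<noteq> {u}" using assms(3) by auto
  then have "nbrs L u \<noteq> {}" using conn_has_nbr[OF assms(1) u(1)] by blast
  moreover have "finite (nbrs L u)" using fin by (simp add: nbrs_def)
  ultimately have "card (nbrs L u) = 1" using u(2) by (metis One_nat_def Suc_leI card_gt_0_iff le_antisym less_2_cases_iff less_one nat_less_le)
  then obtain p where "nbrs L u = {p}" by (auto simp: card_1_singleton_iff)
  then show thesis using that u(1) by blast
qed

text \<open>Removing a leaf removes exactly the edge to its neighbour. The number of edges is needed
  to know how many words of the input to read.\<close>

lemma edge_count_aux:
  "conn L \<Longrightarrow> L \<subseteq> V \<Longrightarrow> card L = Suc k \<Longrightarrow> card {e \<in> E. e \<subseteq> L} = k"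
proof (induction k arbitrary: L)
  case 0
  then obtain v where "L = {v}" by (auto simp: card_1_singleton_iff)
  then have "{e \<in> E. e \<subseteq> L} = {}" using simple by (fastforce simp: subset_singleton_iff)
  then show ?case by (simp only: card.empty)
next
  case (Suc k)
  obtain u p where u: "u \<in> L" "nbrs L u = {p}" using leaf_exists[of L] Suc.prems by auto
  have fin: "finite L" using Suc.prems by (metis card.infinite nat.distinct(1))
  have pL: "p \<in> L" "adj u p" "p \<noteq> u" using u adj_neq by (auto simp: nbrs_def)
  have IH: "card {e \<in> E. e \<subseteq> L - {u}} = k"
    by (rule Suc.IH) (use Suc.prems conn_remove_leaf[OF Suc.prems(1) u] u fin in auto)
  have eup: "e = {u, p}" if "e \<in> E" "e \<subseteq> L" "u \<in> e" for e
  proof -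
    obtain x y where xy: "e = {x, y}" "adj x y" using simple_edge[OF \<open>e \<in> E\<close>] by blast
    then obtain z where z: "e = {u, z}" "adj u z"
    proof (cases "u = x")
      case False
      then have "u = y" using \<open>u \<in> e\<close> xy(1) by blast
      then have "e = {u, x}" "adj u x" using xy adj_sym by (auto simp: insert_commute)
      then show thesis by (rule that)
    qed (use that in blast)
    have "z \<in> nbrs L u" using z \<open>e \<subseteq> L\<close> unfolding nbrs_def by blast
    then have "z = p" unfolding u(2) by simp
    then show ?thesis using z(1) by simp
  qed
  have "{e \<in> E. e \<subseteq> L} = insert {u, p} {e \<in> E. e \<subseteq> L - {u}}"
  proof (rule equalityI; rule subsetI)
    fix e assume e: "e \<in> {e \<in> E. e \<subseteq> L}"
    show "e \<in> insert {u, p} {e \<in> E. e \<subseteq> L - {u}}"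
    proof (cases "u \<in> e")
      case True
      then have "e = {u, p}" using eup e by simp
      then show ?thesis by simp
    qed (use e in blast)
  next
    fix e assume "e \<in> insert {u, p} {e \<in> E. e \<subseteq> L - {u}}"
    moreover have "{u, p} \<in> {e \<in> E. e \<subseteq> L}" using pL(1,2) u(1) unfolding adj_def by simp
    ultimately show "e \<in> {e \<in> E. e \<subseteq> L}" by blast
  qed
  moreover have "finite {e \<in> E. e \<subseteq> L - {u}}" using fin by (auto intro: finite_subset[of _ "Pow L"])
  ultimately show ?case using IH by simp
qed

lemma edge_count: "card E + 1 = card V"
proof -
  have "card V \<noteq> 0" using conn_nonempty[OF conn_V] finite_V by simp
  then obtain k where k: "card V = Suc k" by (cases "card V") auto
  have "{e \<in> E. e \<subseteq> V} = E" using simple by auto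
  then show ?thesis using edge_count_aux[OF conn_V subset_refl k] k by simp
qed

text \<open>Starting from V, leaves are removed until i nodes are left. So the minima over connected
  sets of a given size range over nonempty collections.\<close>

lemma conn_subset_exists:
  assumes "1 \<le> i" "i \<le> card V"
  shows "\<exists>C\<subseteq>V. conn C \<and> card C = i"
  using assms(2,1)
proof (induction rule: inc_induct)
  case base
  then show ?case using conn_V by blast
next
  case (step i)
  then obtain C where C: "C \<subseteq> V" "conn C" "card C = Suc i" by auto
  obtain u p where u: "u \<in> C" "nbrs C u = {p}" using leaf_exists[of C] C step by auto
  have "conn (C - {u})" by (rule conn_remove_leaf[OF C(2) u])
  moreover have "card (C - {u}) = i" using C u by simp
  ultimately show ?case using C(1) by blast
qed

end

section \<open>Connectivity by paths and connectivity by cuts\<close>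

lemma connected_graph_conn:
  assumes "finite_graph W E" "F \<subseteq> E" "connected_graph (C, F)" "simple_graph (C, F)"
  shows "finite_graph.conn E C"
proof -
  interpret finite_graph W E by fact
  have step: "\<exists>a\<in>S. \<exists>b\<in>C - S. adj a b" if "(x, y) \<in> {(x, y). {x, y} \<in> F}\<^sup>*" "x \<in> S" "y \<notin> S" for x y S
    using that
  proof (induction rule: rtrancl_induct)
    case base then show ?case by blast
  next
    case (step y z)
    show ?case
    proof (cases "y \<in> S")
      case True
      moreover have "z \<in> C" using step(2) assms(4) by (auto simp: simple_graph_def)
      moreover have "adj y z" using step(2) assms(2) by (auto simp: adj_def)
      ultimately show ?thesis using step.prems by blast
    qed (use step in blast)
  qed
  show ?thesis
    unfolding conn_def
  proof (intro conjI allI impI)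
    show "C \<noteq> {}" using assms(3) by (simp add: connected_graph_def)
    fix S assume S: "S \<subseteq> C" "S \<noteq> {}" "S \<noteq> C"
    then obtain x y where xy: "x \<in> S" "y \<in> C" "y \<notin> S" by blast
    then have "(x, y) \<in> {(x, y). {x, y} \<in> F}\<^sup>*" using assms(3) S by (auto simp: connected_graph_def)
    then show "\<exists>a\<in>S. \<exists>b\<in>C - S. adj a b" using step xy by blast
  qed
qed

text \<open>The induced subgraph is connected: the nodes reachable from x form a subset of C that no
  edge within C leaves, so they cannot form a proper cut.\<close>

lemma conn_connected_graph:
  assumes "finite_graph W E" "finite_graph.conn E C"
  shows "connected_graph (C, {e \<in> E. e \<subseteq> C})"
proof -
  interpret finite_graph W E by fact
  let ?R = "{(x, y). {x, y} \<in> {e \<in> E. e \<subseteq> C}}"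
  have "(x, y) \<in> ?R\<^sup>*" if xy: "x \<in> C" "y \<in> C" for x y
  proof (rule ccontr)
    assume n: "(x, y) \<notin> ?R\<^sup>*"
    let ?S = "{z \<in> C. (x, z) \<in> ?R\<^sup>*}"
    have "\<exists>a\<in>?S. \<exists>b\<in>C - ?S. adj a b"
      by (rule conn_cut[OF assms(2)]) (use xy n in auto)
    then obtain a b where ab: "a \<in> ?S" "b \<in> C - ?S" "adj a b" by blast
    then have "(a, b) \<in> ?R" by (auto simp: adj_def)
    then have "(x, b) \<in> ?R\<^sup>*" using ab(1) by (auto intro: rtrancl_into_rtrancl)
    then show False using ab(2) by blast
  qed
  then show ?thesis using conn_nonempty[OF assms(2)] by (simp add: connected_graph_def)
qed

section \<open>Families of sets and their minimum weights\<close>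

section \<open>Families of connected sets and their weights\<close>

definition fprod :: "nat set set \<Rightarrow> nat set set \<Rightarrow> nat set set" where
  "fprod F G = {A \<union> D |A D. A \<in> F \<and> D \<in> G}"

text \<open>As a function of the size i, this is the sequence the program stores for a family; a
  size that does not occur has the value I, which fits \<open>cv\<close>.\<close>

definition mw :: "(nat \<Rightarrow> nat) \<Rightarrow> nat \<Rightarrow> nat set set \<Rightarrow> nat \<Rightarrow> nat" where
  "mw lab I F i = Min (insert I (sum lab ` {C \<in> F. card C = i}))"

lemma le_mw:
  assumes "F \<subseteq> Pow X" "finite X"
  shows "z \<le> mw lab I F i \<longleftrightarrow> z \<le> I \<and> (\<forall>C\<in>F. card C = i \<longrightarrow> z \<le> sum lab C)"
proof -
  have "finite {C \<in> F. card C = i}" using assms by (auto intro: finite_subset[of _ "Pow X"])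
  then show ?thesis unfolding mw_def by (subst Min_ge_iff) auto
qed

lemma mw_attained:
  assumes "F \<subseteq> Pow X" "finite X"
  shows "mw lab I F i = I \<or> (\<exists>C\<in>F. card C = i \<and> mw lab I F i = sum lab C)"
proof -
  have "finite {C \<in> F. card C = i}" using assms by (auto intro: finite_subset[of _ "Pow X"])
  then have "mw lab I F i \<in> insert I (sum lab ` {C \<in> F. card C = i})"
    unfolding mw_def by (intro Min_in) auto
  then show ?thesis by auto
qed

lemma mw_le: assumes "F \<subseteq> Pow X" "finite X" shows "mw lab I F i \<le> I"
  using le_mw[OF assms, of "mw lab I F i" lab I i] by simp

lemma mw_empty [simp]: "mw lab I {} i = I"
  by (simp add: mw_def)

lemma mw_unit [simp]: "mw lab I {{}} i = (if i = 0 then 0 else I)"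
proof -
  have "{C \<in> {{} :: nat set}. card C = i} = (if i = 0 then {{}} else {})" by auto
  then show ?thesis unfolding mw_def by (simp only:) simp
qed

lemma mw_big:
  assumes "F \<subseteq> Pow X" "finite X" "card X < i"
  shows "mw lab I F i = I"
proof -
  have "card C \<noteq> i" if "C \<in> F" for C
  proof -
    have "card C \<le> card X" by (rule card_mono) (use that assms in auto)
    then show ?thesis using assms(3) by simp
  qed
  then have "{C \<in> F. card C = i} = {}" by blast
  then show ?thesis by (simp only: mw_def image_empty Min_singleton)
qed

lemma mw_Un:
  assumes "F \<union> G \<subseteq> Pow X" "finite X"
  shows "mw lab I (F \<union> G) i = min (mw lab I F i) (mw lab I G i)"
proof (rule nat_eq_by_le)
  fix z
  have "F \<subseteq> Pow X" "G \<subseteq> Pow X" using assms(1) by auto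
  then show "z \<le> mw lab I (F \<union> G) i \<longleftrightarrow> z \<le> min (mw lab I F i) (mw lab I G i)"
    by (auto simp: le_mw[OF _ assms(2)] le_mw[OF assms])
qed

lemma mw_insert_empty:
  assumes "F \<subseteq> Pow X" "finite X"
  shows "mw lab I (insert {} F) i = (if i = 0 then 0 else mw lab I F i)"
proof (cases "i = 0")
  case True
  have "z \<le> mw lab I (insert {} F) 0 \<longleftrightarrow> z \<le> 0" for z
    using assms by (subst le_mw[of _ X]) auto
  then show ?thesis using True nat_eq_by_le by simp
next
  case False
  then have "{C \<in> insert {} F. card C = i} = {C \<in> F. card C = i}" by auto
  then show ?thesis using False unfolding mw_def by simp
qed

text \<open>The link between families and convolutions: for members over disjoint ground sets, sizes
  and weights add up. If one of the two factors has no member of the required size, its value I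
  alone is at least every z \<le> I.\<close>

lemma mw_fprod:
  assumes F: "F \<subseteq> Pow X" "finite X" and G: "G \<subseteq> Pow Y" "finite Y" and XY: "X \<inter> Y = {}"
  shows "mw lab I (fprod F G) s = cv I (mw lab I F) (mw lab I G) s"
proof (rule nat_eq_by_le)
  fix z
  have FG: "fprod F G \<subseteq> Pow (X \<union> Y)" "finite (X \<union> Y)"
    using F(1) G(1) F(2) G(2) unfolding fprod_def by (blast, simp)
  have c: "card (A \<union> D) = card A + card D \<and> sum lab (A \<union> D) = sum lab A + sum lab D" if "A \<in> F" "D \<in> G" for A D
  proof -
    have "A \<subseteq> X" "D \<subseteq> Y" using that F(1) G(1) by blast+
    then have "finite A" "finite D" "A \<inter> D = {}"
      using finite_subset[OF _ F(2)] finite_subset[OF _ G(2)] XY by blast+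
    then show ?thesis by (simp add: card_Un_disjoint sum.union_disjoint)
  qed
  show "z \<le> mw lab I (fprod F G) s \<longleftrightarrow> z \<le> cv I (mw lab I F) (mw lab I G) s"
    unfolding le_mw[OF FG] le_cv
  proof (intro iffI conjI allI impI ballI)
    assume L: "z \<le> I \<and> (\<forall>C\<in>fprod F G. card C = s \<longrightarrow> z \<le> sum lab C)"
    then show "z \<le> I" by blast
    fix i j assume ij: "i + j = s"
    show "z \<le> mw lab I F i + mw lab I G j"
    proof (cases "mw lab I F i = I \<or> mw lab I G j = I")
      case True then show ?thesis using L by auto
    next
      case False
      obtain A where A: "A \<in> F" "card A = i" "mw lab I F i = sum lab A"
        using mw_attained[OF F, of lab I i] False by blast
      obtain D where D: "D \<in> G" "card D = j" "mw lab I G j = sum lab D"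
        using mw_attained[OF G, of lab I j] False by blast
      note AD = A D
      have "A \<union> D \<in> fprod F G" using AD by (auto simp: fprod_def)
      moreover have "card (A \<union> D) = s" using c[OF AD(1,4)] AD(2,5) ij by simp
      ultimately have "z \<le> sum lab (A \<union> D)" using L by blast
      then show ?thesis using c[OF AD(1,4)] AD(3,6) by simp
    qed
  next
    assume R: "z \<le> I \<and> (\<forall>i j. i + j = s \<longrightarrow> z \<le> mw lab I F i + mw lab I G j)"
    then show "z \<le> I" by blast
    fix C assume C: "C \<in> fprod F G" "card C = s"
    then obtain A D where AD: "A \<in> F" "D \<in> G" "C = A \<union> D" by (auto simp: fprod_def)
    have "mw lab I F (card A) \<le> sum lab A" "mw lab I G (card D) \<le> sum lab D"
      using le_mw[OF F, of "mw lab I F (card A)" lab I "card A"] le_mw[OF G, of "mw lab I G (card D)" lab I "card D"] AD by auto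
    moreover have "card A + card D = s" using c[OF AD(1,2)] C(2) AD(3) by simp
    then have "z \<le> mw lab I F (card A) + mw lab I G (card D)" using R by blast
    ultimately show "z \<le> sum lab C" using c[OF AD(1,2)] AD(3) by simp
  qed
qed

section \<open>How the families change when parts are closed, merged or joined\<close>

context finite_graph
begin

text \<open>
  The nodes of the tree are contracted into their remaining neighbours, leaf by leaf. Of the nodes
  contracted into v, the set W v is small and K v is closed; all connections between the two go
  through the gate b v. The families FA, FB, FG consist of the parts in W v of connected sets which
  contain v but no closed node, which contain v and the gate, and which contain the gate.
\<close>

definition FA :: "(nat \<Rightarrow> nat set) \<Rightarrow> nat \<Rightarrow> nat set set" where
  "FA W v = {C. C \<subseteq> W v \<and> conn C \<and> v \<in> C}"
definition FB :: "(nat \<Rightarrow> nat set) \<Rightarrow> (nat \<Rightarrow> nat set) \<Rightarrow> (nat \<Rightarrow> nat) \<Rightarrow> nat \<Rightarrow> nat set set" where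
  "FB W K b v = {C. K v \<noteq> {} \<and> C \<subseteq> W v \<and> conn (insert (b v) C) \<and> v \<in> insert (b v) C}"
definition FG :: "(nat \<Rightarrow> nat set) \<Rightarrow> (nat \<Rightarrow> nat set) \<Rightarrow> (nat \<Rightarrow> nat) \<Rightarrow> nat \<Rightarrow> nat set set" where
  "FG W K b v = {C. K v \<noteq> {} \<and> C \<subseteq> W v \<and> conn (insert (b v) C)}"
definition FH :: "(nat \<Rightarrow> nat set) \<Rightarrow> (nat \<Rightarrow> nat) \<Rightarrow> nat \<Rightarrow> nat set set" where
  "FH K b v = {C. C \<subseteq> K v \<and> conn C \<and> b v \<in> C}"
definition FS :: "nat set \<Rightarrow> (nat \<Rightarrow> nat set) \<Rightarrow> (nat \<Rightarrow> nat set) \<Rightarrow> nat set set" where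
  "FS L W K = {C. conn C \<and> (\<exists>v\<in>L. C \<subseteq> W v \<or> C \<subseteq> K v)}"

text \<open>The clause on v in K v keeps gates intact under contraction: a part merged into v is
  attached at v itself, so if v is closed, its new neighbours can reach K v only through v, which
  has to be the gate.\<close>

definition ginv :: "nat set \<Rightarrow> (nat \<Rightarrow> nat set) \<Rightarrow> (nat \<Rightarrow> nat set) \<Rightarrow> (nat \<Rightarrow> nat) \<Rightarrow> bool" where
  "ginv L W K b \<longleftrightarrow> (\<Union>v\<in>L. W v \<union> K v) = V \<and>
    (\<forall>v\<in>L. W v \<inter> K v = {} \<and> v \<in> W v \<union> K v \<and> (K v \<noteq> {} \<longrightarrow> b v \<in> K v) \<and> (v \<in> K v \<longrightarrow> b v = v) \<and>
       (\<forall>x\<in>W v. \<forall>y\<in>K v. adj x y \<longrightarrow> y = b v)) \<and>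
    (\<forall>v\<in>L. \<forall>w\<in>L. v \<noteq> w \<longrightarrow> (W v \<union> K v) \<inter> (W w \<union> K w) = {} \<and>
       (\<forall>x\<in>W v \<union> K v. \<forall>y\<in>W w \<union> K w. adj x y \<longrightarrow> x = v \<and> y = w))"

lemma ginvD:
  assumes "ginv L W K b" "v \<in> L"
  shows "W v \<union> K v \<subseteq> V" "W v \<inter> K v = {}" "v \<in> W v \<union> K v" "K v \<noteq> {} \<Longrightarrow> b v \<in> K v" "v \<in> K v \<Longrightarrow> b v = v"
    "\<And>x y. x \<in> W v \<Longrightarrow> y \<in> K v \<Longrightarrow> adj x y \<Longrightarrow> y = b v"
  using assms unfolding ginv_def by blast+

lemma ginvD2:
  assumes "ginv L W K b" "v \<in> L" "w \<in> L" "v \<noteq> w"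
  shows "(W v \<union> K v) \<inter> (W w \<union> K w) = {}"
    "\<And>x y. x \<in> W v \<union> K v \<Longrightarrow> y \<in> W w \<union> K w \<Longrightarrow> adj x y \<Longrightarrow> x = v \<and> y = w"
  using assms unfolding ginv_def by blast+

lemma families_subset:
  assumes "ginv L W K b" "v \<in> L"
  shows "FA W v \<subseteq> Pow (W v)" "FB W K b v \<subseteq> Pow (W v)" "FG W K b v \<subseteq> Pow (W v)" "FH K b v \<subseteq> Pow (K v)"
    "FS L W K \<subseteq> Pow V" "finite (W v)" "finite (K v)"
proof -
  show "FS L W K \<subseteq> Pow V" using assms(1) unfolding FS_def ginv_def by blast
  show "finite (W v)" "finite (K v)" using ginvD(1)[OF assms] finite_V by (auto dest: finite_subset)
qed (auto simp: FA_def FB_def FG_def FH_def)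

lemma ginv_close:
  assumes "ginv L W K b" "v \<in> L"
  shows "ginv L (W(v := {})) (K(v := W v \<union> K v)) (b(v := v))"
proof -
  have R: "(W(v := {})) w \<union> (K(v := W v \<union> K v)) w = W w \<union> K w" for w by auto
  show ?thesis
    unfolding ginv_def R
  proof (intro conjI ballI impI)
    show "(\<Union>v\<in>L. W v \<union> K v) = V" using assms(1) by (simp add: ginv_def)
    fix w assume w: "w \<in> L"
    note D = ginvD[OF assms(1) w]
    show "(W(v := {})) w \<inter> (K(v := W v \<union> K v)) w = {}" using D(2) by simp
    show "w \<in> W w \<union> K w" by (rule D(3))
    show "(b(v := v)) w \<in> (K(v := W v \<union> K v)) w" if "(K(v := W v \<union> K v)) w \<noteq> {}"
      using that D(3,4) by (cases "w = v") simp_all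
    show "(b(v := v)) w = w" if "w \<in> (K(v := W v \<union> K v)) w"
      using that D(5) by (cases "w = v") simp_all
    show "y = (b(v := v)) w" if "x \<in> (W(v := {})) w" "y \<in> (K(v := W v \<union> K v)) w" "adj x y" for x y
      using that D(6)[of x y] by (cases "w = v") simp_all
    fix w' assume w': "w' \<in> L" "w \<noteq> w'"
    note D2 = ginvD2[OF assms(1) w w']
    show "(W w \<union> K w) \<inter> (W w' \<union> K w') = {}" by (rule D2(1))
    fix x y assume "x \<in> W w \<union> K w" "y \<in> W w' \<union> K w'" "adj x y"
    then show "x = w" "y = w'" using D2(2) by blast+
  qed
qed

text \<open>A connected set that meets both parts contains the gate and falls apart there into two
  connected pieces (\<open>conn_separate\<close>); conversely, two pieces that share the gate form a
  connected set (\<open>conn_union_point\<close>). The gate is counted with the closed piece only,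
  which is why members of \<open>FB\<close> and \<open>FG\<close> do not contain it.\<close>

lemma close_families:
  assumes g: "ginv L W K b" and v: "v \<in> L"
  shows "FH (K(v := W v \<union> K v)) (b(v := v)) v = FA W v \<union> fprod (FB W K b v) (FH K b v)"
    "FS L (W(v := {})) (K(v := W v \<union> K v)) = FS L W K \<union> fprod (FG W K b v) (FH K b v)"
proof -
  note D = ginvD[OF g v]
  have split: "b v \<in> C" "conn (C \<inter> K v)" "conn (insert (b v) (C \<inter> W v))" "C = (C \<inter> W v) \<union> (C \<inter> K v)"
    if "conn C" "C \<subseteq> W v \<union> K v" "C \<inter> W v \<noteq> {}" "C \<inter> K v \<noteq> {}" for C
    using conn_separate[OF that(1,2) D(2,6) that(3,4)] that(2) by auto
  have join: "conn (A \<union> D)" if "A \<in> FG W K b v" "D \<in> FH K b v" for A D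
  proof -
    have "conn (insert (b v) A \<union> D)"
      by (rule conn_union_point[of _ _ "b v"]) (use that in \<open>auto simp: FG_def FH_def\<close>)
    moreover have "insert (b v) A \<union> D = A \<union> D" using that by (auto simp: FH_def)
    ultimately show ?thesis by simp
  qed
  \<comment> \<open>A connected set inside K v that contains the gate is a product with an empty
    open piece.\<close>
  have empty: "{} \<in> FG W K b v" if "K v \<noteq> {}" using that conn_singleton by (auto simp: FG_def)
  have BG: "FB W K b v \<subseteq> FG W K b v" by (auto simp: FB_def FG_def)
  have dec: "C \<in> fprod (FG W K b v) (FH K b v)" if C: "conn C" "C \<subseteq> W v \<union> K v" "C \<inter> K v \<noteq> {}" "b v \<in> C" for C
  proof (cases "C \<inter> W v = {}")
    case True
    then have "C \<in> FH K b v" "K v \<noteq> {}" using C by (auto simp: FH_def)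
    then show ?thesis using empty unfolding fprod_def by blast
  next
    case False
    note s = split[OF C(1,2) False C(3)]
    have "C \<inter> W v \<in> FG W K b v" "C \<inter> K v \<in> FH K b v" using s D(4) C(3) by (auto simp: FG_def FH_def)
    then show ?thesis using s(4) unfolding fprod_def by blast
  qed
  show "FH (K(v := W v \<union> K v)) (b(v := v)) v = FA W v \<union> fprod (FB W K b v) (FH K b v)"
  proof (rule equalityI; rule subsetI)
    fix C assume "C \<in> FH (K(v := W v \<union> K v)) (b(v := v)) v"
    then have C: "C \<subseteq> W v \<union> K v" "conn C" "v \<in> C" by (auto simp: FH_def)
    show "C \<in> FA W v \<union> fprod (FB W K b v) (FH K b v)"
    proof (cases "C \<inter> K v = {}")
      case True
      then have "C \<in> FA W v" using C by (auto simp: FA_def)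
      then show ?thesis by blast
    next
      case K: False
      have "b v \<in> C"
      proof (cases "C \<inter> W v = {}")
        case True
        then show ?thesis using C D(5) by auto
      next
        case False
        show ?thesis by (rule split(1)[OF C(2,1) False K])
      qed
      then obtain A D' where AD: "A \<in> FG W K b v" "D' \<in> FH K b v" "C = A \<union> D'"
        using dec[OF C(2,1) K] by (auto simp: fprod_def)
      have "v \<in> insert (b v) A"
      proof (cases "v \<in> A")
        case False
        then have "v \<in> K v" using AD C(3) by (auto simp: FH_def)
        then show ?thesis using D(5) by simp
      qed simp
      then have "A \<in> FB W K b v" using AD(1) by (auto simp: FB_def FG_def)
      then show ?thesis using AD unfolding fprod_def by blast
    qed
  next
    fix C assume "C \<in> FA W v \<union> fprod (FB W K b v) (FH K b v)"
    then show "C \<in> FH (K(v := W v \<union> K v)) (b(v := v)) v"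
    proof
      assume "C \<in> FA W v" then show ?thesis by (auto simp: FA_def FH_def)
    next
      assume "C \<in> fprod (FB W K b v) (FH K b v)"
      then obtain A D' where AD: "A \<in> FB W K b v" "D' \<in> FH K b v" "C = A \<union> D'" by (auto simp: fprod_def)
      then have "conn C" using join BG by blast
      then show ?thesis using AD by (auto simp: FB_def FH_def)
    qed
  qed
  show "FS L (W(v := {})) (K(v := W v \<union> K v)) = FS L W K \<union> fprod (FG W K b v) (FH K b v)"
  proof (rule equalityI; rule subsetI)
    fix C assume "C \<in> FS L (W(v := {})) (K(v := W v \<union> K v))"
    then obtain w where C: "conn C" "w \<in> L" "C \<subseteq> (W(v := {})) w \<or> C \<subseteq> (K(v := W v \<union> K v)) w" by (auto simp: FS_def)
    show "C \<in> FS L W K \<union> fprod (FG W K b v) (FH K b v)"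
    proof (cases "w = v \<and> C \<inter> W v \<noteq> {} \<and> C \<inter> K v \<noteq> {}")
      case True
      then have s: "C \<subseteq> W v \<union> K v" "C \<inter> W v \<noteq> {}" "C \<inter> K v \<noteq> {}" using C(3) by auto
      then show ?thesis using dec[OF C(1) s(1,3) split(1)[OF C(1) s]] by blast
    next
      case False
      have ne: "C \<noteq> {}" by (rule conn_nonempty[OF C(1)])
      have "C \<subseteq> W w \<or> C \<subseteq> K w"
      proof (cases "w = v")
        case True then show ?thesis using False C(3) ne by auto
      next
        case False then show ?thesis using C(3) by simp
      qed
      then show ?thesis using C(1,2) by (auto simp: FS_def)
    qed
  next
    fix C assume C: "C \<in> FS L W K \<union> fprod (FG W K b v) (FH K b v)"
    then show "C \<in> FS L (W(v := {})) (K(v := W v \<union> K v))"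
    proof
      assume "C \<in> FS L W K"
      then obtain w where w: "conn C" "w \<in> L" "C \<subseteq> W w \<or> C \<subseteq> K w" by (auto simp: FS_def)
      then have "C \<subseteq> (W(v := {})) w \<or> C \<subseteq> (K(v := W v \<union> K v)) w" by auto
      then show ?thesis using w unfolding FS_def by blast
    next
      assume "C \<in> fprod (FG W K b v) (FH K b v)"
      then obtain A D' where AD: "A \<in> FG W K b v" "D' \<in> FH K b v" "C = A \<union> D'" by (auto simp: fprod_def)
      then have "conn C" "C \<subseteq> (K(v := W v \<union> K v)) v" using join by (auto simp: FG_def FH_def)
      then show ?thesis using v unfolding FS_def by blast
    qed
  qed
qed

lemma closed_families:
  assumes "W v = {}" "b v = v" "K v \<noteq> {}"
  shows "FA W v = {}" "FB W K b v = {{}}" "FG W K b v = {{}}"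
  using assms conn_singleton by (auto simp: FA_def FB_def FG_def)

definition merge_sets :: "nat \<Rightarrow> nat \<Rightarrow> (nat \<Rightarrow> nat set) \<Rightarrow> nat \<Rightarrow> nat set" where
  "merge_sets p u R = R(p := R p \<union> R u)"
definition merge_gate :: "nat \<Rightarrow> nat \<Rightarrow> (nat \<Rightarrow> nat set) \<Rightarrow> (nat \<Rightarrow> nat) \<Rightarrow> nat \<Rightarrow> nat" where
  "merge_gate p u K b = b(p := if K p \<noteq> {} then b p else b u)"

text \<open>Two closed parts can only be merged if the open parts are empty.\<close>

definition mergeable :: "nat set \<Rightarrow> (nat \<Rightarrow> nat set) \<Rightarrow> (nat \<Rightarrow> nat set) \<Rightarrow> nat \<Rightarrow> nat \<Rightarrow> bool" where
  "mergeable L W K u p \<longleftrightarrow> u \<in> L \<and> p \<in> L \<and> u \<noteq> p \<and> nbrs L u = {p} \<and>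
     (K u = {} \<or> K p = {} \<or> (W u = {} \<and> W p = {}))"

text \<open>As u has no remaining neighbour except p, an edge between the part of u and another part
  is the edge from u to p. The gate of the union is well defined because two nonempty closed parts
  occur only without open parts, and then no edge between open and closed nodes has to be
  considered.\<close>

lemma ginv_merge:
  assumes g: "ginv L W K b" and m: "mergeable L W K u p"
  shows "ginv (L - {u}) (merge_sets p u W) (merge_sets p u K) (merge_gate p u K b)"
proof -
  have L: "u \<in> L" "p \<in> L" "u \<noteq> p" "nbrs L u = {p}" using m by (auto simp: mergeable_def)
  note Du = ginvD[OF g L(1)] and Dp = ginvD[OF g L(2)] and Dup = ginvD2[OF g L(1,2,3)]
  have up: "\<And>x y. x \<in> W u \<union> K u \<Longrightarrow> y \<in> W p \<union> K p \<Longrightarrow> adj x y \<Longrightarrow> x = u \<and> y = p" by (rule Dup(2))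
  have nu: "w = p" if "w \<in> L" "w \<noteq> u" "x \<in> W u \<union> K u" "y \<in> W w \<union> K w" "adj x y" for x y w
  proof -
    have "x = u \<and> y = w" using ginvD2(2)[OF g L(1) that(1) _ that(3,4,5)] that(2) by blast
    then have "w \<in> nbrs L u" using that by (auto simp: nbrs_def)
    then show ?thesis using L(4) by auto
  qed
  let ?W = "merge_sets p u W" and ?K = "merge_sets p u K" and ?b = "merge_gate p u K b"
  have R: "?W v \<union> ?K v = (if v = p then (W p \<union> K p) \<union> (W u \<union> K u) else W v \<union> K v)" for v
    by (auto simp: merge_sets_def)
  show ?thesis
    unfolding ginv_def R
  proof (intro conjI ballI impI)
    show "(\<Union>v\<in>L - {u}. if v = p then W p \<union> K p \<union> (W u \<union> K u) else W v \<union> K v) = V"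
    proof -
      have "(\<Union>v\<in>L. W v \<union> K v) = V" using g by (simp add: ginv_def)
      then show ?thesis using L(1-3) by (auto split: if_splits)
    qed
    fix v assume v: "v \<in> L - {u}"
    then have vL: "v \<in> L" "v \<noteq> u" by auto
    note Dv = ginvD[OF g vL(1)]
    show "?W v \<inter> ?K v = {}"
      using Dv(2) Du(2) Dp(2) Dup(1) by (auto simp: merge_sets_def)
    show "v \<in> (if v = p then W p \<union> K p \<union> (W u \<union> K u) else W v \<union> K v)" using Dv(3) by auto
    show "?b v \<in> ?K v" if "?K v \<noteq> {}"
      using that Dv(4) Du(4) Dp(4) by (auto simp: merge_sets_def merge_gate_def split: if_splits)
    show "?b v = v" if "v \<in> ?K v"
      using that Dv(5) Dp(3) Dup(1) by (auto simp: merge_sets_def merge_gate_def split: if_splits)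
    show "y = ?b v" if "x \<in> ?W v" "y \<in> ?K v" "adj x y" for x y
    proof (cases "v = p")
      case False
      then show ?thesis using that Dv(6) by (auto simp: merge_sets_def merge_gate_def)
    next
      case True
      have xy: "x \<in> W p \<or> x \<in> W u" "y \<in> K p \<or> y \<in> K u" using that True by (auto simp: merge_sets_def)
      have 1: "y = b p" if "x \<in> W p" "y \<in> K p" using Dp(6) that \<open>adj x y\<close> by blast
      have 2: "y = b u" if "x \<in> W u" "y \<in> K u" using Du(6) that \<open>adj x y\<close> by blast
      have 3: "y = b p" if "x \<in> W u" "y \<in> K p" using up[of x y] Dp(5) that \<open>adj x y\<close> by auto
      have 4: "y = b u" if "x \<in> W p" "y \<in> K u" using up[of y x] Du(5) that \<open>adj x y\<close> adj_sym by auto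
      have ex: "K u = {} \<or> K p = {}" using m xy by (auto simp: mergeable_def)
      show ?thesis using xy 1 2 3 4 ex True by (auto simp: merge_gate_def)
    qed
    fix w assume w: "w \<in> L - {u}" "v \<noteq> w"
    then have wL: "w \<in> L" "w \<noteq> u" by auto
    note Dvw = ginvD2[OF g vL(1) wL(1) w(2)]
    show "(if v = p then W p \<union> K p \<union> (W u \<union> K u) else W v \<union> K v) \<inter> (if w = p then W p \<union> K p \<union> (W u \<union> K u) else W w \<union> K w) = {}"
      using Dvw(1) ginvD2(1)[OF g L(1) vL(1)] ginvD2(1)[OF g L(1) wL(1)] vL wL w(2) by auto
    fix x y assume xy: "x \<in> (if v = p then W p \<union> K p \<union> (W u \<union> K u) else W v \<union> K v)"
      "y \<in> (if w = p then W p \<union> K p \<union> (W u \<union> K u) else W w \<union> K w)" "adj x y"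
    have "x \<in> W v \<union> K v"
    proof (rule ccontr)
      assume n: "x \<notin> W v \<union> K v"
      then have "v = p" "x \<in> W u \<union> K u" using xy(1) by (auto split: if_splits)
      then have "w = p" using nu[OF wL] xy w(2) by (auto split: if_splits)
      then show False using \<open>v = p\<close> w(2) by simp
    qed
    moreover have "y \<in> W w \<union> K w"
    proof (rule ccontr)
      assume n: "y \<notin> W w \<union> K w"
      then have "w = p" "y \<in> W u \<union> K u" using xy(2) by (auto split: if_splits)
      then have "v = p" using nu[OF vL, of y x] xy w(2) adj_sym by (auto split: if_splits)
      then show False using \<open>w = p\<close> w(2) by simp
    qed
    ultimately show "x = v" "y = w" using Dvw(2) xy(3) by blast+
  qed
qed

text \<open>The two factors are recovered by intersection with the disjoint ground sets, so
  membership becomes a condition on two traces.\<close>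

lemma fprod_iff:
  assumes "F \<subseteq> Pow X" "G \<subseteq> Pow Y" "X \<inter> Y = {}"
  shows "C \<in> fprod F G \<longleftrightarrow> C \<subseteq> X \<union> Y \<and> C \<inter> X \<in> F \<and> C \<inter> Y \<in> G"
proof
  assume "C \<in> fprod F G"
  then obtain A D where AD: "C = A \<union> D" "A \<in> F" "D \<in> G" by (auto simp: fprod_def)
  then have "A \<subseteq> X" "D \<subseteq> Y" using assms by auto
  then have "C \<inter> X = A" "C \<inter> Y = D" "C \<subseteq> X \<union> Y" using AD(1) assms(3) by blast+
  then show "C \<subseteq> X \<union> Y \<and> C \<inter> X \<in> F \<and> C \<inter> Y \<in> G" using AD by simp
next
  assume *: "C \<subseteq> X \<union> Y \<and> C \<inter> X \<in> F \<and> C \<inter> Y \<in> G"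
  then have "C = (C \<inter> X) \<union> (C \<inter> Y)" by blast
  then show "C \<in> fprod F G" using * unfolding fprod_def by blast
qed

lemma conn_cross:
  assumes C: "conn C" "C \<subseteq> P \<union> U" and PU: "P \<inter> U = {}"
    and e: "\<forall>x\<in>U. \<forall>y\<in>P. adj x y \<longrightarrow> x = u \<and> y = p"
    and ne: "C \<inter> P \<noteq> {}" "C \<inter> U \<noteq> {}"
  shows "p \<in> C" "u \<in> C" "conn (C \<inter> P)" "conn (C \<inter> U)"
proof -
  have UP: "C \<subseteq> U \<union> P" "U \<inter> P = {}" using C PU by auto
  show "p \<in> C" "conn (C \<inter> P)"
    using conn_separate(1,2)[OF C(1) UP, of p] e ne by blast+
  show "u \<in> C" "conn (C \<inter> U)"
    using conn_separate(1,2)[OF C(1,2) PU, of u] e ne adj_sym by blast+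
qed

text \<open>The edge from u to p is the only link between the sides. A connected set through p that
  reaches the other side uses this edge and is connected on both sides; two connected sets at its
  ends are linked by it.\<close>

lemma conn_top_iff:
  assumes C: "C \<subseteq> P \<union> U" and PU: "P \<inter> U = {}" and pu: "p \<in> P" "u \<in> U" "adj u p"
    and e: "\<forall>x\<in>U. \<forall>y\<in>P. adj x y \<longrightarrow> x = u \<and> y = p"
  shows "conn C \<and> p \<in> C \<longleftrightarrow> conn (C \<inter> P) \<and> p \<in> C \<and> (C \<inter> U = {} \<or> conn (C \<inter> U) \<and> u \<in> C)"
proof
  assume L: "conn C \<and> p \<in> C"
  show "conn (C \<inter> P) \<and> p \<in> C \<and> (C \<inter> U = {} \<or> conn (C \<inter> U) \<and> u \<in> C)"
  proof (cases "C \<inter> U = {}")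
    case True
    then have "C \<inter> P = C" using C by blast
    then show ?thesis using L True by simp
  next
    case False
    have "C \<inter> P \<noteq> {}" using L pu by blast
    from conn_cross[OF _ C PU e this False] L show ?thesis by blast
  qed
next
  assume R: "conn (C \<inter> P) \<and> p \<in> C \<and> (C \<inter> U = {} \<or> conn (C \<inter> U) \<and> u \<in> C)"
  show "conn C \<and> p \<in> C"
  proof (cases "C \<inter> U = {}")
    case True
    then have "C \<inter> P = C" using C by blast
    then show ?thesis using R by simp
  next
    case False
    have "conn ((C \<inter> U) \<union> (C \<inter> P))"
      by (rule conn_union_edge[of _ _ u p]) (use R False pu in auto)
    moreover have "(C \<inter> U) \<union> (C \<inter> P) = C" using C by blast
    ultimately show ?thesis using R by simp
  qed
qed

text \<open>Since at most one closed part is nonempty, there is one gate. A set at p is a piece at p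
  with an optional piece at u. If the gate belongs to p, the piece at u stays optional; if it
  belongs to u, a set at p reaches the gate only through u, so both pieces are present. A set at the
  gate either stays on the gate's side or crosses from u to p and thus contains p. For the same
  reason each connected set that is new in the merged open part contains p.\<close>

lemma merge_families:
  assumes g: "ginv L W K b" and m: "mergeable L W K u p" and ex: "K u = {} \<or> K p = {}"
  defines "W' \<equiv> merge_sets p u W" and "K' \<equiv> merge_sets p u K" and "b' \<equiv> merge_gate p u K b"
  shows "FA W' p = fprod (FA W p) (insert {} (FA W u))"
    "FB W' K' b' p = fprod (FB W K b p) (insert {} (FA W u)) \<union> fprod (FA W p) (FB W K b u)"
    "FG W' K' b' p = FG W K b p \<union> FG W K b u \<union> FB W' K' b' p"
    "FH K' b' p = (if K u = {} then FH K b p else FH K b u)"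
    "FS (L - {u}) W' K' = FS L W K \<union> FA W' p"
proof -
  have L: "u \<in> L" "p \<in> L" "u \<noteq> p" "nbrs L u = {p}" using m by (auto simp: mergeable_def)
  have au: "adj u p" using L(4) by (auto simp: nbrs_def)
  let ?P = "W p \<union> K p" and ?U = "W u \<union> K u"
  note Du = ginvD[OF g L(1)] and Dp = ginvD[OF g L(2)]
  have PU: "?P \<inter> ?U = {}" using ginvD2(1)[OF g L(1,2,3)] by blast
  have e: "\<forall>x\<in>?U. \<forall>y\<in>?P. adj x y \<longrightarrow> x = u \<and> y = p" using ginvD2(2)[OF g L(1,2,3)] by blast
  note top = conn_top_iff[OF _ PU Dp(3) Du(3) au e]
  note cross = conn_cross[OF _ _ PU e]
  have W': "W' p = W p \<union> W u" "K' p = K p \<union> K u" "b' p = (if K p \<noteq> {} then b p else b u)"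
    by (simp_all add: W'_def K'_def b'_def merge_sets_def merge_gate_def)
  have OO: "W p \<inter> W u = {}" using PU by blast
  have sub: "FA W p \<subseteq> Pow (W p)" "FB W K b p \<subseteq> Pow (W p)" "insert {} (FA W u) \<subseteq> Pow (W u)" "FB W K b u \<subseteq> Pow (W u)"
    by (auto simp: FA_def FB_def)
  have cap: "C \<inter> ?P = C \<inter> W p" "C \<inter> ?U = C \<inter> W u" if "C \<subseteq> W p \<union> W u" for C
    using that PU Dp(2) Du(2) by blast+
  show A: "FA W' p = fprod (FA W p) (insert {} (FA W u))"
  proof (rule equalityI; rule subsetI)
    fix C assume "C \<in> FA W' p"
    then have C: "C \<subseteq> W p \<union> W u" "conn C" "p \<in> C" by (auto simp: FA_def W')
    then have CS: "C \<subseteq> ?P \<union> ?U" by blast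
    have t: "conn (C \<inter> W p)" "C \<inter> W u = {} \<or> conn (C \<inter> W u) \<and> u \<in> C"
      using top[OF CS] C(2,3) unfolding cap[OF C(1)] by blast+
    have "p \<in> C \<inter> W p" using C PU Dp(3) by blast
    moreover have "u \<in> W u" if "u \<in> C" using that C(1) PU Du(3) by blast
    ultimately show "C \<in> fprod (FA W p) (insert {} (FA W u))"
      unfolding fprod_iff[OF sub(1,3) OO] using t C(1) unfolding FA_def by blast
  next
    fix C assume C: "C \<in> fprod (FA W p) (insert {} (FA W u))"
    then have "C \<subseteq> W p \<union> W u" "C \<inter> W p \<in> FA W p" "C \<inter> W u \<in> insert {} (FA W u)"
      unfolding fprod_iff[OF sub(1,3) OO] by blast+
    then have C: "C \<subseteq> W p \<union> W u" "conn (C \<inter> W p)" "p \<in> C" "C \<inter> W u = {} \<or> conn (C \<inter> W u) \<and> u \<in> C"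
      by (auto simp: FA_def)
    then have CS: "C \<subseteq> ?P \<union> ?U" by blast
    have "conn C \<and> p \<in> C" using top[OF CS] C(2-4) unfolding cap[OF C(1)] by blast
    then show "C \<in> FA W' p" using C(1) by (simp add: FA_def W')
  qed
  have Bp: "C \<in> FB W K b p \<longleftrightarrow> K p \<noteq> {} \<and> C \<subseteq> W p \<and> conn (insert (b p) C) \<and> p \<in> insert (b p) C" for C by (simp add: FB_def)
  have Bu: "C \<in> FB W K b u \<longleftrightarrow> K u \<noteq> {} \<and> C \<subseteq> W u \<and> conn (insert (b u) C) \<and> u \<in> insert (b u) C" for C by (simp add: FB_def)
  have B': "C \<in> FB W' K' b' p \<longleftrightarrow> (K p \<noteq> {} \<or> K u \<noteq> {}) \<and> C \<subseteq> W p \<union> W u \<and> conn (insert (b' p) C) \<and> p \<in> insert (b' p) C" for C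
    by (auto simp: FB_def W'(1,2))
  have G': "C \<in> FG W' K' b' p \<longleftrightarrow> (K p \<noteq> {} \<or> K u \<noteq> {}) \<and> C \<subseteq> W p \<union> W u \<and> conn (insert (b' p) C)" for C
    by (auto simp: FG_def W'(1,2))
  have caseP: "insert (b p) C \<inter> ?P = insert (b p) (C \<inter> W p)" "insert (b p) C \<inter> ?U = C \<inter> W u" "insert (b p) C \<subseteq> ?P \<union> ?U"
    if "K p \<noteq> {}" "C \<subseteq> W p \<union> W u" for C
    using cap[OF that(2)] Dp(4)[OF that(1)] PU that(2) by blast+
  have caseU: "insert (b u) C \<inter> ?P = C \<inter> W p" "insert (b u) C \<inter> ?U = insert (b u) (C \<inter> W u)" "insert (b u) C \<subseteq> ?P \<union> ?U"
    if "K u \<noteq> {}" "C \<subseteq> W p \<union> W u" for C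
    using cap[OF that(2)] Du(4)[OF that(1)] PU that(2) by blast+
  have FBe: "FB W K b v = {}" "FG W K b v = {}" if "K v = {}" for v using that by (auto simp: FB_def FG_def)
  have fe: "fprod {} G = {}" "fprod F {} = {}" for F G by (auto simp: fprod_def)
  show Beq: "FB W' K' b' p = fprod (FB W K b p) (insert {} (FA W u)) \<union> fprod (FA W p) (FB W K b u)"
  proof (cases "K p = {}")
    case False
    then have Ku: "K u = {}" using ex by blast
    have b: "b' p = b p" using False W'(3) by simp
    have "C \<in> FB W' K' b' p \<longleftrightarrow> C \<in> fprod (FB W K b p) (insert {} (FA W u))" for C
    proof (cases "C \<subseteq> W p \<union> W u")
      case True
      note c = caseP[OF False True]
      have pO: "p \<in> insert (b p) C \<longleftrightarrow> p \<in> insert (b p) (C \<inter> W p)"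
        using True PU Dp(3) by blast
      have uO: "u \<in> insert (b p) C \<longleftrightarrow> u \<in> C \<inter> W u"
        using True PU Du(3) Dp(4)[OF False] by blast
      have t: "conn (insert (b p) C) \<and> p \<in> insert (b p) C \<longleftrightarrow> conn (insert (b p) (C \<inter> W p)) \<and> p \<in> insert (b p) C \<and>
          (C \<inter> W u = {} \<or> conn (C \<inter> W u) \<and> u \<in> insert (b p) C)"
        using top[OF c(3)] unfolding c(1,2) .
      have f: "C \<in> fprod (FB W K b p) (insert {} (FA W u)) \<longleftrightarrow> conn (insert (b p) (C \<inter> W p)) \<and>
          p \<in> insert (b p) (C \<inter> W p) \<and> (C \<inter> W u = {} \<or> conn (C \<inter> W u) \<and> u \<in> C \<inter> W u)"
        unfolding fprod_iff[OF sub(2,3) OO] Bp unfolding FA_def using False True by simp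
      have X: "C \<in> FB W' K' b' p \<longleftrightarrow> conn (insert (b p) C) \<and> p \<in> insert (b p) C"
        unfolding B' b using False True by simp
      show ?thesis unfolding X f pO[symmetric] uO[symmetric] by (rule t)
    next
      case n: False
      show ?thesis unfolding B' fprod_iff[OF sub(2,3) OO] using n by simp
    qed
    then show ?thesis unfolding FBe(1)[OF Ku] fe by blast
  next
    case Kp: True
    show ?thesis
    proof (cases "K u = {}")
      case True
      then have "FB W' K' b' p = {}" using B' Kp by blast
      then show ?thesis unfolding FBe(1)[OF True] FBe(1)[OF Kp] fe by blast
    next
      case False
      have b: "b' p = b u" using Kp W'(3) by simp
      have "C \<in> FB W' K' b' p \<longleftrightarrow> C \<in> fprod (FA W p) (FB W K b u)" for C
      proof (cases "C \<subseteq> W p \<union> W u")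
        case True
        note c = caseU[OF False True]
        have pO: "p \<in> insert (b u) C \<longleftrightarrow> p \<in> C \<inter> W p"
          using True PU Dp(3) Du(4)[OF False] by blast
        have uO: "u \<in> insert (b u) C \<longleftrightarrow> u \<in> insert (b u) (C \<inter> W u)"
          using True PU Du(3) by blast
        have ne: "insert (b u) (C \<inter> W u) \<noteq> {}" by simp
        have t: "conn (insert (b u) C) \<and> p \<in> insert (b u) C \<longleftrightarrow> conn (C \<inter> W p) \<and> p \<in> insert (b u) C \<and>
            (conn (insert (b u) (C \<inter> W u)) \<and> u \<in> insert (b u) C)"
          using top[OF c(3)] ne unfolding c(1,2) by simp
        have f: "C \<in> fprod (FA W p) (FB W K b u) \<longleftrightarrow> conn (C \<inter> W p) \<and> p \<in> C \<inter> W p \<and>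
            (conn (insert (b u) (C \<inter> W u)) \<and> u \<in> insert (b u) (C \<inter> W u))"
          unfolding fprod_iff[OF sub(1,4) OO] Bu unfolding FA_def using False True by simp
        have X: "C \<in> FB W' K' b' p \<longleftrightarrow> conn (insert (b u) C) \<and> p \<in> insert (b u) C"
          unfolding B' b using False True by simp
        show ?thesis unfolding X f pO[symmetric] uO[symmetric] by (rule t)
      next
      case n: False
      show ?thesis unfolding B' fprod_iff[OF sub(1,4) OO] using n by simp
    qed
      then show ?thesis unfolding FBe(1)[OF Kp] fe by blast
    qed
  qed
  show "FG W' K' b' p = FG W K b p \<union> FG W K b u \<union> FB W' K' b' p"
  proof (cases "K p = {}")
    case False
    then have Ku: "K u = {}" using ex by blast
    have b: "b' p = b p" using False W'(3) by simp
    have "C \<in> FG W' K' b' p \<longleftrightarrow> C \<in> FG W K b p \<union> FB W' K' b' p" for C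
    proof (cases "C \<subseteq> W p \<union> W u")
      case True
      note c = caseP[OF False True]
      have "p \<in> insert (b p) C" if "conn (insert (b p) C)" "\<not> C \<subseteq> W p"
        by (rule cross(1)[OF that(1) c(3)], unfold c(1,2)) (use that(2) True in blast)+
      moreover have "C \<in> FG W K b p \<longleftrightarrow> C \<subseteq> W p \<and> conn (insert (b p) C)" using False by (simp add: FG_def)
      moreover have "C \<in> FG W' K' b' p \<longleftrightarrow> conn (insert (b p) C)" "C \<in> FB W' K' b' p \<longleftrightarrow> conn (insert (b p) C) \<and> p \<in> insert (b p) C"
        unfolding G' B' b using False True by simp_all
      ultimately show ?thesis unfolding Un_iff by (simp only:) blast
    next
      case F: False
      then have "C \<notin> FG W' K' b' p" "C \<notin> FB W' K' b' p" unfolding G' B' by simp_all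
      moreover have "C \<notin> FG W K b p" using F unfolding FG_def by blast
      ultimately show ?thesis by simp
    qed
    then show ?thesis unfolding FBe(2)[OF Ku] by blast
  next
    case Kp: True
    show ?thesis
    proof (cases "K u = {}")
      case True
      then show ?thesis using B' G' Kp unfolding FBe(2)[OF True] FBe(2)[OF Kp] by blast
    next
      case False
      have b: "b' p = b u" using Kp W'(3) by simp
      have "C \<in> FG W' K' b' p \<longleftrightarrow> C \<in> FG W K b u \<union> FB W' K' b' p" for C
      proof (cases "C \<subseteq> W p \<union> W u")
        case True
        note c = caseU[OF False True]
        have "p \<in> insert (b u) C" if "conn (insert (b u) C)" "\<not> C \<subseteq> W u"
          by (rule cross(1)[OF that(1) c(3)], unfold c(1,2)) (use that(2) True in blast)+
        moreover have "C \<in> FG W K b u \<longleftrightarrow> C \<subseteq> W u \<and> conn (insert (b u) C)" using False by (simp add: FG_def)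
        moreover have "C \<in> FG W' K' b' p \<longleftrightarrow> conn (insert (b u) C)" "C \<in> FB W' K' b' p \<longleftrightarrow> conn (insert (b u) C) \<and> p \<in> insert (b u) C"
          unfolding G' B' b using False True by simp_all
        ultimately show ?thesis unfolding Un_iff by (simp only:) blast
      next
        case F: False
        then have "C \<notin> FG W' K' b' p" "C \<notin> FB W' K' b' p" unfolding G' B' by simp_all
        moreover have "C \<notin> FG W K b u" using F unfolding FG_def by blast
        ultimately show ?thesis by simp
      qed
      then show ?thesis unfolding FBe(2)[OF Kp] by blast
    qed
  qed
  show "FH K' b' p = (if K u = {} then FH K b p else FH K b u)"
    using ex by (cases "K p = {}") (auto simp: FH_def W')
  show "FS (L - {u}) W' K' = FS L W K \<union> FA W' p"
  proof (rule equalityI; rule subsetI)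
    fix C assume "C \<in> FS (L - {u}) W' K'"
    then obtain w where C: "conn C" "w \<in> L" "w \<noteq> u" "C \<subseteq> W' w \<or> C \<subseteq> K' w" by (auto simp: FS_def)
    show "C \<in> FS L W K \<union> FA W' p"
    proof (cases "w = p")
      case False
      then have "C \<subseteq> W w \<or> C \<subseteq> K w" using C(4) by (simp add: W'_def K'_def merge_sets_def)
      then show ?thesis using C unfolding FS_def by blast
    next
      case True
      consider "C \<subseteq> W p" | "C \<subseteq> W u" | "C \<subseteq> K p" | "C \<subseteq> K u" | "C \<subseteq> W p \<union> W u" "\<not> C \<subseteq> W p" "\<not> C \<subseteq> W u"
        using C(4) ex unfolding True W' by blast
      then show ?thesis
      proof cases
        case 5
        have "p \<in> C" by (rule cross(1)[OF C(1)]) (use 5 in blast)+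
        then show ?thesis using C(1) 5(1) by (simp add: FA_def W')
      qed (use C(1) L(1,2) in \<open>auto simp: FS_def\<close>)
    qed
  next
    fix C assume "C \<in> FS L W K \<union> FA W' p"
    then show "C \<in> FS (L - {u}) W' K'"
    proof
      assume "C \<in> FA W' p"
      then show ?thesis using L(2,3) unfolding FA_def FS_def by blast
    next
      assume "C \<in> FS L W K"
      then obtain w where C: "conn C" "w \<in> L" "C \<subseteq> W w \<or> C \<subseteq> K w" by (auto simp: FS_def)
      have sub: "W w \<subseteq> W' w" "K w \<subseteq> K' w" for w by (auto simp: W'_def K'_def merge_sets_def)
      show ?thesis
      proof (cases "w = u")
        case True
        then have "C \<subseteq> W' p \<or> C \<subseteq> K' p" using C(3) unfolding W' by blast
        then show ?thesis using C(1) L(2,3) unfolding FS_def by blast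
      next
        case False
        then show ?thesis using C sub[of w] unfolding FS_def by blast
      qed
    qed
  qed
qed

text \<open>Without open parts both gates are the nodes u and p themselves. So sets at p have an
  optional piece at u, and a connected set that is contained in neither old part uses the edge
  between u and p and hence contains p.\<close>

lemma join_families:
  assumes g: "ginv L W K b" and m: "mergeable L W K u p" and ne: "K u \<noteq> {}" "K p \<noteq> {}" and Oe: "W u = {}" "W p = {}"
  defines "K' \<equiv> merge_sets p u K" and "b' \<equiv> merge_gate p u K b"
  shows "b' p = p" "FH K' b' p = fprod (FH K b p) (insert {} (FH K b u))"
    "FS (L - {u}) (merge_sets p u W) K' = FS L W K \<union> FH K' b' p"
proof -
  have L: "u \<in> L" "p \<in> L" "u \<noteq> p" "nbrs L u = {p}" using m by (auto simp: mergeable_def)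
  have au: "adj u p" using L(4) by (auto simp: nbrs_def)
  note Du = ginvD[OF g L(1)] and Dp = ginvD[OF g L(2)]
  have up: "u \<in> K u" "p \<in> K p" "b u = u" "b p = p" using Du(3,5) Dp(3,5) Oe by auto
  have PU: "K p \<inter> K u = {}" using ginvD2(1)[OF g L(1,2,3)] by blast
  have e: "\<forall>x\<in>K u. \<forall>y\<in>K p. adj x y \<longrightarrow> x = u \<and> y = p" using ginvD2(2)[OF g L(1,2,3)] by blast
  have W': "K' p = K p \<union> K u" "b' p = p"
    using ne up by (simp_all add: K'_def b'_def merge_sets_def merge_gate_def)
  have OM: "merge_sets p u W = W" using Oe by (simp add: merge_sets_def fun_upd_idem)
  show "b' p = p" by (rule W'(2))
  have sub: "FH K b p \<subseteq> Pow (K p)" "insert {} (FH K b u) \<subseteq> Pow (K u)" by (auto simp: FH_def)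
  show "FH K' b' p = fprod (FH K b p) (insert {} (FH K b u))"
  proof -
    have "C \<in> FH K' b' p \<longleftrightarrow> C \<in> fprod (FH K b p) (insert {} (FH K b u))" for C
    proof (cases "C \<subseteq> K p \<union> K u")
      case True
      have pu: "p \<in> C \<inter> K p \<longleftrightarrow> p \<in> C" "u \<in> C \<inter> K u \<longleftrightarrow> u \<in> C" using up by blast+
      have "C \<in> fprod (FH K b p) (insert {} (FH K b u)) \<longleftrightarrow> conn (C \<inter> K p) \<and> p \<in> C \<inter> K p \<and>
          (C \<inter> K u = {} \<or> conn (C \<inter> K u) \<and> u \<in> C \<inter> K u)"
        unfolding fprod_iff[OF sub PU] unfolding FH_def up using True by simp
      moreover have "C \<in> FH K' b' p \<longleftrightarrow> conn C \<and> p \<in> C" unfolding FH_def W' using True by simp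
      ultimately show ?thesis using conn_top_iff[OF True PU up(2,1) au e] unfolding pu by argo
    next
      case False
      then show ?thesis unfolding fprod_iff[OF sub PU] unfolding FH_def W' by blast
    qed
    then show ?thesis by blast
  qed
  show "FS (L - {u}) (merge_sets p u W) K' = FS L W K \<union> FH K' b' p"
    unfolding OM
  proof (rule equalityI; rule subsetI)
    fix C assume "C \<in> FS (L - {u}) W K'"
    then obtain w where C: "conn C" "w \<in> L" "w \<noteq> u" "C \<subseteq> W w \<or> C \<subseteq> K' w" by (auto simp: FS_def)
    show "C \<in> FS L W K \<union> FH K' b' p"
    proof (cases "w = p")
      case False
      then have "C \<subseteq> W w \<or> C \<subseteq> K w" using C(4) by (simp add: K'_def merge_sets_def)
      then show ?thesis using C unfolding FS_def by blast
    next
      case True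
      consider "C \<subseteq> K p" | "C \<subseteq> K u" | "C \<subseteq> K p \<union> K u" "\<not> C \<subseteq> K p" "\<not> C \<subseteq> K u"
        using C(4) unfolding True W' Oe by blast
      then show ?thesis
      proof cases
        case 3
        have "p \<in> C" by (rule conn_cross(1)[OF C(1) 3(1) PU e]) (use 3 in blast)+
        then show ?thesis using C(1) 3(1) by (simp add: FH_def W')
      qed (use C(1) L(1,2) in \<open>auto simp: FS_def\<close>)
    qed
  next
    fix C assume "C \<in> FS L W K \<union> FH K' b' p"
    then show "C \<in> FS (L - {u}) W K'"
    proof
      assume "C \<in> FH K' b' p"
      then show ?thesis using L(2,3) unfolding FH_def FS_def by blast
    next
      assume "C \<in> FS L W K"
      then obtain w where C: "conn C" "w \<in> L" "C \<subseteq> W w \<or> C \<subseteq> K w" by (auto simp: FS_def)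
      have sub: "K w \<subseteq> K' w" for w by (auto simp: K'_def merge_sets_def)
      show ?thesis
      proof (cases "w = u")
        case True
        then have "C \<subseteq> K' p" using C(3) conn_nonempty[OF C(1)] unfolding W' Oe(1) True by blast
        then show ?thesis using C(1) L(2,3) unfolding FS_def by blast
      next
        case False
        then show ?thesis using C sub[of w] unfolding FS_def by blast
      qed
    qed
  qed
qed

end

section \<open>The program for trees: representation and operations on parts\<close>

section \<open>The tree program\<close>

text \<open>The quadratic convolution, merged by minimum into D. Among open parts of at most r nodes
  it is affordable: over the whole contraction it costs O(n r).\<close>

definition nconv :: "nat \<Rightarrow> nat \<Rightarrow> aexp \<Rightarrow> aexp \<Rightarrow> nat \<Rightarrow> aexp \<Rightarrow> aexp \<Rightarrow> com" where
  "nconv D X ox lx Y oy ly = For 21 lx (tabulate 22 ly D (V 21)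
     (let e = Rd D (Plus (V 21) (V 22)) in
        Minus e (Minus e (Plus (Rd X (Plus ox (V 21))) (Rd Y (Plus oy (V 22)))))))"

definition min_into :: "nat \<Rightarrow> aexp \<Rightarrow> aexp \<Rightarrow> nat \<Rightarrow> aexp \<Rightarrow> com" where
  "min_into D od l X ox = tabulate 25 l D od (let e = Rd D (Plus od (V 25)) in Minus e (Minus e (Rd X (Plus ox (V 25)))))"

definition copy :: "nat \<Rightarrow> aexp \<Rightarrow> aexp \<Rightarrow> nat \<Rightarrow> aexp \<Rightarrow> com" where
  "copy D od l X ox = tabulate 25 l D od (Rd X (Plus ox (V 25)))"

definition row :: "nat \<Rightarrow> aexp" where
  "row x = Times (V x) (V 7)"
text \<open>Rows of closed parts are addressed through the handle in array 36, unlike rows of open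
  parts. A node without a closed part can thus take over the closed part of a leaf in constant time
  instead of copying it.\<close>

definition hrow :: "nat \<Rightarrow> aexp" where
  "hrow x = Times (Rd 36 (V x)) (V 8)"
definition size_open :: "nat \<Rightarrow> aexp" where
  "size_open x = Rd 34 (V x)"
definition size_closed :: "nat \<Rightarrow> aexp" where
  "size_closed x = Rd 35 (V x)"

text \<open>Variable 10 holds the node v. The product of \<open>FG\<close> with \<open>FH\<close>
  contributes the connected sets that use both parts to the answers in array 39. The product of
  \<open>FB\<close> with \<open>FH\<close>, together with \<open>FA\<close>, is the new
  \<open>FH\<close>. Both need the old closed row, which is replaced only afterwards. The last
  stores install the rows of a node without open part (\<open>closed_families\<close>): I for the
  empty family, 0 for the family of the empty set.\<close>

definition close :: com where
  "close =
    Seq (conv 32 (row 10) (Plus (size_open 10) (N 1)) 33 (hrow 10) (Plus (size_closed 10) (N 1)))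
    (Seq (min_into 39 (N 0) (Plus (Plus (size_open 10) (size_closed 10)) (N 1)) 42 (N 0))
    (Seq (conv 31 (row 10) (Plus (size_open 10) (N 1)) 33 (hrow 10) (Plus (size_closed 10) (N 1)))
    (Seq (min_into 42 (N 0) (Plus (size_open 10) (N 1)) 30 (row 10))
    (Seq (copy 33 (hrow 10) (Plus (Plus (size_open 10) (size_closed 10)) (N 1)) 42 (N 0))
    (Seq (St 35 (V 10) (Plus (size_open 10) (size_closed 10)))
    (Seq (St 34 (V 10) (N 0))
    (Seq (St 30 (row 10) (V 6))
    (Seq (St 31 (row 10) (N 0))
      (St 32 (row 10) (N 0))))))))))"

text \<open>Variables 11 and 12 hold the leaf u and its neighbour p. The first store gives size 0
  the weight 0 in the row of u, that is, it adds the empty set to \<open>FH\<close> of u.\<close>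

definition join :: com where
  "join =
    Seq (St 33 (hrow 11) (N 0))
    (Seq (conv 33 (hrow 12) (Plus (size_closed 12) (N 1)) 33 (hrow 11) (Plus (size_closed 11) (N 1)))
    (Seq (copy 33 (hrow 12) (Plus (Plus (size_closed 12) (size_closed 11)) (N 1)) 42 (N 0))
    (Seq (min_into 39 (N 0) (Plus (Plus (size_closed 12) (size_closed 11)) (N 1)) 42 (N 0))
      (St 35 (V 12) (Plus (size_closed 12) (size_closed 11))))))"

text \<open>Arrays 43, 44 and 42 collect the new \<open>FA\<close>, \<open>FB\<close> and
  \<open>FG\<close> of p; the old rows are replaced when all products have been formed. The first
  store adds the empty set to \<open>FA\<close> of u. Both positions of the gate are covered by the
  same code, as rows of empty families are constantly I. In the end p takes over the closed row of u
  if it has none of its own.\<close>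

definition merge_open :: com where
  "merge_open = (let l = Plus (Plus (size_open 12) (size_open 11)) (N 1);
        lp = Plus (size_open 12) (N 1); lu = Plus (size_open 11) (N 1) in
    Seq (St 30 (row 11) (N 0))
    (Seq (tabulate 25 l 43 (N 0) (V 6))
    (Seq (tabulate 25 l 44 (N 0) (V 6))
    (Seq (nconv 43 30 (row 12) lp 30 (row 11) lu)
    (Seq (nconv 44 31 (row 12) lp 30 (row 11) lu)
    (Seq (nconv 44 30 (row 12) lp 31 (row 11) lu)
    (Seq (copy 42 (N 0) l 44 (N 0))
    (Seq (min_into 42 (N 0) lp 32 (row 12))
    (Seq (min_into 42 (N 0) lu 32 (row 11))
    (Seq (copy 30 (row 12) l 43 (N 0))
    (Seq (copy 31 (row 12) l 44 (N 0))
    (Seq (copy 32 (row 12) l 42 (N 0))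
    (Seq (min_into 39 (N 0) l 43 (N 0))
    (Seq (St 34 (V 12) (Plus (size_open 12) (size_open 11)))
      (Ite (size_closed 12) (N 1)
        (Seq (St 36 (V 12) (Rd 36 (V 11))) (St 35 (V 12) (size_closed 11)))
        (Asg 28 (N 0)))))))))))))))))"

lemma row_index_eq: "i < k \<Longrightarrow> j < k \<Longrightarrow> v * k + i = w * k + j \<longleftrightarrow> v = w \<and> i = (j::nat)"
proof
  assume ij: "i < k" "j < k" and e: "v * k + i = w * k + j"
  have "v = (v * k + i) div k" "w = (w * k + j) div k" using div_block[OF ij(1)] div_block[OF ij(2)] by simp_all
  then show "v = w \<and> i = j" using e by simp
qed auto

context bounded_machine
begin

lemma wp_copy:
  assumes "val l g a = n" "ok l g a" "n \<le> B" "val od g a = p" "ok od g a" "val ox g a = q" "ok ox g a"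
    "25 \<notin> avars l" "25 \<notin> avars od" "25 \<notin> avars ox" "D \<notin> aarrs l" "D \<notin> aarrs od" "D \<notin> aarrs ox" "D \<noteq> X"
    "\<And>i. i < n \<Longrightarrow> a X (q + i) \<le> B"
    and Q: "\<And>g' a'. (\<And>y. y \<noteq> 25 \<Longrightarrow> g' y = g y) \<Longrightarrow> (\<And>C. C \<noteq> D \<Longrightarrow> a' C = a C) \<Longrightarrow>
       (\<And>j. j < p \<or> p + n \<le> j \<Longrightarrow> a' D j = a D j) \<Longrightarrow> (\<And>i. i < n \<Longrightarrow> a' D (p + i) = a X (q + i)) \<Longrightarrow>
       Q (g', a', t + 2 * n + 2)"
  shows "wp (copy D od l X ox) Q (g, a, t)"
  unfolding copy_def
proof (rule wp_tabulate[where n = n and p = p and F = "\<lambda>i. a X (q + i)"])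
  fix i g' a'
  assume *: "i < n" "g' 25 = i" "\<And>y. y \<noteq> 25 \<Longrightarrow> g' y = g y" "\<And>C. C \<noteq> D \<Longrightarrow> a' C = a C"
  have v: "\<And>y. y \<in> avars ox \<Longrightarrow> g' y = g y" "\<And>C. C \<in> aarrs ox \<Longrightarrow> a' C = a C"
    using assms(10,13) *(3,4) by metis+
  have "val ox g' a' = q" using val_cong[OF v] assms(6) by simp
  moreover have "ok ox g' a'" using ok_cong[OF v] assms(7) by simp
  moreover have "a' X = a X" using *(4) assms(14) by metis
  ultimately show "ok (Rd X (Plus ox (V 25))) g' a' \<and> val (Rd X (Plus ox (V 25))) g' a' = a X (q + i) \<and> a X (q + i) \<le> B"
    using assms(15)[OF *(1)] *(2) by simp
qed (use assms in auto)

lemma wp_min_into: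
  assumes "val l g a = n" "ok l g a" "n \<le> B" "val od g a = p" "ok od g a" "val ox g a = q" "ok ox g a"
    "25 \<notin> avars l" "25 \<notin> avars od" "25 \<notin> avars ox" "D \<notin> aarrs l" "D \<notin> aarrs od" "D \<notin> aarrs ox" "D \<noteq> X"
    "\<And>i. i < n \<Longrightarrow> a X (q + i) \<le> B" "\<And>i. i < n \<Longrightarrow> a D (p + i) \<le> B"
    and Q: "\<And>g' a'. (\<And>y. y \<noteq> 25 \<Longrightarrow> g' y = g y) \<Longrightarrow> (\<And>C. C \<noteq> D \<Longrightarrow> a' C = a C) \<Longrightarrow>
       (\<And>j. j < p \<or> p + n \<le> j \<Longrightarrow> a' D j = a D j) \<Longrightarrow> (\<And>i. i < n \<Longrightarrow> a' D (p + i) = min (a D (p + i)) (a X (q + i))) \<Longrightarrow>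
       Q (g', a', t + 2 * n + 2)"
  shows "wp (min_into D od l X ox) Q (g, a, t)"
  unfolding min_into_def Let_def
proof (rule wp_tabulate[where n = n and p = p and F = "\<lambda>i. min (a D (p + i)) (a X (q + i))"])
  fix i g' a'
  assume *: "i < n" "g' 25 = i" "\<And>y. y \<noteq> 25 \<Longrightarrow> g' y = g y" "\<And>C. C \<noteq> D \<Longrightarrow> a' C = a C"
     "\<And>j. j < p \<or> p + i \<le> j \<Longrightarrow> a' D j = a D j"
  have v: "\<And>y. y \<in> avars ox \<Longrightarrow> g' y = g y" "\<And>C. C \<in> aarrs ox \<Longrightarrow> a' C = a C"
    "\<And>y. y \<in> avars od \<Longrightarrow> g' y = g y" "\<And>C. C \<in> aarrs od \<Longrightarrow> a' C = a C"
    using assms(9,10,12,13) *(3,4) by metis+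
  have "val ox g' a' = q" "val od g' a' = p" using val_cong[OF v(1,2)] val_cong[OF v(3,4)] assms(4,6) by simp_all
  moreover have "ok ox g' a'" "ok od g' a'" using ok_cong[OF v(1,2)] ok_cong[OF v(3,4)] assms(5,7) by simp_all
  moreover have "a' X = a X" using *(4) assms(14) by metis
  moreover have "a' D (p + i) = a D (p + i)" by (rule *(5)) simp
  ultimately show "ok (Minus (Rd D (Plus od (V 25))) (Minus (Rd D (Plus od (V 25))) (Rd X (Plus ox (V 25))))) g' a' \<and>
     val (Minus (Rd D (Plus od (V 25))) (Minus (Rd D (Plus od (V 25))) (Rd X (Plus ox (V 25))))) g' a' =
       min (a D (p + i)) (a X (q + i)) \<and> min (a D (p + i)) (a X (q + i)) \<le> B"
    using assms(15,16)[OF *(1)] *(2) by (simp add: nat_diff_diff_min min.coboundedI1 del: diff_diff_cancel)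
qed (use assms in auto)

lemma wp_nconv:
  assumes lx: "val lx g a = p" "ok lx g a" "p \<le> B" and ly: "val ly g a = q" "ok ly g a" "q \<le> B"
    and o: "val ox g a = o1" "ok ox g a" "val oy g a = o2" "ok oy g a"
    and fr: "(avars lx \<union> avars ly \<union> avars ox \<union> avars oy) \<inter> {21, 22} = {}"
      "D \<notin> aarrs lx" "D \<notin> aarrs ly" "D \<notin> aarrs ox" "D \<notin> aarrs oy" "D \<noteq> X" "D \<noteq> Y"
    and f: "\<And>i. f i \<le> I" "\<And>i. p \<le> i \<Longrightarrow> f i = I" "\<And>i. i < p \<Longrightarrow> a X (o1 + i) = f i"
    and h: "\<And>i. h i \<le> I" "\<And>i. q \<le> i \<Longrightarrow> h i = I" "\<And>i. i < q \<Longrightarrow> a Y (o2 + i) = h i"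
    and d: "\<And>s. s < p + q - 1 \<Longrightarrow> a D s \<le> I" and I: "2 * I \<le> B"
    and Q: "\<And>g' a' t'. (\<And>y. y \<notin> {21, 22} \<Longrightarrow> g' y = g y) \<Longrightarrow> (\<And>C. C \<noteq> D \<Longrightarrow> a' C = a C) \<Longrightarrow>
       (\<And>s. s < p + q - 1 \<Longrightarrow> a' D s = min (a D s) (cv I f h s)) \<Longrightarrow> t' \<le> t + 2 + p * (2 * q + 3) \<Longrightarrow> Q (g', a', t')"
  shows "wp (nconv D X ox lx Y oy ly) Q (g, a, t)"
  unfolding nconv_def
proof (rule wp_For[where n = p and I = "\<lambda>i g' a' t'. (\<forall>s z. z \<le> a' D s \<longleftrightarrow> z \<le> a D s \<and>
      (\<forall>i' j. i' < i \<longrightarrow> j < q \<longrightarrow> i' + j = s \<longrightarrow> z \<le> f i' + h j)) \<and> t' = t + 1 + i * (2 * q + 3)"])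
  let ?c = "tabulate 22 ly D (V 21)
     (let e = Rd D (Plus (V 21) (V 22)) in Minus e (Minus e (Plus (Rd X (Plus ox (V 21))) (Rd Y (Plus oy (V 22))))))"
  have mw: "mods ?c = {22}" "warrs ?c = {D}" by (auto simp: tabulate_def Let_def)
  fix i g1 a1 t1
  assume inv: "(\<forall>s z. z \<le> a1 D s \<longleftrightarrow> z \<le> a D s \<and>
      (\<forall>i' j. i' < i \<longrightarrow> j < q \<longrightarrow> i' + j = s \<longrightarrow> z \<le> f i' + h j)) \<and> t1 = t + 1 + i * (2 * q + 3)"
    and i: "i < p" "g1 21 = i" and g1: "\<And>y. y \<noteq> 21 \<Longrightarrow> y \<notin> mods ?c \<Longrightarrow> g1 y = g y" and a1: "\<And>C. C \<notin> warrs ?c \<Longrightarrow> a1 C = a C"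
  have g1': "\<And>y. y \<noteq> 21 \<Longrightarrow> y \<noteq> 22 \<Longrightarrow> g1 y = g y" and a1': "\<And>C. C \<noteq> D \<Longrightarrow> a1 C = a C"
    using g1 a1 unfolding mw by auto
  have eo: "val e g' a' = val e g a \<and> ok e g' a' = ok e g a"
    if "avars e \<inter> {21, 22} = {}" "D \<notin> aarrs e" "\<And>y. y \<noteq> 21 \<Longrightarrow> y \<noteq> 22 \<Longrightarrow> g' y = g y" "\<And>C. C \<noteq> D \<Longrightarrow> a' C = a C" for e g' a'
  proof -
    have n: "21 \<notin> avars e" "22 \<notin> avars e" using that(1) by blast+
    have v: "\<And>y. y \<in> avars e \<Longrightarrow> g' y = g y" "\<And>C. C \<in> aarrs e \<Longrightarrow> a' C = a C"
      by (rule that(3); use n in metis) (rule that(4); use that(2) in metis)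
    show ?thesis using val_cong[OF v] ok_cong[OF v] by simp
  qed
  have fr': "avars ly \<inter> {21, 22} = {}" "avars ox \<inter> {21, 22} = {}" "avars oy \<inter> {21, 22} = {}" using fr(1) by blast+
  have dI: "a1 D (i + j) \<le> B" if "j < q" for j
  proof -
    have "a1 D (i + j) \<le> a D (i + j)" using inv by blast
    moreover have "a D (i + j) \<le> I" by (rule d) (use that i in linarith)
    ultimately show ?thesis using I by linarith
  qed
  show "wp ?c (\<lambda>(g', a', t'). (\<lambda>i g' a' t'. (\<forall>s z. z \<le> a' D s \<longleftrightarrow> z \<le> a D s \<and>
      (\<forall>i' j. i' < i \<longrightarrow> j < q \<longrightarrow> i' + j = s \<longrightarrow> z \<le> f i' + h j)) \<and> t' = t + 1 + i * (2 * q + 3)) (Suc i) (g'(21 := Suc i)) a' (Suc t')) (g1, a1, t1)"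
  proof (rule wp_tabulate[where n = q and p = i and F = "\<lambda>j. min (a1 D (i + j)) (f i + h j)"])
    show "val ly g1 a1 = q" "ok ly g1 a1" using eo[OF fr'(1) fr(3) g1' a1'] ly by auto
    fix j g2 a2
    assume *: "j < q" "g2 22 = j" "\<And>y. y \<noteq> 22 \<Longrightarrow> g2 y = g1 y" "\<And>C. C \<noteq> D \<Longrightarrow> a2 C = a1 C"
      "\<And>k. k < i \<or> i + j \<le> k \<Longrightarrow> a2 D k = a1 D k"
    have g2: "\<And>y. y \<noteq> 21 \<Longrightarrow> y \<noteq> 22 \<Longrightarrow> g2 y = g y" and a2: "\<And>C. C \<noteq> D \<Longrightarrow> a2 C = a C"
      using *(3,4) g1' a1' by auto
    have "val ox g2 a2 = o1 \<and> ok ox g2 a2 \<and> val oy g2 a2 = o2 \<and> ok oy g2 a2"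
      using eo[OF fr'(2) fr(4) g2 a2] eo[OF fr'(3) fr(5) g2 a2] o by blast
    moreover have "a2 X = a X" "a2 Y = a Y" using a2 fr(6,7) by metis+
    moreover have "g2 21 = i" using *(3)[of 21] i by simp
    moreover have "a2 D (i + j) = a1 D (i + j)" by (rule *(5)) simp
    moreover have "f i \<le> B" "h j \<le> B" "f i + h j \<le> B" using f(1)[of i] h(1)[of j] I by linarith+
    ultimately show "ok (let e = Rd D (Plus (V 21) (V 22)) in Minus e (Minus e (Plus (Rd X (Plus ox (V 21))) (Rd Y (Plus oy (V 22)))))) g2 a2 \<and>
      val (let e = Rd D (Plus (V 21) (V 22)) in Minus e (Minus e (Plus (Rd X (Plus ox (V 21))) (Rd Y (Plus oy (V 22)))))) g2 a2 =
        min (a1 D (i + j)) (f i + h j) \<and> min (a1 D (i + j)) (f i + h j) \<le> B"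
      using *(2) f(3)[OF i(1)] h(3)[OF *(1)] dI[OF *(1)]
      by (simp add: Let_def nat_diff_diff_min min.coboundedI1 del: diff_diff_cancel)
  next
    fix g2 a2
    assume *: "\<And>k. k < i \<or> i + q \<le> k \<Longrightarrow> a2 D k = a1 D k" "\<And>j. j < q \<Longrightarrow> a2 D (i + j) = min (a1 D (i + j)) (f i + h j)"
    have "z \<le> a2 D s \<longleftrightarrow> z \<le> a D s \<and> (\<forall>i' j. i' < Suc i \<longrightarrow> j < q \<longrightarrow> i' + j = s \<longrightarrow> z \<le> f i' + h j)" for s z
    proof -
      have "z \<le> a2 D s \<longleftrightarrow> z \<le> a1 D s \<and> (\<forall>j. j < q \<longrightarrow> i + j = s \<longrightarrow> z \<le> f i + h j)"
      proof (cases "s < i \<or> i + q \<le> s")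
        case True
        then show ?thesis using *(1)[OF True] by auto
      next
        case False
        then obtain j where j: "s = i + j" "j < q" by (metis le_Suc_ex nat_add_left_cancel_less not_le)
        then show ?thesis using *(2)[OF j(2)] by auto
      qed
      then show ?thesis using inv by (auto simp: less_Suc_eq)
    qed
    then show "case (g2, a2, t1 + 2 * q + 2) of (g', a', t') \<Rightarrow> (\<lambda>i g' a' t'. (\<forall>s z. z \<le> a' D s \<longleftrightarrow> z \<le> a D s \<and>
      (\<forall>i' j. i' < i \<longrightarrow> j < q \<longrightarrow> i' + j = s \<longrightarrow> z \<le> f i' + h j)) \<and> t' = t + 1 + i * (2 * q + 3)) (Suc i) (g'(21 := Suc i)) a' (Suc t')"
      using inv by simp
  qed (use ly fr i in auto)
next
  let ?c = "tabulate 22 ly D (V 21)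
     (let e = Rd D (Plus (V 21) (V 22)) in Minus e (Minus e (Plus (Rd X (Plus ox (V 21))) (Rd Y (Plus oy (V 22))))))"
  have mw: "mods ?c = {22}" "warrs ?c = {D}" by (auto simp: tabulate_def Let_def)
  fix g1 a1 t1
  assume inv: "(\<forall>s z. z \<le> a1 D s \<longleftrightarrow> z \<le> a D s \<and>
      (\<forall>i' j. i' < p \<longrightarrow> j < q \<longrightarrow> i' + j = s \<longrightarrow> z \<le> f i' + h j)) \<and> t1 = t + 1 + p * (2 * q + 3)"
    and g1: "\<And>y. y \<noteq> 21 \<Longrightarrow> y \<notin> mods ?c \<Longrightarrow> g1 y = g y" and a1: "\<And>C. C \<notin> warrs ?c \<Longrightarrow> a1 C = a C"
  show "Q (g1, a1, Suc t1)"
  proof (rule Q)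
    fix s assume s: "s < p + q - 1"
    have "z \<le> a1 D s \<longleftrightarrow> z \<le> min (a D s) (cv I f h s)" for z
    proof -
      have "z \<le> f i + h j" if "\<forall>i' j. i' < p \<longrightarrow> j < q \<longrightarrow> i' + j = s \<longrightarrow> z \<le> f i' + h j" "z \<le> a D s" "i + j = s" for i j
      proof (cases "i < p \<and> j < q")
        case True then show ?thesis using that by blast
      next
        case False
        then have "f i = I \<or> h j = I" using f(2) h(2) not_le by blast
        then show ?thesis using that(2) d[OF s] by auto
      qed
      moreover have "z \<le> I" if "z \<le> a D s" using that d[OF s] by simp
      ultimately show ?thesis using inv unfolding min.bounded_iff le_cv by blast
    qed
    then show "a1 D s = min (a D s) (cv I f h s)" by (rule nat_eq_by_le)
  qed (use g1 a1 inv in \<open>auto simp: mw\<close>)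
qed (use lx fr in \<open>auto simp: tabulate_def Let_def\<close>)

end

section \<open>Correctness and time of the operations on parts\<close>

lemma fprod_subset: "F \<subseteq> Pow X \<Longrightarrow> G \<subseteq> Pow Y \<Longrightarrow> fprod F G \<subseteq> Pow (X \<union> Y)"
  unfolding fprod_def by blast

lemma (in bounded_machine) wp_St:
  assumes "ok e g a" "ok f g a" "val e g a = p" "val f g a = x" "x \<le> B" "Q (g, a(A := (a A)(p := x)), Suc t)"
  shows "wp (St A e f) Q (g, a, t)"
  using assms by simp

text \<open>B is quadratic in n because it bounds sums of neighbours, up to n * n, and numbers of
  products in a convolution, up to (2 n + 4)^2. The labels are a parameter, so that the locale can
  be interpreted for the labels and again for their complements.\<close>

locale tree_machine = bounded_machine B tau + tree_on V E
  for B :: nat and tau :: "nat \<Rightarrow> nat" and V :: "nat set" and E :: "nat set set" +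
  fixes n r m :: nat and lab :: "nat \<Rightarrow> nat"
  assumes V_eq: "V = {..<n}" and r: "1 \<le> r" "r \<le> n" and m_eq: "m = csr r"
    and B_eq: "B = 200 * ((n + 2) * (n + 2))" and tau_ge: "m * m \<le> tau m"
begin

definition I :: nat where "I = 2 * n + 2"
definition kw :: nat where "kw = 2 * r + 1"
definition hw :: nat where "hw = n + 1"

text \<open>An upper bound for the time of a convolution with an open part.\<close>

definition conv_time :: nat where "conv_time = 4 * ((n + 1) div m + 2) * tau m"

definition base :: "(nat \<Rightarrow> nat) \<Rightarrow> bool" where
  "base g \<longleftrightarrow> g 2 = n \<and> g 3 = r \<and> g 4 = m \<and> g 5 = m * m \<and> g 6 = I \<and> g 7 = kw \<and> g 8 = hw"

text \<open>Rows are specified up to the current size of their part only; what lies behind is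
  arbitrary. An open row has 2 r + 1 cells because two open parts of at most r nodes are merged
  before the result is closed.\<close>

definition node_ok :: "(nat \<Rightarrow> nat \<Rightarrow> nat) \<Rightarrow> (nat \<Rightarrow> nat set) \<Rightarrow> (nat \<Rightarrow> nat set) \<Rightarrow> (nat \<Rightarrow> nat) \<Rightarrow> nat \<Rightarrow> bool" where
  "node_ok a W K b v \<longleftrightarrow> a 34 v = card (W v) \<and> a 35 v = card (K v) \<and> a 36 v < n \<and> card (W v) \<le> 2 * r \<and>
     (\<forall>i\<le>card (W v). a 30 (v * kw + i) = mw lab I (FA W v) i \<and> a 31 (v * kw + i) = mw lab I (FB W K b v) i \<and>
        a 32 (v * kw + i) = mw lab I (FG W K b v) i) \<and>
     (\<forall>i\<le>card (K v). a 33 (a 36 v * hw + i) = mw lab I (FH K b v) i)"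

definition tinv :: "(nat \<Rightarrow> nat \<Rightarrow> nat) \<Rightarrow> nat set \<Rightarrow> (nat \<Rightarrow> nat set) \<Rightarrow> (nat \<Rightarrow> nat set) \<Rightarrow> (nat \<Rightarrow> nat) \<Rightarrow> bool" where
  "tinv a L W K b \<longleftrightarrow> ginv L W K b \<and> (\<forall>v\<in>L. node_ok a W K b v) \<and> inj_on (a 36) L \<and>
     (\<forall>i\<le>n. a 39 i = mw lab I (FS L W K) i)"

lemma m_bounds: "1 \<le> m" "m \<le> r" "r \<le> m * m" "m * m \<le> 4 * r" "m \<le> n"
  using csr_bounds[OF r(1)] r(2) m_eq by auto

lemma B_lin: "400 * n + 800 \<le> B"
proof -
  have "2 * (n + 2) \<le> (n + 2) * (n + 2)" by (intro mult_le_mono1) simp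
  then have "200 * (2 * (n + 2)) \<le> B" unfolding B_eq by (intro mult_le_mono2)
  then show ?thesis by simp
qed

lemma B_bounds: "2 * I \<le> B" "I \<le> B" "8 * n + 8 \<le> B" "n * n \<le> B"
proof -
  show "2 * I \<le> B" "I \<le> B" "8 * n + 8 \<le> B" using B_lin by (simp_all add: I_def)
  have "n * n \<le> (n + 2) * (n + 2)" by (intro mult_le_mono) simp_all
  also have "\<dots> \<le> B" unfolding B_eq by simp
  finally show "n * n \<le> B" .
qed

lemma conv_bounds:
  assumes "p \<le> 2 * n + 1" "q \<le> 2 * n + 1"
  shows "(p div (m * m) + 1) * (q div m + 2) \<le> B"
    "(p div (m * m) + 1) * (m * m) + (q div m + 2) * m + m * m \<le> B"
proof -
  have d: "p div (m * m) \<le> p" "q div m \<le> q" "p div (m * m) * (m * m) \<le> p" "q div m * m \<le> q"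
    by (rule div_times_less_eq_dividend div_le_dividend)+
  have "p div (m * m) + 1 \<le> 2 * n + 4" "q div m + 2 \<le> 2 * n + 4" using d(1,2) assms by linarith+
  then have "(p div (m * m) + 1) * (q div m + 2) \<le> (2 * n + 4) * (2 * n + 4)" by (rule mult_le_mono)
  also have "\<dots> = 4 * ((n + 2) * (n + 2))" by (simp add: algebra_simps)
  also have "\<dots> \<le> B" unfolding B_eq by simp
  finally show "(p div (m * m) + 1) * (q div m + 2) \<le> B" .
  have "(p div (m * m) + 1) * (m * m) + (q div m + 2) * m + m * m =
      p div (m * m) * (m * m) + m * m + (q div m * m + 2 * m) + m * m"
    by (simp only: distrib_right mult_1_left)
  also have "\<dots> \<le> 400 * n + 800" using d(3,4) assms m_bounds(4,5) r(2) by linarith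
  also have "\<dots> \<le> B" by (rule B_lin)
  finally show "(p div (m * m) + 1) * (m * m) + (q div m + 2) * m + m * m \<le> B" .
qed

text \<open>The open sequence is the one cut into blocks. Its length is at most 2 r + 1 \<le> 3 m^2,
  so there are at most four blocks; the closed sequence determines the number of shifts.\<close>

lemma conv_time_ge:
  assumes "p \<le> 2 * r + 1" "q \<le> n + 1"
  shows "(p div (m * m) + 1) * (q div m + 2) * tau m \<le> conv_time" "n + 1 \<le> conv_time"
proof -
  have mm: "0 < m * m" using m_bounds(1) by simp
  have "p \<le> 3 * (m * m)" using assms(1) r(1) m_bounds(3) by linarith
  then have "p div (m * m) \<le> 3 * (m * m) div (m * m)" by (intro div_le_mono)
  also have "\<dots> = 3" using mm by simp
  finally have "p div (m * m) + 1 \<le> 4" by simp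
  moreover have "q div m + 2 \<le> (n + 1) div m + 2" using assms(2) by (simp add: div_le_mono)
  ultimately show "(p div (m * m) + 1) * (q div m + 2) * tau m \<le> conv_time"
    unfolding conv_time_def by (intro mult_le_mono) simp_all
  have "m * 1 \<le> m * m" using m_bounds(1) by (intro mult_le_mono2) simp
  then have "m \<le> tau m" using tau_ge by linarith
  then have "((n + 1) div m + 1) * m \<le> 4 * ((n + 1) div m + 2) * tau m" by (intro mult_le_mono) simp_all
  moreover have "n + 1 < ((n + 1) div m + 1) * m"
    using m_bounds(1) dividend_less_div_times[of m "n + 1"] by simp
  ultimately show "n + 1 \<le> conv_time" unfolding conv_time_def by linarith
qed

lemma tinvD:
  assumes "tinv a L W K b" "v \<in> L"
  shows "ginv L W K b" "node_ok a W K b v" "v < n" "card (W v) + card (K v) \<le> n" "finite (W v)" "finite (K v)"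
proof -
  show g: "ginv L W K b" and "node_ok a W K b v" using assms by (auto simp: tinv_def)
  note D = ginvD[OF g assms(2)]
  show "v < n" using D(1,3) V_eq by blast
  show f: "finite (W v)" "finite (K v)" using families_subset(6,7)[OF g assms(2)] .
  have "card (W v) + card (K v) = card (W v \<union> K v)" using D(2) f by (simp add: card_Un_disjoint)
  also have "\<dots> \<le> card V" by (rule card_mono[OF finite_V D(1)])
  finally show "card (W v) + card (K v) \<le> n" by (simp add: V_eq)
qed

text \<open>Rows of other nodes survive as long as the rows of v are the only ones that change.\<close>

lemma node_ok_other:
  assumes "node_ok a W K b w" "W' w = W w" "K' w = K w" "b' w = b w"
    and "a' 34 w = a 34 w" "a' 35 w = a 35 w" "a' 36 w = a 36 w"
    and "\<And>i. i < kw \<Longrightarrow> a' 30 (w * kw + i) = a 30 (w * kw + i) \<and> a' 31 (w * kw + i) = a 31 (w * kw + i) \<and>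
       a' 32 (w * kw + i) = a 32 (w * kw + i)"
    and "\<And>i. i < hw \<Longrightarrow> a' 33 (a 36 w * hw + i) = a 33 (a 36 w * hw + i)" and "card (K w) \<le> n"
  shows "node_ok a' W' K' b' w"
proof -
  have F: "FA W' w = FA W w" "FB W' K' b' w = FB W K b w" "FG W' K' b' w = FG W K b w" "FH K' b' w = FH K b w"
    using assms(2,3,4) by (simp_all add: FA_def FB_def FG_def FH_def)
  have "i < kw" if "i \<le> card (W w)" for i using that assms(1) by (simp add: node_ok_def kw_def)
  moreover have "i < hw" if "i \<le> card (K w)" for i using that assms(10) by (simp add: hw_def)
  ultimately show ?thesis using assms unfolding node_ok_def F by simp
qed

text \<open>Two convolutions of an open with a closed sequence and work linear in n. Their results
  are the rows of the families in \<open>close_families\<close>, by \<open>mw_fprod\<close> for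
  products and \<open>mw_Un\<close> for unions; other nodes are unaffected because their rows and
  handles differ.\<close>

lemma wp_close:
  assumes g: "base g" "g 10 = v" and T: "tinv a L W K b" and v: "v \<in> L"
    and Q: "\<And>g' a' t'. (\<And>y. y \<notin> {20..28} \<Longrightarrow> g' y = g y) \<Longrightarrow>
      (\<And>A. A \<notin> {0, 1, 30, 31, 32, 33, 34, 35, 39, 40, 41, 42} \<Longrightarrow> a' A = a A) \<Longrightarrow>
      tinv a' L (W(v := {})) (K(v := W v \<union> K v)) (b(v := v)) \<Longrightarrow> t' \<le> t + 200 * conv_time \<Longrightarrow> Q (g', a', t')"
  shows "wp close Q (g, a, t)"
proof -
  note D = tinvD[OF T v] and S = families_subset[OF tinvD(1)[OF T v] v]
  let ?s = "card (W v)" and ?h = "card (K v)" and ?hp = "a 36 v"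
  have ok: "a 34 v = ?s" "a 35 v = ?h" "?hp < n" "?s \<le> 2 * r"
    and A: "\<And>i. i \<le> ?s \<Longrightarrow> a 30 (v * kw + i) = mw lab I (FA W v) i"
    and Bt: "\<And>i. i \<le> ?s \<Longrightarrow> a 31 (v * kw + i) = mw lab I (FB W K b v) i"
    and G: "\<And>i. i \<le> ?s \<Longrightarrow> a 32 (v * kw + i) = mw lab I (FG W K b v) i"
    and H: "\<And>i. i \<le> ?h \<Longrightarrow> a 33 (?hp * hw + i) = mw lab I (FH K b v) i"
    using D(2) by (auto simp: node_ok_def)
  have ans: "\<And>i. i \<le> n \<Longrightarrow> a 39 i = mw lab I (FS L W K) i" and inj: "inj_on (a 36) L" using T by (auto simp: tinv_def)
  have gb: "g 2 = n" "g 4 = m" "g 5 = m * m" "g 6 = I" "g 7 = kw" "g 8 = hw" using g(1) by (auto simp: base_def)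
  have sB: "?s \<le> B" "?h \<le> B" "?hp \<le> B" "?s + ?h + 1 \<le> B" "?s + 1 \<le> B" using D(4) ok(3) B_bounds(3) by linarith+
  have mI: "mw lab I (FA W v) i \<le> I" "mw lab I (FB W K b v) i \<le> I" "mw lab I (FG W K b v) i \<le> I"
     "mw lab I (FH K b v) i \<le> I" "mw lab I (FS L W K) i \<le> I" for i
    by (rule mw_le[OF S(1) S(6)] mw_le[OF S(2) S(6)] mw_le[OF S(3) S(6)] mw_le[OF S(4) S(7)] mw_le[OF S(5) finite_V])+
  have cb: "(?s + 1) \<le> 2 * n + 1" "(?h + 1) \<le> 2 * n + 1" using D(4) r by linarith+
  note cB = conv_bounds[OF cb]
  have ct: "?s + 1 \<le> 2 * r + 1" "?h + 1 \<le> n + 1" using ok(4) D(4) by linarith+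
  note cT = conv_time_ge[OF ct]
  have cvI: "cv I f h i \<le> I" for f h i using le_cv[of "cv I f h i" I f h i] by simp
  let ?Z1 = "cv I (mw lab I (FG W K b v)) (mw lab I (FH K b v))" and ?Z2 = "cv I (mw lab I (FB W K b v)) (mw lab I (FH K b v))"
  have kw: "?s < kw" "0 < kw" using ok(4) by (simp_all add: kw_def)
  have hw: "?s + ?h < hw" using D(4) by (simp add: hw_def)
  show ?thesis
    unfolding close_def wp.simps(3)
  proof (rule wp_conv[where m = m and I = I and p = "?s + 1" and q = "?h + 1" and ?o1.0 = "v * kw" and ?o2.0 = "?hp * hw"
        and f = "mw lab I (FG W K b v)" and h = "mw lab I (FH K b v)", OF gb(2-4)])
    show "mw lab I (FG W K b v) i = I" if "?s + 1 \<le> i" for i by (rule mw_big[OF S(3,6)]) (use that in simp)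
    show "mw lab I (FH K b v) i = I" if "?h + 1 \<le> i" for i by (rule mw_big[OF S(4,7)]) (use that in simp)
  next
    fix g1 a1 t1
    assume g1: "\<And>y. y \<notin> {20..27} \<Longrightarrow> g1 y = g y" and a1: "\<And>A. A \<notin> {0, 1, 40, 41, 42} \<Longrightarrow> a1 A = a A"
      and Z1: "\<And>s. s \<le> ?s + 1 + (?h + 1) \<Longrightarrow> a1 42 s = ?Z1 s"
      and t1: "t1 \<le> t + 60 * (((?s + 1) div (m * m) + 1) * ((?h + 1) div m + 2) * tau m)"
    show "wp (min_into 39 (N 0) (Plus (Plus (size_open 10) (size_closed 10)) (N 1)) 42 (N 0))
       (wp (conv 31 (row 10) (Plus (size_open 10) (N 1)) 33 (hrow 10) (Plus (size_closed 10) (N 1)))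
       (wp (min_into 42 (N 0) (Plus (size_open 10) (N 1)) 30 (row 10))
       (wp (copy 33 (hrow 10) (Plus (Plus (size_open 10) (size_closed 10)) (N 1)) 42 (N 0))
       (wp (St 35 (aexp.V 10) (Plus (size_open 10) (size_closed 10)))
       (wp (St 34 (aexp.V 10) (N 0))
       (wp (St 30 (row 10) (aexp.V 6))
       (wp (St 31 (row 10) (N 0))
       (wp (St 32 (row 10) (N 0)) Q)))))))) (g1, a1, t1)"
    proof (rule wp_min_into[where n = "?s + ?h + 1" and p = 0 and q = 0])
      show "a1 39 (0 + i) \<le> B" if "i < ?s + ?h + 1" for i
      proof -
        have "i \<le> n" using that D(4) by linarith
        then show ?thesis using a1[of 39] ans[of i] mI(5)[of i] B_bounds(2) by simp
      qed
      show "a1 42 (0 + i) \<le> B" if "i < ?s + ?h + 1" for i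
        using Z1[of i] that cvI[of "mw lab I (FG W K b v)" "mw lab I (FH K b v)" i] B_bounds(2) by simp
    next
      fix g2 a2
      assume g2: "\<And>y. y \<noteq> 25 \<Longrightarrow> g2 y = g1 y" and a2: "\<And>C. C \<noteq> 39 \<Longrightarrow> a2 C = a1 C"
        and ans2': "\<And>j. j < 0 \<or> 0 + (?s + ?h + 1) \<le> j \<Longrightarrow> a2 39 j = a1 39 j"
        and ans2: "\<And>i. i < ?s + ?h + 1 \<Longrightarrow> a2 39 (0 + i) = min (a1 39 (0 + i)) (a1 42 (0 + i))"
      have gg: "g2 y = g y" if "y \<notin> {20..27}" for y
      proof -
        have "y \<noteq> 25" using that by auto
        then show ?thesis using g1[OF that] g2 by simp
      qed
      have aa: "a2 A = a A" if "A \<notin> {0, 1, 39, 40, 41, 42}" for A using a1[of A] a2[of A] that by simp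
      have v2: "g2 4 = m" "g2 5 = m * m" "g2 6 = I" "g2 7 = kw" "g2 8 = hw" "g2 10 = v" "a2 34 v = ?s" "a2 35 v = ?h"
        "a2 36 = a 36" "a2 31 = a 31" "a2 33 = a 33"
        using gg gb g(2) aa ok by simp_all
      show "wp (conv 31 (row 10) (Plus (size_open 10) (N 1)) 33 (hrow 10) (Plus (size_closed 10) (N 1)))
       (wp (min_into 42 (N 0) (Plus (size_open 10) (N 1)) 30 (row 10))
       (wp (copy 33 (hrow 10) (Plus (Plus (size_open 10) (size_closed 10)) (N 1)) 42 (N 0))
       (wp (St 35 (aexp.V 10) (Plus (size_open 10) (size_closed 10)))
       (wp (St 34 (aexp.V 10) (N 0))
       (wp (St 30 (row 10) (aexp.V 6))
       (wp (St 31 (row 10) (N 0))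
       (wp (St 32 (row 10) (N 0)) Q))))))) (g2, a2, t1 + 2 * (?s + ?h + 1) + 2)"
      proof (rule wp_conv[where m = m and I = I and p = "?s + 1" and q = "?h + 1" and ?o1.0 = "v * kw" and ?o2.0 = "?hp * hw"
            and f = "mw lab I (FB W K b v)" and h = "mw lab I (FH K b v)"])
        show "mw lab I (FB W K b v) i = I" if "?s + 1 \<le> i" for i by (rule mw_big[OF S(2,6)]) (use that in simp)
        show "mw lab I (FH K b v) i = I" if "?h + 1 \<le> i" for i by (rule mw_big[OF S(4,7)]) (use that in simp)
      next
        fix g3 a3 t3
        assume g3: "\<And>y. y \<notin> {20..27} \<Longrightarrow> g3 y = g2 y" and a3: "\<And>A. A \<notin> {0, 1, 40, 41, 42} \<Longrightarrow> a3 A = a2 A"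
          and Z3: "\<And>s. s \<le> ?s + 1 + (?h + 1) \<Longrightarrow> a3 42 s = ?Z2 s"
          and t3: "t3 \<le> t1 + 2 * (?s + ?h + 1) + 2 + 60 * (((?s + 1) div (m * m) + 1) * ((?h + 1) div m + 2) * tau m)"
        have gg3: "g3 y = g y" if "y \<notin> {20..27}" for y using g3[OF that] gg[OF that] by simp
        have aa3: "a3 A = a A" if "A \<notin> {0, 1, 39, 40, 41, 42}" for A using a3[of A] aa[of A] that by simp
        show "wp (min_into 42 (N 0) (Plus (size_open 10) (N 1)) 30 (row 10))
          (wp (copy 33 (hrow 10) (Plus (Plus (size_open 10) (size_closed 10)) (N 1)) 42 (N 0))
          (wp (St 35 (aexp.V 10) (Plus (size_open 10) (size_closed 10)))
          (wp (St 34 (aexp.V 10) (N 0))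
          (wp (St 30 (row 10) (aexp.V 6))
          (wp (St 31 (row 10) (N 0))
          (wp (St 32 (row 10) (N 0)) Q)))))) (g3, a3, t3)"
        proof (rule wp_min_into[where n = "?s + 1" and p = 0 and q = "v * kw"])
          show "a3 30 (v * kw + i) \<le> B" if "i < ?s + 1" for i
            using A[of i] aa3[of 30] that mI(1)[of i] B_bounds(2) by simp
          show "a3 42 (0 + i) \<le> B" if "i < ?s + 1" for i
            using Z3[of i] that cvI[of "mw lab I (FB W K b v)" "mw lab I (FH K b v)" i] B_bounds(2) by simp
        next
          fix g4 a4
          assume g4: "\<And>y. y \<noteq> 25 \<Longrightarrow> g4 y = g3 y" and a4: "\<And>C. C \<noteq> 42 \<Longrightarrow> a4 C = a3 C"
            and z4': "\<And>j. j < 0 \<or> 0 + (?s + 1) \<le> j \<Longrightarrow> a4 42 j = a3 42 j"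
            and z4: "\<And>i. i < ?s + 1 \<Longrightarrow> a4 42 (0 + i) = min (a3 42 (0 + i)) (a3 30 (v * kw + i))"
          have Z4: "a4 42 i = min (mw lab I (FA W v) i) (?Z2 i)" if "i < ?s + ?h + 1" for i
          proof (cases "i < ?s + 1")
            case True
            then show ?thesis using z4[OF True] Z3[of i] aa3[of 30] A[of i] by (simp add: min.commute)
          next
            case False
            then have "mw lab I (FA W v) i = I" by (intro mw_big[OF S(1,6)]) simp
            then show ?thesis using z4'[of i] Z3[of i] False that cvI[of "mw lab I (FB W K b v)" "mw lab I (FH K b v)" i] by simp
          qed
          have gg4: "g4 y = g y" if "y \<notin> {20..27}" for y
          proof -
            have "y \<noteq> 25" using that by auto
            then show ?thesis using gg3[OF that] g4 by simp
          qed
          have aa4: "a4 A = a A" if "A \<notin> {0, 1, 39, 40, 41, 42}" for A using a4[of A] aa3[of A] that by simp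
          show "wp (copy 33 (hrow 10) (Plus (Plus (size_open 10) (size_closed 10)) (N 1)) 42 (N 0))
            (wp (St 35 (aexp.V 10) (Plus (size_open 10) (size_closed 10)))
            (wp (St 34 (aexp.V 10) (N 0))
            (wp (St 30 (row 10) (aexp.V 6))
            (wp (St 31 (row 10) (N 0))
            (wp (St 32 (row 10) (N 0)) Q))))) (g4, a4, t3 + 2 * (?s + 1) + 2)"
          proof (rule wp_copy[where n = "?s + ?h + 1" and p = "?hp * hw" and q = 0])
            show "a4 42 (0 + i) \<le> B" if "i < ?s + ?h + 1" for i
              using Z4[OF that] mI(1)[of i] B_bounds(2) by (simp add: min.coboundedI1)
          next
            fix g5 a5
            assume g5: "\<And>y. y \<noteq> 25 \<Longrightarrow> g5 y = g4 y" and a5: "\<And>C. C \<noteq> 33 \<Longrightarrow> a5 C = a4 C"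
              and h5': "\<And>j. j < ?hp * hw \<or> ?hp * hw + (?s + ?h + 1) \<le> j \<Longrightarrow> a5 33 j = a4 33 j"
              and h5: "\<And>i. i < ?s + ?h + 1 \<Longrightarrow> a5 33 (?hp * hw + i) = a4 42 (0 + i)"
            have gg5: "g5 y = g y" if "y \<notin> {20..28}" for y
            proof -
              have "y \<noteq> 25" "y \<notin> {20..27}" using that by auto
              then show ?thesis using gg4 g5 by simp
            qed
            have aa5: "a5 A = a A" if "A \<notin> {0, 1, 33, 39, 40, 41, 42}" for A using a5[of A] aa4[of A] that by simp
            have g5v: "g5 10 = v" "g5 6 = I" "g5 7 = kw" using gg5 g(2) gb by auto
            have a5v: "a5 34 v = ?s" "a5 35 v = ?h" using aa5 ok by auto
            define a6 where "a6 = a5(35 := (a5 35)(v := ?s + ?h), 34 := (a5 34)(v := 0), 30 := (a5 30)(v * kw := I),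
               31 := (a5 31)(v * kw := 0), 32 := (a5 32)(v * kw := 0))"
            have "Q (g5, a6, Suc (Suc (Suc (Suc (Suc (t3 + 2 * (?s + 1) + 2 + 2 * (?s + ?h + 1) + 2))))))"
            proof (rule Q)
              show "g5 y = g y" if "y \<notin> {20..28}" for y by (rule gg5[OF that])
              show "a6 A = a A" if "A \<notin> {0, 1, 30, 31, 32, 33, 34, 35, 39, 40, 41, 42}" for A
                using that aa5[of A] by (simp add: a6_def)
              show "Suc (Suc (Suc (Suc (Suc (t3 + 2 * (?s + 1) + 2 + 2 * (?s + ?h + 1) + 2))))) \<le> t + 200 * conv_time"
                using t3 t1 cT D(4) unfolding distrib_left by linarith
              \<comment> \<open>The answers are updated up to size ?s + ?h only; there is no larger
                set using both parts.\<close>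
              have "?Z1 i = I" if "?s + ?h < i" for i
              proof -
                have c: "card (W v \<union> K v) < i" using that card_Un_le[of "W v" "K v"] by linarith
                have "mw lab I (fprod (FG W K b v) (FH K b v)) i = I"
                  by (rule mw_big[OF _ _ c]) (use S D(5,6) in \<open>auto simp: fprod_def\<close>)
                then show ?thesis using mw_fprod[OF S(3,6,4,7) ginvD(2)[OF D(1) v]] by simp
              qed
              note Zbig = this
              have ans6: "a6 39 i = mw lab I (FS L (W(v := {})) (K(v := W v \<union> K v))) i" if i: "i \<le> n" for i
              proof -
                have sub: "FS L W K \<union> fprod (FG W K b v) (FH K b v) \<subseteq> Pow V"
                  using S(5) fprod_subset[OF S(3,4)] ginvD(1)[OF D(1) v] by blast
                have "a6 39 i = a2 39 i" using a5[of 39] a4[of 39] a3[of 39] by (simp add: a6_def)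
                also have "\<dots> = min (mw lab I (FS L W K) i) (?Z1 i)"
                proof (cases "i < ?s + ?h + 1")
                  case True
                  then show ?thesis using ans2[OF True] a1[of 39] ans[OF i] Z1[of i] by simp
                next
                  case False
                  then show ?thesis using ans2'[of i] a1[of 39] ans[OF i] Zbig[of i] mI(5)[of i] by simp
                qed
                also have "\<dots> = mw lab I (FS L W K \<union> fprod (FG W K b v) (FH K b v)) i"
                  using mw_Un[OF sub finite_V] mw_fprod[OF S(3,6,4,7) ginvD(2)[OF D(1) v]] by simp
                finally show ?thesis using close_families(2)[OF D(1) v] by simp
              qed
              let ?W = "W(v := {})" and ?K = "K(v := W v \<union> K v)" and ?b = "b(v := v)"
              have Kne: "W v \<union> K v \<noteq> {}" using ginvD(3)[OF D(1) v] by blast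
              have cl: "FA ?W v = {}" "FB ?W ?K ?b v = {{}}" "FG ?W ?K ?b v = {{}}"
                using closed_families[of ?W v ?b ?K] Kne by simp_all
              have cK: "card (W v \<union> K v) = ?s + ?h" using ginvD(2)[OF D(1) v] D(5,6) by (simp add: card_Un_disjoint)
              have Hv: "a6 33 (?hp * hw + i) = mw lab I (FH ?K ?b v) i" if "i \<le> ?s + ?h" for i
              proof -
                have sub: "FA W v \<union> fprod (FB W K b v) (FH K b v) \<subseteq> Pow V"
                  using S(1) fprod_subset[OF S(2,4)] ginvD(1)[OF D(1) v] by blast
                have "a6 33 (?hp * hw + i) = min (mw lab I (FA W v) i) (?Z2 i)"
                  using h5[of i] Z4[of i] that by (simp add: a6_def)
                also have "\<dots> = mw lab I (FA W v \<union> fprod (FB W K b v) (FH K b v)) i"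
                  using mw_Un[OF sub finite_V] mw_fprod[OF S(2,6,4,7) ginvD(2)[OF D(1) v]] by simp
                finally show ?thesis using close_families(1)[OF D(1) v] by simp
              qed
              have "node_ok a6 ?W ?K ?b v"
                unfolding node_ok_def using cl cK Hv aa5[of 36] ok(3) by (simp add: a6_def)
              moreover have "node_ok a6 ?W ?K ?b w" if w: "w \<in> L" "w \<noteq> v" for w
              proof (rule node_ok_other[of a W K b w])
                show "node_ok a W K b w" "card (K w) \<le> n" using tinvD(2,4)[OF T w(1)] by auto
                show "a6 34 w = a 34 w" "a6 35 w = a 35 w" "a6 36 w = a 36 w" using aa5 w(2) by (simp_all add: a6_def)
                show "a6 30 (w * kw + i) = a 30 (w * kw + i) \<and> a6 31 (w * kw + i) = a 31 (w * kw + i) \<and>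
                   a6 32 (w * kw + i) = a 32 (w * kw + i)" if "i < kw" for i
                proof -
                  have "w * kw + i \<noteq> v * kw" using row_index_eq[OF that kw(2), of w v] w(2) by simp
                  then show ?thesis using aa5 by (simp add: a6_def)
                qed
                show "a6 33 (a 36 w * hw + i) = a 33 (a 36 w * hw + i)" if "i < hw" for i
                proof -
                  have hpw: "a 36 w \<noteq> ?hp" using inj w v by (auto dest: inj_onD)
                  have "a 36 w * hw + i \<noteq> ?hp * hw + j" if "j < ?s + ?h + 1" for j
                    using row_index_eq[OF \<open>i < hw\<close>, of j "a 36 w" ?hp] hpw that hw by simp
                  then have "a 36 w * hw + i < ?hp * hw \<or> ?hp * hw + (?s + ?h + 1) \<le> a 36 w * hw + i"
                    by (metis le_Suc_ex nat_add_left_cancel_less not_le)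
                  then show ?thesis using h5' aa4[of 33] by (simp add: a6_def)
                qed
              qed (use w in auto)
              ultimately have "\<forall>w\<in>L. node_ok a6 ?W ?K ?b w" by blast
              moreover have "inj_on (a6 36) L" using inj aa5[of 36] by (simp add: a6_def)
              ultimately show "tinv a6 L ?W ?K ?b"
                using ginv_close[OF D(1) v] ans6 unfolding tinv_def by blast
            qed
            note final = this
            show "wp (St 35 (aexp.V 10) (Plus (size_open 10) (size_closed 10)))
              (wp (St 34 (aexp.V 10) (N 0))
              (wp (St 30 (row 10) (aexp.V 6))
              (wp (St 31 (row 10) (N 0))
              (wp (St 32 (row 10) (N 0)) Q)))) (g5, a5, t3 + 2 * (?s + 1) + 2 + 2 * (?s + ?h + 1) + 2)"
              unfolding size_open_def size_closed_def row_def
              apply (rule wp_St[where p = v and x = "?s + ?h"])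
              using g5v a5v sB apply simp_all[5]
              apply (rule wp_St[where p = v and x = 0])
              using g5v apply simp_all[5]
              apply (rule wp_St[where p = "v * kw" and x = I])
              using g5v B_bounds(2) apply simp_all[5]
              apply (rule wp_St[where p = "v * kw" and x = 0])
              using g5v apply simp_all[5]
              apply (rule wp_St[where p = "v * kw" and x = 0])
              using g5v apply simp_all[5]
              using final by (simp add: a6_def)
          qed (use gg4 aa4 g(2) gb ok sB in \<open>auto simp: size_open_def size_closed_def hrow_def\<close>)
        qed (use gg3 aa3 g(2) gb ok sB in \<open>auto simp: size_open_def size_closed_def row_def\<close>)
      qed (use v2 sB cB mI(2,4) Bt H m_bounds(1) B_bounds(1) tau_ge in \<open>simp_all add: size_open_def size_closed_def row_def hrow_def\<close>)
    qed (use g1 a1 g(2) gb ok sB in \<open>auto simp: size_open_def size_closed_def\<close>)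
  qed (use g(2) gb ok(1,2) sB cB mI(3,4) G H m_bounds(1) B_bounds(1) tau_ge in
      \<open>simp_all add: size_open_def size_closed_def row_def hrow_def\<close>)
qed

end

lemma cv_le: "cv I f h i \<le> I"
  unfolding cv_def by (intro Min_le) auto

context tree_machine
begin

lemma mergeableD:
  assumes "tinv a L W K b" "mergeable L W K u p"
  shows "u \<in> L" "p \<in> L" "u \<noteq> p" "W u \<inter> W p = {}" "K u \<inter> K p = {}"
    "card (W u) + card (K u) + (card (W p) + card (K p)) \<le> n"
proof -
  show L: "u \<in> L" "p \<in> L" "u \<noteq> p" using assms(2) by (auto simp: mergeable_def)
  note D = ginvD2(1)[OF tinvD(1)[OF assms(1) L(1)] L(1-3)]
  show "W u \<inter> W p = {}" "K u \<inter> K p = {}" using D by blast+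
  note Du = tinvD(5,6)[OF assms(1) L(1)] and Dp = tinvD(5,6)[OF assms(1) L(2)]
  note Gu = ginvD[OF tinvD(1)[OF assms(1) L(1)] L(1)] and Gp = ginvD[OF tinvD(1)[OF assms(1) L(1)] L(2)]
  have "card (W u) + card (K u) = card (W u \<union> K u)" "card (W p) + card (K p) = card (W p \<union> K p)"
    using Du Dp Gu(2) Gp(2) by (simp_all add: card_Un_disjoint)
  moreover have "card (W u \<union> K u) + card (W p \<union> K p) = card ((W u \<union> K u) \<union> (W p \<union> K p))"
    using Du Dp D by (intro card_Un_disjoint[symmetric]) auto
  moreover have "\<dots> \<le> card V" using Gu(1) Gp(1) by (intro card_mono[OF finite_V]) blast
  ultimately show "card (W u) + card (K u) + (card (W p) + card (K p)) \<le> n" by (simp add: V_eq)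
qed

text \<open>The time is that of a single convolution of the two closed sequences and of linear work.
  It is kept in terms of the two sizes, so that it can be charged to their product.\<close>

lemma wp_join:
  assumes g: "base g" "g 11 = u" "g 12 = p" and T: "tinv a L W K b" and M: "mergeable L W K u p"
    and ne: "K u \<noteq> {}" "K p \<noteq> {}" and We: "W u = {}" "W p = {}"
    and Q: "\<And>g' a' t'. (\<And>y. y \<notin> {20..28} \<Longrightarrow> g' y = g y) \<Longrightarrow>
      (\<And>A. A \<notin> {0, 1, 33, 35, 39, 40, 41, 42} \<Longrightarrow> a' A = a A) \<Longrightarrow>
      tinv a' (L - {u}) (merge_sets p u W) (merge_sets p u K) (merge_gate p u K b) \<Longrightarrow>
      t' \<le> t + 60 * (((card (K p) + 1) div (m * m) + 1) * ((card (K u) + 1) div m + 2) * tau m) + 20 * n \<Longrightarrow> Q (g', a', t')"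
  shows "wp join Q (g, a, t)"
proof -
  note L = mergeableD[OF T M]
  note Du = tinvD[OF T L(1)] and Dp = tinvD[OF T L(2)]
  note Su = families_subset[OF Du(1) L(1)] and Sp = families_subset[OF Dp(1) L(2)]
  let ?hu = "card (K u)" and ?hp = "card (K p)"
  have oku: "a 35 u = ?hu" "a 36 u < n" and okp: "a 35 p = ?hp" "a 36 p < n"
    and Hu: "\<And>i. i \<le> ?hu \<Longrightarrow> a 33 (a 36 u * hw + i) = mw lab I (FH K b u) i"
    and Hp: "\<And>i. i \<le> ?hp \<Longrightarrow> a 33 (a 36 p * hw + i) = mw lab I (FH K b p) i"
    using Du(2) Dp(2) by (auto simp: node_ok_def)
  have ans: "\<And>i. i \<le> n \<Longrightarrow> a 39 i = mw lab I (FS L W K) i" and inj: "inj_on (a 36) L" using T by (auto simp: tinv_def)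
  have hne: "a 36 u \<noteq> a 36 p" using inj L(1-3) by (auto dest: inj_onD)
  have gb: "g 2 = n" "g 4 = m" "g 5 = m * m" "g 6 = I" "g 7 = kw" "g 8 = hw" using g(1) by (auto simp: base_def)
  have hh: "?hp + ?hu \<le> n" using L(6) by linarith
  have sB: "?hp \<le> B" "?hu \<le> B" "?hp + ?hu + 1 \<le> B" "?hp + ?hu \<le> B" "?hp + 1 \<le> B" "?hu + 1 \<le> B" "a 36 u \<le> B" "a 36 p \<le> B"
    using hh oku(2) okp(2) B_bounds(3) by linarith+
  let ?F = "insert {} (FH K b u)"
  have SF: "?F \<subseteq> Pow (K u)" using Su(4) by blast
  have mI: "mw lab I (FH K b p) i \<le> I" "mw lab I ?F i \<le> I" "mw lab I (FS L W K) i \<le> I" for i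
    by (rule mw_le[OF Sp(4,7)] mw_le[OF SF Su(7)] mw_le[OF Su(5) finite_V])+
  have cb: "?hp + 1 \<le> 2 * n + 1" "?hu + 1 \<le> 2 * n + 1" using hh by linarith+
  note cB = conv_bounds[OF cb]
  have hw: "0 < hw" "?hp + ?hu < hw" "?hp < hw" "?hu < hw" using hh by (simp_all add: hw_def)
  let ?Z = "cv I (mw lab I (FH K b p)) (mw lab I ?F)"
  have cvI: "?Z i \<le> I" for i by (rule cv_le)
  define a1 where "a1 = a(33 := (a 33)(a 36 u * hw := 0))"
  have a1: "a1 C = a C" if "C \<noteq> 33" for C using that by (simp add: a1_def)
  \<comment> \<open>Overwriting the entry for size 0 by 0 turns the row of \<open>FH\<close> of u
    into the row of this family with the empty set added.\<close>
  have H1u: "a1 33 (a 36 u * hw + i) = mw lab I ?F i" if "i < ?hu + 1" for i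
    using Hu[of i] that mw_insert_empty[OF Su(4,7), of lab I i] by (simp add: a1_def)
  have H1: "a1 33 (a 36 w * hw + i) = a 33 (a 36 w * hw + i)" if "i < hw" "a 36 w \<noteq> a 36 u" for i w
    using row_index_eq[OF that(1) hw(1), of "a 36 w" "a 36 u"] that(2) by (simp add: a1_def)
  have a36: "a1 36 = a 36" "a1 35 = a 35" "a1 39 = a 39" using a1 by simp_all
  show ?thesis
    unfolding join_def wp.simps(3)
    apply (rule wp_St[where p = "a 36 u * hw" and x = 0])
    using g gb sB apply (simp_all add: hrow_def)[5]
    unfolding a1_def[symmetric]
    apply (rule wp_conv[where m = m and I = I and p = "?hp + 1" and q = "?hu + 1" and ?o1.0 = "a 36 p * hw" and
        ?o2.0 = "a 36 u * hw" and nb = "(?hp + 1) div (m * m) + 1" and nJ = "(?hu + 1) div m + 2" and f = "mw lab I (FH K b p)" and h = "mw lab I ?F", OF gb(2-4)])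
    using g gb sB a36 oku(1) okp(1) m_bounds(1) B_bounds(1) cB apply (simp_all add: hrow_def size_closed_def)[19]
    subgoal using mI(1) .
    subgoal for i by (rule mw_big[OF Sp(4,7)]) simp
    subgoal for i using H1[of i p] Hp[of i] hw hne by simp
    subgoal using mI(2) .
    subgoal for i by (rule mw_big[OF SF Su(7)]) simp
    subgoal for i using H1u[of i] by simp
    subgoal by (rule tau_ge)
    subgoal premises p2 for g2 a2 t2
    proof -
      have g2: "g2 y = g y" if "y \<notin> {20..28}" for y using p2(1)[of y] that by auto
      have gv: "g2 11 = u" "g2 12 = p" "g2 8 = hw" using g2 g gb by simp_all
      have av: "a2 36 = a 36" "a2 35 = a 35" "a2 33 = a1 33" "a2 39 = a 39" using p2(2) a36 by simp_all
      show ?thesis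
        apply (rule wp_copy[where n = "?hp + ?hu + 1" and p = "a 36 p * hw" and q = 0])
        using gv av sB oku(1) okp(1) apply (simp_all add: hrow_def size_closed_def)[14]
        subgoal for i using p2(3)[of i] cvI[of i] B_bounds(2) by simp
        subgoal premises p3 for g3 a3
        proof -
          have gv3: "g3 11 = u" "g3 12 = p" using gv p3(1) by simp_all
          have av3: "a3 36 = a 36" "a3 35 = a 35" "a3 39 = a 39" "a3 42 = a2 42" using p3(2) av by simp_all
          show ?thesis
            apply (rule wp_min_into[where n = "?hp + ?hu + 1" and p = 0 and q = 0])
            using gv3 av3 sB oku(1) okp(1) apply (simp_all add: size_closed_def)[14]
            subgoal for i using p2(3)[of i] cvI[of i] B_bounds(2) av3(4) by simp
            subgoal for i using ans[of i] mI(3)[of i] B_bounds(2) av3(3) hh by simp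
            subgoal premises p4 for g4 a4
            proof -
              have gv4: "g4 11 = u" "g4 12 = p" using gv3 p4(1) by simp_all
              have av4: "a4 36 = a 36" "a4 35 = a 35" "a4 33 = a3 33" using p4(2) av3 by simp_all
              define a5 where "a5 = a4(35 := (a4 35)(p := ?hp + ?hu))"
              let ?W = "merge_sets p u W" and ?K = "merge_sets p u K" and ?b = "merge_gate p u K b"
              note J = join_families[OF Du(1) M ne We]
              have cK: "card (?K p) = ?hp + ?hu"
                using L(5) Du(6) Dp(6) by (simp add: merge_sets_def card_Un_disjoint Int_commute)
              have Hnew: "a5 33 (a 36 p * hw + i) = mw lab I (FH ?K ?b p) i" if "i \<le> ?hp + ?hu" for i
              proof -
                have "a5 33 (a 36 p * hw + i) = ?Z i" using p3(4)[of i] p2(3)[of i] that av4(3) by (simp add: a5_def)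
                also have "\<dots> = mw lab I (fprod (FH K b p) ?F) i"
                  using mw_fprod[OF Sp(4,7) SF Su(7)] L(5) by (simp add: Int_commute)
                finally show ?thesis using J(2) by simp
              qed
              have Kn: "?K p \<subseteq> V" "finite (?K p)"
                using ginvD(1)[OF Du(1) L(1)] ginvD(1)[OF Du(1) L(2)] Du(6) Dp(6) by (auto simp: merge_sets_def)
              have HF: "FH ?K ?b p \<subseteq> Pow (?K p)" by (auto simp: FH_def)
              have ans5: "a5 39 i = mw lab I (FS (L - {u}) ?W ?K) i" if i: "i \<le> n" for i
              proof -
                have sub: "FS L W K \<union> FH ?K ?b p \<subseteq> Pow V" using Su(5) HF Kn(1) by blast
                have "a5 39 i = min (mw lab I (FS L W K) i) (mw lab I (FH ?K ?b p) i)"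
                proof (cases "i < ?hp + ?hu + 1")
                  case True
                  have "a3 42 i = mw lab I (FH ?K ?b p) i"
                    using Hnew[of i] True p3(4)[of i] av4(3) av3(4) by (simp add: a5_def)
                  then show ?thesis using p4(4)[OF True] av3(3) ans[OF i] by (simp add: a5_def)
                next
                  case False
                  then have "mw lab I (FH ?K ?b p) i = I" using cK by (intro mw_big[OF HF Kn(2)]) simp
                  then show ?thesis using p4(3)[of i] False av3(3) ans[OF i] mI(3)[of i] by (simp add: a5_def)
                qed
                then show ?thesis using mw_Un[OF sub finite_V] J(3) by simp
              qed
              have fin: "Q (g4, a5, Suc (t2 + 2 * (?hp + ?hu + 1) + 2 + 2 * (?hp + ?hu + 1) + 2))"
              proof (rule Q)
                show "g4 y = g y" if "y \<notin> {20..28}" for y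
                proof -
                  have "y \<noteq> 25" using that by auto
                  then show ?thesis using g2[OF that] p3(1) p4(1) by simp
                qed
                show "a5 A = a A" if "A \<notin> {0, 1, 33, 35, 39, 40, 41, 42}" for A
                  using that p2(2)[of A] p3(2)[of A] p4(2)[of A] a1[of A] by (simp add: a5_def)
                show "Suc (t2 + 2 * (?hp + ?hu + 1) + 2 + 2 * (?hp + ?hu + 1) + 2) \<le>
                   t + 60 * (((?hp + 1) div (m * m) + 1) * ((?hu + 1) div m + 2) * tau m) + 20 * n"
                  using p2(4) hh r unfolding distrib_left by linarith
                have "W p = {}" "W u = {}" using We by simp_all
                have cf: "FA ?W p = {}" "FB ?W ?K ?b p = {{}}" "FG ?W ?K ?b p = {{}}"
                  by (rule closed_families; use We ne J(1) in \<open>simp add: merge_sets_def\<close>)+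
                \<comment> \<open>The open rows of p are not written: before and after the join they
                  are those of a closed node, by \<open>closed_families\<close>.\<close>
                have old: "a 30 (p * kw + 0) = mw lab I (FA W p) 0" "a 31 (p * kw + 0) = mw lab I (FB W K b p) 0"
                   "a 32 (p * kw + 0) = mw lab I (FG W K b p) 0" using Dp(2) We(2) unfolding node_ok_def by auto
                have "b p = p" using ginvD(3,5)[OF Dp(1) L(2)] We by simp
                then have "FA W p = {}" "FB W K b p = {{}}" "FG W K b p = {{}}" using closed_families[of W p b K] We(2) ne(2) by simp_all
                note old' = old[unfolded this]
                have r5: "a5 30 = a 30" "a5 31 = a 31" "a5 32 = a 32" "a5 34 = a 34" "a5 36 = a 36"
                  using p2(2) p3(2) p4(2) a1 by (simp_all add: a5_def)
                have Wp: "?W p = {}" using We by (simp add: merge_sets_def)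
                have "node_ok a5 ?W ?K ?b p"
                proof -
                  have "a 34 p = 0" using Dp(2) We(2) by (simp add: node_ok_def)
                  moreover have "a5 35 p = card (?K p)" using cK by (simp add: a5_def)
                  moreover have "\<forall>i\<le>card (?K p). a5 33 (a5 36 p * hw + i) = mw lab I (FH ?K ?b p) i" using Hnew cK r5(5) by simp
                  ultimately show ?thesis
                    unfolding node_ok_def Wp cf using old' r5 okp(2) by simp
                qed
                moreover have "node_ok a5 ?W ?K ?b w" if w: "w \<in> L" "w \<noteq> u" "w \<noteq> p" for w
                proof (rule node_ok_other[of a W K b w])
                  show "node_ok a W K b w" "card (K w) \<le> n" using tinvD(2,4)[OF T w(1)] by auto
                  show "a5 35 w = a 35 w" using av4 w(3) by (simp add: a5_def)
                  show "a5 33 (a 36 w * hw + i) = a 33 (a 36 w * hw + i)" if "i < hw" for i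
                  proof -
                    have n1: "a 36 w \<noteq> a 36 p" "a 36 w \<noteq> a 36 u" using inj w L(1,2) by (auto dest: inj_onD)
                    have "a 36 w * hw + i \<noteq> a 36 p * hw + j" if "j < ?hp + ?hu + 1" for j
                      using row_index_eq[OF \<open>i < hw\<close>, of j "a 36 w" "a 36 p"] n1 that hw by simp
                    then have "a 36 w * hw + i < a 36 p * hw \<or> a 36 p * hw + (?hp + ?hu + 1) \<le> a 36 w * hw + i"
                      by (metis le_Suc_ex nat_add_left_cancel_less not_le)
                    then show ?thesis using p3(3) av4(3) av(3) H1[OF that n1(2)] by (simp add: a5_def)
                  qed
                qed (use w r5 in \<open>simp_all add: merge_sets_def merge_gate_def\<close>)
                ultimately have "\<forall>w\<in>L - {u}. node_ok a5 ?W ?K ?b w" by blast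
                moreover have "inj_on (a5 36) (L - {u})" unfolding r5(5) using inj by (rule inj_on_subset) blast
                ultimately show "tinv a5 (L - {u}) ?W ?K ?b"
                  using ginv_merge[OF Du(1) M] ans5 unfolding tinv_def by blast
              qed
              show ?thesis
                apply (rule wp_St[where p = p and x = "?hp + ?hu"])
                using gv4 av4 sB oku(1) okp(1) apply (simp_all add: size_closed_def)[5]
                using fin by (simp only: a5_def)
            qed
            done
        qed
        done
    qed
    done
qed

end

context tree_machine
begin

text \<open>The merged open part has at most 2 r nodes and fits into the row of p. Each of the three
  naive products costs twice the product of the two sizes plus O(r), everything else is O(r). Closed
  rows are not moved.\<close>

lemma wp_merge_open:
  assumes g: "base g" "g 11 = u" "g 12 = p" and T: "tinv a L W K b" and M: "mergeable L W K u p"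
    and ex: "K u = {} \<or> K p = {}" and small: "card (W u) \<le> r" "card (W p) \<le> r"
    and Q: "\<And>g' a' t'. (\<And>y. y \<notin> {20..28} \<Longrightarrow> g' y = g y) \<Longrightarrow>
      (\<And>A. A \<notin> {30, 31, 32, 34, 35, 36, 39, 42, 43, 44} \<Longrightarrow> a' A = a A) \<Longrightarrow>
      tinv a' (L - {u}) (merge_sets p u W) (merge_sets p u K) (merge_gate p u K b) \<Longrightarrow>
      t' \<le> t + 6 * (card (W p) * card (W u)) + 300 * r \<Longrightarrow> Q (g', a', t')"
  shows "wp merge_open Q (g, a, t)"
proof -
  note L = mergeableD[OF T M]
  note Du = tinvD[OF T L(1)] and Dp = tinvD[OF T L(2)]
  note Su = families_subset[OF Du(1) L(1)] and Sp = families_subset[OF Dp(1) L(2)]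
  let ?su = "card (W u)" and ?sp = "card (W p)"
  have oku: "a 34 u = ?su" "a 35 u = card (K u)" "a 36 u < n" and okp: "a 34 p = ?sp" "a 35 p = card (K p)" "a 36 p < n"
    and rowu: "\<And>i. i \<le> ?su \<Longrightarrow> a 30 (u * kw + i) = mw lab I (FA W u) i"
      "\<And>i. i \<le> ?su \<Longrightarrow> a 31 (u * kw + i) = mw lab I (FB W K b u) i"
      "\<And>i. i \<le> ?su \<Longrightarrow> a 32 (u * kw + i) = mw lab I (FG W K b u) i"
    and rowp: "\<And>i. i \<le> ?sp \<Longrightarrow> a 30 (p * kw + i) = mw lab I (FA W p) i"
      "\<And>i. i \<le> ?sp \<Longrightarrow> a 31 (p * kw + i) = mw lab I (FB W K b p) i"
      "\<And>i. i \<le> ?sp \<Longrightarrow> a 32 (p * kw + i) = mw lab I (FG W K b p) i"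
    using Du(2) Dp(2) by (auto simp: node_ok_def)
  have ans: "\<And>i. i \<le> n \<Longrightarrow> a 39 i = mw lab I (FS L W K) i" and inj: "inj_on (a 36) L" using T by (auto simp: tinv_def)
  have gb: "g 6 = I" "g 7 = kw" using g(1) by (auto simp: base_def)
  have ss: "?sp + ?su \<le> n" using L(6) by linarith
  have sB: "?sp + ?su + 1 \<le> B" "?sp + 1 \<le> B" "?su + 1 \<le> B" "?sp + ?su \<le> B" "?sp \<le> B" "?su \<le> B" "a 36 u \<le> B" "a 36 p \<le> B"
    "card (K u) \<le> B" "card (K p) \<le> B"
    using ss oku(3) okp(3) Du(4) Dp(4) B_bounds(3) by linarith+
  let ?F = "insert {} (FA W u)"
  have SF: "?F \<subseteq> Pow (W u)" using Su(1) by blast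
  let ?Ap = "mw lab I (FA W p)" and ?A0 = "mw lab I ?F" and ?Bp = "mw lab I (FB W K b p)" and ?Bu = "mw lab I (FB W K b u)"
    and ?Gp = "mw lab I (FG W K b p)" and ?Gu = "mw lab I (FG W K b u)"
  have mI: "?Ap i \<le> I" "?A0 i \<le> I" "?Bp i \<le> I" "?Bu i \<le> I" "?Gp i \<le> I" "?Gu i \<le> I" "mw lab I (FS L W K) i \<le> I" for i
    by (rule mw_le[OF Sp(1,6)] mw_le[OF SF Su(6)] mw_le[OF Sp(2,6)] mw_le[OF Su(2,6)] mw_le[OF Sp(3,6)]
      mw_le[OF Su(3,6)] mw_le[OF Su(5) finite_V])+
  have big: "?Ap i = I" "?Bp i = I" "?Gp i = I" if "?sp + 1 \<le> i" for i
    by (rule mw_big[OF Sp(1,6)] mw_big[OF Sp(2,6)] mw_big[OF Sp(3,6)]; use that in simp)+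
  have bigu: "?A0 i = I" "?Bu i = I" "?Gu i = I" if "?su + 1 \<le> i" for i
    by (rule mw_big[OF SF Su(6)] mw_big[OF Su(2,6)] mw_big[OF Su(3,6)]; use that in simp)+
  have cvI: "cv I f h i \<le> I" for f h i by (rule cv_le)
  let ?nA = "cv I ?Ap ?A0"
  let ?nB = "\<lambda>i. min (cv I ?Bp ?A0 i) (cv I ?Ap ?Bu i)"
  let ?nG = "\<lambda>i. min (min (?nB i) (?Gp i)) (?Gu i)"
  have kw: "0 < kw" "?sp + ?su < kw" "?sp < kw" "?su < kw" using small by (simp_all add: kw_def)
  define a1 where "a1 = a(30 := (a 30)(u * kw := 0))"
  have a1: "a1 C = a C" if "C \<noteq> 30" for C using that by (simp add: a1_def)
  have up: "p * kw + i \<noteq> u * kw" if "i < kw" for i using row_index_eq[OF that kw(1), of p u] L(3) by auto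
  have R1p: "a1 30 (p * kw + i) = ?Ap i" if "i < ?sp + 1" for i
    using rowp(1)[of i] that up[of i] kw by (simp add: a1_def)
  have R1u: "a1 30 (u * kw + i) = ?A0 i" if "i < ?su + 1" for i
    using rowu(1)[of i] that mw_insert_empty[OF Su(1,6), of lab I i] by (simp add: a1_def)
  have IB: "I \<le> B" "2 * I \<le> B" by (rule B_bounds)+
  let ?l = "?sp + ?su + 1"
  have l: "?sp + 1 + (?su + 1) - 1 = ?l" by simp
  have a1v: "a1 34 = a 34" "a1 35 = a 35" "a1 36 = a 36" using a1 by simp_all
  show ?thesis
    unfolding merge_open_def Let_def wp.simps(3)
    apply (rule wp_St[where p = "u * kw" and x = 0])
    using g gb apply (simp_all add: row_def)[5]
    unfolding a1_def[symmetric]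
    apply (rule wp_tabulate[where n = ?l and p = 0 and F = "\<lambda>_. I"])
    using g gb sB a1v oku okp IB apply (simp_all add: size_open_def)[10]
    subgoal premises p2 for g2 a2
    proof -
      have v2: "g2 11 = u" "g2 12 = p" "g2 6 = I" "g2 7 = kw" "a2 34 = a 34" using p2(2,3) g gb a1v by simp_all
      show ?thesis
        apply (rule wp_tabulate[where n = ?l and p = 0 and F = "\<lambda>_. I"])
        using v2 sB oku okp IB apply (simp_all add: size_open_def)[10]
        subgoal premises p3 for g3 a3
        proof -
          have v3: "g3 11 = u" "g3 12 = p" "g3 6 = I" "g3 7 = kw" "a3 34 = a 34" "a3 30 = a1 30" "a3 31 = a 31" "a3 43 = a2 43"
            using p3(2,3) v2 p2(3) a1 by simp_all
          show ?thesis
            apply (rule wp_nconv[where p = "?sp + 1" and q = "?su + 1" and ?o1.0 = "p * kw" and ?o2.0 = "u * kw" and I = I and f = ?Ap and h = ?A0])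
            using v3 sB oku okp apply (simp_all add: size_open_def row_def)[17]
            subgoal by (rule mI)
            subgoal by (rule big)
            subgoal for i using R1p[of i] v3(6) by simp
            subgoal by (rule mI)
            subgoal by (rule bigu)
            subgoal for i using R1u[of i] v3(6) by simp
            subgoal for s using p2(5)[of s] v3(8) unfolding l by simp
            subgoal by (rule IB)
            subgoal premises p4 for g4 a4 t4
            proof -
              have v4: "g4 11 = u" "g4 12 = p" "g4 6 = I" "g4 7 = kw" "a4 34 = a 34" "a4 30 = a1 30" "a4 31 = a 31" "a4 44 = a3 44"
                using p4(1,2) v3 by simp_all
              have r43: "a4 43 s = ?nA s" if "s < ?l" for s
                using p4(3)[of s] that p2(5)[of s] v3(8) cvI[of ?Ap ?A0 s] unfolding l by simp
              show ?thesis
                apply (rule wp_nconv[where p = "?sp + 1" and q = "?su + 1" and ?o1.0 = "p * kw" and ?o2.0 = "u * kw" and I = I and f = ?Bp and h = ?A0])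
                using v4 sB oku okp apply (simp_all add: size_open_def row_def)[17]
                subgoal by (rule mI)
                subgoal by (rule big)
                subgoal for i using rowp(2)[of i] v4(7) by simp
                subgoal by (rule mI)
                subgoal by (rule bigu)
                subgoal for i using R1u[of i] v4(6) by simp
                subgoal for s using p3(5)[of s] v4(8) unfolding l by simp
                subgoal by (rule IB)
                subgoal premises p5 for g5 a5 t5
                proof -
                  have v5: "g5 11 = u" "g5 12 = p" "g5 6 = I" "g5 7 = kw" "a5 34 = a 34" "a5 30 = a1 30" "a5 31 = a 31" "a5 43 = a4 43"
                    using p5(1,2) v4 by simp_all
                  have r44: "a5 44 s = cv I ?Bp ?A0 s" if "s < ?l" for s
                    using p5(3)[of s] that p3(5)[of s] v4(8) cvI[of ?Bp ?A0 s] unfolding l by simp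
                  show ?thesis
                    apply (rule wp_nconv[where p = "?sp + 1" and q = "?su + 1" and ?o1.0 = "p * kw" and ?o2.0 = "u * kw" and I = I and f = ?Ap and h = ?Bu])
                    using v5 sB oku okp apply (simp_all add: size_open_def row_def)[17]
                    subgoal by (rule mI)
                    subgoal by (rule big)
                    subgoal for i using R1p[of i] v5(6) by simp
                    subgoal by (rule mI)
                    subgoal by (rule bigu)
                    subgoal for i using rowu(2)[of i] v5(7) by simp
                    subgoal for s using r44[of s] cvI[of ?Bp ?A0 s] unfolding l by simp
                    subgoal by (rule IB)
                    subgoal premises p6 for g6 a6 t6
                    proof -
                      have gg6: "g6 y = g y" if "y \<notin> {20..28}" for y
                      proof -
                        have "y \<noteq> 25" "y \<notin> {21, 22}" using that by auto
                        then show ?thesis using p2(2) p3(2) p4(1) p5(1) p6(1) by simp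
                      qed
                      have aa6: "a6 C = a C" if "C \<notin> {30, 43, 44}" for C
                        using that a1[of C] p2(3)[of C] p3(3)[of C] p4(2)[of C] p5(2)[of C] p6(2)[of C] by simp
                      have r6: "a6 43 s = ?nA s" "a6 44 s = ?nB s" if "s < ?l" for s
                        using r43[OF that] r44[OF that] p6(2)[of 43] v5(8) p6(3)[of s] that unfolding l by simp_all
                      have a630: "a6 30 = a1 30" using p6(2)[of 30] v5(6) by simp
                      have t6: "t6 \<le> t + 1 + 2 * (2 * ?l + 2) + 3 * (2 + (?sp + 1) * (2 * (?su + 1) + 3))"
                        using p6(4) p5(4) p4(4) by simp
                      have v6: "g6 11 = u" "g6 12 = p" "g6 7 = kw" using gg6 g gb by simp_all
                      have nBI: "?nB i \<le> I" "?nA i \<le> I" for i using cvI by (simp_all add: min.coboundedI1)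
                      show ?thesis
                        apply (rule wp_copy[where n = ?l and p = 0 and q = 0])
                        using v6 aa6 sB oku okp apply (simp_all add: size_open_def)[14]
                        subgoal for i using r6(2)[of i] nBI(1)[of i] IB by simp
                        subgoal premises p7 for g7 a7
                        proof -
                          have v7: "g7 11 = u" "g7 12 = p" "g7 7 = kw" using p7(1) v6 by simp_all
                          have aa7: "a7 34 = a 34" "a7 32 = a 32" using p7(2) aa6 by simp_all
                          have r7: "a7 42 i = ?nB i" if "i < ?l" for i using p7(4)[OF that] r6(2)[OF that] by simp
                          show ?thesis
                            apply (rule wp_min_into[where n = "?sp + 1" and p = 0 and q = "p * kw"])
                            using v7 aa7 sB oku okp apply (simp_all add: size_open_def row_def)[14]
                            subgoal for i using rowp(3)[of i] aa7(2) mI(5)[of i] IB by simp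
                            subgoal for i using r7[of i] nBI(1)[of i] IB by simp
                            subgoal premises p8 for g8 a8
                            proof -
                              have v8: "g8 11 = u" "g8 12 = p" "g8 7 = kw" using p8(1) v7 by simp_all
                              have aa8: "a8 34 = a 34" "a8 32 = a 32" using p8(2) aa7 by simp_all
                              have r8: "a8 42 i = min (?nB i) (?Gp i)" if i: "i < ?l" for i
                              proof (cases "i < ?sp + 1")
                                case True
                                then show ?thesis using p8(4)[OF True] r7[OF i] rowp(3)[of i] aa7(2) by simp
                              next
                                case False
                                then show ?thesis using p8(3)[of i] r7[OF i] big(3)[of i] nBI(1)[of i] by (simp add: min.absorb1)
                              qed
                              show ?thesis
                                apply (rule wp_min_into[where n = "?su + 1" and p = 0 and q = "u * kw"])
                                using v8 aa8 sB oku okp apply (simp_all add: size_open_def row_def)[14]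
                                subgoal for i using rowu(3)[of i] aa8(2) mI(6)[of i] IB by simp
                                subgoal for i using r8[of i] nBI(1)[of i] IB by (simp add: min.coboundedI1)
                                subgoal premises p9 for g9 a9
                                proof -
                                  have r9: "a9 42 i = ?nG i" if i: "i < ?l" for i
                                  proof (cases "i < ?su + 1")
                                    case True
                                    then show ?thesis using p9(4)[OF True] r8[OF i] rowu(3)[of i] aa8(2) by simp
                                  next
                                    case False
                                    then show ?thesis using p9(3)[of i] r8[OF i] bigu(3)[of i] nBI(1)[of i]
                                      by (simp add: min.absorb1 min.coboundedI1)
                                  qed
                                  have gg9: "g9 y = g y" if "y \<notin> {20..28}" for y
                                  proof -
                                    have "y \<noteq> 25" using that by auto
                                    then show ?thesis using gg6[OF that] p7(1) p8(1) p9(1) by simp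
                                  qed
                                  have aa9: "a9 C = a6 C" if "C \<noteq> 42" for C using that p7(2) p8(2) p9(2) by simp
                                  have v9: "g9 11 = u" "g9 12 = p" "g9 7 = kw" "a9 34 = a 34" using gg9 g gb aa9 aa6 by simp_all
                                  have r9': "a9 43 i = ?nA i" "a9 44 i = ?nB i" if "i < ?l" for i using r6[OF that] aa9 by simp_all
                                  show ?thesis
                                    apply (rule wp_copy[where n = ?l and p = "p * kw" and q = 0])
                                    using v9 sB oku okp apply (simp_all add: size_open_def row_def)[14]
                                    subgoal for i using r9'(1)[of i] nBI(2)[of i] IB by simp
                                    subgoal premises p10 for g10 a10
                                    proof -
                                      have v10: "g10 11 = u" "g10 12 = p" "g10 7 = kw" "a10 34 = a 34" "a10 44 = a9 44" "a10 42 = a9 42" "a10 43 = a9 43"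
                                        using p10(1,2) v9 by simp_all
                                      show ?thesis
                                        apply (rule wp_copy[where n = ?l and p = "p * kw" and q = 0])
                                        using v10 sB oku okp apply (simp_all add: size_open_def row_def)[14]
                                        subgoal for i using r9'(2)[of i] v10(5) nBI(1)[of i] IB by simp
                                        subgoal premises p11 for g11 a11
                                        proof -
                                          have v11: "g11 11 = u" "g11 12 = p" "g11 7 = kw" "a11 34 = a 34" "a11 42 = a9 42" "a11 43 = a9 43"
                                            using p11(1,2) v10 by simp_all
                                          show ?thesis
                                            apply (rule wp_copy[where n = ?l and p = "p * kw" and q = 0])
                                            using v11 sB oku okp apply (simp_all add: size_open_def row_def)[14]
                                            subgoal for i using r9[of i] v11(5) nBI(1)[of i] IB by (simp add: min.coboundedI1)
                                            subgoal premises p12 for g12 a12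
                                            proof -
                                              have v12: "g12 11 = u" "g12 12 = p" "a12 34 = a 34" "a12 43 = a9 43" "a12 39 = a 39"
                                                using p10(2) p11(2) p12(1,2) v11 aa9 aa6 by simp_all
                                              show ?thesis
                                                apply (rule wp_min_into[where n = ?l and p = 0 and q = 0])
                                                using v12 sB oku okp apply (simp_all add: size_open_def)[14]
                                                subgoal for i using r9'(1)[of i] v12(4) nBI(2)[of i] IB by simp
                                                subgoal for i using ans[of i] v12(5) mI(7)[of i] ss IB by simp
                                                subgoal premises p13 for g13 a13
                                                proof -
  let ?W = "merge_sets p u W" and ?K = "merge_sets p u K" and ?b = "merge_gate p u K b"
  note MF = merge_families[OF Du(1) M ex]
  have gg: "g13 y = g y" if "y \<notin> {20..28}" for y
  proof -
    have "y \<noteq> 25" using that by auto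
    then show ?thesis using gg9[OF that] p10(1) p11(1) p12(1) p13(1) by simp
  qed
  have aa: "a13 C = a C" if "C \<notin> {30, 31, 32, 39, 42, 43, 44}" for C
    using that p10(2) p11(2) p12(2) p13(2) aa9 aa6 by simp
  have W': "?W p = W p \<union> W u" "?K p = K p \<union> K u" by (simp_all add: merge_sets_def)
  have cW: "card (?W p) = ?sp + ?su" "card (?K p) = card (K p) + card (K u)"
    using L(4,5) Du(5,6) Dp(5,6) unfolding W' by (simp_all add: card_Un_disjoint Int_commute)
  have fW: "?W p \<subseteq> V" "finite (?W p)"
    using ginvD(1)[OF Du(1) L(1)] ginvD(1)[OF Du(1) L(2)] Du(5) Dp(5) unfolding W' by auto
  have Wd: "W p \<inter> W u = {}" using L(4) by blast
  have fam: "FA ?W p \<subseteq> Pow (?W p)" "FB ?W ?K ?b p \<subseteq> Pow (?W p)" "FG ?W ?K ?b p \<subseteq> Pow (?W p)" by (auto simp: FA_def FB_def FG_def)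
  have eA: "mw lab I (FA ?W p) i = ?nA i" for i unfolding MF(1) by (rule mw_fprod[OF Sp(1,6) SF Su(6) Wd])
  have eB: "mw lab I (FB ?W ?K ?b p) i = ?nB i" for i
  proof -
    have "fprod (FB W K b p) ?F \<union> fprod (FA W p) (FB W K b u) \<subseteq> Pow (?W p)" using fam(2) unfolding MF(2) .
    from mw_Un[OF this fW(2)] show ?thesis
      unfolding MF(2) using mw_fprod[OF Sp(2,6) SF Su(6) Wd] mw_fprod[OF Sp(1,6) Su(2,6) Wd] by simp
  qed
  have eG: "mw lab I (FG ?W ?K ?b p) i = ?nG i" for i
  proof -
    have s1: "FG W K b p \<union> FG W K b u \<union> FB ?W ?K ?b p \<subseteq> Pow (?W p)" using fam(3) unfolding MF(3) .
    then have s2: "FG W K b p \<union> FG W K b u \<subseteq> Pow (?W p)" by blast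
    show ?thesis unfolding MF(3) mw_Un[OF s1 fW(2)] mw_Un[OF s2 fW(2)] eB by (simp add: min.commute min.left_commute min.assoc)
  qed
  have rows: "a13 30 (p * kw + i) = ?nA i" "a13 31 (p * kw + i) = ?nB i" "a13 32 (p * kw + i) = ?nG i" if "i < ?l" for i
  proof -
    show "a13 30 (p * kw + i) = ?nA i" using p10(4)[OF that] r9'(1)[OF that] p11(2) p12(2) p13(2) by simp
    show "a13 31 (p * kw + i) = ?nB i" using p11(4)[OF that] r9'(2)[OF that] v10(5) p12(2) p13(2) by simp
    show "a13 32 (p * kw + i) = ?nG i" using p12(4)[OF that] r9[OF that] v11(5) p13(2) by simp
  qed
  have ans13: "a13 39 i = mw lab I (FS (L - {u}) ?W ?K) i" if i: "i \<le> n" for i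
  proof -
    have sub: "FS L W K \<union> FA ?W p \<subseteq> Pow V" using Su(5) fam(1) fW(1) by blast
    have "a13 39 i = min (mw lab I (FS L W K) i) (?nA i)"
    proof (cases "i < ?l")
      case True
      then show ?thesis using p13(4)[OF True] r9'(1)[OF True] v12(4,5) ans[OF i] by simp
    next
      case False
      then have "mw lab I (FA ?W p) i = I" using cW(1) by (intro mw_big[OF fam(1) fW(2)]) simp
      then show ?thesis using p13(3)[of i] False v12(5) ans[OF i] mI(7)[of i] eA[of i] by simp
    qed
    then show ?thesis unfolding MF(5) mw_Un[OF sub finite_V] eA .
  qed
  have other: "a13 30 (w * kw + i) = a 30 (w * kw + i) \<and> a13 31 (w * kw + i) = a 31 (w * kw + i) \<and> a13 32 (w * kw + i) = a 32 (w * kw + i)"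
    if w: "w \<noteq> p" "w \<noteq> u" and i: "i < kw" for w i
  proof -
    have "w * kw + i \<noteq> p * kw + j" if "j < ?l" for j
      using row_index_eq[OF i, of j w p] w(1) that kw by simp
    then have o: "w * kw + i < p * kw \<or> p * kw + ?l \<le> w * kw + i"
      by (metis le_Suc_ex nat_add_left_cancel_less not_le)
    have "w * kw + i \<noteq> u * kw" using row_index_eq[OF i kw(1), of w u] w(2) by auto
    then have "a1 30 (w * kw + i) = a 30 (w * kw + i)" by (simp add: a1_def)
    then show ?thesis using p10(2) p10(3)[OF o] p11(2) p11(3)[OF o] p12(2) p12(3)[OF o] p13(2) aa9 aa6 a630 by simp
  qed
  \<comment> \<open>Stated for every array state that differs from \<open>a13\<close> only in sizes
    and handles, so as to serve both outcomes of the last test: p takes over the closed part of u,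
    or keeps its own.\<close>
  have final: "tinv a' (L - {u}) ?W ?K ?b" if a': "\<And>C. C \<notin> {34, 35, 36} \<Longrightarrow> a' C = a13 C"
     "a' 34 p = ?sp + ?su" "\<And>w. w \<noteq> p \<Longrightarrow> a' 34 w = a 34 w" "a' 35 p = card (?K p)" "\<And>w. w \<noteq> p \<Longrightarrow> a' 35 w = a 35 w"
     "a' 36 p = a 36 (if K p = {} then u else p)" "\<And>w. w \<noteq> p \<Longrightarrow> a' 36 w = a 36 w" for a'
  proof -
    have r': "a' 30 = a13 30" "a' 31 = a13 31" "a' 32 = a13 32" "a' 33 = a 33" "a' 39 = a13 39" using a'(1) aa by simp_all
    have "node_ok a' ?W ?K ?b p"
    proof -
      have "a' 33 (a' 36 p * hw + i) = mw lab I (FH ?K ?b p) i" if i: "i \<le> card (?K p)" for i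
      proof (cases "K p = {}")
        case True
        then have e: "FH ?K ?b p = FH K b u"
          unfolding MF(4) by (auto simp: FH_def)
        have "i \<le> card (K u)" using i cW(2) True by simp
        then have "a 33 (a 36 u * hw + i) = mw lab I (FH K b u) i" using Du(2) by (simp add: node_ok_def)
        then show ?thesis using True a'(6) r'(4) unfolding e by simp
      next
        case False
        then have Ku: "K u = {}" using ex by blast
        then have "i \<le> card (K p)" using i cW(2) by simp
        then have "a 33 (a 36 p * hw + i) = mw lab I (FH K b p) i" using Dp(2) by (simp add: node_ok_def)
        then show ?thesis using False Ku a'(6) r'(4) unfolding MF(4) by simp
      qed
      moreover have "a' 36 p < n" using a'(6) oku(3) okp(3) by simp
      ultimately show ?thesis
        unfolding node_ok_def using a'(2,4) cW(1) small rows eA eB eG r' by simp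
    qed
    moreover have "node_ok a' ?W ?K ?b w" if w: "w \<in> L" "w \<noteq> u" "w \<noteq> p" for w
    proof (rule node_ok_other[of a W K b w])
      show "node_ok a W K b w" "card (K w) \<le> n" using tinvD(2,4)[OF T w(1)] by auto
      show "a' 30 (w * kw + i) = a 30 (w * kw + i) \<and> a' 31 (w * kw + i) = a 31 (w * kw + i) \<and> a' 32 (w * kw + i) = a 32 (w * kw + i)"
        if "i < kw" for i using other[OF w(3,2) that] r' by simp
    qed (use w a' r' in \<open>simp_all add: merge_sets_def merge_gate_def\<close>)
    ultimately have "\<forall>w\<in>L - {u}. node_ok a' ?W ?K ?b w" by blast
    \<comment> \<open>The handle of p may be the former one of u. As u is gone, no other remaining
      node has it.\<close>
    moreover have "inj_on (a' 36) (L - {u})"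
    proof (rule inj_onI)
      fix x y assume xy: "x \<in> L - {u}" "y \<in> L - {u}" "a' 36 x = a' 36 y"
      let ?q = "if K p = {} then u else p"
      have q: "?q \<in> L" using L by simp
      show "x = y"
        using xy a'(6,7) inj_onD[OF inj, of x y] inj_onD[OF inj, of ?q y] inj_onD[OF inj, of x ?q] q L(1,2)
        by (cases "x = p"; cases "y = p") (auto split: if_splits)
    qed
    moreover have "\<forall>i\<le>n. a' 39 i = mw lab I (FS (L - {u}) ?W ?K) i" using ans13 r'(5) by simp
    ultimately show ?thesis using ginv_merge[OF Du(1) M] unfolding tinv_def by blast
  qed
  have T: "t6 + 2 * ?l + 2 + 2 * (?sp + 1) + 2 + 2 * (?su + 1) + 2 + 2 * ?l + 2 + 2 * ?l + 2 + 2 * ?l + 2 + 2 * ?l + 2 + 4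
      \<le> t + 6 * (?sp * ?su) + 300 * r"
  proof -
    have "(?sp + 1) * (2 * (?su + 1) + 3) = 2 * (?sp * ?su) + 5 * ?sp + 2 * ?su + 5" by (simp add: algebra_simps)
    then show ?thesis using t6 small r(1) unfolding distrib_left by linarith
  qed
  have v13: "g13 11 = u" "g13 12 = p" "a13 34 = a 34" "a13 35 = a 35" "a13 36 = a 36" using gg g aa by simp_all
  have out: "A \<notin> {30, 31, 32, 34, 35, 36, 39, 42, 43, 44} \<Longrightarrow> a13 A = a A" for A using aa[of A] by simp
  show ?thesis
    apply (rule wp_St[where p = p and x = "?sp + ?su"])
    using v13 sB oku okp apply (simp_all add: size_open_def)[5]
  proof (cases "card (K p) < 1")
    case True
    then have Kp: "K p = {}" using Dp(6) by simp
    show "wp (Ite (size_closed 12) (N 1) (Seq (St 36 (aexp.V 12) (Rd 36 (aexp.V 11))) (St 35 (aexp.V 12) (size_closed 11))) (Asg 28 (N 0))) Q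
      (g13, a13(34 := (a13 34)(p := ?sp + ?su)), Suc (t6 + 2 * ?l + 2 + 2 * (?sp + 1) + 2 + 2 * (?su + 1) + 2 + 2 * ?l + 2 + 2 * ?l + 2 + 2 * ?l + 2 + 2 * ?l + 2))"
      using v13 oku okp sB True apply (simp add: size_closed_def)
      apply (rule Q)
      subgoal by (rule gg)
      subgoal for A using out[of A] by simp
      subgoal by (rule final) (use v13 cW(2) Kp in \<open>simp_all\<close>)
      subgoal using T by simp
      done
  next
    case False
    then have Kp: "K p \<noteq> {}" by auto
    then have Ku: "K u = {}" using ex by blast
    show "wp (Ite (size_closed 12) (N 1) (Seq (St 36 (aexp.V 12) (Rd 36 (aexp.V 11))) (St 35 (aexp.V 12) (size_closed 11))) (Asg 28 (N 0))) Q
      (g13, a13(34 := (a13 34)(p := ?sp + ?su)), Suc (t6 + 2 * ?l + 2 + 2 * (?sp + 1) + 2 + 2 * (?su + 1) + 2 + 2 * ?l + 2 + 2 * ?l + 2 + 2 * ?l + 2 + 2 * ?l + 2))"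
      using v13 oku okp sB False apply (simp add: size_closed_def)
      apply (rule Q)
      subgoal for y using gg[of y] by auto
      subgoal for A using out[of A] by simp
      subgoal by (rule final) (use v13 cW(2) okp Kp Ku in \<open>simp_all\<close>)
      subgoal using T by simp
      done
  qed
                                                qed
                                                done
                                            qed
                                            done
                                        qed
                                        done
                                    qed
                                    done
                                qed
                                done
                            qed
                            done
                        qed
                        done
                    qed
                    done
                qed
                done
            qed
            done
        qed
        done
    qed
    done
qed

end

section \<open>Amortised cost of one contraction\<close>

definition tree_step :: com where
  "tree_step = Ite (N 0) (Times (size_closed 11) (size_closed 12))
    (Seq (Asg 10 (V 11)) (Seq close (Seq (Asg 10 (V 12)) (Seq close join))))
    (Seq merge_open (Ite (V 3) (size_open 12) (Seq (Asg 10 (V 12)) close) (Asg 28 (N 0))))"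

context tree_machine
begin

text \<open>
  Every node contracted into v pays for the naive products (first term), for the closing of open
  parts and for joins (second term); joins of two closed parts are paid by the growth of the sum of
  the squares of the sizes of the closed parts.
\<close>

definition rho :: real where "rho = real (tau m) / real m ^ 3"
definition pot1 :: "nat \<Rightarrow> nat \<Rightarrow> real" where
  "pot1 s h = 3 * (2 * real r * real s - real s * real s) + 13000 * real n * rho * (3 * real s + 2 * real r * of_bool (0 < h)) -
     1500 * rho * (real h * real h)"
definition pot :: "nat set \<Rightarrow> (nat \<Rightarrow> nat set) \<Rightarrow> (nat \<Rightarrow> nat set) \<Rightarrow> real" where
  "pot L W K = (\<Sum>v\<in>L. pot1 (card (W v)) (card (K v)))"

definition good :: "nat set \<Rightarrow> (nat \<Rightarrow> nat set) \<Rightarrow> (nat \<Rightarrow> nat set) \<Rightarrow> bool" where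
  "good L W K \<longleftrightarrow> (\<forall>v\<in>L. card (W v) \<le> r \<and> (0 < card (K v) \<longrightarrow> r < card (K v)))"

lemma rho_nonneg: "0 \<le> rho" and tau_rho: "real (tau m) = rho * real m ^ 3"
  using m_bounds(1) by (auto simp: rho_def)

text \<open>From tau m \<ge> m * m one gets rho * m \<ge> 1, and m is at most r. Consequently work
  linear in n is dominated by n r rho, the order of one closing.\<close>

lemma r_rho: "1 \<le> real r * rho"
proof -
  have "real (m * m) \<le> real (tau m)" using tau_ge by (simp only: of_nat_le_iff)
  then have "real m * real m \<le> rho * real m ^ 3" using tau_rho by simp
  then have "(real m * real m) * 1 \<le> (real m * real m) * (rho * real m)" by (simp add: power3_eq_cube ac_simps)
  then have "1 \<le> rho * real m" using m_bounds(1) by (subst (asm) mult_le_cancel_left_pos) auto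
  also have "\<dots> \<le> rho * real r" using rho_nonneg m_bounds(2) by (intro mult_left_mono) auto
  finally show ?thesis by (simp add: mult.commute)
qed

text \<open>The constant is 4 * 4 * 4: the number of blocks, the bound 4 n for the number of shifts
  times m, and the bound 4 r for m * m.\<close>

lemma conv_time_rho: "real conv_time \<le> 64 * (real n * real r * rho)"
proof -
  have "((n + 1) div m + 2) * m \<le> 4 * n"
  proof -
    have "(n + 1) div m * m \<le> n + 1" by (rule div_times_less_eq_dividend)
    then show ?thesis using m_bounds(5) r unfolding distrib_right by linarith
  qed
  then have a: "real ((n + 1) div m + 2) * real m \<le> 4 * real n" by (metis of_nat_le_iff of_nat_mult of_nat_numeral)
  have b: "real m * real m \<le> 4 * real r" using m_bounds(4) by (metis of_nat_le_iff of_nat_mult of_nat_numeral)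
  have "real conv_time = 4 * (real ((n + 1) div m + 2) * real m) * (real m * real m) * rho"
    unfolding conv_time_def of_nat_mult tau_rho by (simp add: power3_eq_cube ac_simps)
  also have "\<dots> \<le> 4 * (4 * real n) * (4 * real r) * rho"
    by (rule mult_right_mono[OF mult_mono[OF mult_left_mono[OF a] b]]) (use rho_nonneg in simp_all)
  finally show ?thesis by (simp add: ac_simps)
qed

lemma n_rho: "real n \<le> real n * real r * rho"
  using mult_left_mono[OF r_rho, of "real n"] by (simp add: mult.assoc)

text \<open>Rounding up to whole blocks adds at most m * m \<le> 4 r to the first length, and the
  additional shifts add 2 m to the second. Because both closed parts have more than r nodes, these
  terms can be charged to the parts themselves.\<close>

lemma join_time_rho:
  assumes "r < hp" "r < hu"
  shows "real (((hp + 1) div (m * m) + 1) * ((hu + 1) div m + 2) * tau m) \<le> 24 * rho * (real hp * real hu)"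
proof -
  have "((hp + 1) div (m * m) + 1) * (m * m) \<le> 6 * hp"
  proof -
    have "(hp + 1) div (m * m) * (m * m) \<le> hp + 1" by (rule div_times_less_eq_dividend)
    then show ?thesis using m_bounds(4) assms(1) unfolding distrib_right[of _ 1] by linarith
  qed
  then have a: "real ((hp + 1) div (m * m) + 1) * (real m * real m) \<le> 6 * real hp" by (metis of_nat_le_iff of_nat_mult of_nat_numeral)
  have "((hu + 1) div m + 2) * m \<le> 4 * hu"
  proof -
    have "(hu + 1) div m * m \<le> hu + 1" by (rule div_times_less_eq_dividend)
    then show ?thesis using m_bounds(2) assms(2) unfolding distrib_right by linarith
  qed
  then have b: "real ((hu + 1) div m + 2) * real m \<le> 4 * real hu" by (metis of_nat_le_iff of_nat_mult of_nat_numeral)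
  have "real (((hp + 1) div (m * m) + 1) * ((hu + 1) div m + 2) * tau m) =
      (real ((hp + 1) div (m * m) + 1) * (real m * real m)) * (real ((hu + 1) div m + 2) * real m) * rho"
    unfolding of_nat_mult tau_rho by (simp add: power3_eq_cube ac_simps)
  also have "\<dots> \<le> (6 * real hp) * (4 * real hu) * rho"
    by (rule mult_right_mono[OF mult_mono[OF a b]]) (use rho_nonneg in simp_all)
  finally show ?thesis by (simp add: ac_simps)
qed

lemma open_part_nonneg: "s \<le> 2 * r \<Longrightarrow> 0 \<le> 2 * real r * real s - real s * real s"
proof -
  assume "s \<le> 2 * r"
  then have "real s \<le> 2 * real r" by simp
  then have "real s * real s \<le> (2 * real r) * real s" by (intro mult_right_mono) auto
  then show ?thesis by simp
qed

lemma pot1_close_eqs: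
  shows "0 < s + h \<Longrightarrow> pot1 0 (s + h) = 26000 * (real n * real r * rho) - 1500 * (rho * (real (s + h) * real (s + h)))"
    "pot1 s h = 3 * (2 * real r * real s - real s * real s) + 39000 * (real n * real s * rho) +
       26000 * (real n * real r * rho) * of_bool (0 < h) - 1500 * (rho * (real h * real h))"
  by (simp_all add: pot1_def algebra_simps)

text \<open>The part is closed already and keeps its credit, the contribution of its open nodes is
  nonnegative and given up, and the square enters negatively. So closings in preparation of a join
  do not raise the potential.\<close>

lemma pot1_close_any:
  assumes "s \<le> 2 * r" "0 < h"
  shows "pot1 0 (s + h) \<le> pot1 s h"
proof -
  have aux: "P \<le> P'" if "P = 26000 * x - 1500 * z" "P' = 3 * y + 39000 * u + 26000 * x * 1 - 1500 * z'" "z' \<le> z" "0 \<le> u" "0 \<le> y"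
    for P P' x y z z' u :: real using that by linarith
  have z: "rho * (real h * real h) \<le> rho * (real (s + h) * real (s + h))"
    by (intro mult_left_mono[OF mult_mono] rho_nonneg) auto
  have u: "0 \<le> real n * real s * rho" using rho_nonneg by simp
  have h: "0 < s + h" "of_bool (0 < h) = (1::real)" using assms(2) by simp_all
  show ?thesis by (rule aux[OF pot1_close_eqs(1)[OF h(1)] pot1_close_eqs(2)[of s h, unfolded h(2)] z u open_part_nonneg[OF assms(1)]])
qed

text \<open>More than r open nodes bring at least 39000 n r rho. Of this, 26000 n r rho become the
  credit of the closed part, and 13000 n r rho are released for the closing itself.\<close>

lemma pot1_close_big:
  assumes "s \<le> 2 * r" "r < s"
  shows "pot1 0 (s + h) + 13000 * (real n * real r * rho) \<le> pot1 s h"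
proof -
  have aux: "P + 13000 * x \<le> P'" if "P = 26000 * x - 1500 * z" "P' = 3 * y + 39000 * u + w - 1500 * z'" "z' \<le> z" "x \<le> u" "0 \<le> w" "0 \<le> y"
    for P P' x y z z' u w :: real using that by linarith
  have z: "rho * (real h * real h) \<le> rho * (real (s + h) * real (s + h))"
    by (intro mult_left_mono[OF mult_mono] rho_nonneg) auto
  have u: "real n * real r * rho \<le> real n * real s * rho"
    by (intro mult_right_mono mult_left_mono rho_nonneg) (use assms(2) in auto)
  have w: "0 \<le> 26000 * (real n * real r * rho) * of_bool (0 < h)" using rho_nonneg by simp
  have h: "0 < s + h" using assms(2) by simp
  show ?thesis by (rule aux[OF pot1_close_eqs(1)[OF h] pot1_close_eqs(2) z u w open_part_nonneg[OF assms(1)]])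
qed

text \<open>The term - 3 s^2 falls by 6 s s', which is the leading cost of the three naive
  products.\<close>

lemma pot1_merge_open:
  assumes "h = 0 \<or> h' = 0"
  shows "pot1 (s + s') (h + h') + 6 * (real s * real s') = pot1 s h + pot1 s' h'"
  using assms unfolding pot1_def by (auto simp: algebra_simps)

text \<open>Two closed parts become one. The credit of the other is released and pays for the two
  closings before the join, and the square term falls by 3000 rho h h', which pays for the
  convolution.\<close>

lemma pot1_join:
  assumes "0 < h" "0 < h'"
  shows "pot1 0 (h + h') + 26000 * (real n * real r * rho) + 3000 * rho * (real h * real h') = pot1 0 h + pot1 0 h'"
  using assms unfolding pot1_def by (simp add: algebra_simps)

lemma pot_close:
  assumes "finite L" "v \<in> L"
  shows "pot L (W(v := {})) (K(v := W v \<union> K v)) = pot L W K - pot1 (card (W v)) (card (K v)) + pot1 0 (card (W v \<union> K v))"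
proof -
  have "pot L f h = pot1 (card (f v)) (card (h v)) + (\<Sum>w\<in>L - {v}. pot1 (card (f w)) (card (h w)))" for f h
    unfolding pot_def by (rule sum.remove[OF assms])
  moreover have "(\<Sum>w\<in>L - {v}. pot1 (card ((W(v := {})) w)) (card ((K(v := W v \<union> K v)) w))) =
      (\<Sum>w\<in>L - {v}. pot1 (card (W w)) (card (K w)))" by (rule sum.cong) auto
  ultimately show ?thesis by simp
qed

lemma pot_merge:
  assumes "finite L" "u \<in> L" "p \<in> L" "u \<noteq> p"
  shows "pot (L - {u}) (merge_sets p u W) (merge_sets p u K) =
    pot L W K - pot1 (card (W u)) (card (K u)) - pot1 (card (W p)) (card (K p)) + pot1 (card (W p \<union> W u)) (card (K p \<union> K u))"
proof -
  let ?f = "\<lambda>W K w. pot1 (card (W w)) (card (K w))"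
  have "pot L W K = ?f W K u + (?f W K p + (\<Sum>w\<in>L - {u} - {p}. ?f W K w))"
    unfolding pot_def using assms by (simp add: sum.remove[of L u] sum.remove[of "L - {u}" p])
  moreover have "pot (L - {u}) (merge_sets p u W) (merge_sets p u K) = ?f (merge_sets p u W) (merge_sets p u K) p +
      (\<Sum>w\<in>L - {u} - {p}. ?f (merge_sets p u W) (merge_sets p u K) w)"
    unfolding pot_def using assms by (simp add: sum.remove[of "L - {u}" p])
  moreover have "(\<Sum>w\<in>L - {u} - {p}. ?f (merge_sets p u W) (merge_sets p u K) w) = (\<Sum>w\<in>L - {u} - {p}. ?f W K w)"
    by (rule sum.cong) (auto simp: merge_sets_def)
  ultimately show ?thesis by (simp add: merge_sets_def)
qed

text \<open>The factor is 200 * 64 from \<open>conv_time_rho\<close>, plus 1 for the additional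
  tick.\<close>

lemma close_cost:
  "real t' \<le> real t + 1 + 200 * real conv_time \<Longrightarrow> real t' \<le> real t + 12801 * (real n * real r * rho)"
  using conv_time_rho n_rho r by (smt (verit) of_nat_1 of_nat_mono)

text \<open>If both nodes have closed parts, both open parts are closed, whatever their size, and
  the closed parts are joined. Otherwise the open parts are merged and the result is closed if it
  exceeds r. In both cases the increase of the clock is covered by the decrease of the potential, up
  to O(r) for the contraction itself.\<close>

lemma wp_tree_step:
  assumes g: "base g" "g 11 = u" "g 12 = p" and T: "tinv a L W K b" and G: "good L W K"
    and up: "u \<in> L" "p \<in> L" "u \<noteq> p" "nbrs L u = {p}"
    and Q: "\<And>g' a' t' W' K' b'. (\<And>y. y \<notin> insert 10 {20..28} \<Longrightarrow> g' y = g y) \<Longrightarrow>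
      (\<And>A. A \<notin> {0, 1, 30, 31, 32, 33, 34, 35, 36, 39, 40, 41, 42, 43, 44} \<Longrightarrow> a' A = a A) \<Longrightarrow>
      tinv a' (L - {u}) W' K' b' \<Longrightarrow> good (L - {u}) W' K' \<Longrightarrow>
      real t' + pot (L - {u}) W' K' \<le> real t + pot L W K + 310 * real r \<Longrightarrow> Q (g', a', t')"
  shows "wp tree_step Q (g, a, t)"
proof -
  note Du = tinvD[OF T up(1)] and Dp = tinvD[OF T up(2)]
  have "L \<subseteq> V" using ginvD(1,3)[OF Du(1)] by blast
  then have fL: "finite L" using finite_V finite_subset by blast
  have sz: "a 35 u = card (K u)" "a 35 p = card (K p)" using Du(2) Dp(2) by (auto simp: node_ok_def)
  have szB: "card (K u) \<le> B" "card (K p) \<le> B" "u \<le> B" "p \<le> B" "r \<le> B"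
    using Du(3,4) Dp(3,4) B_bounds(3) r by linarith+
  have "card (K u) * card (K p) \<le> n * n" using Du(4) Dp(4) by (intro mult_le_mono) linarith+
  then have szP: "card (K u) * card (K p) \<le> B" using B_bounds(4) by linarith
  have b3: "g 3 = r" using g by (simp add: base_def)
  have baseI: "base g'" if "\<And>y. y \<notin> insert 10 {20..28} \<Longrightarrow> g' y = g y" for g' using g(1) that by (simp add: base_def)
  have disj: "W v \<inter> K v = {}" "finite (W v)" "finite (K v)" if "v \<in> L" for v
    using ginvD(2)[OF Du(1) that] tinvD(5,6)[OF T that] by auto
  have Gu: "card (W u) \<le> r" "0 < card (K u) \<Longrightarrow> r < card (K u)" and Gp: "card (W p) \<le> r" "0 < card (K p) \<Longrightarrow> r < card (K p)"
    using G up by (auto simp: good_def)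
  show ?thesis
  proof (cases "0 < card (K u) * card (K p)")
    case True
    then have ne: "K u \<noteq> {}" "K p \<noteq> {}" "0 < card (K u)" "0 < card (K p)" by auto
    show ?thesis
      unfolding tree_step_def
      apply (simp add: size_closed_def g sz szB ne(3,4) szP)
      apply (rule wp_close[where v = u and L = L and W = W and K = K and b = b])
      subgoal by (rule baseI) simp
      subgoal by simp
      subgoal by (rule T)
      subgoal by (rule up(1))
      subgoal premises p1 for g1 a1 t1
      proof -
        let ?W1 = "W(u := {})" and ?K1 = "K(u := W u \<union> K u)" and ?b1 = "b(u := u)"
        have g1: "g1 y = g y" if "y \<notin> insert 10 {20..28}" for y using p1(1)[of y] that by (simp del: atLeastAtMost_iff)
        have gv: "g1 12 = p" using g1 g by simp
        show ?thesis
          apply (simp add: gv szB)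
          apply (rule wp_close[where v = p and L = L and W = ?W1 and K = ?K1 and b = ?b1])
          subgoal by (rule baseI) (use g1 in \<open>simp del: atLeastAtMost_iff\<close>)
          subgoal by simp
          subgoal by (rule p1(3))
          subgoal by (rule up(2))
          subgoal premises p2 for g2 a2 t2
          proof -
            let ?W2 = "?W1(p := {})" and ?K2 = "?K1(p := ?W1 p \<union> ?K1 p)" and ?b2 = "?b1(p := p)"
            have g2: "g2 y = g y" if "y \<notin> insert 10 {20..28}" for y
              using p2(1)[of y] g1[OF that] that by (simp del: atLeastAtMost_iff)
            have K2: "?K2 u = W u \<union> K u" "?K2 p = W p \<union> K p" "?W2 u = {}" "?W2 p = {}" using up(3) by auto
            have M: "mergeable L ?W2 ?K2 u p" using up by (auto simp: mergeable_def)
            have c: "card (?K2 u) = card (W u) + card (K u)" "card (?K2 p) = card (W p) + card (K p)"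
              using disj[OF up(1)] disj[OF up(2)] unfolding K2 by (simp_all add: card_Un_disjoint)
            have rc: "r < card (?K2 p)" "r < card (?K2 u)" using c Gu(2) Gp(2) ne by simp_all
            show ?thesis
              apply (rule wp_join[where u = u and p = p and L = L and W = ?W2 and K = ?K2 and b = ?b2])
              subgoal by (rule baseI) (rule g2)
              subgoal using g2 g by simp
              subgoal using g2 g by simp
              subgoal by (rule p2(3))
              subgoal by (rule M)
              subgoal using ne up(3) by auto
              subgoal using ne by auto
              subgoal using up(3) by simp
              subgoal by simp
              subgoal premises p3 for g3 a3 t3
              proof (rule Q)
                show "g3 y = g y" if "y \<notin> insert 10 {20..28}" for y using p3(1)[of y] g2[OF that] that by simp
                show "a3 A = a A" if "A \<notin> {0, 1, 30, 31, 32, 33, 34, 35, 36, 39, 40, 41, 42, 43, 44}" for A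
                  using that p3(2)[of A] p2(2)[of A] p1(2)[of A] by simp
                show "tinv a3 (L - {u}) (merge_sets p u ?W2) (merge_sets p u ?K2) (merge_gate p u ?K2 ?b2)" by (rule p3(3))
                have K2d: "?K2 p \<inter> ?K2 u = {}" "finite (?K2 p)" "finite (?K2 u)"
                  using ginvD2(1)[OF Du(1) up(1-3)] disj[OF up(1)] disj[OF up(2)] unfolding K2 by auto
                have cm: "card (?K2 p \<union> ?K2 u) = card (?K2 p) + card (?K2 u)" by (rule card_Un_disjoint[OF K2d(2,3,1)])
                show "good (L - {u}) (merge_sets p u ?W2) (merge_sets p u ?K2)"
                proof -
                  have "card (merge_sets p u ?W2 w) \<le> r \<and> (0 < card (merge_sets p u ?K2 w) \<longrightarrow> r < card (merge_sets p u ?K2 w))"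
                    if w: "w \<in> L - {u}" for w
                  proof (cases "w = p")
                    case True
                    have "merge_sets p u ?W2 p = {}" "merge_sets p u ?K2 p = ?K2 p \<union> ?K2 u"
                      using K2(3,4) by (simp_all add: merge_sets_def)
                    then show ?thesis using True cm rc by (simp only: card.empty) linarith
                  next
                    case False
                    then show ?thesis using w G by (simp add: merge_sets_def good_def)
                  qed
                  then show ?thesis unfolding good_def by blast
                qed
                have P1: "pot (L - {u}) (merge_sets p u ?W2) (merge_sets p u ?K2) =
                    pot L ?W2 ?K2 - pot1 0 (card (?K2 u)) - pot1 0 (card (?K2 p)) + pot1 0 (card (?K2 p) + card (?K2 u))"
                  using pot_merge[OF fL up(1-3), of ?W2 ?K2] cm unfolding K2(3,4) by simp
                have P2: "pot L ?W2 ?K2 \<le> pot L W K"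
                proof -
                  have "pot L ?W2 ?K2 \<le> pot L ?W1 ?K1"
                    using pot_close[OF fL up(2), of ?W1 ?K1] pot1_close_any[of "card (W p)" "card (K p)"] c Gp(1) ne(4) K2(2) up(3)
                    by simp
                  also have "\<dots> \<le> pot L W K"
                    using pot_close[OF fL up(1), of W K] pot1_close_any[of "card (W u)" "card (K u)"] c Gu(1) ne(3) K2(1) by simp
                  finally show ?thesis .
                qed
                have rc0: "0 < card (?K2 p)" "0 < card (?K2 u)" using rc by linarith+
                have P: "pot (L - {u}) (merge_sets p u ?W2) (merge_sets p u ?K2) + 26000 * (real n * real r * rho) +
                    3000 * rho * (real (card (?K2 p)) * real (card (?K2 u))) \<le> pot L W K"
                  using pot1_join[OF rc0] P1 P2 by linarith
                \<comment> \<open>The convolution of a join takes 60 ticks per unit and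
                  \<open>join_time_rho\<close> gives the factor 24; the product 1440 is below
                  3000.\<close>
                have J: "60 * real (((card (?K2 p) + 1) div (m * m) + 1) * ((card (?K2 u) + 1) div m + 2) * tau m) \<le>
                    3000 * rho * (real (card (?K2 p)) * real (card (?K2 u)))"
                proof -
                  have "0 \<le> rho * (real (card (?K2 p)) * real (card (?K2 u)))" using rho_nonneg by simp
                  then show ?thesis using join_time_rho[OF rc] by simp
                qed
                have "real t3 \<le> real t2 + 60 * real (((card (?K2 p) + 1) div (m * m) + 1) * ((card (?K2 u) + 1) div m + 2) * tau m) + 20 * real n"
                proof -
                  have "real t3 \<le> real (t2 + 60 * (((card (?K2 p) + 1) div (m * m) + 1) * ((card (?K2 u) + 1) div m + 2) * tau m) + 20 * n)"
                    using p3(4) by (simp only: of_nat_le_iff)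
                  then show ?thesis by simp
                qed
                then have t3: "real t3 \<le> real t2 + 60 * real (((card (?K2 p) + 1) div (m * m) + 1) * ((card (?K2 u) + 1) div m + 2) * tau m) + 20 * real n" .
                have "real t2 \<le> real t1 + 1 + 200 * real conv_time" using p2(4) by linarith
                then have t2: "real t2 \<le> real t1 + 12801 * (real n * real r * rho)" by (rule close_cost)
                have "real t1 \<le> real t + 2 + 200 * real conv_time" using p1(4) by linarith
                then have t1: "real t1 \<le> real t + 1 + 12801 * (real n * real r * rho)" using close_cost[of t1 "t + 1"] by simp
                have r1: "1 \<le> real r" using r by simp
                \<comment> \<open>Here X is n r rho. Two closings at 12801 X and linear work of at
                  most 20 X stay below the released credit 26000 X; Z pays for the
                  convolution.\<close>
                have aux: "x3 + q \<le> x0 + q0 + 310 * rr"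
                  if "x3 \<le> x2 + 60 * c + 20 * nn" "x2 \<le> x1 + 12801 * X" "x1 \<le> x0 + 1 + 12801 * X" "q + 26000 * X + Z \<le> q0"
                    "60 * c \<le> Z" "nn \<le> X" "1 \<le> rr" "0 \<le> nn" for x0 x1 x2 x3 q q0 c nn X Z rr :: real
                  using that by linarith
                show "real t3 + pot (L - {u}) (merge_sets p u ?W2) (merge_sets p u ?K2) \<le> real t + pot L W K + 310 * real r"
                  by (rule aux[OF t3 t2 t1 P J n_rho r1 of_nat_0_le_iff])
              qed
              done
          qed
          done
      qed
      done
  next
    case False
    have ex: "K u = {} \<or> K p = {}" "card (K p) = 0 \<or> card (K u) = 0" using False Du(6) Dp(6) by auto
    have skip: "wp (Ite (N 0) (Times (size_closed 11) (size_closed 12)) c1 c2) Q (g, a, t)" if "wp c2 Q (g, a, Suc t)" for c1 c2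
      using ex(2) that by (elim disjE) (simp_all add: size_closed_def g sz szB)
    let ?W = "merge_sets p u W" and ?K = "merge_sets p u K" and ?b = "merge_gate p u K b"
    have M: "mergeable L W K u p" using up ex by (auto simp: mergeable_def)
    note MD = mergeableD(4,5)[OF T M]
    have c: "card (?W p) = card (W p) + card (W u)" "card (?K p) = card (K p) + card (K u)"
      using MD disj[OF up(1)] disj[OF up(2)] by (simp_all add: merge_sets_def card_Un_disjoint Int_commute)
    have P: "pot (L - {u}) ?W ?K + 6 * (real (card (W p)) * real (card (W u))) = pot L W K"
      using pot_merge[OF fL up(1-3), of W K] pot1_merge_open[OF ex(2), of "card (W p)" "card (W u)"] c
      by (simp add: merge_sets_def)
    have Gm: "r < card (?K p)" if "0 < card (?K p)" using that c(2) Gu(2) Gp(2) by linarith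
    show ?thesis
      unfolding tree_step_def
      apply (rule skip)
      apply simp
      apply (rule wp_merge_open[where u = u and p = p and L = L and W = W and K = K and b = b])
      subgoal by (rule g(1))
      subgoal by (rule g(2))
      subgoal by (rule g(3))
      subgoal by (rule T)
      subgoal by (rule M)
      subgoal by (rule ex(1))
      subgoal by (rule Gu(1))
      subgoal by (rule Gp(1))
      subgoal premises p1 for g1 a1 t1
      proof -
        have g1: "g1 12 = p" "g1 3 = r" using p1(1) g b3 by simp_all
        have pL: "p \<in> L - {u}" using up by blast
        note N = tinvD[OF p1(3) pL]
        have s: "a1 34 p = card (?W p)" "card (?W p) \<le> 2 * r" using N(2) by (auto simp: node_ok_def)
        have sB: "card (?W p) \<le> B" using N(4) B_bounds(3) by linarith
        have t1: "real t1 \<le> real t + 1 + 6 * (real (card (W p)) * real (card (W u))) + 300 * real r"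
        proof -
          have "real t1 \<le> real (Suc t + 6 * (card (W p) * card (W u)) + 300 * r)" using p1(4) by (simp only: of_nat_le_iff)
          then show ?thesis by simp
        qed
        have r1: "1 \<le> real r" using r by simp
        show ?thesis
        proof (cases "r < card (?W p)")
          case False
          show ?thesis
            apply (simp add: size_open_def g1 s(1) sB False)
            apply (rule Q[where W' = ?W and K' = ?K and b' = ?b])
            subgoal for y using p1(1)[of y] by auto
            subgoal for A using p1(2)[of A] by simp
            subgoal by (rule p1(3))
            subgoal
            proof -
              have "card (?W w) \<le> r \<and> (0 < card (?K w) \<longrightarrow> r < card (?K w))" if w: "w \<in> L - {u}" for w
              proof (cases "w = p")
                case True
                then show ?thesis using False Gm by simp
              next
                case False
                then show ?thesis using w G by (simp add: merge_sets_def good_def)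
              qed
              then show "good (L - {u}) ?W ?K" unfolding good_def by blast
            qed
            subgoal using P t1 r1 by (simp | (simp only: of_nat_Suc; linarith))
            done
        next
          case True
          show ?thesis
            apply (simp add: size_open_def g1 s(1) sB True szB)
            apply (rule wp_close[where v = p and L = "L - {u}" and W = ?W and K = ?K and b = ?b])
            subgoal by (rule baseI) (use p1(1) in auto)
            subgoal by simp
            subgoal by (rule p1(3))
            subgoal by (rule pL)
            subgoal premises p2 for g2 a2 t2
            proof (rule Q)
              show "g2 y = g y" if "y \<notin> insert 10 {20..28}" for y using p2(1)[of y] p1(1)[of y] that by simp
              show "a2 A = a A" if "A \<notin> {0, 1, 30, 31, 32, 33, 34, 35, 36, 39, 40, 41, 42, 43, 44}" for A
                using that p2(2)[of A] p1(2)[of A] by simp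
              show "tinv a2 (L - {u}) (?W(p := {})) (?K(p := ?W p \<union> ?K p)) (?b(p := p))" by (rule p2(3))
              have cu: "card (?W p \<union> ?K p) = card (?W p) + card (?K p)"
                using ginvD(2)[OF N(1) pL] N(5,6) by (simp add: card_Un_disjoint)
              show "good (L - {u}) (?W(p := {})) (?K(p := ?W p \<union> ?K p))"
              proof -
                have "card ((?W(p := {})) w) \<le> r \<and> (0 < card ((?K(p := ?W p \<union> ?K p)) w) \<longrightarrow> r < card ((?K(p := ?W p \<union> ?K p)) w))"
                  if w: "w \<in> L - {u}" for w
                proof (cases "w = p")
                  case wp: True
                  then show ?thesis using True cu by simp
                next
                  case False
                  then show ?thesis using w G by (simp add: merge_sets_def good_def)
                qed
                then show ?thesis unfolding good_def by blast
              qed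
              have fLu: "finite (L - {u})" using fL by simp
              have P2: "pot (L - {u}) (?W(p := {})) (?K(p := ?W p \<union> ?K p)) + 13000 * (real n * real r * rho) \<le> pot (L - {u}) ?W ?K"
                unfolding pot_close[OF fLu pL] cu using pot1_close_big[OF s(2) True, of "card (?K p)"] by linarith
              have "real t2 \<le> real (t1 + 1) + 1 + 200 * real conv_time" using p2(4) by linarith
              then have t2: "real t2 \<le> real t1 + 1 + 12801 * (real n * real r * rho)" using close_cost[of t2 "t1 + 1"] by simp
              have X: "0 \<le> real n * real r * rho" using rho_nonneg by simp
              have aux: "x2 + qb \<le> x0 + q0 + 310 * rr"
                if "x1 \<le> x0 + 1 + 6 * c + 300 * rr" "x2 \<le> x1 + 1 + 12801 * X" "q + 6 * c = q0" "qb + 13000 * X \<le> q" "0 \<le> X" "1 \<le> rr"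
                for x0 x1 x2 q qb q0 c X rr :: real using that by linarith
              show "real t2 + pot (L - {u}) (?W(p := {})) (?K(p := ?W p \<union> ?K p)) \<le> real t + pot L W K + 310 * real r"
                by (rule aux[OF t1 t2 P P2 X r1])
            qed
            done
        qed
      qed
      done
  qed
qed

end

section \<open>The queue of leaves\<close>

definition tree_body :: com where
  "tree_body = Seq (Asg 11 (Rd 48 (V 13))) (Seq (Asg 12 (Rd 38 (V 11))) (Seq tree_step
    (Seq (St 38 (V 12) (Minus (Rd 38 (V 12)) (V 11))) (Seq (St 37 (V 12) (Minus (Rd 37 (V 12)) (N 1)))
      (Ite (N 0) (Rd 37 (V 12))
        (Ite (Rd 37 (V 12)) (N 2) (Seq (St 48 (V 14) (V 12)) (Asg 14 (Plus (V 14) (N 1)))) (Asg 28 (N 0)))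
        (Asg 28 (N 0)))))))"

context tree_machine
begin

text \<open>The queue qs lists all nodes that have become leaves; its first k nodes have been contracted.\<close>

definition qinv :: "nat set \<Rightarrow> nat \<Rightarrow> nat list \<Rightarrow> (nat \<Rightarrow> nat) \<Rightarrow> (nat \<Rightarrow> nat \<Rightarrow> nat) \<Rightarrow> bool" where
  "qinv L k qs g a \<longleftrightarrow> base g \<and> conn L \<and> L = V - set (take k qs) \<and> distinct qs \<and> set qs \<subseteq> V \<and>
     (\<forall>i<length qs. a 48 i = qs ! i) \<and> g 14 = length qs \<and> k \<le> length qs \<and>
     (\<forall>v\<in>L. (v \<in> set qs \<longleftrightarrow> card (nbrs L v) \<le> 1) \<and> a 37 v = card (nbrs L v) \<and> a 38 v = \<Sum>(nbrs L v))"

lemma qinv_update: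
  assumes "qinv L k qs g a" "x \<notin> {2, 3, 4, 5, 6, 7, 8, 14}"
  shows "qinv L k qs (g(x := y)) a"
proof -
  have e: "(g(x := y)) 14 = g 14" "base (g(x := y)) = base g" using assms(2) by (auto simp: base_def)
  show ?thesis using assms(1) unfolding qinv_def e .
qed

lemma qinv_card: "qinv L k qs g a \<Longrightarrow> card L = n - k"
proof -
  assume q: "qinv L k qs g a"
  then have "card (set (take k qs)) = k" "set (take k qs) \<subseteq> V" "L = V - set (take k qs)"
    by (auto simp: qinv_def distinct_card dest: in_set_takeD)
  then show ?thesis using finite_V V_eq by (simp add: card_Diff_subset)
qed

text \<open>The remaining graph is connected, so it has a leaf. That leaf has been queued and is not
  among the first k entries, which are no longer in L; hence the queue is not exhausted and its next
  entry has exactly one neighbour left. Array 38 stores the sum of the remaining neighbours of a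
  node, which for a leaf is its neighbour, so adjacency lists can be avoided.\<close>

lemma qinv_leaf:
  assumes q: "qinv L k qs g a" and k: "k < n - 1"
  obtains p where "k < length qs" "qs ! k \<in> L" "p \<in> L" "qs ! k \<noteq> p" "nbrs L (qs ! k) = {p}" "a 48 k = qs ! k" "a 38 (qs ! k) = p"
proof -
  have Q: "conn L" "L = V - set (take k qs)" "distinct qs" "set qs \<subseteq> V" "\<forall>i<length qs. a 48 i = qs ! i" "k \<le> length qs"
    "\<forall>v\<in>L. (v \<in> set qs \<longleftrightarrow> card (nbrs L v) \<le> 1) \<and> a 37 v = card (nbrs L v) \<and> a 38 v = \<Sum>(nbrs L v)"
    using q by (auto simp: qinv_def)
  have c: "2 \<le> card L" using qinv_card[OF q] k by simp
  have LV: "L \<subseteq> V" using Q(2) by blast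
  obtain x y where x: "x \<in> L" "nbrs L x = {y}" using leaf_exists[OF Q(1) LV c] by blast
  then have "x \<in> set qs" "x \<notin> set (take k qs)" using Q(7) Q(2) by auto
  then have kl: "k < length qs" using Q(6) by (cases "k = length qs") auto
  have "qs ! k \<notin> set (take k qs)"
    using Q(3) kl by (auto simp: in_set_conv_nth nth_eq_iff_index_eq)
  then have uL: "qs ! k \<in> L" using Q(2,4) kl nth_mem by blast
  then have c1: "card (nbrs L (qs ! k)) \<le> 1" using Q(7) kl nth_mem by blast
  have "L \<noteq> {qs ! k}" using c by auto
  then have "nbrs L (qs ! k) \<noteq> {}" using conn_has_nbr[OF Q(1) uL] by blast
  moreover have fin: "finite (nbrs L (qs ! k))" using LV finite_V finite_subset[of "nbrs L (qs ! k)" V] by (auto simp: nbrs_def)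
  ultimately have "0 < card (nbrs L (qs ! k))" by (simp add: card_gt_0_iff)
  then have "card (nbrs L (qs ! k)) = 1" using c1 by linarith
  then obtain p where p: "nbrs L (qs ! k) = {p}" by (auto simp: card_1_singleton_iff)
  have "p \<in> nbrs L (qs ! k)" using p by simp
  then have "p \<in> L" "qs ! k \<noteq> p" using adj_neq by (auto simp: nbrs_def)
  moreover have "a 38 (qs ! k) = p" using Q(7) uL p by simp
  ultimately show thesis using that kl uL p Q(5) by blast
qed

text \<open>Only p loses a neighbour. It becomes a leaf exactly if it had two neighbours; if it had
  just one, it is in the queue already and must not be entered again.\<close>

lemma qinv_next:
  assumes q: "qinv L k qs g a" and u: "k < length qs" "u = qs ! k" "u \<in> L" "p \<in> L" "u \<noteq> p" "nbrs L u = {p}"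
    and b: "base g'" and qs': "qs' = (if card (nbrs L p) = 2 then qs @ [p] else qs)"
    and a': "\<And>i. i < length qs' \<Longrightarrow> a' 48 i = qs' ! i" "g' 14 = length qs'"
      "a' 37 p = a 37 p - 1" "a' 38 p = a 38 p - u" "\<And>w. w \<noteq> p \<Longrightarrow> a' 37 w = a 37 w" "\<And>w. w \<noteq> p \<Longrightarrow> a' 38 w = a 38 w"
  shows "qinv (L - {u}) (Suc k) qs' g' a'"
proof -
  have Q: "conn L" "L = V - set (take k qs)" "distinct qs" "set qs \<subseteq> V" "k \<le> length qs"
    "\<And>v. v \<in> L \<Longrightarrow> (v \<in> set qs \<longleftrightarrow> card (nbrs L v) \<le> 1) \<and> a 37 v = card (nbrs L v) \<and> a 38 v = \<Sum>(nbrs L v)"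
    using q by (auto simp: qinv_def)
  have LV: "L \<subseteq> V" using Q(2) by blast
  have fin: "finite (nbrs L v)" for v using LV finite_V finite_subset[of "nbrs L v" V] by (auto simp: nbrs_def)
  have up: "u \<in> nbrs L p" using u(3,6) adj_sym by (auto simp: nbrs_def)
  have np: "nbrs (L - {u}) p = nbrs L p - {u}" by (auto simp: nbrs_def)
  have no: "nbrs (L - {u}) w = nbrs L w" if "w \<in> L" "w \<noteq> p" for w
  proof -
    have "u \<notin> nbrs L w"
    proof
      assume "u \<in> nbrs L w"
      then have "w \<in> nbrs L u" using that adj_sym by (auto simp: nbrs_def)
      then show False using u(6) that(2) by simp
    qed
    then show ?thesis by (auto simp: nbrs_def)
  qed
  have cp: "card (nbrs (L - {u}) p) = card (nbrs L p) - 1" "\<Sum>(nbrs (L - {u}) p) = \<Sum>(nbrs L p) - u" "1 \<le> card (nbrs L p)"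
    using up fin[of p] unfolding np by (simp_all add: sum_diff1_nat card_gt_0_iff Suc_le_eq) blast
  have pq: "p \<notin> set qs" if "card (nbrs L p) = 2" using Q(6)[OF u(4)] that by simp
  have take: "take (Suc k) qs' = take k qs @ [u]" using u(1,2) qs' by (simp add: take_Suc_conv_app_nth nth_append)
  have set': "set qs' = set qs \<union> (if card (nbrs L p) = 2 then {p} else {})" using qs' by simp
  have node: "(v \<in> set qs' \<longleftrightarrow> card (nbrs (L - {u}) v) \<le> 1) \<and> a' 37 v = card (nbrs (L - {u}) v) \<and> a' 38 v = \<Sum>(nbrs (L - {u}) v)"
    if v: "v \<in> L - {u}" for v
  proof (cases "v = p")
    case False
    then show ?thesis using Q(6)[of v] v no[of v] a'(5,6) set' by auto
  next
    case True
    have "p \<in> set qs' \<longleftrightarrow> card (nbrs L p) \<le> 2" using set' Q(6)[OF u(4)] by auto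
    moreover have "a' 37 p = card (nbrs L p) - 1" "a' 38 p = \<Sum>(nbrs L p) - u" using Q(6)[OF u(4)] a'(3,4) by simp_all
    ultimately show ?thesis using True cp by auto
  qed
  show ?thesis
    unfolding qinv_def
  proof (intro conjI)
    show "conn (L - {u})" by (rule conn_remove_leaf[OF Q(1) u(3,6)])
    show "L - {u} = V - set (take (Suc k) qs')" unfolding take using Q(2) by auto
    show "distinct qs'" "set qs' \<subseteq> V" using Q(3,4) pq qs' u(4) LV by auto
    show "Suc k \<le> length qs'" using u(1) qs' by simp
    show "\<forall>v\<in>L - {u}. (v \<in> set qs' \<longleftrightarrow> card (nbrs (L - {u}) v) \<le> 1) \<and> a' 37 v = card (nbrs (L - {u}) v) \<and> a' 38 v = \<Sum>(nbrs (L - {u}) v)"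
      using node by blast
  qed (use b a' in auto)
qed

lemma nbrs_bounds: "L \<subseteq> V \<Longrightarrow> card (nbrs L v) \<le> n \<and> \<Sum>(nbrs L v) \<le> n * n"
proof -
  assume "L \<subseteq> V"
  then have s: "nbrs L v \<subseteq> {..<n}" using V_eq by (auto simp: nbrs_def)
  then have c: "card (nbrs L v) \<le> n" using card_mono[OF finite_lessThan s] by simp
  have "x \<le> n" if "x \<in> nbrs L v" for x using that s by (auto simp: less_imp_le)
  then have "\<Sum>(nbrs L v) \<le> card (nbrs L v) * n" using sum_bounded_above[of "nbrs L v" "\<lambda>x. x" n] by simp
  also have "\<dots> \<le> n * n" using c by (rule mult_le_mono1)
  finally show ?thesis using c by blast
qed

lemma wp_tree_body:
  assumes q: "qinv L k qs g a" and k: "k < n - 1" "g 13 = k" and T: "tinv a L W K b" and G: "good L W K"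
    and Q: "\<And>g' a' t' L' W' K' b' qs'. qinv L' (Suc k) qs' g' a' \<Longrightarrow> tinv a' L' W' K' b' \<Longrightarrow> good L' W' K' \<Longrightarrow>
      (\<And>y. y \<notin> {10, 11, 12, 14} \<union> {20..28} \<Longrightarrow> g' y = g y) \<Longrightarrow>
      (\<And>A. A \<notin> {0, 1, 30, 31, 32, 33, 34, 35, 36, 37, 38, 39, 40, 41, 42, 43, 44, 48} \<Longrightarrow> a' A = a A) \<Longrightarrow>
      real t' + pot L' W' K' \<le> real t + pot L W K + 320 * real r \<Longrightarrow> Q (g', a', t')"
  shows "wp tree_body Q (g, a, t)"
proof -
  obtain p where u: "k < length qs" "qs ! k \<in> L" "p \<in> L" "qs ! k \<noteq> p" "nbrs L (qs ! k) = {p}" "a 48 k = qs ! k" "a 38 (qs ! k) = p"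
    using qinv_leaf[OF q k(1)] by metis
  define u' where "u' = qs ! k"
  note u = u[folded u'_def]
  have LV: "L \<subseteq> V" using q by (auto simp: qinv_def)
  have uB: "u' \<le> B" "p \<le> B" using tinvD(3)[OF T] u(2,3) B_bounds(3) by fastforce+
  have dp: "a 37 p = card (nbrs L p)" "a 38 p = \<Sum>(nbrs L p)" "base g" "g 14 = length qs" "\<forall>i<length qs. a 48 i = qs ! i"
    "distinct qs" "set qs \<subseteq> V"
    using q u(3) by (auto simp: qinv_def)
  have dB: "a 37 p \<le> B" "a 38 p \<le> B" "card (nbrs L p) \<le> B" using nbrs_bounds[OF LV, of p] dp(1,2) B_bounds(3,4) by linarith+
  have dS: "\<Sum>(nbrs L p) - u' \<le> B" using dB(2) dp(2) by simp
  have c0: "card (nbrs L p) \<noteq> 0"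
  proof -
    have "u' \<in> nbrs L p" using u(2,5) adj_sym by (auto simp: nbrs_def)
    moreover have "finite (nbrs L p)" using LV finite_V finite_subset[of "nbrs L p" V] by (auto simp: nbrs_def)
    ultimately show ?thesis by auto
  qed
  have "length qs = card (set qs)" using dp(6) by (simp add: distinct_card)
  also have "\<dots> \<le> n" using card_mono[OF finite_V dp(7)] V_eq by simp
  finally have lq: "Suc (length qs) \<le> B" using B_bounds(3) by linarith
  show ?thesis
    unfolding tree_body_def
    apply (simp add: u(6,7) k(2) uB)
    apply (rule wp_tree_step[where u = u' and p = p and L = L and W = W and K = K and b = b])
    subgoal using dp(3) by (simp add: base_def)
    subgoal by simp
    subgoal by simp
    subgoal by (rule T)
    subgoal by (rule G)
    subgoal by (rule u(2))
    subgoal by (rule u(3))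
    subgoal by (rule u(4))
    subgoal by (rule u(5))
    subgoal premises s for g1 a1 t1 W1 K1 b1
    proof -
      have g1: "g1 11 = u'" "g1 12 = p" "g1 13 = k" "g1 14 = length qs" using s(1) k dp(4) by simp_all
      have a1: "a1 37 = a 37" "a1 38 = a 38" "a1 48 = a 48" using s(2) by simp_all
      have tinvI: "tinv a' (L - {u'}) W1 K1 b1" if "\<And>A. A \<notin> {37, 38, 48} \<Longrightarrow> a' A = a1 A" for a'
        using s(3) that unfolding tinv_def node_ok_def by simp
      have r1: "1 \<le> real r" using r by simp
      have base1: "base g'" if "\<And>y. y \<notin> {10, 11, 12, 14} \<union> {20..28} \<Longrightarrow> g' y = g y" for g'
        using dp(3) that by (simp add: base_def)
      have fr: "g1 y = g y" if "y \<notin> {10, 11, 12, 14} \<union> {20..28}" for y using s(1)[of y] that by simp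
      let ?a = "a1(38 := (a1 38)(p := \<Sum>(nbrs L p) - u'), 37 := (a1 37)(p := card (nbrs L p) - 1))"
      show ?thesis
      proof (cases "card (nbrs L p) = 2")
        case True
        show ?thesis
          using g1 a1 dp(1,2) dB uB lq dS True apply simp
          apply (rule Q[where L' = "L - {u'}" and qs' = "qs @ [p]" and W' = W1 and K' = K1 and b' = b1])
          subgoal
            apply (rule qinv_next[OF q u(1) u'_def u(2-5)])
            subgoal by (rule base1) (use fr in \<open>simp del: atLeastAtMost_iff\<close>)
            subgoal using True by simp
            subgoal for i using dp(5) by (auto simp: nth_append less_Suc_eq)
            using dp(1,2) True a1 apply simp_all
            done
          subgoal by (rule tinvI) simp
          subgoal by (rule s(4))
          subgoal for y using fr[of y] by auto
          subgoal for A using s(2)[of A] by simp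
          subgoal using s(5) r1 by simp
          done
      next
        case False
        have final: "Q (g', ?a, t')" if h: "\<And>y. y \<noteq> 28 \<Longrightarrow> g' y = g1 y" "t' \<le> t1 + 5" for g' t'
        proof (rule Q[where L' = "L - {u'}" and qs' = qs and W' = W1 and K' = K1 and b' = b1])
          show "qinv (L - {u'}) (Suc k) qs g' ?a"
            apply (rule qinv_next[OF q u(1) u'_def u(2-5)])
            subgoal by (rule base1) (use fr h(1) in auto)
            subgoal using False by simp
            using dp a1 h(1) g1 apply simp_all
            done
          show "tinv ?a (L - {u'}) W1 K1 b1" by (rule tinvI) simp
          show "good (L - {u'}) W1 K1" by (rule s(4))
          show "g' y = g y" if y: "y \<notin> {10, 11, 12, 14} \<union> {20..28}" for y using fr[OF y] h(1)[of y] y by auto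
          show "?a A = a A" if "A \<notin> {0, 1, 30, 31, 32, 33, 34, 35, 36, 37, 38, 39, 40, 41, 42, 43, 44, 48}" for A
            using s(2)[of A] that by simp
          show "real t' + pot (L - {u'}) W1 K1 \<le> real t + pot L W K + 320 * real r" using s(5) r1 h(2) by simp
        qed
        \<comment> \<open>If p had one neighbour the outer test fails, and if it had at least three
          the inner one; the two final clocks differ by one tick.\<close>
        have e4: "Q (g1(28 := 0), ?a, Suc (Suc (Suc (Suc t1))))" by (rule final) simp_all
        have e5: "Q (g1(28 := 0), ?a, Suc (Suc (Suc (Suc (Suc t1)))))" by (rule final) simp_all
        show ?thesis
        proof (cases "card (nbrs L p) = 1")
          case True
          show ?thesis
            using e4 g1 a1 dp(1,2) dB uB dS True by simp
        next
          case F: False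
          obtain c where c: "card (nbrs L p) = Suc (Suc (Suc c))"
            using c0 False F by (metis One_nat_def Suc_1 not0_implies_Suc)
          show ?thesis
            using e5 g1 a1 dp(1,2) dB uB dS c by simp
        qed
      qed
    qed
    done
qed

end

section \<open>One pass over a tree for given labels\<close>

definition read_edge :: com where
  "read_edge = (let e = Plus (Plus (N 2) (V 2)) (Times (N 2) (V 15)) in
    Seq (Asg 11 (Rd 49 e)) (Seq (Asg 12 (Rd 49 (Plus e (N 1))))
    (Seq (St 37 (V 11) (Plus (Rd 37 (V 11)) (N 1))) (Seq (St 37 (V 12) (Plus (Rd 37 (V 12)) (N 1)))
    (Seq (St 38 (V 11) (Plus (Rd 38 (V 11)) (V 12))) (St 38 (V 12) (Plus (Rd 38 (V 12)) (V 11))))))))"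

definition init_node :: com where
  "init_node = (let r0 = row 15; r1 = Plus (row 15) (N 1) in
    Seq (St 30 r0 (V 6)) (Seq (St 30 r1 (Rd 45 (V 15))) (Seq (St 31 r0 (V 6)) (Seq (St 31 r1 (V 6))
    (Seq (St 32 r0 (V 6)) (Seq (St 32 r1 (V 6)) (Seq (St 34 (V 15) (N 1)) (Seq (St 35 (V 15) (N 0))
    (Seq (St 36 (V 15) (V 15)) (Seq (St 33 (Times (V 15) (V 8)) (V 6))
      (St 39 (N 1) (Minus (Rd 39 (N 1)) (Minus (Rd 39 (N 1)) (Rd 45 (V 15)))))))))))))))"

text \<open>After n - 1 contractions a single node is left, the last one in the queue. Closing it
  moves the whole tree into one closed part, so that array 39 then accounts for all connected
  sets.\<close>

definition tree_pass :: com where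
  "tree_pass = Seq (tabulate 25 (V 2) 37 (N 0) (N 0)) (Seq (tabulate 25 (V 2) 38 (N 0) (N 0))
    (Seq (For 15 (Minus (V 2) (N 1)) read_edge)
    (Seq (tabulate 25 (Plus (V 2) (N 1)) 39 (N 0) (V 6))
    (Seq (For 15 (V 2) init_node)
    (Seq (Asg 14 (N 0))
    (Seq (For 15 (V 2) (Ite (Rd 37 (V 15)) (N 2) (Seq (St 48 (V 14) (V 15)) (Asg 14 (Plus (V 14) (N 1)))) (Asg 28 (N 0))))
    (Seq (For 13 (Minus (V 2) (N 1)) tree_body)
    (Seq (Asg 10 (Rd 48 (Minus (V 2) (N 1)))) close))))))))"

lemma tree_body_mods: "mods tree_body \<subseteq> {10, 11, 12, 14} \<union> {20..28}"
  "warrs tree_body \<subseteq> {0, 1, 30, 31, 32, 33, 34, 35, 36, 37, 38, 39, 40, 41, 42, 43, 44, 48}"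
  by (simp_all add: tree_body_def tree_step_def close_def conv_def conv_init_def conv_run_def conv_body_def tabulate_def
    min_into_def copy_def join_def merge_open_def nconv_def Let_def)

text \<open>The neighbours of v among the first j edges, as a set. The counters and sums of the
  program refer to it, which is correct because no edge is listed twice
  (\<open>listed_Suc\<close>).\<close>

definition listed :: "(nat \<times> nat) list \<Rightarrow> nat \<Rightarrow> nat \<Rightarrow> nat set" where
  "listed es j v = {w. {v, w} \<in> (\<lambda>(x, y). {x, y}) ` set (take j es)}"

lemma listed_Suc:
  assumes j: "j < length es" and e: "es ! j = (x, y)" and ne: "x \<noteq> y" and d: "distinct (map (\<lambda>(x, y). {x, y}) es)"
  shows "listed es (Suc j) v = listed es j v \<union> (if v = x then {y} else if v = y then {x} else {})"
    "y \<notin> listed es j x" "x \<notin> listed es j y"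
proof -
  have t: "take (Suc j) es = take j es @ [(x, y)]" using j e by (simp add: take_Suc_conv_app_nth)
  then show "listed es (Suc j) v = listed es j v \<union> (if v = x then {y} else if v = y then {x} else {})"
    using ne by (auto simp: listed_def doubleton_eq_iff)
  have "distinct (map (\<lambda>(x, y). {x, y}) (take (Suc j) es))" using d by (simp add: take_map[symmetric] distinct_take)
  then have "{x, y} \<notin> (\<lambda>(x, y). {x, y}) ` set (take j es)" unfolding t by simp
  then show "y \<notin> listed es j x" "x \<notin> listed es j y" by (auto simp: listed_def insert_commute)
qed

context tree_machine
begin

definition CV :: "nat set set" where
  "CV = {C. conn C \<and> C \<subseteq> V}"

lemma wp_read_edges:
  assumes g: "g 2 = n" and d: "\<And>v. v < n \<Longrightarrow> a 37 v = 0" "\<And>v. v < n \<Longrightarrow> a 38 v = 0"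
    and es: "E = (\<lambda>(x, y). {x, y}) ` set es" "distinct (map (\<lambda>(x, y). {x, y}) es)" "length es = n - 1"
      "\<And>j. j < n - 1 \<Longrightarrow> a 49 (2 + n + 2 * j) = fst (es ! j) \<and> a 49 (2 + n + 2 * j + 1) = snd (es ! j)"
    and Q: "\<And>g' a'. (\<And>y. y \<notin> {11, 12, 15} \<Longrightarrow> g' y = g y) \<Longrightarrow> (\<And>A. A \<notin> {37, 38} \<Longrightarrow> a' A = a A) \<Longrightarrow>
      (\<And>v. v < n \<Longrightarrow> a' 37 v = card (nbrs V v) \<and> a' 38 v = \<Sum>(nbrs V v)) \<Longrightarrow> Q (g', a', t + 2 + 7 * (n - 1))"
  shows "wp (For 15 (Minus (aexp.V 2) (N 1)) read_edge) Q (g, a, t)"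
proof -
  have mw: "mods read_edge = {11, 12}" "warrs read_edge = {37, 38}" by (auto simp: read_edge_def Let_def)
  have nB: "n \<le> B" "n * n \<le> B" using B_bounds(3,4) by linarith+
  have sub: "listed es j v \<subseteq> nbrs V v" for j v
  proof
    fix w assume "w \<in> listed es j v"
    then have "{v, w} \<in> (\<lambda>(x, y). {x, y}) ` set (take j es)" by (simp only: listed_def mem_Collect_eq)
    then have "{v, w} \<in> E" unfolding es(1) by (rule rev_subsetD) (rule image_mono[OF set_take_subset])
    then show "w \<in> nbrs V v" using simple[of "{v, w}"] by (simp add: nbrs_def adj_def)
  qed
  have fin: "finite (listed es j v)" for j v
    using finite_subset[OF sub] finite_subset[of "nbrs V v" V] finite_V by (auto simp: nbrs_def)
  have finn: "finite (nbrs V v)" for v using finite_V by (auto simp: nbrs_def)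
  have bd: "card (listed es j v) \<le> B" "\<Sum>(listed es j v) \<le> B" for j v
  proof -
    have "card (listed es j v) \<le> card (nbrs V v)" by (rule card_mono[OF finn sub])
    then show "card (listed es j v) \<le> B" using nbrs_bounds[of V v] nB by simp
    have "\<Sum>(listed es j v) \<le> \<Sum>(nbrs V v)" by (rule sum_mono2[OF finn sub]) simp
    then show "\<Sum>(listed es j v) \<le> B" using nbrs_bounds[of V v] nB by simp
  qed
  have all: "listed es (n - 1) v = nbrs V v" for v
  proof
    have tk: "take (n - 1) es = es" using es(3) by simp
    show "nbrs V v \<subseteq> listed es (n - 1) v"
    proof
      fix w assume "w \<in> nbrs V v"
      then have "{v, w} \<in> E" by (simp add: nbrs_def adj_def)
      then show "w \<in> listed es (n - 1) v" unfolding listed_def tk mem_Collect_eq es(1) .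
    qed
  qed (rule sub)
  show ?thesis
  proof (rule wp_For[where n = "n - 1" and I = "\<lambda>j g' a' t'. (\<forall>v<n. a' 37 v = card (listed es j v) \<and> a' 38 v = \<Sum>(listed es j v)) \<and> t' = t + 1 + 7 * j"])
    show "n - 1 \<le> B" "val (Minus (aexp.V 2) (N 1)) g a = n - 1" using nB g by simp_all
    show "(\<forall>v<n. a 37 v = card (listed es 0 v) \<and> a 38 v = \<Sum>(listed es 0 v)) \<and> Suc t = t + 1 + 7 * 0"
      using d by (simp add: listed_def)
  next
    fix j g1 a1 t1
    assume inv: "(\<forall>v<n. a1 37 v = card (listed es j v) \<and> a1 38 v = \<Sum>(listed es j v)) \<and> t1 = t + 1 + 7 * j"
      and j: "j < n - 1" "g1 15 = j" and g1: "\<And>y. y \<noteq> 15 \<Longrightarrow> y \<notin> mods read_edge \<Longrightarrow> g1 y = g y"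
      and a1: "\<And>A. A \<notin> warrs read_edge \<Longrightarrow> a1 A = a A"
    obtain x y where xy: "es ! j = (x, y)" by (cases "es ! j")
    have jl: "j < length es" using j es(3) by simp
    have "(x, y) \<in> set es" using nth_mem[OF jl] xy by simp
    then have xyE: "{x, y} \<in> E" unfolding es(1) by force
    have ne: "x \<noteq> y" using simple[OF xyE] by auto
    have xn: "x < n" "y < n" using simple[OF xyE] V_eq by auto
    have v49: "a1 49 (2 + n + 2 * j) = x" "a1 49 (2 + n + 2 * j + 1) = y" using es(4)[OF j(1)] xy a1[of 49] by (simp_all add: mw)
    have g2: "g1 2 = n" using g1[of 2] g by (simp add: mw)
    note S = listed_Suc[OF jl xy ne es(2)]
    have cx: "card (listed es (Suc j) x) = card (listed es j x) + 1" "\<Sum>(listed es (Suc j) x) = \<Sum>(listed es j x) + y"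
      and cy: "card (listed es (Suc j) y) = card (listed es j y) + 1" "\<Sum>(listed es (Suc j) y) = \<Sum>(listed es j y) + x"
      using S(2,3) fin ne unfolding S(1) by simp_all
    have co: "listed es (Suc j) v = listed es j v" if "v \<noteq> x" "v \<noteq> y" for v using that unfolding S(1) by simp
    have bb: "card (listed es j x) \<le> B" "card (listed es j y) \<le> B" "\<Sum>(listed es j x) \<le> B" "\<Sum>(listed es j y) \<le> B"
      "card (listed es j x) + 1 \<le> B" "card (listed es j y) + 1 \<le> B" "\<Sum>(listed es j x) + y \<le> B" "\<Sum>(listed es j y) + x \<le> B"
      using bd[of j] bd[of "Suc j" x] bd[of "Suc j" y] cx cy by simp_all
    have xB: "x \<le> B" "y \<le> B" using xn nB by simp_all
    have i1: "a1 37 x = card (listed es j x)" "a1 37 y = card (listed es j y)" "a1 38 x = \<Sum>(listed es j x)" "a1 38 y = \<Sum>(listed es j y)"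
      using inv xn by simp_all
    have no3: "a1 37 v = card (listed es (Suc j) v)" "a1 38 v = \<Sum>(listed es (Suc j) v)" if "v \<noteq> x" "v \<noteq> y" "v < n" for v
      using inv co[OF that(1,2)] that(3) by simp_all
    have jB: "2 + n + 2 * j + 1 \<le> B" "2 + n + 2 * j \<le> B" "2 * j \<le> B" "j \<le> B" "2 + n \<le> B" "n \<le> B" "2 \<le> B" "1 \<le> B"
      using j(1) B_bounds(3) by linarith+
    have t1: "t1 = t + 1 + 7 * j" using inv by blast
    show "wp read_edge (\<lambda>(g', a', t'). (\<lambda>j g' a' t'. (\<forall>v<n. a' 37 v = card (listed es j v) \<and> a' 38 v = \<Sum>(listed es j v)) \<and> t' = t + 1 + 7 * j)
        (Suc j) (g'(15 := Suc j)) a' (Suc t')) (g1, a1, t1)"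
      unfolding read_edge_def Let_def
      using v49 g2 j(2) i1 bb xB ne ne[symmetric] jB t1
      by ((simp add: cx cy no3; fail) | (simp add: cx cy, (auto simp: no3)[1]) | (simp, use cx cy no3 in fastforce))
  next
    fix g1 a1 t1
    assume inv: "(\<forall>v<n. a1 37 v = card (listed es (n - 1) v) \<and> a1 38 v = \<Sum>(listed es (n - 1) v)) \<and> t1 = t + 1 + 7 * (n - 1)"
      and g1: "\<And>y. y \<noteq> 15 \<Longrightarrow> y \<notin> mods read_edge \<Longrightarrow> g1 y = g y" and a1: "\<And>A. A \<notin> warrs read_edge \<Longrightarrow> a1 A = a A"
    have "Q (g1, a1, t + 2 + 7 * (n - 1))"
      by (rule Q) (use g1 a1 inv all in \<open>auto simp: mw\<close>)
    then show "Q (g1, a1, Suc t1)" using inv by simp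
  qed (auto simp: mw)
qed

lemma mw_single: "mw lab I {{v}} i = (if i = 1 then min I (lab v) else I)"
proof -
  have e: "{C \<in> {{v}}. card C = i} = (if i = 1 then {{v}} else {})" by auto
  show ?thesis unfolding mw_def e by simp
qed

lemma initial_families:
  "FA (\<lambda>v. {v}) v = {{v}}" "FB (\<lambda>v. {v}) (\<lambda>_. {}) b v = {}" "FG (\<lambda>v. {v}) (\<lambda>_. {}) b v = {}" "FH (\<lambda>_. {}) b v = {}"
  "FS V (\<lambda>v. {v}) (\<lambda>_. {}) = (\<lambda>v. {v}) ` V"
  using conn_singleton conn_nonempty
  by (auto simp: FA_def FB_def FG_def FH_def FS_def subset_singleton_iff)

lemma mw_singletons: "mw lab I ((\<lambda>v. {v}) ` V) i = (if i = 1 then Min (insert I (lab ` V)) else I)"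
proof -
  have e: "{C \<in> (\<lambda>v. {v}) ` V. card C = i} = (if i = 1 then (\<lambda>v. {v}) ` V else {})" by auto
  show ?thesis unfolding mw_def e by (simp add: image_image)
qed

lemma ginv_initial: "ginv V (\<lambda>v. {v}) (\<lambda>_. {}) b"
  by (auto simp: ginv_def)

text \<open>Initially every node forms an open part by itself and there are no closed parts. The
  sets collected so far are the singletons, so only size 1 has an answer below I, namely the least
  label.\<close>

lemma wp_init_nodes:
  assumes g: "base g" and a: "\<And>i. i < n \<Longrightarrow> a 45 i = lab i" "\<And>i. lab i \<le> 1" "\<And>i. i \<le> n \<Longrightarrow> a 39 i = I"
    and Q: "\<And>g' a'. (\<And>y. y \<noteq> 15 \<Longrightarrow> g' y = g y) \<Longrightarrow> (\<And>A. A \<notin> {30, 31, 32, 33, 34, 35, 36, 39} \<Longrightarrow> a' A = a A) \<Longrightarrow>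
      tinv a' V (\<lambda>v. {v}) (\<lambda>_. {}) id \<Longrightarrow> Q (g', a', t + 2 + 12 * n)"
  shows "wp (For 15 (aexp.V 2) init_node) Q (g, a, t)"
proof -
  have mw: "mods init_node = {}" "warrs init_node = {30, 31, 32, 33, 34, 35, 36, 39}" by (auto simp: init_node_def Let_def)
  have nB: "n \<le> B" "I \<le> B" "1 \<le> B" using B_bounds(2,3) by linarith+
  have kw: "0 < kw" "1 < kw" "0 < hw" using r by (auto simp: kw_def hw_def)
  let ?R = "\<lambda>w a'. a' 30 (w * kw) = I \<and> a' 30 (w * kw + 1) = lab w \<and> a' 31 (w * kw) = I \<and> a' 31 (w * kw + 1) = I \<and>
    a' 32 (w * kw) = I \<and> a' 32 (w * kw + 1) = I \<and> a' 34 w = 1 \<and> a' 35 w = 0 \<and> a' 36 w = w \<and> a' 33 (w * hw) = I"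
  let ?J = "\<lambda>i g' a' t'. (\<forall>w<i. ?R w a') \<and> (\<forall>j. j \<le> n \<longrightarrow> j \<noteq> 1 \<longrightarrow> a' 39 j = I) \<and> a' 39 1 = Min (insert I (lab ` {..<i})) \<and> t' = t + 1 + 12 * i"
  show ?thesis
  proof (rule wp_For[where n = n and I = ?J])
    show "val (aexp.V 2) g a = n" using g by (simp add: base_def)
    show "?J 0 (g(15 := 0)) a (Suc t)" using a(3) r by simp
  next
    fix i g1 a1 t1
    assume inv: "?J i g1 a1 t1" and i: "i < n" "g1 15 = i" and g1: "\<And>y. y \<noteq> 15 \<Longrightarrow> y \<notin> mods init_node \<Longrightarrow> g1 y = g y"
      and a1: "\<And>A. A \<notin> warrs init_node \<Longrightarrow> a1 A = a A"
    have gv: "g1 6 = I" "g1 7 = kw" "g1 8 = hw" using g1 g by (simp_all add: mw base_def)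
    have l: "a1 45 i = lab i" "lab i \<le> B" using a1[of 45] a(1)[OF i(1)] a(2)[of i] nB by (simp_all add: mw)
    have ne: "w * kw \<noteq> i * kw" "w * kw + 1 \<noteq> i * kw" "w * kw \<noteq> i * kw + 1" "w * kw + 1 \<noteq> i * kw + 1" "w * hw \<noteq> i * hw" if "w < i" for w
      using row_index_eq[OF kw(1) kw(1), of w i] row_index_eq[OF kw(2) kw(1), of w i] row_index_eq[OF kw(1) kw(2), of w i]
        row_index_eq[OF kw(2) kw(2), of w i] kw(3) that by simp_all
    define M where "M = Min (insert I (lab ` {..<i}))"
    have M: "a1 39 1 = M" using inv M_def by simp
    have "M \<le> I" unfolding M_def by (rule Min_le) auto
    then have MB: "M \<le> B" using nB by linarith
    have "Min (insert I (lab ` {..<Suc i})) = Min (insert (lab i) (insert I (lab ` {..<i})))"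
      by (simp add: lessThan_Suc insert_commute)
    also have "\<dots> = min M (lab i)" unfolding M_def by (subst Min_insert) (auto simp: min.commute)
    finally have MS: "Min (insert I (lab ` {..<Suc i})) = min M (lab i)" .
    define post :: "state \<Rightarrow> bool" where "post = (\<lambda>(g', a', t'). ?J (Suc i) (g'(15 := Suc i)) a' (Suc t'))"
    have new: "post (g', a', t')"
      if a': "\<And>w. w < i \<Longrightarrow> ?R w a'" "?R i a'" "\<And>j. j \<noteq> 1 \<Longrightarrow> a' 39 j = a1 39 j" "a' 39 1 = min M (lab i)" "t' = t1 + 11" for g' a' t'
    proof -
      have "\<forall>w<Suc i. ?R w a'" using a'(1,2) by (auto simp only: less_Suc_eq)
      moreover have "\<forall>j. j \<le> n \<longrightarrow> j \<noteq> 1 \<longrightarrow> a' 39 j = I" using a'(3) inv by simp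
      moreover have "Suc t' = t + 1 + 12 * Suc i" using a'(5) inv by simp
      ultimately show ?thesis using a'(4) MS unfolding post_def prod.case by (simp only: simp_thms)
    qed
    have old: "?R w a1" if "w < i" for w using inv that by blast
    have "wp init_node post (g1, a1, t1)"
      unfolding init_node_def Let_def row_def wp.simps(3)
      apply (rule wp_St[where p = "i * kw" and x = I]) using gv i(2) nB apply simp_all[5]
      apply (rule wp_St[where p = "i * kw + 1" and x = "lab i"]) using gv i(2) nB l apply simp_all[5]
      apply (rule wp_St[where p = "i * kw" and x = I]) using gv i(2) nB apply simp_all[5]
      apply (rule wp_St[where p = "i * kw + 1" and x = I]) using gv i(2) nB apply simp_all[5]
      apply (rule wp_St[where p = "i * kw" and x = I]) using gv i(2) nB apply simp_all[5]
      apply (rule wp_St[where p = "i * kw + 1" and x = I]) using gv i(2) nB apply simp_all[5]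
      apply (rule wp_St[where p = i and x = 1]) using gv i(2) nB apply simp_all[5]
      apply (rule wp_St[where p = i and x = 0]) using gv i(2) nB apply simp_all[5]
      apply (rule wp_St[where p = i and x = i]) using gv i nB apply simp_all[5]
      apply (rule wp_St[where p = "i * hw" and x = I]) using gv i(2) nB apply simp_all[5]
      apply (rule wp_St[where p = 1 and x = "min M (lab i)"]) using gv i(2) nB l M MB apply (simp_all add: nat_diff_diff_min min.coboundedI1 del: diff_diff_cancel)[5]
      apply (rule new)
      subgoal for w using old[of w] ne[of w] by simp
      subgoal by simp
      subgoal for j by simp
      subgoal by simp
      subgoal by simp
      done
    then show "wp init_node (\<lambda>(g', a', t'). ?J (Suc i) (g'(15 := Suc i)) a' (Suc t')) (g1, a1, t1)" unfolding post_def .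
  next
    fix g1 a1 t1
    assume inv: "?J n g1 a1 t1" and g1: "\<And>y. y \<noteq> 15 \<Longrightarrow> y \<notin> mods init_node \<Longrightarrow> g1 y = g y"
      and a1: "\<And>A. A \<notin> warrs init_node \<Longrightarrow> a1 A = a A"
    have "tinv a1 V (\<lambda>v. {v}) (\<lambda>_. {}) id"
      unfolding tinv_def
    proof (intro conjI ballI allI impI)
      show "ginv V (\<lambda>v. {v}) (\<lambda>_. {}) id" by (rule ginv_initial)
      have R: "?R v a1" if "v < n" for v using inv that by blast
      show "inj_on (a1 36) V" using R V_eq by (auto simp: inj_on_def)
      show "a1 39 i = mw lab I (FS V (\<lambda>v. {v}) (\<lambda>_. {})) i" if "i \<le> n" for i
      proof -
        have F: "mw lab I (FS V (\<lambda>v. {v}) (\<lambda>_. {})) i = (if i = 1 then Min (insert I (lab ` V)) else I)"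
          by (simp only: initial_families(5) mw_singletons)
        have "a1 39 1 = Min (insert I (lab ` {..<n}))" and o: "i \<noteq> 1 \<Longrightarrow> a1 39 i = I" using inv that by blast+
        then show ?thesis unfolding F unfolding V_eq by (cases "i = 1") simp_all
      qed
      fix v assume "v \<in> V"
      then have v: "v < n" using V_eq by simp
      have lI: "min I (lab v) = lab v" using a(2)[of v] by (simp add: I_def)
      show "node_ok a1 (\<lambda>v. {v}) (\<lambda>_. {}) id v"
        unfolding node_ok_def initial_families mw_single lI using R[OF v] v r
        by ((auto simp: le_Suc_eq; fail) | (intro conjI allI impI; force simp: le_Suc_eq))
    qed
    then have tv: "tinv a1 V (\<lambda>v. {v}) (\<lambda>_. {}) id" .
    have "Q (g1, a1, t + 2 + 12 * n)"
    proof (rule Q)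
      show "g1 y = g y" if "y \<noteq> 15" for y using g1[OF that] by (simp add: mw)
      show "a1 A = a A" if "A \<notin> {30, 31, 32, 33, 34, 35, 36, 39}" for A by (rule a1) (use that in \<open>simp only: mw not_False_eq_True\<close>)
      show "tinv a1 V (\<lambda>v. {v}) (\<lambda>_. {}) id" by (rule tv)
    qed
    then show "Q (g1, a1, Suc t1)" using inv by simp
  qed (use nB in \<open>auto simp: mw\<close>)
qed

end

context tree_machine
begin

lemma wp_fill_queue:
  assumes g: "base g" "g 14 = 0" and d: "\<And>v. v < n \<Longrightarrow> a 37 v = card (nbrs V v) \<and> a 38 v = \<Sum>(nbrs V v)"
    and Q: "\<And>g' a' t' qs. (\<And>y. y \<notin> {14, 15, 28} \<Longrightarrow> g' y = g y) \<Longrightarrow> (\<And>A. A \<noteq> 48 \<Longrightarrow> a' A = a A) \<Longrightarrow>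
      qinv V 0 qs g' a' \<Longrightarrow> t' \<le> t + 2 + 5 * n \<Longrightarrow> Q (g', a', t')"
  shows "wp (For 15 (aexp.V 2) (Ite (Rd 37 (aexp.V 15)) (N 2) (Seq (St 48 (aexp.V 14) (aexp.V 15)) (Asg 14 (Plus (aexp.V 14) (N 1)))) (Asg 28 (N 0)))) Q (g, a, t)"
proof -
  let ?c = "Ite (Rd 37 (aexp.V 15)) (N 2) (Seq (St 48 (aexp.V 14) (aexp.V 15)) (Asg 14 (Plus (aexp.V 14) (N 1)))) (Asg 28 (N 0))"
  have nB: "n + 1 \<le> B" using B_bounds(3) by linarith
  let ?P = "\<lambda>i (g' :: nat \<Rightarrow> nat) (a' :: nat \<Rightarrow> nat \<Rightarrow> nat) qs. distinct qs \<and> set qs = {v. v < i \<and> card (nbrs V v) \<le> 1} \<and> (\<forall>j<length qs. a' 48 j = qs ! j) \<and> g' 14 = length qs"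
  let ?J = "\<lambda>i g' a' t'. (\<exists>qs. ?P i g' a' qs) \<and> t' \<le> t + 1 + 5 * i"
  show ?thesis
  proof (rule wp_For[where n = n and I = ?J])
    show "n \<le> B" "val (aexp.V 2) g a = n" using nB g by (simp_all add: base_def)
    show "?J 0 (g(15 := 0)) a (Suc t)" using g by (auto intro!: exI[of _ "[]"])
  next
    fix i g1 a1 t1
    assume inv: "?J i g1 a1 t1" and i: "i < n" "g1 15 = i" and a1: "\<And>A. A \<notin> warrs ?c \<Longrightarrow> a1 A = a A"
    obtain qs where qs: "?P i g1 a1 qs" and t1: "t1 \<le> t + 1 + 5 * i" using inv by blast
    have a37: "a1 37 i = card (nbrs V i)" using a1[of 37] d[OF i(1)] by simp
    have dB: "card (nbrs V i) \<le> B" "i \<le> B" using conjunct1[OF nbrs_bounds[OF subset_refl, of i]] nB i(1) by linarith+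
    have "card (set qs) \<le> card {..<n}" by (rule card_mono) (use qs i(1) in auto)
    moreover have "card (set qs) = length qs" by (rule distinct_card) (use qs in blast)
    ultimately have lq: "length qs \<le> n" by (simp only: card_lessThan)
    have lB: "Suc (length qs) \<le> B" using lq nB by linarith
    show "wp ?c (\<lambda>(g', a', t'). ?J (Suc i) (g'(15 := Suc i)) a' (Suc t')) (g1, a1, t1)"
    proof (cases "card (nbrs V i) < 2")
      case True
      have "?P (Suc i) ((g1(14 := Suc (length qs)))(15 := Suc i)) (a1(48 := (a1 48)(length qs := i))) (qs @ [i])"
        using qs True by (auto simp: nth_append less_Suc_eq)
      then show ?thesis using True a37 i(2) qs lB dB t1
        by (simp del: fun_upd_apply) (auto intro!: exI[of _ "qs @ [i]"])
    next
      case False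
      have "?P (Suc i) ((g1(28 := 0))(15 := Suc i)) a1 qs" using qs False by (auto simp: less_Suc_eq)
      then show ?thesis using False a37 i(2) dB t1
        by (simp del: fun_upd_apply) (auto intro!: exI[of _ qs])
    qed
  next
    fix g1 a1 t1
    assume inv: "?J n g1 a1 t1" and g1: "\<And>y. y \<noteq> 15 \<Longrightarrow> y \<notin> mods ?c \<Longrightarrow> g1 y = g y" and a1: "\<And>A. A \<notin> warrs ?c \<Longrightarrow> a1 A = a A"
    obtain qs where qs: "?P n g1 a1 qs" and t1: "t1 \<le> t + 1 + 5 * n" using inv by blast
    show "Q (g1, a1, Suc t1)"
    proof (rule Q)
      show "g1 y = g y" if "y \<notin> {14, 15, 28}" for y using g1[of y] that by simp
      show "a1 A = a A" if "A \<noteq> 48" for A using a1[of A] that by simp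
      have "base g1" using g(1) g1 by (simp add: base_def)
      then show "qinv V 0 qs g1 a1"
        unfolding qinv_def using qs conn_V V_eq d a1[of 37] a1[of 38] by auto
      show "Suc t1 \<le> t + 2 + 5 * n" using t1 by simp
    qed
  qed auto
qed

text \<open>The clock plus the potential grows by at most 320 r per contraction, and the tick of the
  loop makes it 321 r; summing up gives the claim.\<close>

lemma wp_contract:
  assumes q: "qinv V 0 qs g a" and T: "tinv a V (\<lambda>v. {v}) (\<lambda>_. {}) id"
    and Q: "\<And>g' a' t' L W K b qs. (\<And>y. y \<notin> {10, 11, 12, 13, 14} \<union> {20..28} \<Longrightarrow> g' y = g y) \<Longrightarrow>
      (\<And>A. A \<notin> {0, 1, 30, 31, 32, 33, 34, 35, 36, 37, 38, 39, 40, 41, 42, 43, 44, 48} \<Longrightarrow> a' A = a A) \<Longrightarrow>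
      qinv L (n - 1) qs g' a' \<Longrightarrow> tinv a' L W K b \<Longrightarrow> good L W K \<Longrightarrow>
      real t' + pot L W K \<le> real t + pot V (\<lambda>v. {v}) (\<lambda>_. {}) + 2 + 321 * real r * real n \<Longrightarrow> Q (g', a', t')"
  shows "wp (For 13 (Minus (aexp.V 2) (N 1)) tree_body) Q (g, a, t)"
proof -
  let ?p0 = "pot V (\<lambda>v. {v}) (\<lambda>_. {})"
  let ?P = "\<lambda>k g' a' t' L W K b qs. qinv L k qs g' a' \<and> tinv a' L W K b \<and> good L W K \<and>
      real t' + pot L W K \<le> real t + ?p0 + 1 + 321 * real r * real k"
  have m13: "13 \<notin> mods tree_body" "2 \<notin> mods tree_body" using tree_body_mods(1) by auto
  have r1: "1 \<le> real r" using r by simp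
  show ?thesis
  proof (rule wp_For[where n = "n - 1" and I = "\<lambda>k g' a' t'. \<exists>L W K b qs. ?P k g' a' t' L W K b qs"])
    show "n - 1 \<le> B" using B_bounds(3) by linarith
    show "val (Minus (aexp.V 2) (N 1)) g a = n - 1" using q by (simp add: qinv_def base_def)
    have "good V (\<lambda>v. {v}) (\<lambda>_. {})" using r by (simp add: good_def)
    moreover have "qinv V 0 qs (g(13 := 0)) a" by (rule qinv_update[OF q]) simp
    ultimately show "\<exists>L W K b qs. ?P 0 (g(13 := 0)) a (Suc t) L W K b qs" using T
      by (intro exI[of _ V] exI[of _ "\<lambda>v. {v}"] exI[of _ "\<lambda>_. {}"] exI[of _ id] exI[of _ qs]) simp
  next
    fix k g1 a1 t1
    assume "\<exists>L W K b qs. ?P k g1 a1 t1 L W K b qs" and k: "k < n - 1" "g1 13 = k"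
    then obtain L W K b qs where P: "?P k g1 a1 t1 L W K b qs" by blast
    show "wp tree_body (\<lambda>(g', a', t'). \<exists>L W K b qs. ?P (Suc k) (g'(13 := Suc k)) a' (Suc t') L W K b qs) (g1, a1, t1)"
    proof (rule wp_tree_body[where L = L and qs = qs and W = W and K = K and b = b])
      show "qinv L k qs g1 a1" "k < n - 1" "g1 13 = k" "tinv a1 L W K b" "good L W K" using P k by blast+
    next
      fix g' a' t' L' W' K' b' qs'
      assume *: "qinv L' (Suc k) qs' g' a'" "tinv a' L' W' K' b'" "good L' W' K'"
        "real t' + pot L' W' K' \<le> real t1 + pot L W K + 320 * real r"
      have "qinv L' (Suc k) qs' (g'(13 := Suc k)) a'" by (rule qinv_update[OF *(1)]) simp
      moreover have "real (Suc t') + pot L' W' K' \<le> real t + ?p0 + 1 + 321 * real r * real (Suc k)"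
        using *(4) P r1 by (simp add: algebra_simps)
      ultimately have "?P (Suc k) (g'(13 := Suc k)) a' (Suc t') L' W' K' b' qs'" using *(2,3) by blast
      then show "case (g', a', t') of (g', a', t') \<Rightarrow> \<exists>L W K b qs. ?P (Suc k) (g'(13 := Suc k)) a' (Suc t') L W K b qs" by blast
    qed
  next
    fix g1 a1 t1
    assume "\<exists>L W K b qs. ?P (n - 1) g1 a1 t1 L W K b qs"
      and g1: "\<And>y. y \<noteq> 13 \<Longrightarrow> y \<notin> mods tree_body \<Longrightarrow> g1 y = g y" and a1: "\<And>A. A \<notin> warrs tree_body \<Longrightarrow> a1 A = a A"
    then obtain L W K b qs where P: "?P (n - 1) g1 a1 t1 L W K b qs" by blast
    show "Q (g1, a1, Suc t1)"
    proof (rule Q[where L = L and W = W and K = K and b = b and qs = qs])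
      show "g1 y = g y" if "y \<notin> {10, 11, 12, 13, 14} \<union> {20..28}" for y
        by (rule g1) (use that tree_body_mods(1) in auto)
      show "a1 A = a A" if "A \<notin> {0, 1, 30, 31, 32, 33, 34, 35, 36, 37, 38, 39, 40, 41, 42, 43, 44, 48}" for A
        by (rule a1) (use that tree_body_mods(2) in blast)
      show "qinv L (n - 1) qs g1 a1" "tinv a1 L W K b" "good L W K" using P by blast+
      have "real r * real (n - 1) \<le> real r * real n" by (intro mult_left_mono) auto
      then show "real (Suc t1) + pot L W K \<le> real t + ?p0 + 2 + 321 * real r * real n" using P by simp
    qed
  qed (use m13 in auto)
qed

text \<open>A single node contributes at most 6 r + 39000 n rho, and there are n of them; this is
  where both terms n r and n^2 rho of the time bound originate.\<close>

lemma pot_initial: "pot V (\<lambda>v. {v}) (\<lambda>_. {}) \<le> 6 * (real r * real n) + 39000 * (real n * real n * rho)"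
proof -
  have "pot V (\<lambda>v. {v}) (\<lambda>_. {}) = real n * pot1 1 0" by (simp add: pot_def V_eq)
  also have "\<dots> \<le> real n * (6 * real r + 39000 * real n * rho)"
    by (intro mult_left_mono) (simp_all add: pot1_def)
  finally show ?thesis by (simp add: algebra_simps)
qed

text \<open>The time of the contraction is at most the initial potential minus the final one, plus
  O(n r). The final potential is bounded below, since its only negative term comes from a square of
  at most n^2.\<close>

lemma wp_tree_pass:
  assumes g: "base g" and lab: "\<And>i. i < n \<Longrightarrow> a 45 i = lab i" "\<And>i. lab i \<le> 1"
    and es: "E = (\<lambda>(x, y). {x, y}) ` set es" "distinct (map (\<lambda>(x, y). {x, y}) es)" "length es = n - 1"
      "\<And>j. j < n - 1 \<Longrightarrow> a 49 (2 + n + 2 * j) = fst (es ! j) \<and> a 49 (2 + n + 2 * j + 1) = snd (es ! j)"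
    and Q: "\<And>g' a' t'. (\<And>y. y \<notin> {10..15} \<union> {20..28} \<Longrightarrow> g' y = g y) \<Longrightarrow> (\<And>A. A \<notin> {0, 1} \<union> {30..44} \<union> {48} \<Longrightarrow> a' A = a A) \<Longrightarrow>
      (\<And>i. i \<le> n \<Longrightarrow> a' 39 i = mw lab I CV i) \<Longrightarrow>
      real t' \<le> real t + 400 * (real r * real n) + 60000 * (real n * real n * rho) \<Longrightarrow> Q (g', a', t')"
  shows "wp tree_pass Q (g, a, t)"
proof -
  have nB: "n \<le> B" "n + 1 \<le> B" "I \<le> B" using B_bounds(2,3) by linarith+
  have gb: "g 2 = n" "g 6 = I" using g by (simp_all add: base_def)
  show ?thesis
    unfolding tree_pass_def wp.simps(3)
    apply (rule wp_tabulate[where n = n and p = 0 and F = "\<lambda>_. 0"])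
    using gb nB apply simp_all[10]
    subgoal premises p1 for g1 a1
      apply (rule wp_tabulate[where n = n and p = 0 and F = "\<lambda>_. 0"])
      using gb nB p1(2) apply simp_all[10]
      subgoal premises p2 for g2 a2
        apply (rule wp_read_edges[where es = es])
        subgoal using p1(2) p2(2) gb by simp
        subgoal for v using p2(3) p1(5)[of v] by simp
        subgoal for v using p2(5)[of v] by simp
        subgoal by (rule es)
        subgoal by (rule es)
        subgoal by (rule es)
        subgoal for j using es(4)[of j] p1(3) p2(3) by simp
        subgoal premises p3 for g3 a3
          apply (rule wp_tabulate[where n = "n + 1" and p = 0 and F = "\<lambda>_. I"])
          using gb nB p1(2) p2(2) p3(1) apply simp_all[10]
          subgoal premises p4 for g4 a4
          proof -
            have g4: "g4 y = g y" if "y \<notin> {10..15} \<union> {20..28}" for y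
            proof -
              have "y \<noteq> 25" "y \<notin> {11, 12, 15}" using that by auto
              then show ?thesis using p1(2) p2(2) p3(1) p4(2) by simp
            qed
            have a4: "a4 A = a A" if "A \<notin> {37, 38, 39}" for A using that p1(3) p2(3) p3(2) p4(3) by simp
            have b4: "base g4" using g g4 by (simp add: base_def)
            show ?thesis
              apply (rule wp_init_nodes)
              subgoal by (rule b4)
              subgoal for i using lab(1)[of i] a4 by simp
              subgoal by (rule lab)
              subgoal for i using p4(5)[of i] by simp
              subgoal premises p5 for g5 a5
              proof -
                have g5: "g5 y = g y" if "y \<notin> {10..15} \<union> {20..28}" for y
                proof -
                  have "y \<noteq> 15" using that by auto
                  then show ?thesis using g4[OF that] p5(1) by simp
                qed
                have b5: "base (g5(14 := 0))" using g g5 by (simp add: base_def)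
                show ?thesis
                  apply (simp del: wp.simps(5) fun_upd_apply One_nat_def)
                  apply (rule wp_fill_queue)
                  subgoal by (rule b5)
                  subgoal by simp
                  subgoal for v using p3(3)[of v] p4(3) p5(2) by simp
                  subgoal premises p6 for g6 a6 t6 qs
                  proof -
                    have T6: "tinv a6 V (\<lambda>v. {v}) (\<lambda>_. {}) id"
                      using p5(3) p6(2) unfolding tinv_def node_ok_def by simp
                    show ?thesis
                      apply (rule wp_contract[OF p6(3) T6])
                      subgoal premises p7 for g7 a7 t7 L W K b qs'
                      proof -
                        have q: "base g7" "conn L" "L = V - set (take (n - 1) qs')" "distinct qs'" "set qs' \<subseteq> V"
                          "\<forall>i<length qs'. a7 48 i = qs' ! i" "\<forall>v\<in>L. v \<in> set qs' \<longleftrightarrow> card (nbrs L v) \<le> 1"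
                          using p7(3) by (auto simp: qinv_def)
                        have "card L = 1" using qinv_card[OF p7(3)] r by simp
                        then obtain v where L: "L = {v}" by (auto simp: card_1_singleton_iff)
                        have "nbrs L v = {}" using L adj_neq by (auto simp: nbrs_def)
                        then have "v \<in> set qs'" using q(7) L by simp
                        then obtain j where j: "j < length qs'" "qs' ! j = v" by (auto simp: in_set_conv_nth)
                        \<comment> \<open>The remaining node v has not been contracted, so it cannot
                          be among the first n - 1 entries of the queue; hence it is the last
                          one.\<close>
                        have "\<not> j < n - 1"
                        proof
                          assume "j < n - 1"
                          then have "v \<in> set (take (n - 1) qs')" using j by (auto simp: in_set_conv_nth)
                          then show False using q(3) L by blast
                        qed
                        moreover have "length qs' \<le> n"
                          using card_mono[OF finite_V q(5)] q(4) V_eq by (simp add: distinct_card)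
                        ultimately have jn: "j = n - 1" using j(1) by linarith
                        have v: "a7 48 (n - 1) = v" "v < n" using q(6) j jn tinvD(3)[OF p7(4), of v] L by auto
                        have b7: "base (g7(10 := v))" using q(1) by (simp add: base_def)
                        have g72: "g7 2 = n" using q(1) by (simp add: base_def)
                        have v0: "a7 48 (n - Suc 0) = v" "v \<le> B" using v nB(1) by simp_all
                        note vB = v0(2)
                        have vL: "v \<in> L" using L by simp
                        show ?thesis
                          apply (simp add: v0 vB nB(1) g72)
                          apply (rule wp_close[OF b7 _ p7(4) vL])
                          subgoal by simp
                          subgoal premises p8 for g8 a8 t8
                          proof (rule Q)
                            show "g8 y = g y" if "y \<notin> {10..15} \<union> {20..28}" for y
                            proof -
                              have "y \<notin> {20..28}" "y \<noteq> 10" "y \<noteq> 14" "y \<notin> {10, 11, 12, 13, 14} \<union> {20..28}" "y \<notin> {14, 15, 28}"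
                                using that by auto
                              then show ?thesis using p8(1)[of y] p7(1)[of y] p6(1)[of y] g5[OF that] by simp
                            qed
                            show "a8 A = a A" if "A \<notin> {0, 1} \<union> {30..44} \<union> {48}" for A
                            proof -
                              have "A \<notin> {0, 1, 30, 31, 32, 33, 34, 35, 36, 37, 38, 39, 40, 41, 42, 43, 44, 48}" using that by auto
                              then show ?thesis using p8(2)[of A] p7(2)[of A] p6(2)[of A] p5(2)[of A] a4[of A] by simp
                            qed
                            have U: "W v \<union> K v = V" using tinvD(1)[OF p7(4) vL] L by (simp add: ginv_def)
                            \<comment> \<open>The only remaining part is V, so every connected set
                              lies in it.\<close>
                            have "FS L (W(v := {})) (K(v := W v \<union> K v)) = CV"
                              using L U conn_nonempty by (auto simp: FS_def CV_def)
                            then show "a8 39 i = mw lab I CV i" if "i \<le> n" for i using p8(3) that unfolding tinv_def by simp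
                            let ?X = "real n * real n * rho"
                            have nr: "real n * real r * rho \<le> ?X"
                              using r(2) rho_nonneg by (intro mult_right_mono mult_left_mono) auto
                            have pe: "- (1500 * ?X) \<le> pot L W K"
                            proof -
                              have "card (K v) \<le> n" "card (W v) \<le> 2 * r" using tinvD(2,4)[OF p7(4) vL] by (auto simp: node_ok_def)
                              then have "real (card (K v)) * real (card (K v)) \<le> real n * real n" by (intro mult_mono) auto
                              then have "rho * (real (card (K v)) * real (card (K v))) \<le> rho * (real n * real n)"
                                using rho_nonneg by (rule mult_left_mono)
                              moreover have "0 \<le> 13000 * real n * rho * (3 * real (card (W v)) + 2 * real r * of_bool (0 < card (K v)))"
                                using rho_nonneg by simp
                              moreover have "pot L W K = pot1 (card (W v)) (card (K v))" by (simp add: pot_def L)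
                              ultimately show ?thesis
                                using open_part_nonneg[OF \<open>card (W v) \<le> 2 * r\<close>] unfolding pot1_def by (simp add: ac_simps)
                            qed
                            have "real t8 \<le> real t7 + 1 + 200 * real conv_time" using p8(4) by linarith
                            then have t8: "real t8 \<le> real t7 + 12801 * ?X" using close_cost[of t8 t7] nr by linarith
                            have rn: "real n \<le> real r * real n" "1 \<le> real n" using r by simp_all
                            have "real t6 \<le> real t + 60 * real n" using p6(4) r by linarith
                            then have t7: "real t7 \<le> real t + 60 * real n + 2 + 321 * real r * real n + pot V (\<lambda>v. {v}) (\<lambda>_. {}) + 1500 * ?X"
                              using p7(6) pe by linarith
                            have rr: "321 * real r * real n = 321 * (real r * real n)" by simp
                            have X: "0 \<le> ?X" using rho_nonneg by simp
                            \<comment> \<open>With X for n^2 rho: 12801 for the final closing, 39000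
                              for the initial potential and 1500 for the final one stay below 60000.
                              The multiples 60, 2, 321 and 6 of n r stay below 400.\<close>
                            have aux: "x8 \<le> x0 + 400 * p + 60000 * X"
                              if "x8 \<le> x7 + 12801 * X" "x7 \<le> x0 + 60 * nn + 2 + q + P + 1500 * X" "q = 321 * p" "P \<le> 6 * p + 39000 * X"
                                "nn \<le> p" "1 \<le> nn" "0 \<le> X" for x0 x7 x8 nn q p P X :: real
                              using that by linarith
                            show "real t8 \<le> real t + 400 * (real r * real n) + 60000 * ?X"
                              by (rule aux[OF t8 t7 rr pot_initial rn X])
                          qed
                          done
                      qed
                      done
                  qed
                  done
              qed
              done
          qed
          done
        done
      done
    done
qed

end

section \<open>Assembling the result for trees\<close>

definition tree_prog :: com where
  "tree_prog = Seq (Asg 2 (Rd 0 (N 0))) (Seq (Asg 3 (Rd 0 (N 1))) (Seq prologue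
    (Seq (Asg 7 (Plus (Times (N 2) (V 3)) (N 1))) (Seq (Asg 8 (Plus (V 2) (N 1)))
    (Seq (tabulate 25 (Times (N 3) (V 2)) 49 (N 0) (Rd 0 (V 25)))
    (Seq (tabulate 25 (V 2) 45 (N 0) (Rd 49 (Plus (N 2) (V 25))))
    (Seq tree_pass
    (Seq (tabulate 25 (V 2) 46 (N 0) (Rd 39 (Plus (V 25) (N 1))))
    (Seq (tabulate 25 (V 2) 45 (N 0) (Minus (N 1) (Rd 45 (V 25))))
    (Seq tree_pass
    (Seq (tabulate 25 (V 2) 46 (V 2) (Minus (Plus (V 25) (N 1)) (Rd 39 (Plus (V 25) (N 1)))))
      (tabulate 25 (Plus (V 2) (V 2)) 1 (N 0) (Rd 46 (V 25))))))))))))))"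

context tree_machine
begin

lemma mw_CV_le: "mw lab' I CV i \<le> I"
  by (rule mw_le[OF _ finite_V]) (auto simp: CV_def)

text \<open>The pass is run with the labels and, by a second interpretation of the locale, with
  their complements. The input has 2 + n + 2 (n - 1) = 3 n words and is first moved to array 49,
  because calls overwrite array 0; the answers wait in array 46, because calls overwrite array
  1.\<close>

lemma wp_tree_prog:
  assumes a0: "a 0 0 = n" "a 0 (Suc 0) = r" "\<And>i. i < n \<Longrightarrow> a 0 (2 + i) = lab i" and lab: "\<And>i. lab i \<le> 1"
    and es: "E = (\<lambda>(x, y). {x, y}) ` set es" "distinct (map (\<lambda>(x, y). {x, y}) es)" "length es = n - 1"
      "\<And>j. j < n - 1 \<Longrightarrow> a 0 (2 + n + 2 * j) = fst (es ! j) \<and> a 0 (2 + n + 2 * j + 1) = snd (es ! j)"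
  shows "wp tree_prog (\<lambda>(g, a', t). (\<forall>i<n. a' 1 i = mw lab I CV (Suc i)) \<and>
     (\<forall>i<n. a' 1 (n + i) = Suc i - mw (\<lambda>i. 1 - lab i) I CV (Suc i)) \<and>
     real t \<le> 900 * (real r * real n) + 120000 * (real n * real n * rho)) ((\<lambda>_. 0), a, 0)"
proof -
  let ?lab' = "\<lambda>i. 1 - lab i"
  interpret two: tree_machine B tau V E n r m ?lab' by unfold_locales (use V_eq r m_eq B_eq tau_ge in simp_all)
  have nB: "6 * n + 2 \<le> B" "n + 1 \<le> B" "n + n \<le> B" "3 * n \<le> B" "n \<le> B" "r \<le> B" "2 * r + 1 \<le> B" "2 * r \<le> B" "2 \<le> B" "3 \<le> B" "I \<le> B" "1 \<le> B"
    using B_bounds(2,3) r by linarith+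
  have in_B: "a 0 i \<le> B" if i: "i < 3 * n" for i
  proof -
    consider "i = 0" | "i = 1" | "2 \<le> i" "i < 2 + n" | "2 + n \<le> i" by linarith
    then show ?thesis
    proof cases
      case 3
      then obtain k where k: "i = 2 + k" using le_Suc_ex by blast
      then have "a 0 i = lab k" unfolding k by (intro a0(3)) (use 3 k in simp)
      then show ?thesis using lab[of k] nB(12) by linarith
    next
      case 4
      define j where "j = (i - (2 + n)) div 2"
      have "i - (2 + n) = 2 * j \<or> i - (2 + n) = 2 * j + 1" unfolding j_def by presburger
      then have ij: "i = 2 + n + 2 * j \<or> i = 2 + n + 2 * j + 1" using 4 by linarith
      then have j: "j < n - 1" using i by linarith
      then have "es ! j \<in> set es" using es(3) by simp
      then have "{fst (es ! j), snd (es ! j)} \<in> E" unfolding es(1) by (metis (mono_tags, lifting) case_prod_beta image_eqI)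
      then have "fst (es ! j) < n" "snd (es ! j) < n" using simple V_eq by auto
      then have "a 0 i < n" using ij es(4)[OF j] by auto
      then show ?thesis using nB(5) by linarith
    qed (use a0 nB in simp_all)
  qed
  show ?thesis
    unfolding tree_prog_def
    apply (simp add: a0 nB(5,6) del: mult_Suc)
    apply (rule wp_prologue[where n = n and r = r])
    using nB r apply simp_all[5]
    subgoal premises p for g0 t0
    proof -
      have g0: "g0 2 = n" "g0 3 = r" using p(1) by simp_all
      define g1 where "g1 = g0(7 := Suc (2 * r), 8 := Suc n)"
      have b1: "base g1" unfolding base_def g1_def I_def kw_def hw_def using p(2-4) g0 m_eq by simp
      then have v1: "g1 2 = n" by (simp add: base_def)
      have nS: "Suc (2 * r) \<le> B" "Suc n \<le> B" "2 * r \<le> B" "2 \<le> B" "Suc 0 \<le> B" using nB by simp_all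
      show ?thesis
        apply (simp add: g1_def[symmetric] nB(5,6) nS g0)
        apply (rule wp_tabulate[where n = "3 * n" and p = 0 and F = "a 0"])
        using v1 nB apply simp_all[9]
        using in_B apply simp
        subgoal premises q for g2 a2
          apply (rule wp_tabulate[where n = n and p = 0 and F = lab])
          using q(2) v1 nB apply simp_all[9]
          subgoal for i g' a' using q(5)[of "2 + i"] a0(3)[of i] lab[of i] nB(1,2,12) r by simp
          subgoal premises s for g3 a3
          proof -
            have b3: "base g3" using b1 q(2) s(2) by (simp add: base_def)
            have a49: "a3 49 i = a 0 i" if "i < 3 * n" for i using q(5)[OF that] s(3) by simp
            show ?thesis
              apply (rule wp_tree_pass[where es = es, OF b3 _ lab es(1-3)])
              subgoal for i using s(5)[of i] by simp
              subgoal for j using es(4)[of j] a49[of "2 + n + 2 * j"] a49[of "2 + n + 2 * j + 1"] by simp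
              subgoal premises u for g4 a4 t4
              proof -
                have b4: "base g4" using b3 u(1) by (simp add: base_def)
                have v4: "g4 2 = n" using b4 by (simp add: base_def)
                show ?thesis
                  apply (rule wp_tabulate[where n = n and p = 0 and F = "\<lambda>i. mw lab I CV (Suc i)"])
                  using v4 nB apply simp_all[9]
                  subgoal for i g' a' using u(3)[of "Suc i"] mw_CV_le[of lab "Suc i"] nB by simp
                  subgoal premises w for g5 a5
                    apply (rule wp_tabulate[where n = n and p = 0 and F = ?lab'])
                    using w(2) v4 nB apply simp_all[9]
                    subgoal for i g' a' using w(3)[of 45] u(2)[of 45] s(5)[of i] lab[of i] nB(12) nB(2) by simp
                    subgoal premises x for g6 a6
                    proof -
                      have b6: "base g6" using b4 w(2) x(2) by (simp add: base_def)
                      have a49': "a6 49 i = a 0 i" if "i < 3 * n" for i using a49[OF that] u(2) w(3) x(3) by simp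
                      show ?thesis
                        apply (rule two.wp_tree_pass[where es = es, OF b6 _ _ es(1-3)])
                        subgoal for i using x(5)[of i] by simp
                        subgoal by simp
                        subgoal for j using es(4)[of j] a49'[of "2 + n + 2 * j"] a49'[of "2 + n + 2 * j + 1"] by simp
                        subgoal premises y for g7 a7 t7
                        proof -
                          have b7: "base g7" using b6 y(1) by (simp add: base_def)
                          have v7: "g7 2 = n" using b7 by (simp add: base_def)
                          show ?thesis
                            apply (rule wp_tabulate[where n = n and p = n and F = "\<lambda>i. Suc i - mw ?lab' I CV (Suc i)"])
                            using v7 nB apply simp_all[9]
                            subgoal for i g' a' using v7 y(3)[of "Suc i"] mw_CV_le[of ?lab' "Suc i"] nB by simp
                            subgoal premises z for g8 a8
                            proof -
                              have g8: "g8 2 = n" using z(2) v7 by simp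
                              have o1: "a8 46 i = mw lab I CV (Suc i)" if "i < n" for i
                                using z(4)[of i] y(2) x(3) w(5)[of i] that by simp
                              have o2: "a8 46 (n + i) = Suc i - mw ?lab' I CV (Suc i)" if "i < n" for i
                                using z(5) that by simp
                              have o3: "a8 46 i \<le> B" if "i < n + n" for i
                              proof (cases "i < n")
                                case True
                                then show ?thesis using o1[OF True] mw_CV_le[of lab "Suc i"] nB(11) by simp
                              next
                                case False
                                then show ?thesis using o2[of "i - n"] that nB(5) by simp
                              qed
                              have n1: "1 \<le> real n" and r1: "1 \<le> real r" using r by simp_all
                              have rr: "real r * 1 \<le> real r * real n" using n1 by (intro mult_left_mono) auto
                              have nn: "1 * real n \<le> real r * real n" using r1 by (intro mult_right_mono) auto
                              have "t0 \<le> 7 + 3 * r" using p(5) by simp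
                              then have "real t0 \<le> real (7 + 3 * r)" by (simp only: of_nat_le_iff)
                              then have "real t0 \<le> 7 + 3 * real r" by simp
                              then have t0: "real t0 \<le> 20 * (real r * real n)" using rr r1 by linarith
                              have t4: "real t4 \<le> real t0 + 8 * real n + 10 + 400 * (real r * real n) + 60000 * (real n * real n * rho)"
                                using u(4) by simp
                              have t7: "real t7 \<le> real t4 + 4 * real n + 10 + 400 * (real r * real n) + 60000 * (real n * real n * rho)"
                                using y(4) by simp
                              have aux: "x7 + 6 * k + 4 \<le> 900 * p + 120000 * X"
                                if "x0 \<le> 20 * p" "x4 \<le> x0 + 8 * k + 10 + 400 * p + 60000 * X" "x7 \<le> x4 + 4 * k + 10 + 400 * p + 60000 * X"
                                  "1 * k \<le> p" "1 \<le> k" for x0 x4 x7 k p X :: real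
                                using that by linarith
                              have "real (t7 + 2 * n + 2 + 2 * (n + n) + 2) = real t7 + 6 * real n + 4" by simp
                              also have "\<dots> \<le> 900 * (real r * real n) + 120000 * (real n * real n * rho)"
                                by (rule aux[OF t0 t4 t7 nn n1])
                              finally have T: "real (t7 + 2 * n + 2 + 2 * (n + n) + 2) \<le> 900 * (real r * real n) + 120000 * (real n * real n * rho)" .
                              show ?thesis
                                apply (rule wp_tabulate[where n = "n + n" and p = 0 and F = "\<lambda>i. a8 46 i"])
                                using g8 nB apply simp_all[9]
                                using o3 apply simp
                                subgoal for g9 a9
                                  using o1 o2 T by auto
                                done
                            qed
                            done
                        qed
                        done
                    qed
                    done
                  done
              qed
              done
          qed
          done
        done
    qed
    done
qed

text \<open>The truncation at I = 2 n + 2 has no effect here: connected sets of size i exist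
  (\<open>conn_subset_exists\<close>), and their weights are at most n.\<close>

lemma mw_CV:
  assumes "1 \<le> i" "i \<le> n" and lab: "\<And>i. lab' i \<le> (1::nat)"
  shows "mw lab' I CV i = Min (sum lab' ` {C. conn C \<and> C \<subseteq> V \<and> card C = i})"
proof -
  let ?S = "sum lab' ` {C. conn C \<and> C \<subseteq> V \<and> card C = i}"
  have "{C. conn C \<and> C \<subseteq> V \<and> card C = i} \<subseteq> Pow V" by blast
  then have fin: "finite ?S" using finite_V by (intro finite_imageI) (meson finite_Pow_iff finite_subset)
  obtain C where C: "C \<subseteq> V" "conn C" "card C = i" using conn_subset_exists[of i] assms(1,2) V_eq by auto
  then have ne: "?S \<noteq> {}" by blast
  have "sum lab' C \<le> (\<Sum>i\<in>C. 1)" using lab by (intro sum_mono) auto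
  then have "sum lab' C \<le> I" using C assms(2) by (simp add: I_def)
  moreover have "sum lab' C \<in> ?S" using C by blast
  then have "Min ?S \<le> sum lab' C" by (rule Min_le[OF fin])
  ultimately have le: "Min ?S \<le> I" by linarith
  have e: "{C \<in> CV. card C = i} = {C. conn C \<and> C \<subseteq> V \<and> card C = i}" by (auto simp: CV_def)
  show ?thesis unfolding mw_def e Min_insert[OF fin ne] using le by (rule min_absorb2)
qed

end

text \<open>Only the nodes of a subgraph are counted. The node set of a connected subgraph is
  connected in the whole graph, and conversely a connected node set carries its induced
  subgraph.\<close>

lemma connected_subgraph_ones_eq:
  assumes "finite_graph {..<length L} E" and E: "E = (\<lambda>(x, y). {x, y}) ` set es"
  shows "connected_subgraph_ones (L, es) i =
    sum (\<lambda>v. of_bool (v < length L \<and> L ! v) :: nat) ` {C. finite_graph.conn E C \<and> C \<subseteq> {..<length L} \<and> card C = i}"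
proof -
  interpret finite_graph "{..<length L}" E by fact
  have G: "graph_of (L, es) = ({..<length L}, E)" by (simp add: graph_of_def E)
  have c: "card {v \<in> C. L ! v} = (\<Sum>v\<in>C. of_bool (v < length L \<and> L ! v))" if "C \<subseteq> {..<length L}" for C
  proof -
    have "finite C" using that finite_subset by blast
    moreover have "{v \<in> C. L ! v} = C \<inter> {v. v < length L \<and> L ! v}" using that by auto
    ultimately show ?thesis by simp
  qed
  show ?thesis
  proof (rule equalityI; rule subsetI)
    fix x :: nat assume "x \<in> connected_subgraph_ones (L, es) i"
    then obtain H where H: "subgraph_of H (graph_of (L, es))" "connected_graph H" "card (fst H) = i" "x = card {v \<in> fst H. L ! v}"
      by (auto simp: connected_subgraph_ones_def)
    obtain C F where CF: "H = (C, F)" by (cases H)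
    have "F \<subseteq> E" "C \<subseteq> {..<length L}" "simple_graph (C, F)" using H(1) by (simp_all add: CF G subgraph_of_def)
    moreover have "conn C" by (rule connected_graph_conn[OF assms(1)]) (use calculation H(2) CF in auto)
    ultimately show "x \<in> sum (\<lambda>v. of_bool (v < length L \<and> L ! v) :: nat) ` {C. conn C \<and> C \<subseteq> {..<length L} \<and> card C = i}"
      using H(3,4) c[of C] by (auto simp: CF)
  next
    fix x :: nat assume "x \<in> sum (\<lambda>v. of_bool (v < length L \<and> L ! v) :: nat) ` {C. conn C \<and> C \<subseteq> {..<length L} \<and> card C = i}"
    then obtain C where C: "conn C" "C \<subseteq> {..<length L}" "card C = i" "x = (\<Sum>v\<in>C. of_bool (v < length L \<and> L ! v))" by blast
    let ?H = "(C, {e \<in> E. e \<subseteq> C})"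
    have "subgraph_of ?H (graph_of (L, es))" using C(2) simple by (auto simp: subgraph_of_def simple_graph_def G)
    moreover have "connected_graph ?H" by (rule conn_connected_graph[OF assms(1) C(1)])
    ultimately show "x \<in> connected_subgraph_ones (L, es) i"
      unfolding connected_subgraph_ones_def by (intro CollectI exI[of _ ?H] conjI) (simp_all add: C(3,4) c[OF C(2)])
  qed
qed

lemma labelled_tree_tree_on:
  assumes "labelled_tree (L, es)" and E: "E = (\<lambda>(x, y). {x, y}) ` set es"
  shows "tree_on {..<length L} E" "length es = length L - 1" "distinct (map (\<lambda>(x, y). {x, y}) es)"
proof -
  have T: "simple_graph ({..<length L}, E)" "connected_graph ({..<length L}, E)" "\<nexists>vs. is_cycle ({..<length L}, E) vs"
    using assms by (simp_all add: labelled_tree_def tree_graph_def graph_of_def)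
  show d: "distinct (map (\<lambda>(x, y). {x, y}) es)" using assms(1) by (simp add: labelled_tree_def)
  have fg: "finite_graph {..<length L} E" by unfold_locales (use T(1) in \<open>auto simp: simple_graph_def\<close>)
  then interpret finite_graph "{..<length L}" E .
  have "conn {..<length L}" by (rule connected_graph_conn[OF fg subset_refl T(2,1)])
  then show t: "tree_on {..<length L} E" by unfold_locales (use T(3) in simp_all)
  have "card E = length es" using distinct_card[OF d] by (simp add: E)
  then show "length es = length L - 1" using tree_on.edge_count[OF t] by simp
qed

lemma nth_concat_pairs:
  "j < length es \<Longrightarrow> concat (map (\<lambda>(u, v). [u, v]) es) ! (2 * j) = fst (es ! j) \<and>
     concat (map (\<lambda>(u, v). [u, v]) es) ! Suc (2 * j) = snd (es ! j)"
proof (induction es arbitrary: j)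
  case (Cons e es)
  then show ?case by (cases j) (auto simp: split_beta)
qed simp

lemma length_concat_pairs: "length (concat (map (\<lambda>(u, v). [u, v]) es)) = 2 * length es"
  by (induction es) auto

text \<open>Minima are read off from \<open>mw_CV\<close> directly. For maxima, size minus weight is
  the weight under the complemented labels, so \<open>Max_complement\<close> applies.\<close>

lemma tree_outputs:
  assumes "tree_machine B tau {..<length L} E (length L) r m" and E: "E = (\<lambda>(x, y). {x, y}) ` set es"
    and lab: "\<And>v. lab v = of_bool (v < length L \<and> L ! v)" and i: "1 \<le> i" "i \<le> length L"
  shows "Min (connected_subgraph_ones (L, es) i) = mw lab (tree_machine.I (length L)) (tree_machine.CV {..<length L} E) i"
    "Max (connected_subgraph_ones (L, es) i) = i - mw (\<lambda>v. 1 - lab v) (tree_machine.I (length L)) (tree_machine.CV {..<length L} E) i"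
proof -
  interpret tree_machine B tau "{..<length L}" E "length L" r m lab by fact
  let ?F = "{C. conn C \<and> C \<subseteq> {..<length L} \<and> card C = i}"
  have "lab = (\<lambda>v. of_bool (v < length L \<and> L ! v))" using lab by blast
  then have S: "connected_subgraph_ones (L, es) i = sum lab ` ?F"
    using connected_subgraph_ones_eq[OF finite_graph_axioms E, of i] by simp
  have le: "lab v \<le> 1" for v by (simp add: lab)
  show "Min (connected_subgraph_ones (L, es) i) = mw lab I CV i" unfolding S by (rule mw_CV[symmetric, OF i le])
  have "?F \<subseteq> Pow {..<length L}" by blast
  then have fin: "finite ?F" by (meson finite_Pow_iff finite_lessThan finite_subset)
  obtain C where C: "C \<subseteq> {..<length L}" "conn C" "card C = i" using conn_subset_exists[of i] i by auto
  have compl: "sum lab C \<le> i" "i - sum lab C = (\<Sum>v\<in>C. 1 - lab v)" if "C \<in> ?F" for C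
  proof -
    have fC: "finite C" "card C = i" using that finite_subset by auto
    have "sum lab C \<le> (\<Sum>v\<in>C. 1)" by (intro sum_mono le)
    then show "sum lab C \<le> i" using fC by simp
    show "i - sum lab C = (\<Sum>v\<in>C. 1 - lab v)" using fC le by (subst sum_subtractf_nat) auto
  qed
  have "Max (sum lab ` ?F) = i - Min ((\<lambda>x. i - x) ` (sum lab ` ?F))"
  proof (rule Max_complement)
    show "finite (sum lab ` ?F)" using fin by (rule finite_imageI)
    show "sum lab ` ?F \<noteq> {}" using C by blast
    show "x \<le> i" if "x \<in> sum lab ` ?F" for x using that compl(1) by blast
  qed
  also have "(\<lambda>x. i - x) ` (sum lab ` ?F) = sum (\<lambda>v. 1 - lab v) ` ?F"
    unfolding image_image by (rule image_cong) (auto simp only: compl(2))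
  also have "Min \<dots> = mw (\<lambda>v. 1 - lab v) I CV i" by (rule mw_CV[symmetric, OF i]) simp
  finally show "Max (connected_subgraph_ones (L, es) i) = i - mw (\<lambda>v. 1 - lab v) I CV i" by (simp only: S)
qed

text \<open>The command takes at most 900 n r + 120000 n^2 rho ticks, and rho = tau m / m^3 is at
  most C / l m with m the rounded up square root of r. The absolute value of C makes the common
  constant factor nonnegative.\<close>

theorem tree_jpm_solvable:
  assumes l: "\<And>n. l n > 0" and mp: "computes_min_plus P0 d tau" and tau: "\<And>m. 1 \<le> m \<Longrightarrow> m * m \<le> tau m"
    and tauC: "\<And>m. 1 \<le> m \<Longrightarrow> real (tau m) \<le> C * (real m ^ 3 / l m)"
  shows "solvable_in_time_O tree_jpm_problem (\<lambda>(T, r). real (num_nodes T) * real r +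
              real (num_nodes T) ^ 2 / l (nat \<lceil>sqrt (real r)\<rceil>))"
proof (rule solvable_by_com[OF mp, where c = tree_prog and b = 10 and K = "900 + 120000 * \<bar>C\<bar>" and
    inp = "\<lambda>(T, r). num_nodes T # r # map of_bool (fst T) @ concat (map (\<lambda>(u, v). [u, v]) (snd T))" and
    outp = "\<lambda>(T, r). map (\<lambda>i. Min (connected_subgraph_ones T i)) [1..<num_nodes T + 1] @
       map (\<lambda>i. Max (connected_subgraph_ones T i)) [1..<num_nodes T + 1]"])
  fix x assume "x \<in> instances tree_jpm_problem"
  then obtain L es r where x: "x = ((L, es), r)" and tree: "labelled_tree (L, es)" and r: "1 \<le> r" "r \<le> length L"
    by (auto simp: tree_jpm_problem_def num_nodes_def)
  let ?n = "length L"
  let ?B = "200 * ((?n + 2) * (?n + 2))"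
  let ?inp = "?n # r # map of_bool L @ concat (map (\<lambda>(u, v). [u, v]) es)"
  let ?outp = "map (\<lambda>i. Min (connected_subgraph_ones (L, es) i)) [1..<?n + 1] @
       map (\<lambda>i. Max (connected_subgraph_ones (L, es) i)) [1..<?n + 1]"
  define E where "E = (\<lambda>(x, y). {x, y}) ` set es"
  define m where "m = csr r"
  define lab :: "nat \<Rightarrow> nat" where "lab v = of_bool (v < ?n \<and> L ! v)" for v
  note T = labelled_tree_tree_on[OF tree E_def]
  have m1: "1 \<le> m" using csr_bounds(1)[OF r(1)] m_def by simp
  have tm: "tree_machine ?B tau {..<?n} E ?n r m"
    by (intro tree_machine.intro tree_machine_axioms.intro T(1) refl r m_def tau m1)
  interpret tree_machine ?B tau "{..<?n}" E ?n r m lab by (rule tm)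
  have le_n: "2 + ?n + 2 * (?n - 1) = 3 * ?n" using r by simp
  have main: "wp tree_prog (\<lambda>(g, a', t). (\<forall>i<length ?outp. a' 1 i = ?outp ! i) \<and>
      real t \<le> (900 + 120000 * \<bar>C\<bar>) * (real ?n * real r + real ?n ^ 2 / l m)) ((\<lambda>_. 0), a, 0)"
    if a: "\<forall>i<length ?inp. a 0 i = ?inp ! i" for a
  proof -
    have len: "length ?inp = 3 * ?n" using le_n T(2) by (simp add: length_concat_pairs)
    have a0: "a 0 0 = ?n" "a 0 (Suc 0) = r" using a[rule_format, of 0] a[rule_format, of "Suc 0"] by simp_all
    have al: "a 0 (2 + i) = lab i" if "i < ?n" for i
      using a[rule_format, of "2 + i"] that unfolding len by (simp add: nth_append lab_def)
    have ae: "a 0 (2 + ?n + 2 * j) = fst (es ! j) \<and> a 0 (2 + ?n + 2 * j + 1) = snd (es ! j)" if j: "j < ?n - 1" for j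
    proof -
      have "2 + ?n + 2 * j + 1 < length ?inp" using j unfolding len by linarith
      then have "a 0 (2 + ?n + 2 * j) = ?inp ! (2 + ?n + 2 * j)" "a 0 (2 + ?n + 2 * j + 1) = ?inp ! (2 + ?n + 2 * j + 1)"
        using a by auto
      then show ?thesis using nth_concat_pairs[of j es] j T(2) by (simp add: nth_append)
    qed
    have lab1: "lab i \<le> 1" for i by (simp add: lab_def)
    show ?thesis
    proof (rule wp_mono[OF wp_tree_prog[where a = a and es = es, OF a0 al lab1 E_def T(3,2) ae]])
      fix s :: state
      obtain g a' t where s: "s = (g, a', t)" by (cases s) auto
      assume *: "case s of (g, a', t) \<Rightarrow> (\<forall>i<?n. a' 1 i = mw lab I CV (Suc i)) \<and>
        (\<forall>i<?n. a' 1 (?n + i) = Suc i - mw (\<lambda>i. 1 - lab i) I CV (Suc i)) \<and>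
        real t \<le> 900 * (real r * real ?n) + 120000 * (real ?n * real ?n * rho)"
      have o1: "\<forall>i<?n. a' 1 i = mw lab I CV (Suc i)" and o2: "\<forall>i<?n. a' 1 (?n + i) = Suc i - mw (\<lambda>i. 1 - lab i) I CV (Suc i)"
        and t: "real t \<le> 900 * (real r * real ?n) + 120000 * (real ?n * real ?n * rho)"
        using * unfolding s prod.case by blast+
      have o: "Min (connected_subgraph_ones (L, es) (Suc i)) = mw lab I CV (Suc i)"
        "Max (connected_subgraph_ones (L, es) (Suc i)) = Suc i - mw (\<lambda>i. 1 - lab i) I CV (Suc i)" if "i < ?n" for i
        by (rule tree_outputs[OF tm E_def lab_def]; use that in simp)+
      have "a' 1 i = ?outp ! i" if "i < ?n + ?n" for i
      proof (cases "i < ?n")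
        case True
        then show ?thesis using o1 o(1)[OF True] by (simp add: nth_append del: upt_Suc)
      next
        case False
        then obtain j where "i = ?n + j" by (metis le_Suc_ex not_le)
        then show ?thesis using o2 o(2)[of j] that by (simp add: nth_append del: upt_Suc)
      qed
      moreover have "real t \<le> (900 + 120000 * \<bar>C\<bar>) * (real ?n * real r + real ?n ^ 2 / l m)"
      proof -
        have "rho = real (tau m) / real m ^ 3" by (rule rho_def)
        also have "\<dots> \<le> (C * (real m ^ 3 / l m)) / real m ^ 3" using tauC[OF m1] by (rule divide_right_mono) simp
        also have "\<dots> = C / l m" using m1 by simp
        also have "\<dots> \<le> \<bar>C\<bar> / l m" using l[of m] by (intro divide_right_mono) auto
        finally have "real ?n * real ?n * rho \<le> real ?n * real ?n * (\<bar>C\<bar> / l m)" by (intro mult_left_mono) auto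
        also have "\<dots> = \<bar>C\<bar> * (real ?n ^ 2 / l m)" by (simp add: power2_eq_square)
        finally have X: "real ?n * real ?n * rho \<le> \<bar>C\<bar> * (real ?n ^ 2 / l m)" .
        have aux: "x \<le> (900 + 120000 * c) * (p + q)" if "x \<le> 900 * p + 120000 * w" "w \<le> c * q" "0 \<le> c * p" "0 \<le> q"
          for x c p q w :: real
        proof -
          have "(900 + 120000 * c) * (p + q) = 900 * p + 900 * q + 120000 * (c * p) + 120000 * (c * q)" by (simp add: algebra_simps)
          then show ?thesis using that by linarith
        qed
        have q: "0 \<le> real ?n ^ 2 / l m" using l[of m] by simp
        have p: "0 \<le> \<bar>C\<bar> * (real ?n * real r)" by simp
        show ?thesis by (rule aux[OF t[unfolded mult.commute[of "real r"]] X p q])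
      qed
      ultimately show "case s of (g, a', t) \<Rightarrow> (\<forall>i<length ?outp. a' 1 i = ?outp ! i) \<and>
        real t \<le> (900 + 120000 * \<bar>C\<bar>) * (real ?n * real r + real ?n ^ 2 / l m)" unfolding s by simp
    qed
  qed
  have Bn: "?B \<le> (?n + 2) ^ 10"
  proof -
    have e: "x ^ 8 * (x * x) = x ^ 10" for x :: nat using power_add[of x 8 2] by (simp add: power2_eq_square)
    \<comment> \<open>The factor 200 of the bound is below 2 ^ 8, and n + 2 is at least 2.\<close>
    have "(2::nat) ^ 8 \<le> (?n + 2) ^ 8" by (intro power_mono) auto
    then have "256 * ((?n + 2) * (?n + 2)) \<le> (?n + 2) ^ 8 * ((?n + 2) * (?n + 2))" by (intro mult_le_mono1) simp
    then show ?thesis unfolding e by linarith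
  qed
  have B2: "2 \<le> ?B" by simp
  note main' = main[unfolded m_def csr_def]
  show "\<exists>B\<ge>2. B \<le> (magnitude tree_jpm_problem x + 2) ^ 10 \<and>
       (\<forall>a. (\<forall>i<length (case x of (T, r) \<Rightarrow> num_nodes T # r # map of_bool (fst T) @ concat (map (\<lambda>(u, v). [u, v]) (snd T))).
              a 0 i = (case x of (T, r) \<Rightarrow> num_nodes T # r # map of_bool (fst T) @ concat (map (\<lambda>(u, v). [u, v]) (snd T))) ! i) \<longrightarrow>
          bounded_machine.wp B tau tree_prog (\<lambda>(g, a', t).
            (\<forall>i<length (case x of (T, r) \<Rightarrow> map (\<lambda>i. Min (connected_subgraph_ones T i)) [1..<num_nodes T + 1] @
                 map (\<lambda>i. Max (connected_subgraph_ones T i)) [1..<num_nodes T + 1]).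
               a' 1 i = (case x of (T, r) \<Rightarrow> map (\<lambda>i. Min (connected_subgraph_ones T i)) [1..<num_nodes T + 1] @
                 map (\<lambda>i. Max (connected_subgraph_ones T i)) [1..<num_nodes T + 1]) ! i) \<and>
            real t \<le> (900 + 120000 * \<bar>C\<bar>) * (case x of (T, r) \<Rightarrow> real (num_nodes T) * real r +
              real (num_nodes T) ^ 2 / l (nat \<lceil>sqrt (real r)\<rceil>))) ((\<lambda>_. 0), a, 0))"
    unfolding x prod.case num_nodes_def fst_conv snd_conv tree_jpm_problem_def problem.simps
    apply (intro exI[of _ ?B] conjI allI impI)
      apply (rule B2)
     apply (rule Bn)
    apply (erule main')
    done
qed (simp_all add: tree_jpm_problem_def split_beta)

theorem theorem1:
  fixes l :: "nat \<Rightarrow> real"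
  assumes "\<And>n. l n > 0"
    and "solvable_in_time_O min_plus_problem (\<lambda>(A, B). real (dim_row A) ^ 3 / l (dim_row A))"
  shows "solvable_in_time_O string_jpm_problem
           (\<lambda>T. real (length T) ^ 2 / l (nat \<lceil>sqrt (real (length T))\<rceil>)) \<and>
         solvable_in_time_O tree_jpm_problem
           (\<lambda>(T, r). real (num_nodes T) * real r +
              real (num_nodes T) ^ 2 / l (nat \<lceil>sqrt (real r)\<rceil>))"
proof -
  obtain P d tau C where "computes_min_plus P d tau" "\<And>m. 1 \<le> m \<Longrightarrow> m * m \<le> tau m"
    "\<And>m. 1 \<le> m \<Longrightarrow> real (tau m) \<le> C * (real m ^ 3 / l m)"
    using min_plus_program[OF assms(2)] by blast
  then show ?thesis using string_jpm_solvable[of l, OF assms(1)] tree_jpm_solvable[of l, OF assms(1)] by blast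
qed

end
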